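(* Let $A$ be a smooth complex ambient space, $E\to A$ a vector bundle with a section $s$, and let $M=s^{-1}(0)\subset A$ be the zero scheme of $s$, with its natural perfect obstruction theory. Let $N=\mathrm{Spec}\,\mathrm{Sym}^\bullet(\mathrm{Ob}_M)\subset\mathrm{Tot}(E^* )$ be the abelian cone of the obstruction sheaf, and let $\widetilde s\colon\mathrm{Tot}(E^* )\to\mathbb C$ be the function, linear on the fibres, defined by $s$. Then $N\subset\mathrm{Tot}(E^* )$ is the critical locus (the zero scheme of $d\widetilde s$) of the function $\widetilde s$.
   Context: The natural perfect obstruction theory on $M=s^{-1}(0)$ is $E^\bullet=\{E^*|_M\xrightarrow{ds}\Omega_A|_M\}\to\mathbb L_M$ (degrees $-1,0$), so that $(E^\bullet)^\vee=\{T_A|_M\xrightarrow{ds}E|_M\}$ and the obstruction sheaf is $\mathrm{Ob}_M=h^1((E^\bullet)^\vee)=\mathrm{coker}(ds\colon T_A|_M\to E|_M)$. The surjection $E|_M\to\mathrm{Ob}_M$ induces the closed embedding $N=\mathrm{Spec}\,\mathrm{Sym}^\bullet\mathrm{Ob}_M\subset\mathrm{Spec}\,\mathrm{Sym}^\bullet(E|_M)=\mathrm{Tot}(E^* )|_M\subset\mathrm{Tot}(E^* )$. $\mathrm{Tot}(E^* )$ denotes the total space of the dual bundle $E^*$. The function $\widetilde s$ is $\widetilde s(a,e)=\langle e,s(a)\rangle$ for $a\in A$, $e\in E^*_a$. (In the paper this is the local model of a space $M$ with perfect obstruction theory.) *)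

theory Defs
  imports
    "HOL-Analysis.Analysis"
    "HOL-Algebra.Module"
    "HOL-Algebra.QuotRing"
    "HOL-Library.Multiset"
    "HOL-Library.Function_Algebras"
begin

section \<open>Complex varieties as spaces with functions\<close>

text \<open>
  Smooth complex schemes (locally of finite type) are reduced, so they are described, following
  Serre, by their closed points with the Zariski topology and the sheaf of complex valued
  regular functions.  A possibly non-reduced closed subscheme of such a space is given by its
  ideal sheaf.  Sections over an open set \<open>U\<close> are total functions which vanish off \<open>U\<close>;
  restriction to a smaller open set is \<open>cut\<close>.  Neither separatedness nor quasi-compactness nor
  irreducibility is imposed.
\<close>

record 'p fspace =
  topo :: "'p topology"
  reg :: "'p set \<Rightarrow> ('p \<Rightarrow> complex) set"

definition cut :: "'p set \<Rightarrow> ('p \<Rightarrow> 'b::zero) \<Rightarrow> 'p \<Rightarrow> 'b" where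
  "cut V f = (\<lambda>x. if x \<in> V then f x else 0)"

definition is_sheaf :: "'p topology \<Rightarrow> ('p set \<Rightarrow> ('p \<Rightarrow> 'b::zero) set) \<Rightarrow> bool" where
  "is_sheaf T F \<longleftrightarrow>
     (\<forall>U f. openin T U \<longrightarrow> f \<in> F U \<longrightarrow> (\<forall>x. x \<notin> U \<longrightarrow> f x = 0)) \<and>
     (\<forall>U V f. openin T U \<longrightarrow> openin T V \<longrightarrow> V \<subseteq> U \<longrightarrow> f \<in> F U \<longrightarrow> cut V f \<in> F V) \<and>
     (\<forall>U f. openin T U \<longrightarrow> (\<forall>x. x \<notin> U \<longrightarrow> f x = 0) \<longrightarrow>
        (\<forall>x\<in>U. \<exists>V. openin T V \<and> x \<in> V \<and> V \<subseteq> U \<and> cut V f \<in> F V) \<longrightarrow> f \<in> F U)"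

definition space_with_functions :: "'p fspace \<Rightarrow> bool" where
  "space_with_functions X \<longleftrightarrow> is_sheaf (topo X) (reg X) \<and>
     (\<forall>U. openin (topo X) U \<longrightarrow>
        (\<forall>c. cut U (\<lambda>_. c) \<in> reg X U) \<and>
        (\<forall>f\<in>reg X U. \<forall>g\<in>reg X U.
           (\<lambda>x. f x + g x) \<in> reg X U \<and> (\<lambda>x. f x * g x) \<in> reg X U))"

definition open_subspace :: "'p fspace \<Rightarrow> 'p set \<Rightarrow> 'p fspace" where
  "open_subspace X U = \<lparr>topo = subtopology (topo X) U, reg = reg X\<rparr>"

definition fspace_iso :: "'p fspace \<Rightarrow> 'q fspace \<Rightarrow> ('p \<Rightarrow> 'q) \<Rightarrow> bool" where
  "fspace_iso X Y \<phi> \<longleftrightarrow> homeomorphic_map (topo X) (topo Y) \<phi> \<and>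
     (\<forall>V g. openin (topo Y) V \<longrightarrow> (\<forall>y. y \<notin> V \<longrightarrow> g y = 0) \<longrightarrow>
        (let W = {x \<in> topspace (topo X). \<phi> x \<in> V}
         in g \<in> reg Y V \<longleftrightarrow> cut W (\<lambda>x. g (\<phi> x)) \<in> reg X W))"

text \<open>
  The space obtained from a family of pairs \<open>(B, R)\<close> of a set of points and a ring of functions
  on it: the sets \<open>{h \<noteq> 0}\<close>, \<open>h \<in> R\<close>, are basic open sets and regular functions are locally
  quotients \<open>g / h\<close> with \<open>g, h \<in> R\<close>.
\<close>

definition nonvanishing :: "'p set \<Rightarrow> ('p \<Rightarrow> complex) \<Rightarrow> 'p set" where
  "nonvanishing B h = {x \<in> B. h x \<noteq> 0}"

definition fraction_space :: "('p set \<times> ('p \<Rightarrow> complex) set) set \<Rightarrow> 'p fspace" where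
  "fraction_space \<B> =
     \<lparr>topo = topology_generated_by {nonvanishing B h |B R h. (B, R) \<in> \<B> \<and> h \<in> R},
      reg = (\<lambda>W. {f. (\<forall>x. x \<notin> W \<longrightarrow> f x = 0) \<and>
        (\<forall>x\<in>W. \<exists>(B, R)\<in>\<B>. \<exists>g\<in>R. \<exists>h\<in>R. x \<in> nonvanishing B h \<and> nonvanishing B h \<subseteq> W \<and>
            (\<forall>y\<in>nonvanishing B h. f y = g y / h y))})\<rparr>"

text \<open>Affine \<open>m\<close>-space is the set of sequences supported on \<open>{..<m}\<close>.\<close>

definition affine_points :: "nat \<Rightarrow> (nat \<Rightarrow> complex) set" where
  "affine_points m = {z. \<forall>i\<ge>m. z i = 0}"

inductive_set poly_funs :: "nat \<Rightarrow> ((nat \<Rightarrow> complex) \<Rightarrow> complex) set" for m where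
  const: "(\<lambda>_. c) \<in> poly_funs m"
| coord: "i < m \<Longrightarrow> (\<lambda>z. z i) \<in> poly_funs m"
| sum: "f \<in> poly_funs m \<Longrightarrow> g \<in> poly_funs m \<Longrightarrow> (\<lambda>z. f z + g z) \<in> poly_funs m"
| product: "f \<in> poly_funs m \<Longrightarrow> g \<in> poly_funs m \<Longrightarrow> (\<lambda>z. f z * g z) \<in> poly_funs m"

definition algebraic_set :: "nat \<Rightarrow> (nat \<Rightarrow> complex) set \<Rightarrow> bool" where
  "algebraic_set m Z \<longleftrightarrow>
     (\<exists>S\<subseteq>poly_funs m. Z = {z \<in> affine_points m. \<forall>f\<in>S. f z = 0})"

definition affine_variety :: "nat \<Rightarrow> (nat \<Rightarrow> complex) set \<Rightarrow> (nat \<Rightarrow> complex) fspace" where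
  "affine_variety m Z = fraction_space {(Z, poly_funs m)}"

definition pderiv_at :: "nat \<Rightarrow> ((nat \<Rightarrow> complex) \<Rightarrow> complex) \<Rightarrow> (nat \<Rightarrow> complex) \<Rightarrow> complex" where
  "pderiv_at j f z = deriv (\<lambda>t. f (z(j := t))) (z j)"

text \<open>
  Jacobian criterion: near \<open>z\<close> the vanishing ideal of \<open>Z\<close> is generated by polynomials
  \<open>f 0, \<dots>, f (c - 1)\<close> with linearly independent differentials at \<open>z\<close>.
\<close>

definition smooth_at :: "nat \<Rightarrow> (nat \<Rightarrow> complex) set \<Rightarrow> (nat \<Rightarrow> complex) \<Rightarrow> bool" where
  "smooth_at m Z z \<longleftrightarrow> (\<exists>(c::nat) f.
     (\<forall>k<c. f k \<in> poly_funs m \<and> (\<forall>w\<in>Z. f k w = 0)) \<and>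
     (\<forall>g\<in>poly_funs m. (\<forall>w\<in>Z. g w = 0) \<longrightarrow>
        (\<exists>h\<in>poly_funs m. h z \<noteq> 0 \<and>
           (\<exists>q. (\<forall>k<c. q k \<in> poly_funs m) \<and> (\<forall>w. h w * g w = (\<Sum>k<c. q k w * f k w))))) \<and>
     (\<forall>l. (\<forall>j<m. (\<Sum>k<c. l k * pderiv_at j (f k) z) = 0) \<longrightarrow> (\<forall>k<c. l k = 0)))"

definition smooth_variety :: "'p fspace \<Rightarrow> bool" where
  "smooth_variety X \<longleftrightarrow> space_with_functions X \<and>
     (\<forall>p\<in>topspace (topo X). \<exists>U m Z \<phi>. openin (topo X) U \<and> p \<in> U \<and> algebraic_set m Z \<and>
        fspace_iso (open_subspace X U) (affine_variety m Z) \<phi> \<and> smooth_at m Z (\<phi> p))"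


section \<open>Vector bundles\<close>

text \<open>
  A bundle is a family of complex vector spaces, realised as subspaces \<open>fib E x\<close> of one vector
  space with scalar multiplication \<open>scal E\<close> (any family embeds in its direct sum), together with
  its sheaf of regular sections.
\<close>

record ('p, 'v) vbundle =
  scal :: "complex \<Rightarrow> 'v \<Rightarrow> 'v"
  fib :: "'p \<Rightarrow> 'v set"
  sec :: "'p set \<Rightarrow> ('p \<Rightarrow> 'v) set"

definition frame :: "'p fspace \<Rightarrow> ('p, 'v::ab_group_add) vbundle \<Rightarrow> 'p set \<Rightarrow> nat
    \<Rightarrow> (nat \<Rightarrow> 'p \<Rightarrow> 'v) \<Rightarrow> bool" where
  "frame X E U r e \<longleftrightarrow>
     (\<forall>i<r. e i \<in> sec E U) \<and>
     (\<forall>x\<in>U. inj_on (\<lambda>i. e i x) {..<r} \<and>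
        \<not> module.dependent (scal E) ((\<lambda>i. e i x) ` {..<r}) \<and>
        module.span (scal E) ((\<lambda>i. e i x) ` {..<r}) = fib E x) \<and>
     (\<forall>V \<sigma>. openin (topo X) V \<longrightarrow> V \<subseteq> U \<longrightarrow>
        (\<sigma> \<in> sec E V \<longleftrightarrow> (\<exists>c. (\<forall>i<r. c i \<in> reg X V) \<and>
           \<sigma> = cut V (\<lambda>x. \<Sum>i<r. scal E (c i x) (e i x)))))"

definition vector_bundle :: "'p fspace \<Rightarrow> ('p, 'v::ab_group_add) vbundle \<Rightarrow> bool" where
  "vector_bundle X E \<longleftrightarrow>
     vector_space (scal E) \<and>
     (\<forall>x\<in>topspace (topo X). module.subspace (scal E) (fib E x)) \<and>
     is_sheaf (topo X) (sec E) \<and>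
     (\<forall>U. openin (topo X) U \<longrightarrow> (\<forall>\<sigma>\<in>sec E U. \<forall>x\<in>U. \<sigma> x \<in> fib E x)) \<and>
     (\<forall>x\<in>topspace (topo X). \<exists>U r e. openin (topo X) U \<and> x \<in> U \<and> frame X E U r e)"

text \<open>Linear forms on a subspace \<open>S\<close>, extended by zero off \<open>S\<close>.\<close>

definition linear_dual :: "(complex \<Rightarrow> 'v \<Rightarrow> 'v) \<Rightarrow> 'v::ab_group_add set \<Rightarrow> ('v \<Rightarrow> complex) set" where
  "linear_dual sc S = {\<xi>. (\<forall>v. v \<notin> S \<longrightarrow> \<xi> v = 0) \<and>
     (\<forall>v\<in>S. \<forall>w\<in>S. \<xi> (v + w) = \<xi> v + \<xi> w) \<and> (\<forall>c. \<forall>v\<in>S. \<xi> (sc c v) = c * \<xi> v)}"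

text \<open>Regular sections of the dual bundle, i.e. homomorphisms from the sheaf of sections of
  \<open>E\<close> over \<open>U\<close> to the structure sheaf.\<close>

definition dual_sec :: "'p fspace \<Rightarrow> ('p, 'v::ab_group_add) vbundle \<Rightarrow> 'p set
    \<Rightarrow> ('p \<Rightarrow> 'v \<Rightarrow> complex) set" where
  "dual_sec X E U = {\<phi>. (\<forall>x. x \<notin> U \<longrightarrow> \<phi> x = 0) \<and>
     (\<forall>x\<in>U. \<phi> x \<in> linear_dual (scal E) (fib E x)) \<and>
     (\<forall>V \<sigma>. openin (topo X) V \<longrightarrow> V \<subseteq> U \<longrightarrow> \<sigma> \<in> sec E V \<longrightarrow> (\<lambda>x. \<phi> x (\<sigma> x)) \<in> reg X V)}"


section \<open>Closed subschemes and zero schemes\<close>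

definition reg_ring :: "'p fspace \<Rightarrow> 'p set \<Rightarrow> ('p \<Rightarrow> complex) ring" where
  "reg_ring X V = \<lparr>carrier = reg X V, mult = (\<lambda>f g x. f x * g x), one = cut V (\<lambda>_. 1),
     zero = (\<lambda>_. 0), add = (\<lambda>f g x. f x + g x)\<rparr>"

text \<open>The ideal sheaf generated by sets \<open>G V\<close> of regular functions on the open sets \<open>V\<close>.\<close>

definition gen_ideal_sheaf :: "'p fspace \<Rightarrow> ('p set \<Rightarrow> ('p \<Rightarrow> complex) set)
    \<Rightarrow> 'p set \<Rightarrow> ('p \<Rightarrow> complex) set" where
  "gen_ideal_sheaf X G W = {f \<in> reg X W. \<forall>x\<in>W. \<exists>V. openin (topo X) V \<and> x \<in> V \<and> V \<subseteq> W \<and>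
     cut V f \<in> genideal (reg_ring X V) (G V)}"

text \<open>The ideal sheaf of the zero scheme of a section \<open>\<sigma>\<close> of \<open>F\<close>: the image of the map from the
  dual of \<open>F\<close> to the structure sheaf given by pairing with \<open>\<sigma>\<close>.\<close>

definition zero_scheme :: "'p fspace \<Rightarrow> ('p, 'v::ab_group_add) vbundle \<Rightarrow> ('p \<Rightarrow> 'v)
    \<Rightarrow> 'p set \<Rightarrow> ('p \<Rightarrow> complex) set" where
  "zero_scheme X F \<sigma> = gen_ideal_sheaf X (\<lambda>V. {(\<lambda>x. \<phi> x (\<sigma> x)) |\<phi>. \<phi> \<in> dual_sec X F V})"


section \<open>Tangent vectors, differentials, critical loci\<close>

definition regular_at :: "'p fspace \<Rightarrow> 'p \<Rightarrow> ('p \<Rightarrow> complex) set" where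
  "regular_at X p = {f. \<exists>U. openin (topo X) U \<and> p \<in> U \<and> cut U f \<in> reg X U}"

text \<open>Point derivations.  They depend only on the germ of \<open>f\<close> at \<open>p\<close>, by the Leibniz rule applied
  to \<open>f\<close> and the indicator function of a neighbourhood of \<open>p\<close>.\<close>

definition tangent_space :: "'p fspace \<Rightarrow> 'p \<Rightarrow> (('p \<Rightarrow> complex) \<Rightarrow> complex) set" where
  "tangent_space X p = {v. (\<forall>f. f \<notin> regular_at X p \<longrightarrow> v f = 0) \<and>
     (\<forall>f\<in>regular_at X p. \<forall>g\<in>regular_at X p.
        v (\<lambda>x. f x + g x) = v f + v g \<and>
        v (\<lambda>x. f x * g x) = f p * v g + g p * v f) \<and>
     (\<forall>c. \<forall>f\<in>regular_at X p. v (\<lambda>x. c * f x) = c * v f)}"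

definition tangent_sec :: "'p fspace \<Rightarrow> 'p set \<Rightarrow> ('p \<Rightarrow> ('p \<Rightarrow> complex) \<Rightarrow> complex) set" where
  "tangent_sec X U = {\<theta>. (\<forall>p. p \<notin> U \<longrightarrow> \<theta> p = 0) \<and> (\<forall>p\<in>U. \<theta> p \<in> tangent_space X p) \<and>
     (\<forall>V f. openin (topo X) V \<longrightarrow> V \<subseteq> U \<longrightarrow> f \<in> reg X V \<longrightarrow> cut V (\<lambda>p. \<theta> p f) \<in> reg X V)}"

text \<open>Regular differential forms: families of cotangent vectors locally of the form
  \<open>\<Sum>i. f\<^sub>i dg\<^sub>i\<close> with \<open>f\<^sub>i, g\<^sub>i\<close> regular.\<close>

definition cotangent_bundle ::
    "'p fspace \<Rightarrow> ('p, (('p \<Rightarrow> complex) \<Rightarrow> complex) \<Rightarrow> complex) vbundle" where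
  "cotangent_bundle X =
     \<lparr>scal = (\<lambda>c \<omega> v. c * \<omega> v),
      fib = (\<lambda>p. linear_dual (\<lambda>c v f. c * v f) (tangent_space X p)),
      sec = (\<lambda>U. {\<omega>. (\<forall>p. p \<notin> U \<longrightarrow> \<omega> p = 0) \<and>
        (\<forall>p\<in>U. \<omega> p \<in> linear_dual (\<lambda>c v f. c * v f) (tangent_space X p)) \<and>
        (\<forall>p\<in>U. \<exists>V. openin (topo X) V \<and> p \<in> V \<and> V \<subseteq> U \<and>
           (\<exists>(n::nat) f g. (\<forall>i<n. f i \<in> reg X V \<and> g i \<in> reg X V) \<and>
              (\<forall>q\<in>V. \<forall>v\<in>tangent_space X q. \<omega> q v = (\<Sum>i<n. f i q * v (g i)))))})\<rparr>"

definition differential :: "'p fspace \<Rightarrow> ('p \<Rightarrow> complex)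
    \<Rightarrow> 'p \<Rightarrow> (('p \<Rightarrow> complex) \<Rightarrow> complex) \<Rightarrow> complex" where
  "differential X f = cut (topspace (topo X)) (\<lambda>p. cut (tangent_space X p) (\<lambda>v. v f))"

definition critical_locus :: "'p fspace \<Rightarrow> ('p \<Rightarrow> complex) \<Rightarrow> 'p set \<Rightarrow> ('p \<Rightarrow> complex) set" where
  "critical_locus X f = zero_scheme X (cotangent_bundle X) (differential X f)"


section \<open>The total space of the dual bundle\<close>

text \<open>Functions on the part of the total space of the dual of \<open>E\<close> lying over \<open>U\<close> which are
  polynomial on the fibres: the image of the symmetric algebra of the module of sections of
  \<open>E\<close> over \<open>U\<close>.\<close>

inductive_set fibre_polys :: "'p fspace \<Rightarrow> ('p, 'v) vbundle \<Rightarrow> 'p set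
    \<Rightarrow> ('p \<times> ('v \<Rightarrow> complex) \<Rightarrow> complex) set" for X E U where
  base: "f \<in> reg X U \<Longrightarrow> (\<lambda>(a, \<xi>). f a) \<in> fibre_polys X E U"
| linear: "\<sigma> \<in> sec E U \<Longrightarrow> (\<lambda>(a, \<xi>). \<xi> (\<sigma> a)) \<in> fibre_polys X E U"
| sum: "f \<in> fibre_polys X E U \<Longrightarrow> g \<in> fibre_polys X E U \<Longrightarrow>
    (\<lambda>q. f q + g q) \<in> fibre_polys X E U"
| product: "f \<in> fibre_polys X E U \<Longrightarrow> g \<in> fibre_polys X E U \<Longrightarrow>
    (\<lambda>q. f q * g q) \<in> fibre_polys X E U"

definition dual_points_over :: "('p, 'v::ab_group_add) vbundle \<Rightarrow> 'p set
    \<Rightarrow> ('p \<times> ('v \<Rightarrow> complex)) set" where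
  "dual_points_over E U = (SIGMA a:U. linear_dual (scal E) (fib E a))"

definition dual_total_space :: "'p fspace \<Rightarrow> ('p, 'v::ab_group_add) vbundle
    \<Rightarrow> ('p \<times> ('v \<Rightarrow> complex)) fspace" where
  "dual_total_space X E =
     fraction_space {(dual_points_over E U, fibre_polys X E U) |U. openin (topo X) U}"

definition fibre_linear :: "'p fspace \<Rightarrow> ('p, 'v::ab_group_add) vbundle \<Rightarrow> ('p \<Rightarrow> 'v)
    \<Rightarrow> 'p \<times> ('v \<Rightarrow> complex) \<Rightarrow> complex" where
  "fibre_linear X E s = cut (dual_points_over E (topspace (topo X))) (\<lambda>(a, \<xi>). \<xi> (s a))"


section \<open>Symmetric algebras\<close>

text \<open>Polynomials over \<open>R\<close> in commuting variables indexed by \<open>I\<close>, as coefficient functions.\<close>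

definition mpoly_ring :: "('r, 'm) ring_scheme \<Rightarrow> 'q set \<Rightarrow> ('q multiset \<Rightarrow> 'r) ring" where
  "mpoly_ring R I =
     \<lparr>carrier = {F. (\<forall>n. F n \<in> carrier R) \<and> finite {n. F n \<noteq> \<zero>\<^bsub>R\<^esub>} \<and>
        (\<forall>n. F n \<noteq> \<zero>\<^bsub>R\<^esub> \<longrightarrow> set_mset n \<subseteq> I)},
      mult = (\<lambda>F G n. finsum R (\<lambda>k. F k \<otimes>\<^bsub>R\<^esub> G (n - k)) {k. k \<subseteq># n}),
      one = (\<lambda>n. if n = {#} then \<one>\<^bsub>R\<^esub> else \<zero>\<^bsub>R\<^esub>),
      zero = (\<lambda>_. \<zero>\<^bsub>R\<^esub>),
      add = (\<lambda>F G n. F n \<oplus>\<^bsub>R\<^esub> G n)\<rparr>"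

definition mconst :: "('r, 'm) ring_scheme \<Rightarrow> 'r \<Rightarrow> 'q multiset \<Rightarrow> 'r" where
  "mconst R r = (\<lambda>n. if n = {#} then r else \<zero>\<^bsub>R\<^esub>)"

definition mvar :: "('r, 'm) ring_scheme \<Rightarrow> 'q \<Rightarrow> 'q multiset \<Rightarrow> 'r" where
  "mvar R q = (\<lambda>n. if n = {#q#} then \<one>\<^bsub>R\<^esub> else \<zero>\<^bsub>R\<^esub>)"

definition sym_ideal :: "('r, 'm) ring_scheme \<Rightarrow> ('r, 'q, 'n) module_scheme
    \<Rightarrow> ('q multiset \<Rightarrow> 'r) set" where
  "sym_ideal R Q = (let P = mpoly_ring R (carrier Q) in genideal P
     ({mvar R (x \<oplus>\<^bsub>Q\<^esub> y) \<ominus>\<^bsub>P\<^esub> (mvar R x \<oplus>\<^bsub>P\<^esub> mvar R y) |x y. x \<in> carrier Q \<and> y \<in> carrier Q} \<union>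
      {mvar R (r \<odot>\<^bsub>Q\<^esub> x) \<ominus>\<^bsub>P\<^esub> (mconst R r \<otimes>\<^bsub>P\<^esub> mvar R x) |r x. r \<in> carrier R \<and> x \<in> carrier Q}))"

definition sym_algebra :: "('r, 'm) ring_scheme \<Rightarrow> ('r, 'q, 'n) module_scheme
    \<Rightarrow> ('q multiset \<Rightarrow> 'r) set ring" where
  "sym_algebra R Q = mpoly_ring R (carrier Q) Quot sym_ideal R Q"

text \<open>Functoriality for a ring homomorphism \<open>\<rho>\<close> and a \<open>\<rho>\<close>-semilinear map \<open>u\<close>.\<close>

definition mpoly_map :: "('r, 'm) ring_scheme \<Rightarrow> ('r2, 'm2) ring_scheme \<Rightarrow> ('r \<Rightarrow> 'r2) \<Rightarrow> ('q \<Rightarrow> 'q2)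
    \<Rightarrow> ('q multiset \<Rightarrow> 'r) \<Rightarrow> 'q2 multiset \<Rightarrow> 'r2" where
  "mpoly_map R R' \<rho> u F =
     (\<lambda>n. finsum R' (\<lambda>k. \<rho> (F k)) {k. F k \<noteq> \<zero>\<^bsub>R\<^esub> \<and> image_mset u k = n})"

definition sym_map :: "('r, 'm) ring_scheme \<Rightarrow> ('r2, 'm2) ring_scheme
    \<Rightarrow> ('r2, 'q2, 'n2) module_scheme \<Rightarrow> ('r \<Rightarrow> 'r2) \<Rightarrow> ('q \<Rightarrow> 'q2)
    \<Rightarrow> ('q multiset \<Rightarrow> 'r) set \<Rightarrow> ('q2 multiset \<Rightarrow> 'r2) set" where
  "sym_map R R' Q' \<rho> u C =
     (\<Union>F\<in>C. sym_ideal R' Q' +>\<^bsub>mpoly_ring R' (carrier Q')\<^esub> mpoly_map R R' \<rho> u F)"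


section \<open>The obstruction sheaf\<close>

definition sec_module :: "('p, 'v::ab_group_add) vbundle \<Rightarrow> 'p set
    \<Rightarrow> ('p \<Rightarrow> complex, 'p \<Rightarrow> 'v) module" where
  "sec_module E V = \<lparr>carrier = sec E V, mult = undefined, one = undefined,
     zero = (\<lambda>_. 0), add = (\<lambda>\<sigma> \<tau> x. \<sigma> x + \<tau> x), smult = (\<lambda>f \<sigma> x. scal E (f x) (\<sigma> x))\<rparr>"

text \<open>The submodule sheaf \<open>I E\<close> for an ideal sheaf \<open>I\<close>.\<close>

definition ideal_times_sec :: "'p fspace \<Rightarrow> ('p, 'v::ab_group_add) vbundle
    \<Rightarrow> ('p set \<Rightarrow> ('p \<Rightarrow> complex) set) \<Rightarrow> 'p set \<Rightarrow> ('p \<Rightarrow> 'v) set" where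
  "ideal_times_sec X E I U = {\<tau> \<in> sec E U. \<forall>x\<in>U. \<exists>V. openin (topo X) V \<and> x \<in> V \<and> V \<subseteq> U \<and>
     (\<exists>(n::nat) f \<sigma>. (\<forall>i<n. f i \<in> I V \<and> \<sigma> i \<in> sec E V) \<and>
        cut V \<tau> = (\<lambda>y. \<Sum>i<n. scal E (f i y) (\<sigma> i y)))}"

text \<open>
  The objects on the zero scheme \<open>M\<close> of \<open>s\<close> are described by presheaves \<open>V \<mapsto> \<dots>\<close> on the ambient
  space, whose sheafifications are the pushforwards of the sheaves in question; the ideal sheaf
  of the cone below only depends on the sheafifications.
\<close>

definition structure_on_zero :: "'p fspace \<Rightarrow> ('p, 'v::ab_group_add) vbundle \<Rightarrow> ('p \<Rightarrow> 'v) \<Rightarrow> 'p set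
    \<Rightarrow> ('p \<Rightarrow> complex) set ring" where
  "structure_on_zero A E s V = reg_ring A V Quot zero_scheme A E s V"

definition bundle_on_zero :: "'p fspace \<Rightarrow> ('p, 'v::ab_group_add) vbundle \<Rightarrow> ('p \<Rightarrow> 'v) \<Rightarrow> 'p set
    \<Rightarrow> (('p \<Rightarrow> complex) set, ('p \<Rightarrow> 'v) set) module" where
  "bundle_on_zero A E s V =
     (let P = sec_module E V; N = ideal_times_sec A E (zero_scheme A E s) V in
      \<lparr>carrier = a_rcosets\<^bsub>P\<^esub> N, mult = undefined, one = undefined, zero = N, add = set_add P,
       smult = (\<lambda>C D. \<Union>f\<in>C. \<Union>\<tau>\<in>D. N +>\<^bsub>P\<^esub> (f \<odot>\<^bsub>P\<^esub> \<tau>))\<rparr>)"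

text \<open>\<open>\<tau>\<close> represents \<open>ds(\<theta>)\<close> on \<open>M\<close>: locally, if \<open>s = \<Sum>i. c\<^sub>i e\<^sub>i\<close> in a frame, then
  \<open>\<tau> = \<Sum>i. \<theta>(c\<^sub>i) e\<^sub>i\<close> modulo the ideal of \<open>M\<close>.\<close>

definition ds_represents :: "'p fspace \<Rightarrow> ('p, 'v::ab_group_add) vbundle \<Rightarrow> ('p \<Rightarrow> 'v) \<Rightarrow> 'p set
    \<Rightarrow> ('p \<Rightarrow> ('p \<Rightarrow> complex) \<Rightarrow> complex) \<Rightarrow> ('p \<Rightarrow> 'v) \<Rightarrow> bool" where
  "ds_represents A E s U \<theta> \<tau> \<longleftrightarrow> \<tau> \<in> sec E U \<and>
     (\<forall>x\<in>U. \<exists>V r e c. openin (topo A) V \<and> x \<in> V \<and> V \<subseteq> U \<and> frame A E V r e \<and>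
        (\<forall>i<r. c i \<in> reg A V) \<and> cut V s = (\<lambda>y. \<Sum>i<r. scal E (c i y) (e i y)) \<and>
        cut V (\<lambda>y. \<tau> y - (\<Sum>i<r. scal E (\<theta> y (c i)) (e i y)))
          \<in> ideal_times_sec A E (zero_scheme A E s) V)"

text \<open>The image of \<open>ds\<close> on the restriction of the tangent sheaf to \<open>M\<close>, onto which the tangent
  sheaf of \<open>A\<close> surjects.\<close>

definition ds_image :: "'p fspace \<Rightarrow> ('p, 'v::ab_group_add) vbundle \<Rightarrow> ('p \<Rightarrow> 'v) \<Rightarrow> 'p set
    \<Rightarrow> ('p \<Rightarrow> 'v) set set" where
  "ds_image A E s V =
     {ideal_times_sec A E (zero_scheme A E s) V +>\<^bsub>sec_module E V\<^esub> \<tau> |\<tau> \<theta>.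
        \<theta> \<in> tangent_sec A V \<and> ds_represents A E s V \<theta> \<tau>}"

definition quotient_module :: "('r, 'q, 'n) module_scheme \<Rightarrow> 'q set \<Rightarrow> ('r, 'q set) module" where
  "quotient_module Q L = \<lparr>carrier = a_rcosets\<^bsub>Q\<^esub> L, mult = undefined, one = undefined, zero = L,
     add = set_add Q, smult = (\<lambda>r C. \<Union>x\<in>C. L +>\<^bsub>Q\<^esub> (r \<odot>\<^bsub>Q\<^esub> x))\<rparr>"

definition obstruction_sheaf :: "'p fspace \<Rightarrow> ('p, 'v::ab_group_add) vbundle \<Rightarrow> ('p \<Rightarrow> 'v) \<Rightarrow> 'p set
    \<Rightarrow> (('p \<Rightarrow> complex) set, ('p \<Rightarrow> 'v) set set) module" where
  "obstruction_sheaf A E s V = quotient_module (bundle_on_zero A E s V) (ds_image A E s V)"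


section \<open>The abelian cone of the obstruction sheaf\<close>

text \<open>The map from the symmetric algebra of the sections of \<open>E\<close> to that of the obstruction sheaf
  which is induced by the surjection of \<open>E\<close> restricted to \<open>M\<close> onto the obstruction sheaf.\<close>

definition sym_to_obstruction :: "'p fspace \<Rightarrow> ('p, 'v::ab_group_add) vbundle \<Rightarrow> ('p \<Rightarrow> 'v) \<Rightarrow> 'p set
    \<Rightarrow> (('p \<Rightarrow> 'v) multiset \<Rightarrow> 'p \<Rightarrow> complex) set
    \<Rightarrow> (('p \<Rightarrow> 'v) set set multiset \<Rightarrow> ('p \<Rightarrow> complex) set) set" where
  "sym_to_obstruction A E s V =
     sym_map (reg_ring A V) (structure_on_zero A E s V) (obstruction_sheaf A E s V)
       (\<lambda>f. zero_scheme A E s V +>\<^bsub>reg_ring A V\<^esub> f)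
       (\<lambda>\<sigma>. ds_image A E s V +>\<^bsub>bundle_on_zero A E s V\<^esub>
          (ideal_times_sec A E (zero_scheme A E s) V +>\<^bsub>sec_module E V\<^esub> \<sigma>))"

text \<open>The function on the total space of the dual of \<open>E\<close> defined by a polynomial in sections
  of \<open>E\<close>.\<close>

definition sym_eval :: "(('p \<Rightarrow> 'v) multiset \<Rightarrow> 'p \<Rightarrow> complex) \<Rightarrow> 'p \<times> ('v \<Rightarrow> complex) \<Rightarrow> complex" where
  "sym_eval F = (\<lambda>(a, \<xi>). \<Sum>n | F n \<noteq> (\<lambda>_. 0). F n a * (\<Prod>\<sigma>\<in>#n. \<xi> (\<sigma> a)))"

definition cone_equations :: "'p fspace \<Rightarrow> ('p, 'v::ab_group_add) vbundle \<Rightarrow> ('p \<Rightarrow> 'v) \<Rightarrow> 'p set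
    \<Rightarrow> ('p \<times> ('v \<Rightarrow> complex) \<Rightarrow> complex) set" where
  "cone_equations A E s V =
     {sym_eval F |F C. F \<in> C \<and> C \<in> a_kernel (sym_algebra (reg_ring A V) (sec_module E V))
        (sym_algebra (structure_on_zero A E s V) (obstruction_sheaf A E s V))
        (sym_to_obstruction A E s V)}"

text \<open>The ideal sheaf of the spectrum of the symmetric algebra of the obstruction sheaf inside
  the total space of the dual of \<open>E\<close>, the spectrum of the symmetric algebra of \<open>E\<close>.\<close>

definition obstruction_cone :: "'p fspace \<Rightarrow> ('p, 'v::ab_group_add) vbundle \<Rightarrow> ('p \<Rightarrow> 'v)
    \<Rightarrow> ('p \<times> ('v \<Rightarrow> complex)) set \<Rightarrow> ('p \<times> ('v \<Rightarrow> complex) \<Rightarrow> complex) set" where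
  "obstruction_cone A E s = gen_ideal_sheaf (dual_total_space A E)
     (\<lambda>W. {cut W h |V h. openin (topo A) V \<and> W \<subseteq> dual_points_over E V \<and>
        h \<in> cone_equations A E s V})"

end

theory Submission
  imports Defs "HOL-Computational_Algebra.Polynomial"
begin

text \<open>
  In a frame \<open>e\<^sub>i\<close> of \<open>E\<close> over an open set of \<open>A\<close> the section is \<open>s = \<Sum>\<^sub>i c\<^sub>i e\<^sub>i\<close>, the \<open>e\<^sub>i\<close> become coordinates
  \<open>\<xi>\<^sub>i\<close> on the fibres of the dual bundle, and the function on the total space is \<open>F = \<Sum>\<^sub>i c\<^sub>i \<xi>\<^sub>i\<close>, so that
  \<open>dF = \<Sum>\<^sub>i c\<^sub>i d\<xi>\<^sub>i + \<Sum>\<^sub>i \<xi>\<^sub>i dc\<^sub>i\<close>.  Hence the critical locus is cut out by the \<open>c\<^sub>i\<close>, that is by the ideal \<open>I\<close>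
  of the zero scheme \<open>M\<close>, and by the functions \<open>\<Sum>\<^sub>i \<theta>(c\<^sub>i) \<xi>\<^sub>i\<close> for vector fields \<open>\<theta>\<close> on \<open>A\<close>.  The latter are
  the linear functions which belong to the sections \<open>ds(\<theta>) = \<Sum>\<^sub>i \<theta>(c\<^sub>i) e\<^sub>i\<close> of \<open>E\<close>.  On the other hand the
  symmetric algebra of the obstruction sheaf arises from that of \<open>E\<close> by dividing out \<open>I\<close> and the
  image of \<open>ds\<close>, so the cone has the same equations.

  The proof compares the two ideal sheaves on the total space through their generators
  (\<open>gen_ideal_sheaf_subset\<close>).  Let \<open>J\<close> be the critical ideal sheaf.

  The cone equations lie in \<open>J\<close>.  Derivatives of \<open>F\<close> along vector fields of the total space lie in \<open>J\<close>.
  In the vertical direction given by a section \<open>\<phi>\<close> of the dual bundle the derivative is \<open>\<phi>(s)\<close>, and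
  these functions generate \<open>I\<close> (\<open>I_in_J\<close>); along the lift of a vector field \<open>\<theta>\<close> of \<open>A\<close> which is horizontal in
  a frame it is \<open>\<Sum>\<^sub>i \<theta>(c\<^sub>i) \<xi>\<^sub>i\<close> (\<open>ds_in_J\<close>).  So modulo \<open>J\<close> the value of a section of \<open>E\<close> as a linear
  function on the total space only depends on its class in the obstruction sheaf.  By the universal property
  of the symmetric algebra (\<open>evaluation_sym_ideal\<close>), evaluation modulo \<open>J\<close> factors over the symmetric
  algebra of the obstruction sheaf, and therefore vanishes on the kernel (\<open>cone_equation_in_J\<close>).

  The ideal sheaf \<open>J\<close> is contained in that of the cone.  It is generated by the values \<open>\<Phi>(dF)\<close> of linear
  forms \<open>\<Phi>\<close> on differentials, and by the formula for \<open>dF\<close> these are combinations of the functions above,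
  once \<open>dc\<^sub>i = \<Sum>\<^sub>j \<theta>\<^sub>j(c\<^sub>i) dx\<^sub>j\<close> for local coordinates \<open>x\<^sub>j\<close> and vector fields \<open>\<theta>\<^sub>j\<close> on \<open>A\<close>
  (\<open>critical_generator_in\<close>).  Such coordinates exist since \<open>A\<close> is smooth (\<open>smooth_local_coordinates\<close>): near
  a point it has equations with independent differentials, which some of the ambient \<open>dz\<^sub>j\<close>
  complete to a basis of all differentials; the dual vector fields are tangent to \<open>A\<close>.  The local equations
  generate the vanishing ideal only after division by a function that depends on the element of the
  ideal; Hilbert's basis theorem makes one common denominator sufficient.
\<close>

section \<open>Polynomial rings over commutative rings\<close>

text \<open>
  Coefficients, products, induced maps and evaluations of polynomials are all instances of this
  pairing with a function \<open>w\<close> on monomials, so identities between them reduce to exchanging finite sums.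
\<close>

definition pairing :: "('r, 'm) ring_scheme \<Rightarrow> ('t, 'n) ring_scheme \<Rightarrow> ('r \<Rightarrow> 't)
    \<Rightarrow> ('q multiset \<Rightarrow> 't) \<Rightarrow> ('q multiset \<Rightarrow> 'r) \<Rightarrow> 't" where
  "pairing R T \<phi> w F = finsum T (\<lambda>k. \<phi> (F k) \<otimes>\<^bsub>T\<^esub> w k) {k. F k \<noteq> \<zero>\<^bsub>R\<^esub>}"

lemma (in abelian_monoid) finsum_swap:
  assumes "finite A" "finite B" "\<And>a b. a \<in> A \<Longrightarrow> b \<in> B \<Longrightarrow> f a b \<in> carrier G"
  shows "finsum G (\<lambda>a. finsum G (f a) B) A = finsum G (\<lambda>b. finsum G (\<lambda>a. f a b) A) B"
  using assms(1,3)
proof (induction A)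
  case empty
  then show ?case by (simp add: finsum_zero)
next
  case (insert x A)
  then have "finsum G (\<lambda>a. finsum G (f a) B) (insert x A)
     = finsum G (f x) B \<oplus> finsum G (\<lambda>a. finsum G (f a) B) A"
    by (intro finsum_insert) (auto intro!: finsum_closed)
  also have "\<dots> = finsum G (f x) B \<oplus> finsum G (\<lambda>b. finsum G (\<lambda>a. f a b) A) B"
    using insert by simp
  also have "\<dots> = finsum G (\<lambda>b. f x b \<oplus> finsum G (\<lambda>a. f a b) A) B"
    using insert by (intro finsum_addf [symmetric]) (auto intro!: finsum_closed)
  also have "\<dots> = finsum G (\<lambda>b. finsum G (\<lambda>a. f a b) (insert x A)) B"
    using insert by (intro finsum_cong' refl) (auto intro!: finsum_closed)
  finally show ?case .
qed

lemma (in abelian_monoid) finsum_delta: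
  assumes "finite A" "i \<in> A \<Longrightarrow> f i \<in> carrier G"
  shows "finsum G (\<lambda>k. if k = i then f k else \<zero>) A = (if i \<in> A then f i else \<zero>)"
proof (cases "i \<in> A")
  case True
  have "finsum G (\<lambda>k. if k = i then f k else \<zero>) A = finsum G (\<lambda>k. f i) {i}"
    by (rule add.finprod_mono_neutral_cong) (use True assms in auto)
  then show ?thesis using True assms by (simp add: add.finprod_insert)
next
  case False
  have "finsum G (\<lambda>k. if k = i then f k else \<zero>) A = finsum G (\<lambda>k. \<zero>) A"
    by (rule finsum_cong') (use False in auto)
  then show ?thesis using False by (simp add: finsum_zero)
qed

lemma finite_submultisets: "finite {k. k \<subseteq># n}"
proof (rule finite_subset)
  show "{k. k \<subseteq># n} \<subseteq> {M. set_mset M \<subseteq> set_mset n \<and> size M < Suc (size n)}"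
    by (auto dest: mset_subset_eqD size_mset_mono)
  have "{M. set_mset M \<subseteq> set_mset n \<and> size M < Suc (size n)} =
     (\<Union>i<Suc (size n). {M. set_mset M \<subseteq> set_mset n \<and> size M = i})" by auto
  then show "finite {M. set_mset M \<subseteq> set_mset n \<and> size M < Suc (size n)}"
    using finite_multisets_of_size [of "set_mset n"] by (auto simp: multisets_of_size_def)
qed

lemma mpoly_carrierD:
  assumes "F \<in> carrier (mpoly_ring R I)"
  shows "F n \<in> carrier R" "finite {n. F n \<noteq> \<zero>\<^bsub>R\<^esub>}" "F n \<noteq> \<zero>\<^bsub>R\<^esub> \<Longrightarrow> set_mset n \<subseteq> I"
  using assms by (auto simp: mpoly_ring_def)

lemma mpoly_add: "(F \<oplus>\<^bsub>mpoly_ring R I\<^esub> G) n = F n \<oplus>\<^bsub>R\<^esub> G n"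
  by (simp add: mpoly_ring_def)

lemma mpoly_zero: "\<zero>\<^bsub>mpoly_ring R I\<^esub> = (\<lambda>_. \<zero>\<^bsub>R\<^esub>)"
  by (simp add: mpoly_ring_def)

lemma mpoly_one: "\<one>\<^bsub>mpoly_ring R I\<^esub> = mconst R \<one>\<^bsub>R\<^esub>"
  by (simp add: mpoly_ring_def mconst_def)

context cring begin

abbreviation "supp F \<equiv> {n. F n \<noteq> \<zero>}"

lemma mpoly_mult:
  assumes F: "F \<in> carrier (mpoly_ring R I)" and G: "G \<in> carrier (mpoly_ring R I)"
    and A: "finite A" "supp F \<subseteq> A" and B: "finite B" "supp G \<subseteq> B"
  shows "(F \<otimes>\<^bsub>mpoly_ring R I\<^esub> G) n
    = (\<Oplus>k\<in>A. \<Oplus>l\<in>B. if k + l = n then F k \<otimes> G l else \<zero>)"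
proof -
  note [simp] = mpoly_carrierD(1) [OF F] mpoly_carrierD(1) [OF G]
  have inner: "(\<Oplus>l\<in>B. if k + l = n then F k \<otimes> G l else \<zero>)
     = (if k \<subseteq># n then F k \<otimes> G (n - k) else \<zero>)" for k
  proof (cases "k \<subseteq># n")
    case True
    then have "(\<Oplus>l\<in>B. if k + l = n then F k \<otimes> G l else \<zero>)
        = (\<Oplus>l\<in>B. if l = n - k then F k \<otimes> G l else \<zero>)"
      by (intro finsum_cong') (auto simp: subset_mset.add_diff_inverse)
    also have "\<dots> = (if n - k \<in> B then F k \<otimes> G (n - k) else \<zero>)"
      by (rule finsum_delta) (use B in auto)
    also have "\<dots> = F k \<otimes> G (n - k)"
    proof (cases "n - k \<in> B")
      case False
      then have "G (n - k) = \<zero>" using B by blast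
      then show ?thesis using False by simp
    qed simp
    finally show ?thesis using True by simp
  next
    case False
    then have "(\<Oplus>l\<in>B. if k + l = n then F k \<otimes> G l else \<zero>) = (\<Oplus>l\<in>B. \<zero>)"
      by (intro finsum_cong') auto
    then show ?thesis using False by (simp add: finsum_zero)
  qed
  have "(F \<otimes>\<^bsub>mpoly_ring R I\<^esub> G) n = (\<Oplus>k\<in>{k. k \<subseteq># n}. F k \<otimes> G (n - k))"
    by (simp add: mpoly_ring_def)
  also have "\<dots> = (\<Oplus>k\<in>A. if k \<subseteq># n then F k \<otimes> G (n - k) else \<zero>)"
  proof (rule add.finprod_mono_neutral_cong)
    show "F k \<otimes> G (n - k) = \<zero>" if "k \<in> {k. k \<subseteq># n} - A" for k
    proof -
      have "F k = \<zero>" using that A by blast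
      then show ?thesis by simp
    qed
  qed (use A finite_submultisets in auto)
  finally show ?thesis by (simp add: inner)
qed

lemma mpoly_mult_zero_outside:
  assumes "F \<in> carrier (mpoly_ring R I)" "G \<in> carrier (mpoly_ring R I)"
    "n \<notin> (\<lambda>(k, l). k + l) ` (supp F \<times> supp G)"
  shows "(F \<otimes>\<^bsub>mpoly_ring R I\<^esub> G) n = \<zero>"
proof -
  have "(\<Oplus>k\<in>supp F. \<Oplus>l\<in>supp G. if k + l = n then F k \<otimes> G l else \<zero>)
     = (\<Oplus>k\<in>supp F. \<Oplus>l\<in>supp G. \<zero>)"
    by (intro finsum_cong') (use assms(3) in \<open>auto simp: image_iff intro!: finsum_cong'\<close>)
  then show ?thesis
    using mpoly_mult [OF assms(1,2) _ order_refl _ order_refl] assms(1,2)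
    by (simp add: mpoly_carrierD(2) finsum_zero)
qed

lemma mpoly_mult_closed:
  assumes F: "F \<in> carrier (mpoly_ring R I)" and G: "G \<in> carrier (mpoly_ring R I)"
  shows "F \<otimes>\<^bsub>mpoly_ring R I\<^esub> G \<in> carrier (mpoly_ring R I)"
proof -
  note fin = mpoly_carrierD(2) [OF F] mpoly_carrierD(2) [OF G]
  let ?FG = "F \<otimes>\<^bsub>mpoly_ring R I\<^esub> G" and ?S = "(\<lambda>(k, l). k + l) ` (supp F \<times> supp G)"
  have sub: "supp ?FG \<subseteq> ?S"
    using mpoly_mult_zero_outside [OF F G] by blast
  then have "finite (supp ?FG)"
    using fin by (meson finite_SigmaI finite_imageI finite_subset)
  moreover have "?FG n \<in> carrier R" for n
    using mpoly_carrierD(1) [OF F] mpoly_carrierD(1) [OF G]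
    by (auto simp: mpoly_ring_def intro!: finsum_closed)
  moreover have "set_mset n \<subseteq> I" if "?FG n \<noteq> \<zero>" for n
    using sub that mpoly_carrierD(3) [OF F] mpoly_carrierD(3) [OF G] by fastforce
  ultimately show ?thesis
    by (simp add: mpoly_ring_def)
qed

lemma mpoly_mult_comm:
  assumes F: "F \<in> carrier (mpoly_ring R I)" and G: "G \<in> carrier (mpoly_ring R I)"
  shows "F \<otimes>\<^bsub>mpoly_ring R I\<^esub> G = G \<otimes>\<^bsub>mpoly_ring R I\<^esub> F"
proof
  fix n
  note [simp] = mpoly_carrierD(1) [OF F] mpoly_carrierD(1) [OF G]
  have "(\<Oplus>k\<in>supp F. \<Oplus>l\<in>supp G. if k + l = n then F k \<otimes> G l else \<zero>)
    = (\<Oplus>l\<in>supp G. \<Oplus>k\<in>supp F. if k + l = n then F k \<otimes> G l else \<zero>)"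
    by (rule finsum_swap) (use F G in \<open>auto simp: mpoly_carrierD(2)\<close>)
  also have "\<dots> = (\<Oplus>l\<in>supp G. \<Oplus>k\<in>supp F. if l + k = n then G l \<otimes> F k else \<zero>)"
    by (intro finsum_cong') (auto simp: add.commute m_comm intro!: finsum_closed finsum_cong')
  finally show "(F \<otimes>\<^bsub>mpoly_ring R I\<^esub> G) n = (G \<otimes>\<^bsub>mpoly_ring R I\<^esub> F) n"
    by (simp only: mpoly_mult [OF F G mpoly_carrierD(2) [OF F] order_refl mpoly_carrierD(2) [OF G] order_refl]
      mpoly_mult [OF G F mpoly_carrierD(2) [OF G] order_refl mpoly_carrierD(2) [OF F] order_refl])
qed

end

lemma pairing_superset:
  assumes "ring_hom_cring R T \<phi>" and F: "F \<in> carrier (mpoly_ring R I)"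
    and w: "\<And>k. w k \<in> carrier T" and A: "finite A" "{k. F k \<noteq> \<zero>\<^bsub>R\<^esub>} \<subseteq> A"
  shows "pairing R T \<phi> w F = finsum T (\<lambda>k. \<phi> (F k) \<otimes>\<^bsub>T\<^esub> w k) A"
proof -
  interpret ring_hom_cring R T \<phi> by fact
  show ?thesis
    unfolding pairing_def
    by (rule S.add.finprod_mono_neutral_cong_left)
      (use A w F in \<open>auto simp: mpoly_carrierD(1)\<close>)
qed

lemma pairing_closed:
  assumes "ring_hom_cring R T \<phi>" and F: "F \<in> carrier (mpoly_ring R I)"
    and w: "\<And>k. w k \<in> carrier T"
  shows "pairing R T \<phi> w F \<in> carrier T"
proof -
  interpret ring_hom_cring R T \<phi> by fact
  show ?thesis unfolding pairing_def using F w by (auto simp: mpoly_carrierD(1) intro!: S.finsum_closed)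
qed

lemma pairing_mult:
  assumes hom: "ring_hom_cring R T \<phi>"
    and F: "F \<in> carrier (mpoly_ring R I)" and G: "G \<in> carrier (mpoly_ring R I)"
    and w: "\<And>k. w k \<in> carrier T"
    and A: "finite A" "{k. F k \<noteq> \<zero>\<^bsub>R\<^esub>} \<subseteq> A" and B: "finite B" "{k. G k \<noteq> \<zero>\<^bsub>R\<^esub>} \<subseteq> B"
  shows "pairing R T \<phi> w (F \<otimes>\<^bsub>mpoly_ring R I\<^esub> G)
    = finsum T (\<lambda>k. finsum T (\<lambda>l. \<phi> (F k) \<otimes>\<^bsub>T\<^esub> \<phi> (G l) \<otimes>\<^bsub>T\<^esub> w (k + l)) B) A"
proof -
  interpret ring_hom_cring R T \<phi> by fact
  note [simp] = mpoly_carrierD(1) [OF F] mpoly_carrierD(1) [OF G] w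
  let ?FG = "F \<otimes>\<^bsub>mpoly_ring R I\<^esub> G"
  define M where "M = (\<lambda>(k, l). k + l) ` (A \<times> B)"
  have M: "finite M" "\<And>k l. k \<in> A \<Longrightarrow> l \<in> B \<Longrightarrow> k + l \<in> M"
    using A B by (auto simp: M_def)
  have "(\<lambda>(k, l). k + l) ` (R.supp F \<times> R.supp G) \<subseteq> M"
    using A B unfolding M_def by (intro image_mono Sigma_mono) auto
  then have "{n. ?FG n \<noteq> \<zero>\<^bsub>R\<^esub>} \<subseteq> M"
    using R.mpoly_mult_zero_outside [OF F G] by blast
  then have "pairing R T \<phi> w ?FG = finsum T (\<lambda>n. \<phi> (?FG n) \<otimes>\<^bsub>T\<^esub> w n) M"
    using pairing_superset [OF hom R.mpoly_mult_closed [OF F G] w] M by simp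
  also have "\<dots> = finsum T (\<lambda>n. finsum T (\<lambda>k. finsum T (\<lambda>l.
      if n = k + l then \<phi> (F k) \<otimes>\<^bsub>T\<^esub> \<phi> (G l) \<otimes>\<^bsub>T\<^esub> w n else \<zero>\<^bsub>T\<^esub>) B) A) M"
  proof (intro S.finsum_cong' refl)
    fix n
    have "\<phi> (?FG n) = finsum T (\<lambda>k. finsum T (\<lambda>l.
        if n = k + l then \<phi> (F k) \<otimes>\<^bsub>T\<^esub> \<phi> (G l) else \<zero>\<^bsub>T\<^esub>) B) A"
    proof -
      have "\<phi> (finsum R (\<lambda>k. finsum R (\<lambda>l. if k + l = n then F k \<otimes>\<^bsub>R\<^esub> G l else \<zero>\<^bsub>R\<^esub>) B) A)
         = finsum T (\<lambda>k. \<phi> (finsum R (\<lambda>l. if k + l = n then F k \<otimes>\<^bsub>R\<^esub> G l else \<zero>\<^bsub>R\<^esub>) B)) A"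
        by (subst hom_finsum) (auto simp: o_def intro!: R.finsum_closed)
      also have "\<dots> = finsum T (\<lambda>k. finsum T (\<lambda>l.
          \<phi> (if k + l = n then F k \<otimes>\<^bsub>R\<^esub> G l else \<zero>\<^bsub>R\<^esub>)) B) A"
        by (intro S.finsum_cong' refl) (auto simp: o_def intro!: S.finsum_closed)
      also have "\<dots> = finsum T (\<lambda>k. finsum T (\<lambda>l.
          if n = k + l then \<phi> (F k) \<otimes>\<^bsub>T\<^esub> \<phi> (G l) else \<zero>\<^bsub>T\<^esub>) B) A"
        by (intro S.finsum_cong' refl) (auto intro!: S.finsum_closed)
      finally show ?thesis
        by (simp only: R.mpoly_mult [OF F G A B])
    qed
    also have "\<dots> \<otimes>\<^bsub>T\<^esub> w n = finsum T (\<lambda>k. finsum T (\<lambda>l.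
        if n = k + l then \<phi> (F k) \<otimes>\<^bsub>T\<^esub> \<phi> (G l) \<otimes>\<^bsub>T\<^esub> w n else \<zero>\<^bsub>T\<^esub>) B) A"
    proof -
      have "finsum T (\<lambda>k. finsum T (\<lambda>l.
          if n = k + l then \<phi> (F k) \<otimes>\<^bsub>T\<^esub> \<phi> (G l) else \<zero>\<^bsub>T\<^esub>) B) A \<otimes>\<^bsub>T\<^esub> w n
        = finsum T (\<lambda>k. finsum T (\<lambda>l.
          if n = k + l then \<phi> (F k) \<otimes>\<^bsub>T\<^esub> \<phi> (G l) else \<zero>\<^bsub>T\<^esub>) B \<otimes>\<^bsub>T\<^esub> w n) A"
        by (rule S.finsum_ldistr) (use A in \<open>auto intro!: S.finsum_closed\<close>)
      also have "\<dots> = finsum T (\<lambda>k. finsum T (\<lambda>l.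
          (if n = k + l then \<phi> (F k) \<otimes>\<^bsub>T\<^esub> \<phi> (G l) else \<zero>\<^bsub>T\<^esub>) \<otimes>\<^bsub>T\<^esub> w n) B) A"
        by (intro S.finsum_cong' refl S.finsum_ldistr) (use B in \<open>auto intro!: S.finsum_closed\<close>)
      also have "\<dots> = finsum T (\<lambda>k. finsum T (\<lambda>l.
          if n = k + l then \<phi> (F k) \<otimes>\<^bsub>T\<^esub> \<phi> (G l) \<otimes>\<^bsub>T\<^esub> w n else \<zero>\<^bsub>T\<^esub>) B) A"
        by (intro S.finsum_cong' refl) (auto intro!: S.finsum_closed)
      finally show ?thesis .
    qed
    finally show "\<phi> (?FG n) \<otimes>\<^bsub>T\<^esub> w n = finsum T (\<lambda>k. finsum T (\<lambda>l.
        if n = k + l then \<phi> (F k) \<otimes>\<^bsub>T\<^esub> \<phi> (G l) \<otimes>\<^bsub>T\<^esub> w n else \<zero>\<^bsub>T\<^esub>) B) A" .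
  qed (auto intro!: S.finsum_closed)
  also have "\<dots> = finsum T (\<lambda>k. finsum T (\<lambda>n. finsum T (\<lambda>l.
      if n = k + l then \<phi> (F k) \<otimes>\<^bsub>T\<^esub> \<phi> (G l) \<otimes>\<^bsub>T\<^esub> w n else \<zero>\<^bsub>T\<^esub>) B) M) A"
    by (rule S.finsum_swap) (use A B M in \<open>auto intro!: S.finsum_closed\<close>)
  also have "\<dots> = finsum T (\<lambda>k. finsum T (\<lambda>l. finsum T (\<lambda>n.
      if n = k + l then \<phi> (F k) \<otimes>\<^bsub>T\<^esub> \<phi> (G l) \<otimes>\<^bsub>T\<^esub> w n else \<zero>\<^bsub>T\<^esub>) M) B) A"
    by (intro S.finsum_cong' refl S.finsum_swap) (use A B M in \<open>auto intro!: S.finsum_closed\<close>)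
  also have "\<dots> = finsum T (\<lambda>k. finsum T (\<lambda>l. \<phi> (F k) \<otimes>\<^bsub>T\<^esub> \<phi> (G l) \<otimes>\<^bsub>T\<^esub> w (k + l)) B) A"
    by (intro S.finsum_cong' refl) (use A B M in \<open>auto intro!: S.finsum_closed simp: S.finsum_delta\<close>)
  finally show ?thesis .
qed

text \<open>
  Fubini: a product is paired one factor at a time.  Since polynomials are determined by their
  pairings (\<open>mpoly_eqI\<close>), the ring axioms for polynomials follow from this without comparing coefficients
  of iterated products.
\<close>

lemma pairing_mult_iterated:
  assumes hom: "ring_hom_cring R T \<phi>"
    and F: "F \<in> carrier (mpoly_ring R I)" and G: "G \<in> carrier (mpoly_ring R I)"
    and w: "\<And>k. w k \<in> carrier T"
  shows "pairing R T \<phi> w (F \<otimes>\<^bsub>mpoly_ring R I\<^esub> G)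
    = pairing R T \<phi> (\<lambda>k. pairing R T \<phi> (\<lambda>l. w (k + l)) G) F"
proof -
  interpret ring_hom_cring R T \<phi> by fact
  note [simp] = mpoly_carrierD(1) [OF F] mpoly_carrierD(1) [OF G] w
  have "finsum T (\<lambda>l. \<phi> (F k) \<otimes>\<^bsub>T\<^esub> \<phi> (G l) \<otimes>\<^bsub>T\<^esub> w (k + l)) (R.supp G)
     = \<phi> (F k) \<otimes>\<^bsub>T\<^esub> pairing R T \<phi> (\<lambda>l. w (k + l)) G" for k
  proof -
    have "finsum T (\<lambda>l. \<phi> (F k) \<otimes>\<^bsub>T\<^esub> \<phi> (G l) \<otimes>\<^bsub>T\<^esub> w (k + l)) (R.supp G)
      = finsum T (\<lambda>l. \<phi> (F k) \<otimes>\<^bsub>T\<^esub> (\<phi> (G l) \<otimes>\<^bsub>T\<^esub> w (k + l))) (R.supp G)"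
      by (intro S.finsum_cong' refl) (auto simp: S.m_assoc)
    also have "\<dots> = \<phi> (F k) \<otimes>\<^bsub>T\<^esub> pairing R T \<phi> (\<lambda>l. w (k + l)) G"
      unfolding pairing_def
      by (rule S.finsum_rdistr [symmetric]) (use mpoly_carrierD(2) [OF G] in auto)
    finally show ?thesis .
  qed
  then show ?thesis
    unfolding pairing_mult [OF assms mpoly_carrierD(2) [OF F] order_refl mpoly_carrierD(2) [OF G] order_refl]
    by (simp add: pairing_def [of R T \<phi> _ F])
qed

lemma pairing_add:
  assumes hom: "ring_hom_cring R T \<phi>"
    and F: "F \<in> carrier (mpoly_ring R I)" and G: "G \<in> carrier (mpoly_ring R I)"
    and FG: "F \<oplus>\<^bsub>mpoly_ring R I\<^esub> G \<in> carrier (mpoly_ring R I)"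
    and w: "\<And>k. w k \<in> carrier T"
  shows "pairing R T \<phi> w (F \<oplus>\<^bsub>mpoly_ring R I\<^esub> G) = pairing R T \<phi> w F \<oplus>\<^bsub>T\<^esub> pairing R T \<phi> w G"
proof -
  interpret ring_hom_cring R T \<phi> by fact
  note [simp] = mpoly_carrierD(1) [OF F] mpoly_carrierD(1) [OF G] w
  define A where "A = R.supp F \<union> R.supp G"
  have A: "finite A" using mpoly_carrierD(2) [OF F] mpoly_carrierD(2) [OF G] by (simp add: A_def)
  have sub: "R.supp F \<subseteq> A" "R.supp G \<subseteq> A" "R.supp (F \<oplus>\<^bsub>mpoly_ring R I\<^esub> G) \<subseteq> A"
    by (auto simp: A_def mpoly_add)
  have "finsum T (\<lambda>k. \<phi> ((F \<oplus>\<^bsub>mpoly_ring R I\<^esub> G) k) \<otimes>\<^bsub>T\<^esub> w k) A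
      = finsum T (\<lambda>k. \<phi> (F k) \<otimes>\<^bsub>T\<^esub> w k \<oplus>\<^bsub>T\<^esub> \<phi> (G k) \<otimes>\<^bsub>T\<^esub> w k) A"
    by (intro S.finsum_cong' refl) (auto simp: mpoly_add S.l_distr)
  also have "\<dots> = finsum T (\<lambda>k. \<phi> (F k) \<otimes>\<^bsub>T\<^esub> w k) A \<oplus>\<^bsub>T\<^esub> finsum T (\<lambda>k. \<phi> (G k) \<otimes>\<^bsub>T\<^esub> w k) A"
    by (rule S.finsum_addf) auto
  finally show ?thesis
    by (simp add: pairing_superset [OF hom F w A sub(1)] pairing_superset [OF hom G w A sub(2)]
      pairing_superset [OF hom FG w A sub(3)])
qed

lemma (in cring) ring_hom_cring_ident: "ring_hom_cring R R (\<lambda>x. x)"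
  by unfold_locales (auto simp: ring_hom_def)

context cring begin

abbreviation "indic n \<equiv> (\<lambda>k. if k = n then \<one> else \<zero>)"

lemma coeff_eq_pairing:
  assumes F: "F \<in> carrier (mpoly_ring R I)"
  shows "F n = pairing R R (\<lambda>x. x) (indic n) F"
proof -
  note [simp] = mpoly_carrierD(1) [OF F]
  have "pairing R R (\<lambda>x. x) (indic n) F = (\<Oplus>k\<in>insert n (supp F). F k \<otimes> indic n k)"
    by (rule pairing_superset [OF ring_hom_cring_ident F]) (use mpoly_carrierD(2) [OF F] in auto)
  also have "\<dots> = (\<Oplus>k\<in>insert n (supp F). if k = n then F k else \<zero>)"
    by (intro finsum_cong') auto
  also have "\<dots> = F n"
    using mpoly_carrierD(2) [OF F] by (subst finsum_delta) auto
  finally show ?thesis by simp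
qed

text \<open>Already the pairings with indicator functions of monomials give all coefficients.\<close>

lemma mpoly_eqI:
  assumes F: "F \<in> carrier (mpoly_ring R I)" and G: "G \<in> carrier (mpoly_ring R I)"
    and eq: "\<And>w. (\<And>k. w k \<in> carrier R) \<Longrightarrow> pairing R R (\<lambda>x. x) w F = pairing R R (\<lambda>x. x) w G"
  shows "F = G"
proof
  fix n
  have "pairing R R (\<lambda>x. x) (indic n) F = pairing R R (\<lambda>x. x) (indic n) G"
    by (rule eq) auto
  then show "F n = G n"
    using coeff_eq_pairing [OF F, of n] coeff_eq_pairing [OF G, of n] by simp
qed

lemma mconst_closed: "r \<in> carrier R \<Longrightarrow> mconst R r \<in> carrier (mpoly_ring R I)"
  by (auto simp: mpoly_ring_def mconst_def intro: rev_finite_subset [of "{{#}}"])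

lemma mvar_closed: "q \<in> I \<Longrightarrow> mvar R q \<in> carrier (mpoly_ring R I)"
  by (auto simp: mpoly_ring_def mvar_def intro: rev_finite_subset [of "{{#q#}}"])

lemma mpoly_add_closed:
  assumes F: "F \<in> carrier (mpoly_ring R I)" and G: "G \<in> carrier (mpoly_ring R I)"
  shows "F \<oplus>\<^bsub>mpoly_ring R I\<^esub> G \<in> carrier (mpoly_ring R I)"
proof -
  have "supp (\<lambda>n. F n \<oplus> G n) \<subseteq> supp F \<union> supp G" using F G by auto
  then have "finite (supp (\<lambda>n. F n \<oplus> G n))"
    by (rule finite_subset) (use F G in \<open>auto simp: mpoly_carrierD(2)\<close>)
  moreover have "set_mset n \<subseteq> I" if "F n \<oplus> G n \<noteq> \<zero>" for n
    using that mpoly_carrierD(3) [OF F, of n] mpoly_carrierD(3) [OF G, of n] mpoly_carrierD(1) [OF G, of n]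
    by (cases "F n = \<zero>") auto
  ultimately show ?thesis
    using F G by (simp add: mpoly_ring_def)
qed

lemma mpoly_zero_closed: "\<zero>\<^bsub>mpoly_ring R I\<^esub> \<in> carrier (mpoly_ring R I)"
  by (simp add: mpoly_ring_def)

lemma pairing_mconst:
  assumes hom: "ring_hom_cring R T \<phi>" and "r \<in> carrier R" "\<And>k. w k \<in> carrier T"
  shows "pairing R T \<phi> w (mconst R r) = \<phi> r \<otimes>\<^bsub>T\<^esub> w {#}"
proof -
  note mc = mconst_closed
  interpret ring_hom_cring R T \<phi> by fact
  have "pairing R T \<phi> w (mconst R r) = finsum T (\<lambda>k. \<phi> (mconst R r k) \<otimes>\<^bsub>T\<^esub> w k) {{#}}"
    using assms by (intro pairing_superset [OF hom mc]) (auto simp: mconst_def)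
  also have "\<dots> = \<phi> r \<otimes>\<^bsub>T\<^esub> w {#}"
    using assms by (simp add: mconst_def)
  finally show ?thesis .
qed

lemma pairing_mvar:
  assumes hom: "ring_hom_cring R T \<phi>" and w: "\<And>k. w k \<in> carrier T"
  shows "pairing R T \<phi> w (mvar R q) = w {#q#}"
proof -
  note mv = mvar_closed
  interpret ring_hom_cring R T \<phi> by fact
  have "pairing R T \<phi> w (mvar R q) = finsum T (\<lambda>k. \<phi> (mvar R q k) \<otimes>\<^bsub>T\<^esub> w k) {{#q#}}"
    using assms by (intro pairing_superset [OF hom mv [of q UNIV]]) (auto simp: mvar_def)
  also have "\<dots> = w {#q#}"
    using assms by (simp add: mvar_def)
  finally show ?thesis .
qed

lemma mpoly_cring: "cring (mpoly_ring R I)"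
proof (intro cringI abelian_groupI comm_monoidI)
  let ?P = "mpoly_ring R I"
  note id = ring_hom_cring_ident
  fix F G H assume F: "F \<in> carrier ?P" and G: "G \<in> carrier ?P" and H: "H \<in> carrier ?P"
  note c = mpoly_carrierD(1) [OF F] mpoly_carrierD(1) [OF G] mpoly_carrierD(1) [OF H]
  show "F \<otimes>\<^bsub>?P\<^esub> G \<otimes>\<^bsub>?P\<^esub> H = F \<otimes>\<^bsub>?P\<^esub> (G \<otimes>\<^bsub>?P\<^esub> H)"
  proof (rule mpoly_eqI)
    fix w :: "'c multiset \<Rightarrow> 'a" assume w: "\<And>k. w k \<in> carrier R"
    show "pairing R R (\<lambda>x. x) w (F \<otimes>\<^bsub>?P\<^esub> G \<otimes>\<^bsub>?P\<^esub> H) = pairing R R (\<lambda>x. x) w (F \<otimes>\<^bsub>?P\<^esub> (G \<otimes>\<^bsub>?P\<^esub> H))"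
      using F G H w
      by (simp add: pairing_mult_iterated [OF id] mpoly_mult_closed pairing_closed [OF id] add.assoc)
  qed (use F G H in \<open>auto intro!: mpoly_mult_closed\<close>)
  show "(F \<oplus>\<^bsub>?P\<^esub> G) \<otimes>\<^bsub>?P\<^esub> H = F \<otimes>\<^bsub>?P\<^esub> H \<oplus>\<^bsub>?P\<^esub> G \<otimes>\<^bsub>?P\<^esub> H"
  proof (rule mpoly_eqI)
    fix w :: "'c multiset \<Rightarrow> 'a" assume w: "\<And>k. w k \<in> carrier R"
    show "pairing R R (\<lambda>x. x) w ((F \<oplus>\<^bsub>?P\<^esub> G) \<otimes>\<^bsub>?P\<^esub> H) = pairing R R (\<lambda>x. x) w (F \<otimes>\<^bsub>?P\<^esub> H \<oplus>\<^bsub>?P\<^esub> G \<otimes>\<^bsub>?P\<^esub> H)"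
      using F G H w
      by (simp add: pairing_mult_iterated [OF id] pairing_add [OF id] mpoly_mult_closed mpoly_add_closed
        pairing_closed [OF id])
  qed (use F G H in \<open>auto intro!: mpoly_mult_closed mpoly_add_closed\<close>)
  show "\<one>\<^bsub>?P\<^esub> \<otimes>\<^bsub>?P\<^esub> F = F"
  proof (rule mpoly_eqI)
    fix w :: "'c multiset \<Rightarrow> 'a" assume w: "\<And>k. w k \<in> carrier R"
    show "pairing R R (\<lambda>x. x) w (\<one>\<^bsub>?P\<^esub> \<otimes>\<^bsub>?P\<^esub> F) = pairing R R (\<lambda>x. x) w F"
      unfolding mpoly_one using F w
      by (simp add: pairing_mult_iterated [OF id] mconst_closed pairing_mconst [OF id] pairing_closed [OF id])
  qed (use F in \<open>auto simp: mpoly_one intro!: mpoly_mult_closed mconst_closed\<close>)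
  show "\<exists>K\<in>carrier ?P. K \<oplus>\<^bsub>?P\<^esub> F = \<zero>\<^bsub>?P\<^esub>"
  proof
    have "(\<ominus> F n = \<zero>) = (F n = \<zero>)" for n
      using c(1) [of n] by (metis minus_minus minus_zero)
    then show "(\<lambda>n. \<ominus> F n) \<in> carrier ?P"
      using F by (simp add: mpoly_ring_def)
    show "(\<lambda>n. \<ominus> F n) \<oplus>\<^bsub>?P\<^esub> F = \<zero>\<^bsub>?P\<^esub>"
      using c by (auto simp: mpoly_add mpoly_zero l_neg)
  qed
  show "\<zero>\<^bsub>?P\<^esub> \<oplus>\<^bsub>?P\<^esub> F = F" "F \<oplus>\<^bsub>?P\<^esub> G = G \<oplus>\<^bsub>?P\<^esub> F" "F \<oplus>\<^bsub>?P\<^esub> G \<oplus>\<^bsub>?P\<^esub> H = F \<oplus>\<^bsub>?P\<^esub> (G \<oplus>\<^bsub>?P\<^esub> H)"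
    using c by (auto simp: mpoly_add mpoly_zero a_ac)
qed (auto simp: mpoly_add_closed mpoly_mult_closed mpoly_mult_comm mpoly_one mpoly_zero_closed mconst_closed)

end


section \<open>Functoriality and evaluation of symmetric algebras\<close>

lemma mpoly_map_eq_pairing:
  assumes hom: "ring_hom_cring R R' \<rho>" and F: "F \<in> carrier (mpoly_ring R I)"
  shows "mpoly_map R R' \<rho> u F n
    = pairing R R' \<rho> (\<lambda>k. if image_mset u k = n then \<one>\<^bsub>R'\<^esub> else \<zero>\<^bsub>R'\<^esub>) F"
proof -
  interpret ring_hom_cring R R' \<rho> by fact
  note [simp] = mpoly_carrierD(1) [OF F]
  show ?thesis
    unfolding mpoly_map_def pairing_def
    by (rule S.add.finprod_mono_neutral_cong_left) (use mpoly_carrierD(2) [OF F] in auto)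
qed

lemma mpoly_map_zero_outside:
  assumes hom: "ring_hom_cring R R' \<rho>" and F: "F \<in> carrier (mpoly_ring R I)"
    and n: "n \<notin> image_mset u ` {k. F k \<noteq> \<zero>\<^bsub>R\<^esub>}"
  shows "mpoly_map R R' \<rho> u F n = \<zero>\<^bsub>R'\<^esub>"
proof -
  interpret ring_hom_cring R R' \<rho> by fact
  have "{k. F k \<noteq> \<zero>\<^bsub>R\<^esub> \<and> image_mset u k = n} = {}" using n by blast
  then show ?thesis by (simp only: mpoly_map_def S.finsum_empty)
qed

lemma mpoly_map_closed:
  assumes hom: "ring_hom_cring R R' \<rho>" and F: "F \<in> carrier (mpoly_ring R I)" and u: "u ` I \<subseteq> I'"
  shows "mpoly_map R R' \<rho> u F \<in> carrier (mpoly_ring R' I')"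
proof -
  interpret ring_hom_cring R R' \<rho> by fact
  let ?F = "mpoly_map R R' \<rho> u F"
  have sub: "{n. ?F n \<noteq> \<zero>\<^bsub>R'\<^esub>} \<subseteq> image_mset u ` R.supp F"
    using mpoly_map_zero_outside [OF hom F] by blast
  then have "finite {n. ?F n \<noteq> \<zero>\<^bsub>R'\<^esub>}"
    by (rule finite_subset) (use mpoly_carrierD(2) [OF F] in auto)
  moreover have "set_mset n \<subseteq> I'" if "?F n \<noteq> \<zero>\<^bsub>R'\<^esub>" for n
    using sub that mpoly_carrierD(3) [OF F] u by fastforce
  moreover have "?F n \<in> carrier R'" for n
    unfolding mpoly_map_def using mpoly_carrierD(1) [OF F] by (auto intro!: S.finsum_closed)
  ultimately show ?thesis
    by (simp add: mpoly_ring_def)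
qed

lemma pairing_mpoly_map:
  assumes hom: "ring_hom_cring R R' \<rho>" and hom': "ring_hom_cring R' T \<phi>"
    and F: "F \<in> carrier (mpoly_ring R I)" and w: "\<And>k. w k \<in> carrier T"
  shows "pairing R' T \<phi> w (mpoly_map R R' \<rho> u F)
    = pairing R T (\<lambda>r. \<phi> (\<rho> r)) (\<lambda>k. w (image_mset u k)) F"
proof -
  interpret ring_hom_cring R R' \<rho> by fact
  interpret K: ring_hom_cring R' T \<phi> by fact
  note [simp] = mpoly_carrierD(1) [OF F] w
  note fin = mpoly_carrierD(2) [OF F]
  let ?A = "R.supp F" and ?F = "mpoly_map R R' \<rho> u F"
  have "pairing R' T \<phi> w ?F = finsum T (\<lambda>n. \<phi> (?F n) \<otimes>\<^bsub>T\<^esub> w n) (image_mset u ` ?A)"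
    using mpoly_map_zero_outside [OF hom F] fin
    by (intro pairing_superset [OF hom' mpoly_map_closed [OF hom F order_refl]] w finite_imageI) blast+
  also have "\<dots> = finsum T (\<lambda>n. finsum T (\<lambda>k.
      if n = image_mset u k then \<phi> (\<rho> (F k)) \<otimes>\<^bsub>T\<^esub> w n else \<zero>\<^bsub>T\<^esub>) ?A) (image_mset u ` ?A)"
  proof (intro K.S.finsum_cong' refl)
    fix n
    have "\<phi> (?F n) = finsum T (\<lambda>k. if n = image_mset u k then \<phi> (\<rho> (F k)) else \<zero>\<^bsub>T\<^esub>) ?A"
      unfolding mpoly_map_eq_pairing [OF hom F] pairing_def
      by (subst K.hom_finsum) (auto simp: o_def intro!: K.S.finsum_cong')
    also have "\<dots> \<otimes>\<^bsub>T\<^esub> w n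
       = finsum T (\<lambda>k. (if n = image_mset u k then \<phi> (\<rho> (F k)) else \<zero>\<^bsub>T\<^esub>) \<otimes>\<^bsub>T\<^esub> w n) ?A"
      by (rule K.S.finsum_ldistr) (use fin in auto)
    also have "\<dots> = finsum T (\<lambda>k. if n = image_mset u k then \<phi> (\<rho> (F k)) \<otimes>\<^bsub>T\<^esub> w n else \<zero>\<^bsub>T\<^esub>) ?A"
      by (intro K.S.finsum_cong' refl) auto
    finally show "\<phi> (?F n) \<otimes>\<^bsub>T\<^esub> w n
       = finsum T (\<lambda>k. if n = image_mset u k then \<phi> (\<rho> (F k)) \<otimes>\<^bsub>T\<^esub> w n else \<zero>\<^bsub>T\<^esub>) ?A" .
  qed (auto intro!: K.S.finsum_closed)
  also have "\<dots> = finsum T (\<lambda>k. finsum T (\<lambda>n.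
      if n = image_mset u k then \<phi> (\<rho> (F k)) \<otimes>\<^bsub>T\<^esub> w n else \<zero>\<^bsub>T\<^esub>) (image_mset u ` ?A)) ?A"
    by (rule K.S.finsum_swap) (use fin in auto)
  also have "\<dots> = pairing R T (\<lambda>r. \<phi> (\<rho> r)) (\<lambda>k. w (image_mset u k)) F"
    unfolding pairing_def
    by (intro K.S.finsum_cong' refl) (use fin in \<open>auto simp: K.S.finsum_delta\<close>)
  finally show ?thesis .
qed

lemma mpoly_map_mconst:
  assumes hom: "ring_hom_cring R R' \<rho>" and "r \<in> carrier R"
  shows "mpoly_map R R' \<rho> u (mconst R r) = mconst R' (\<rho> r)"
proof
  interpret ring_hom_cring R R' \<rho> by fact
  show "mpoly_map R R' \<rho> u (mconst R r) n = mconst R' (\<rho> r) n" for n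
    using assms by (subst mpoly_map_eq_pairing [OF hom R.mconst_closed])
      (auto simp: R.pairing_mconst [OF hom], auto simp: mconst_def)
qed

lemma mpoly_map_ring_hom:
  assumes hom: "ring_hom_cring R R' \<rho>" and u: "u ` I \<subseteq> I'"
  shows "ring_hom_ring (mpoly_ring R I) (mpoly_ring R' I') (mpoly_map R R' \<rho> u)"
proof -
  interpret ring_hom_cring R R' \<rho> by fact
  interpret P: cring "mpoly_ring R I" by (rule R.mpoly_cring)
  interpret P': cring "mpoly_ring R' I'" by (rule S.mpoly_cring)
  let ?P = "mpoly_ring R I" and ?P' = "mpoly_ring R' I'" and ?m = "mpoly_map R R' \<rho> u"
  note id = S.ring_hom_cring_ident
  note closed = mpoly_map_closed [OF hom _ u]
  show ?thesis
  proof (intro ring_hom_ringI2 P.ring_axioms P'.ring_axioms ring_hom_memI)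
    fix F G assume F: "F \<in> carrier ?P" and G: "G \<in> carrier ?P"
    show "?m F \<in> carrier ?P'" by (rule closed [OF F])
    show "?m (F \<otimes>\<^bsub>?P\<^esub> G) = ?m F \<otimes>\<^bsub>?P'\<^esub> ?m G"
    proof (rule S.mpoly_eqI)
      fix w :: "'e multiset \<Rightarrow> 'c" assume w: "\<And>k. w k \<in> carrier R'"
      show "pairing R' R' (\<lambda>x. x) w (?m (F \<otimes>\<^bsub>?P\<^esub> G)) = pairing R' R' (\<lambda>x. x) w (?m F \<otimes>\<^bsub>?P'\<^esub> ?m G)"
        using F G w closed
        by (simp add: pairing_mpoly_map [OF hom id R.mpoly_mult_closed [OF F G] w]
            pairing_mpoly_map [OF hom id F] pairing_mpoly_map [OF hom id G]
            pairing_mult_iterated [OF id] pairing_mult_iterated [OF hom F G]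
            pairing_closed [OF hom G] pairing_closed [OF id])
    qed (use F G closed in auto)
    show "?m (F \<oplus>\<^bsub>?P\<^esub> G) = ?m F \<oplus>\<^bsub>?P'\<^esub> ?m G"
    proof (rule S.mpoly_eqI)
      fix w :: "'e multiset \<Rightarrow> 'c" assume w: "\<And>k. w k \<in> carrier R'"
      show "pairing R' R' (\<lambda>x. x) w (?m (F \<oplus>\<^bsub>?P\<^esub> G)) = pairing R' R' (\<lambda>x. x) w (?m F \<oplus>\<^bsub>?P'\<^esub> ?m G)"
        using F G w closed
        by (simp add: pairing_mpoly_map [OF hom id R.mpoly_add_closed [OF F G] w]
            pairing_mpoly_map [OF hom id F w] pairing_mpoly_map [OF hom id G w]
            pairing_add [OF id _ _ S.mpoly_add_closed] pairing_add [OF hom F G R.mpoly_add_closed [OF F G]])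
    qed (use F G closed in auto)
  next
    show "?m \<one>\<^bsub>?P\<^esub> = \<one>\<^bsub>?P'\<^esub>"
      by (simp only: mpoly_one mpoly_map_mconst [OF hom R.one_closed] hom_one)
  qed
qed

lemma mpoly_map_mvar:
  assumes hom: "ring_hom_cring R R' \<rho>"
  shows "mpoly_map R R' \<rho> u (mvar R q) = mvar R' (u q)"
proof
  interpret ring_hom_cring R R' \<rho> by fact
  show "mpoly_map R R' \<rho> u (mvar R q) n = mvar R' (u q) n" for n
    by (subst mpoly_map_eq_pairing [OF hom R.mvar_closed [of q UNIV]])
      (auto simp: R.pairing_mvar [OF hom], auto simp: mvar_def)
qed

lemma evaluation_ring_hom:
  assumes hom: "ring_hom_cring R T \<phi>"
    and w: "\<And>k. w k \<in> carrier T" "w {#} = \<one>\<^bsub>T\<^esub>" "\<And>k l. w (k + l) = w k \<otimes>\<^bsub>T\<^esub> w l"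
  shows "ring_hom_ring (mpoly_ring R I) T (pairing R T \<phi> w)"
proof -
  interpret ring_hom_cring R T \<phi> by fact
  interpret P: cring "mpoly_ring R I" by (rule R.mpoly_cring)
  let ?P = "mpoly_ring R I" and ?e = "pairing R T \<phi> w"
  show ?thesis
  proof (intro ring_hom_ringI2 P.ring_axioms S.ring_axioms ring_hom_memI)
    fix F G assume F: "F \<in> carrier ?P" and G: "G \<in> carrier ?P"
    note [simp] = mpoly_carrierD(1) [OF F] mpoly_carrierD(1) [OF G] w(1)
    show "?e F \<in> carrier T" by (rule pairing_closed [OF hom F w(1)])
    show "?e (F \<oplus>\<^bsub>?P\<^esub> G) = ?e F \<oplus>\<^bsub>T\<^esub> ?e G"
      using F G by (simp add: pairing_add [OF hom])
    have inner: "pairing R T \<phi> (\<lambda>l. w (k + l)) G = w k \<otimes>\<^bsub>T\<^esub> ?e G" for k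
    proof -
      have "pairing R T \<phi> (\<lambda>l. w (k + l)) G = finsum T (\<lambda>l. w k \<otimes>\<^bsub>T\<^esub> (\<phi> (G l) \<otimes>\<^bsub>T\<^esub> w l)) (R.supp G)"
        unfolding pairing_def by (intro S.finsum_cong' refl) (auto simp: w(3) S.m_lcomm)
      then show ?thesis
        unfolding pairing_def using mpoly_carrierD(2) [OF G] by (simp add: S.finsum_rdistr)
    qed
    have "?e (F \<otimes>\<^bsub>?P\<^esub> G) = pairing R T \<phi> (\<lambda>k. w k \<otimes>\<^bsub>T\<^esub> ?e G) F"
      by (simp add: pairing_mult_iterated [OF hom F G w(1)] inner)
    also have "\<dots> = finsum T (\<lambda>k. \<phi> (F k) \<otimes>\<^bsub>T\<^esub> w k \<otimes>\<^bsub>T\<^esub> ?e G) (R.supp F)"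
      unfolding pairing_def [of _ _ _ _ F] using pairing_closed [OF hom G w(1)]
      by (intro S.finsum_cong' refl) (auto simp: S.m_assoc)
    also have "\<dots> = ?e F \<otimes>\<^bsub>T\<^esub> ?e G"
      unfolding pairing_def [of _ _ _ _ F] using pairing_closed [OF hom G w(1)] mpoly_carrierD(2) [OF F]
      by (simp add: S.finsum_ldistr)
    finally show "?e (F \<otimes>\<^bsub>?P\<^esub> G) = ?e F \<otimes>\<^bsub>T\<^esub> ?e G" .
  qed (simp add: mpoly_one R.pairing_mconst [OF hom] w)
qed

text \<open>Evaluating a polynomial at values \<open>v q\<close> of the variables is pairing it with the multiplicative
  function on monomials which extends \<open>v\<close>.\<close>

lemma (in cring) multiplicative_extension:
  assumes "\<And>q. v q \<in> carrier R"
  obtains w where "\<And>k. w k \<in> carrier R" "w {#} = \<one>" "\<And>k l. w (k + l) = w k \<otimes> w l" "\<And>q. w {#q#} = v q"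
proof
  define w where "w k = finprod R (\<lambda>q. v q [^] count k q) (set_mset k)" for k
  have w: "w k = finprod R (\<lambda>q. v q [^] count k q) A" if "finite A" "set_mset k \<subseteq> A" for k A
    unfolding w_def by (rule finprod_mono_neutral_cong_left) (use that assms in \<open>auto simp: not_in_iff\<close>)
  show "w k \<in> carrier R" for k
    unfolding w_def using assms by (auto intro!: finprod_closed)
  show "w {#} = \<one>" "\<And>q. w {#q#} = v q"
    using assms by (auto simp: w_def)
  show "w (k + l) = w k \<otimes> w l" for k l
  proof -
    let ?A = "set_mset (k + l)"
    have "w (k + l) = finprod R (\<lambda>q. v q [^] count k q \<otimes> v q [^] count l q) ?A"
      unfolding w_def using assms by (intro finprod_cong') (auto simp: nat_pow_mult)
    also have "\<dots> = w k \<otimes> w l"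
      using assms w [of ?A k] w [of ?A l] by (simp add: finprod_multf)
    finally show ?thesis .
  qed
qed

definition sym_relations :: "('r, 'm) ring_scheme \<Rightarrow> ('r, 'q, 'n) module_scheme
    \<Rightarrow> ('q multiset \<Rightarrow> 'r) set" where
  "sym_relations R Q = (let P = mpoly_ring R (carrier Q) in
     {mvar R (x \<oplus>\<^bsub>Q\<^esub> y) \<ominus>\<^bsub>P\<^esub> (mvar R x \<oplus>\<^bsub>P\<^esub> mvar R y) |x y. x \<in> carrier Q \<and> y \<in> carrier Q} \<union>
     {mvar R (r \<odot>\<^bsub>Q\<^esub> x) \<ominus>\<^bsub>P\<^esub> (mconst R r \<otimes>\<^bsub>P\<^esub> mvar R x) |r x. r \<in> carrier R \<and> x \<in> carrier Q})"

lemma sym_ideal_eq: "sym_ideal R Q = genideal (mpoly_ring R (carrier Q)) (sym_relations R Q)"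
  by (simp add: sym_ideal_def sym_relations_def Let_def)

lemma (in cring) sym_relations_carrier:
  assumes "\<And>x y. x \<in> carrier Q \<Longrightarrow> y \<in> carrier Q \<Longrightarrow> x \<oplus>\<^bsub>Q\<^esub> y \<in> carrier Q"
    and "\<And>r x. r \<in> carrier R \<Longrightarrow> x \<in> carrier Q \<Longrightarrow> r \<odot>\<^bsub>Q\<^esub> x \<in> carrier Q"
  shows "sym_relations R Q \<subseteq> carrier (mpoly_ring R (carrier Q))"
proof -
  interpret P: cring "mpoly_ring R (carrier Q)" by (rule mpoly_cring)
  show ?thesis
    unfolding sym_relations_def Let_def using assms by (auto intro!: mvar_closed mconst_closed)
qed

text \<open>The universal property of the symmetric algebra: its relations say that the variables depend
  linearly on the elements of the module, so evaluation along a linear map kills them.\<close>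

lemma evaluation_sym_ideal:
  assumes hom: "ring_hom_cring R T \<phi>"
    and w: "\<And>k. w k \<in> carrier T" "w {#} = \<one>\<^bsub>T\<^esub>" "\<And>k l. w (k + l) = w k \<otimes>\<^bsub>T\<^esub> w l"
    and Q: "\<And>x y. x \<in> carrier Q \<Longrightarrow> y \<in> carrier Q \<Longrightarrow> x \<oplus>\<^bsub>Q\<^esub> y \<in> carrier Q"
      "\<And>r x. r \<in> carrier R \<Longrightarrow> x \<in> carrier Q \<Longrightarrow> r \<odot>\<^bsub>Q\<^esub> x \<in> carrier Q"
    and add: "\<And>x y. x \<in> carrier Q \<Longrightarrow> y \<in> carrier Q \<Longrightarrow> w {#x \<oplus>\<^bsub>Q\<^esub> y#} = w {#x#} \<oplus>\<^bsub>T\<^esub> w {#y#}"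
    and smult: "\<And>r x. r \<in> carrier R \<Longrightarrow> x \<in> carrier Q \<Longrightarrow> w {#r \<odot>\<^bsub>Q\<^esub> x#} = \<phi> r \<otimes>\<^bsub>T\<^esub> w {#x#}"
    and F: "F \<in> sym_ideal R Q"
  shows "pairing R T \<phi> w F = \<zero>\<^bsub>T\<^esub>"
proof -
  let ?P = "mpoly_ring R (carrier Q)"
  interpret H: ring_hom_cring R T \<phi> by fact
  interpret P: cring ?P by (rule H.R.mpoly_cring)
  interpret ring_hom_ring ?P T "pairing R T \<phi> w" by (rule evaluation_ring_hom [OF hom w])
  have "sym_relations R Q \<subseteq> a_kernel ?P T (pairing R T \<phi> w)"
    using H.R.sym_relations_carrier [of Q, OF Q]
    unfolding a_kernel_def' sym_relations_def Let_def
    by (auto simp: P.minus_eq H.R.mvar_closed H.R.mconst_closed Q add smult w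
        H.R.pairing_mvar [OF hom] H.R.pairing_mconst [OF hom] H.S.r_neg)
  then have "sym_ideal R Q \<subseteq> a_kernel ?P T (pairing R T \<phi> w)"
    unfolding sym_ideal_eq by (intro P.genideal_minimal kernel_is_ideal)
  then show ?thesis using F unfolding a_kernel_def' by blast
qed

text \<open>A semilinear surjection of modules over a surjection of rings: the situation of the map from the
  sections of \<open>E\<close> onto the obstruction module, over the restriction of functions to \<open>M\<close>.\<close>

locale sym_functoriality = ring_hom_cring R R' \<rho>
    for R :: "('r, 'm) ring_scheme" (structure) and R' :: "('s, 'n) ring_scheme" (structure) and \<rho> +
  fixes Q :: "('r, 'q, 'l) module_scheme" and Q' :: "('s, 'p, 'k) module_scheme" and u :: "'q \<Rightarrow> 'p"
  assumes Q_add: "x \<in> carrier Q \<Longrightarrow> y \<in> carrier Q \<Longrightarrow> x \<oplus>\<^bsub>Q\<^esub> y \<in> carrier Q"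
    and Q_smult: "r \<in> carrier R \<Longrightarrow> x \<in> carrier Q \<Longrightarrow> r \<odot>\<^bsub>Q\<^esub> x \<in> carrier Q"
    and onto: "carrier Q' = u ` carrier Q" "carrier R' = \<rho> ` carrier R"
    and u_add: "x \<in> carrier Q \<Longrightarrow> y \<in> carrier Q \<Longrightarrow> u (x \<oplus>\<^bsub>Q\<^esub> y) = u x \<oplus>\<^bsub>Q'\<^esub> u y"
    and u_smult: "r \<in> carrier R \<Longrightarrow> x \<in> carrier Q \<Longrightarrow> u (r \<odot>\<^bsub>Q\<^esub> x) = \<rho> r \<odot>\<^bsub>Q'\<^esub> u x"
begin

lemma Q'_add: "x \<in> carrier Q' \<Longrightarrow> y \<in> carrier Q' \<Longrightarrow> x \<oplus>\<^bsub>Q'\<^esub> y \<in> carrier Q'"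
  using Q_add u_add [symmetric] by (auto simp: onto)

lemma Q'_smult: "r \<in> carrier R' \<Longrightarrow> x \<in> carrier Q' \<Longrightarrow> r \<odot>\<^bsub>Q'\<^esub> x \<in> carrier Q'"
  using Q_smult u_smult [symmetric] by (auto simp: onto)

lemma hom: "ring_hom_cring R R' \<rho>" ..

sublocale P: cring "mpoly_ring R (carrier Q)" by (rule R.mpoly_cring)
sublocale P': cring "mpoly_ring R' (carrier Q')" by (rule S.mpoly_cring)
sublocale m: ring_hom_ring "mpoly_ring R (carrier Q)" "mpoly_ring R' (carrier Q')" "mpoly_map R R' \<rho> u"
  by (rule mpoly_map_ring_hom [OF hom]) (simp add: onto)

lemma sym_ideal_ideal: "ideal (sym_ideal R Q) (mpoly_ring R (carrier Q))"
  unfolding sym_ideal_eq by (intro P.genideal_ideal R.sym_relations_carrier Q_add Q_smult)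

lemma sym_ideal_ideal': "ideal (sym_ideal R' Q') (mpoly_ring R' (carrier Q'))"
  unfolding sym_ideal_eq by (intro P'.genideal_ideal S.sym_relations_carrier Q'_add Q'_smult)

lemma mpoly_map_sym_ideal:
  assumes "F \<in> sym_ideal R Q" shows "mpoly_map R R' \<rho> u F \<in> sym_ideal R' Q'"
proof -
  let ?P = "mpoly_ring R (carrier Q)" and ?P' = "mpoly_ring R' (carrier Q')"
  let ?K = "{F \<in> carrier ?P. mpoly_map R R' \<rho> u F \<in> sym_ideal R' Q'}"
  have rel: "sym_relations R' Q' \<subseteq> sym_ideal R' Q'"
    unfolding sym_ideal_eq by (intro P'.genideal_self S.sym_relations_carrier Q'_add Q'_smult)
  have v: "mvar R' (u x) \<in> carrier ?P'" if "x \<in> carrier Q" for x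
    using that by (intro S.mvar_closed) (simp add: onto)
  have "sym_relations R Q \<subseteq> ?K"
  proof
    fix F assume F: "F \<in> sym_relations R Q"
    then consider (add) x y where "x \<in> carrier Q" "y \<in> carrier Q"
        "F = mvar R (x \<oplus>\<^bsub>Q\<^esub> y) \<ominus>\<^bsub>?P\<^esub> (mvar R x \<oplus>\<^bsub>?P\<^esub> mvar R y)"
      | (smult) r x where "r \<in> carrier R" "x \<in> carrier Q"
        "F = mvar R (r \<odot>\<^bsub>Q\<^esub> x) \<ominus>\<^bsub>?P\<^esub> (mconst R r \<otimes>\<^bsub>?P\<^esub> mvar R x)"
      by (auto simp: sym_relations_def Let_def)
    then have "mpoly_map R R' \<rho> u F \<in> sym_relations R' Q'"
    proof cases
      case add
      then have "mpoly_map R R' \<rho> u F = mvar R' (u x \<oplus>\<^bsub>Q'\<^esub> u y) \<ominus>\<^bsub>?P'\<^esub> (mvar R' (u x) \<oplus>\<^bsub>?P'\<^esub> mvar R' (u y))"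
        by (simp add: P.minus_eq P'.minus_eq R.mvar_closed Q_add u_add mpoly_map_mvar [OF hom])
      then show ?thesis using add unfolding sym_relations_def Let_def onto by blast
    next
      case smult
      then have "mpoly_map R R' \<rho> u F = mvar R' (\<rho> r \<odot>\<^bsub>Q'\<^esub> u x) \<ominus>\<^bsub>?P'\<^esub> (mconst R' (\<rho> r) \<otimes>\<^bsub>?P'\<^esub> mvar R' (u x))"
        by (simp add: P.minus_eq P'.minus_eq R.mvar_closed R.mconst_closed Q_smult u_smult
            mpoly_map_mvar [OF hom] mpoly_map_mconst [OF hom])
      then show ?thesis using smult unfolding sym_relations_def Let_def onto by blast
    qed
    then show "F \<in> ?K" using rel F R.sym_relations_carrier [of Q, OF Q_add Q_smult] by blast
  qed
  then have "sym_ideal R Q \<subseteq> ?K"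
    unfolding sym_ideal_eq [of R Q] by (intro P.genideal_minimal m.ideal_vimage sym_ideal_ideal')
  then show ?thesis using assms by blast
qed

text \<open>The map of symmetric algebras is a union over representatives.  As it respects the relations
  (\<open>mpoly_map_sym_ideal\<close>), this union is a single coset, and the kernel can be tested on any polynomial
  representing the given element.\<close>

lemma kernel_sym_mapI:
  assumes F: "F \<in> carrier (mpoly_ring R (carrier Q))" and F': "mpoly_map R R' \<rho> u F \<in> sym_ideal R' Q'"
  shows "\<exists>C. F \<in> C \<and> C \<in> a_kernel (sym_algebra R Q) (sym_algebra R' Q') (sym_map R R' Q' \<rho> u)"
proof -
  let ?P = "mpoly_ring R (carrier Q)" and ?P' = "mpoly_ring R' (carrier Q')"
  interpret I: ideal "sym_ideal R Q" ?P by (rule sym_ideal_ideal)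
  interpret I': ideal "sym_ideal R' Q'" ?P' by (rule sym_ideal_ideal')
  let ?C = "sym_ideal R Q +>\<^bsub>?P\<^esub> F"
  have img: "sym_ideal R' Q' +>\<^bsub>?P'\<^esub> mpoly_map R R' \<rho> u G = sym_ideal R' Q'" if "G \<in> ?C" for G
  proof -
    obtain H where H: "H \<in> sym_ideal R Q" "G = H \<oplus>\<^bsub>?P\<^esub> F"
      using \<open>G \<in> ?C\<close> by (auto simp: a_r_coset_def')
    then have "mpoly_map R R' \<rho> u G \<in> sym_ideal R' Q'"
      using F F' mpoly_map_sym_ideal [OF H(1)] I.Icarr [OF H(1)] by (simp add: I'.a_closed)
    then show ?thesis using P'.a_rcos_zero [OF sym_ideal_ideal'] by simp
  qed
  have self: "F \<in> ?C"
    using I.a_rcos_self [OF F] .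
  then have "sym_map R R' Q' \<rho> u ?C = sym_ideal R' Q'"
    unfolding sym_map_def using img by blast
  moreover have "?C \<in> carrier (sym_algebra R Q)"
    using F by (auto simp: sym_algebra_def FactRing_def A_RCOSETS_def')
  ultimately show ?thesis using self
    by (auto simp: a_kernel_def' sym_algebra_def FactRing_def)
qed

lemma kernel_sym_mapD:
  assumes C: "C \<in> a_kernel (sym_algebra R Q) (sym_algebra R' Q') (sym_map R R' Q' \<rho> u)" and F: "F \<in> C"
  shows "F \<in> carrier (mpoly_ring R (carrier Q))" "mpoly_map R R' \<rho> u F \<in> sym_ideal R' Q'"
proof -
  let ?P = "mpoly_ring R (carrier Q)" and ?P' = "mpoly_ring R' (carrier Q')"
  interpret I: ideal "sym_ideal R Q" ?P by (rule sym_ideal_ideal)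
  interpret I': ideal "sym_ideal R' Q'" ?P' by (rule sym_ideal_ideal')
  have "C \<in> a_rcosets\<^bsub>?P\<^esub> (sym_ideal R Q)" and zero: "sym_map R R' Q' \<rho> u C = sym_ideal R' Q'"
    using C by (auto simp: a_kernel_def' sym_algebra_def FactRing_def)
  then show carr: "F \<in> carrier ?P"
    using F I.a_rcosets_carrier by blast
  have "mpoly_map R R' \<rho> u F \<in> sym_ideal R' Q' +>\<^bsub>?P'\<^esub> mpoly_map R R' \<rho> u F"
    using I'.a_rcos_self carr by simp
  then show "mpoly_map R R' \<rho> u F \<in> sym_ideal R' Q'"
    using zero F unfolding sym_map_def by blast
qed

end


section \<open>Hilbert's basis theorem\<close>

definition subring :: "'a::comm_ring_1 set \<Rightarrow> bool" where
  "subring R \<longleftrightarrow> 1 \<in> R \<and> (\<forall>a\<in>R. \<forall>b\<in>R. a - b \<in> R \<and> a * b \<in> R)"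

definition ideal_in :: "'a::comm_ring_1 set \<Rightarrow> 'a set \<Rightarrow> bool" where
  "ideal_in R I \<longleftrightarrow> I \<subseteq> R \<and> 0 \<in> I \<and> (\<forall>a\<in>I. \<forall>b\<in>I. a + b \<in> I) \<and> (\<forall>r\<in>R. \<forall>a\<in>I. r * a \<in> I)"

definition combinations :: "'a::comm_ring_1 set \<Rightarrow> nat \<Rightarrow> (nat \<Rightarrow> 'a) \<Rightarrow> 'a set" where
  "combinations R N g = {\<Sum>k<N. q k * g k |q. \<forall>k<N. q k \<in> R}"

definition noetherian :: "'a::comm_ring_1 set \<Rightarrow> bool" where
  "noetherian R \<longleftrightarrow> (\<forall>I. ideal_in R I \<longrightarrow> (\<exists>N g. (\<forall>k<N. g k \<in> I) \<and> I \<subseteq> combinations R N g))"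

definition adjoin :: "'a::comm_ring_1 set \<Rightarrow> 'a \<Rightarrow> 'a set" where
  "adjoin R x = {poly p x |p. \<forall>i. coeff p i \<in> R}"

lemma subring_closed:
  assumes "subring R"
  shows "0 \<in> R" "1 \<in> R" "a \<in> R \<Longrightarrow> b \<in> R \<Longrightarrow> a * b \<in> R" "a \<in> R \<Longrightarrow> b \<in> R \<Longrightarrow> a - b \<in> R"
    "a \<in> R \<Longrightarrow> b \<in> R \<Longrightarrow> a + b \<in> R" "a \<in> R \<Longrightarrow> - a \<in> R"
proof -
  show 1: "1 \<in> R" and *: "\<And>a b. a \<in> R \<Longrightarrow> b \<in> R \<Longrightarrow> a * b \<in> R"
    "\<And>a b. a \<in> R \<Longrightarrow> b \<in> R \<Longrightarrow> a - b \<in> R"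
    using assms by (auto simp: subring_def)
  show 0: "0 \<in> R" using *(2) [OF 1 1] by simp
  show **: "- a \<in> R" if "a \<in> R" for a using *(2) [OF 0 that] by simp
  show "a + b \<in> R" if "a \<in> R" "b \<in> R" for a b using *(2) [OF that(1) ** [OF that(2)]] by simp
qed

lemma subring_sum:
  assumes "subring R" "\<And>i. i \<in> A \<Longrightarrow> f i \<in> R" shows "sum f A \<in> R"
  using assms by (induction A rule: infinite_finite_induct) (auto simp: subring_closed)

lemma subring_power: "subring R \<Longrightarrow> a \<in> R \<Longrightarrow> a ^ n \<in> R"
  by (induction n) (auto simp: subring_closed)

lemma combinations_mono:
  assumes "subring R" "M \<le> N" shows "combinations R M g \<subseteq> combinations R N g"
proof
  fix f assume "f \<in> combinations R M g"
  then obtain q where q: "\<forall>k<M. q k \<in> R" "f = (\<Sum>k<M. q k * g k)" by (auto simp: combinations_def)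
  have "f = (\<Sum>k<N. (if k < M then q k else 0) * g k)"
    unfolding q(2) by (rule sum.mono_neutral_cong_left) (use assms in auto)
  then show "f \<in> combinations R N g"
    using q assms(1) unfolding combinations_def
    by (intro CollectI exI [of _ "\<lambda>k. if k < M then q k else 0"]) (auto simp: subring_closed)
qed

lemma combinations_ideal:
  assumes R: "subring R" and g: "\<And>k. k < N \<Longrightarrow> g k \<in> R"
  shows "ideal_in R (combinations R N g)"
  unfolding ideal_in_def
proof (intro conjI ballI)
  show "combinations R N g \<subseteq> R"
    using g R by (auto simp: combinations_def intro!: subring_sum subring_closed)
  show "0 \<in> combinations R N g"
    using R unfolding combinations_def by (intro CollectI exI [of _ "\<lambda>_. 0"]) (auto simp: subring_closed)
next
  fix a b assume "a \<in> combinations R N g" "b \<in> combinations R N g"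
  then obtain q q' where "\<forall>k<N. q k \<in> R" "\<forall>k<N. q' k \<in> R" "a = (\<Sum>k<N. q k * g k)" "b = (\<Sum>k<N. q' k * g k)"
    by (auto simp: combinations_def)
  then show "a + b \<in> combinations R N g"
    using R unfolding combinations_def
    by (intro CollectI exI [of _ "\<lambda>k. q k + q' k"]) (auto simp: subring_closed distrib_right sum.distrib)
next
  fix r a assume "r \<in> R" "a \<in> combinations R N g"
  then obtain q where "r \<in> R" "\<forall>k<N. q k \<in> R" "a = (\<Sum>k<N. q k * g k)"
    by (auto simp: combinations_def)
  then show "r * a \<in> combinations R N g"
    using R unfolding combinations_def
    by (intro CollectI exI [of _ "\<lambda>k. r * q k"]) (auto simp: subring_closed sum_distrib_left mult.assoc)
qed

lemma ideal_in_sum: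
  assumes "ideal_in R I" "\<And>k. k \<in> A \<Longrightarrow> f k \<in> I" shows "sum f A \<in> I"
  using assms(2) by (induction A rule: infinite_finite_induct) (use assms(1) in \<open>auto simp: ideal_in_def\<close>)

lemma adjoin_mult_power:
  assumes "subring R" "r \<in> R" shows "r * x ^ n \<in> adjoin R x"
  unfolding adjoin_def using assms
  by (intro CollectI exI [of _ "monom r n"]) (auto simp: poly_monom subring_closed)

lemma subring_adjoin:
  assumes R: "subring R" shows "subring (adjoin R x)"
  unfolding subring_def
proof (intro conjI ballI)
  show "1 \<in> adjoin R x" using adjoin_mult_power [OF R, of 1 x 0] R by (simp add: subring_closed)
  fix a b assume "a \<in> adjoin R x" "b \<in> adjoin R x"
  then obtain p q where p: "\<forall>i. coeff p i \<in> R" "a = poly p x" and q: "\<forall>i. coeff q i \<in> R" "b = poly q x"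
    by (auto simp: adjoin_def)
  show "a - b \<in> adjoin R x"
    unfolding adjoin_def using p q R by (intro CollectI exI [of _ "p - q"]) (auto simp: subring_closed)
  show "a * b \<in> adjoin R x"
    unfolding adjoin_def using p q R
    by (intro CollectI exI [of _ "p * q"]) (auto simp: coeff_mult intro!: subring_sum subring_closed)
qed

text \<open>
  A non-finitely generated ideal of \<open>R[x]\<close> yields an infinite sequence of elements \<open>f\<^sub>n\<close>, each of
  minimal degree outside the ideal generated by its predecessors.  As \<open>R\<close> is noetherian, some
  leading coefficient is a combination of earlier ones; as the degrees increase, subtracting the
  corresponding combination of earlier \<open>f\<^sub>k\<close> lowers the degree, against minimality.
\<close>

theorem hilbert_basis:
  assumes R: "subring R" and noeth: "noetherian R" shows "noetherian (adjoin R x)"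
proof (rule ccontr)
  let ?S = "adjoin R x"
  note S = subring_adjoin [OF R, of x]
  assume "\<not> noetherian ?S"
  then obtain I where I: "ideal_in ?S I"
    and not_fg: "\<And>N g. (\<forall>k<N. g k \<in> I) \<Longrightarrow> \<not> I \<subseteq> combinations ?S N g"
    unfolding noetherian_def by blast
  define out where "out f n p \<longleftrightarrow> (\<forall>i. coeff p i \<in> R) \<and> poly p x \<in> I \<and>
      poly p x \<notin> combinations ?S n (\<lambda>k. poly (f k) x)" for f :: "nat \<Rightarrow> 'a poly" and n and p :: "'a poly"
  have "\<exists>f. \<forall>n. out f n (f n) \<and> (\<forall>p. out f n p \<longrightarrow> degree (f n) \<le> degree p)"
  proof (rule dependent_wellorder_choice)
    fix f g :: "nat \<Rightarrow> 'a poly" and n p assume eq: "\<And>k. k < n \<Longrightarrow> f k = g k"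
    have "out f n = out g n"
      unfolding out_def combinations_def using eq by simp
    then show "(out f n p \<and> (\<forall>q. out f n q \<longrightarrow> degree p \<le> degree q)) =
        (out g n p \<and> (\<forall>q. out g n q \<longrightarrow> degree p \<le> degree q))" by simp
  next
    fix n and f :: "nat \<Rightarrow> 'a poly"
    assume "\<And>k. k < n \<Longrightarrow> out f k (f k) \<and> (\<forall>p. out f k p \<longrightarrow> degree (f k) \<le> degree p)"
    then have "\<forall>k<n. poly (f k) x \<in> I" by (auto simp: out_def)
    then obtain h where h: "h \<in> I" "h \<notin> combinations ?S n (\<lambda>k. poly (f k) x)"
      using not_fg [of n "\<lambda>k. poly (f k) x"] by blast
    then obtain p where "\<forall>i. coeff p i \<in> R" "h = poly p x"
      using I by (auto simp: ideal_in_def adjoin_def)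
    then have "\<exists>p. out f n p" using h by (auto simp: out_def)
    then show "\<exists>p. out f n p \<and> (\<forall>q. out f n q \<longrightarrow> degree p \<le> degree q)"
      using ex_has_least_nat [of "out f n" _ degree] by blast
  qed
  then obtain f where f: "\<And>n. out f n (f n)" and least: "\<And>n p. out f n p \<Longrightarrow> degree (f n) \<le> degree p"
    by blast
  have coeff: "coeff (f n) i \<in> R" and fI: "poly (f n) x \<in> I" for n i
    using f by (auto simp: out_def)
  have deg_mono: "degree (f k) \<le> degree (f n)" if "k \<le> n" for k n
  proof (rule least)
    show "out f k (f n)"
      using f [of n] combinations_mono [OF S that, of "\<lambda>k. poly (f k) x"] by (auto simp: out_def)
  qed
  define l where "l n = lead_coeff (f n)" for n
  have lR: "l n \<in> R" for n by (simp add: l_def coeff)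
  have comb: "ideal_in R (combinations R n l)" for n
    by (rule combinations_ideal [OF R]) (rule lR)
  have "ideal_in R (\<Union>n. combinations R n l)"
    unfolding ideal_in_def
  proof (intro conjI ballI)
    fix a b assume "a \<in> (\<Union>n. combinations R n l)" "b \<in> (\<Union>n. combinations R n l)"
    then obtain m n where "a \<in> combinations R m l" "b \<in> combinations R n l" by blast
    then have "a \<in> combinations R (max m n) l" "b \<in> combinations R (max m n) l"
      using combinations_mono [OF R max.cobounded1] combinations_mono [OF R max.cobounded2] by blast+
    then show "a + b \<in> (\<Union>n. combinations R n l)"
      using comb [of "max m n"] by (auto simp: ideal_in_def)
  next
    fix r a assume "r \<in> R" "a \<in> (\<Union>n. combinations R n l)"
    then obtain n where "r \<in> R" "a \<in> combinations R n l" by blast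
    then have "r * a \<in> combinations R n l" using comb [of n] by (simp add: ideal_in_def)
    then show "r * a \<in> (\<Union>n. combinations R n l)" by blast
  next
    show "(\<Union>n. combinations R n l) \<subseteq> R" using comb unfolding ideal_in_def by blast
    show "0 \<in> (\<Union>n. combinations R n l)" using comb unfolding ideal_in_def by blast
  qed
  then obtain N g where g: "\<forall>k<N. g k \<in> (\<Union>n. combinations R n l)"
      and gen: "(\<Union>n. combinations R n l) \<subseteq> combinations R N g"
    using noeth unfolding noetherian_def by blast
  from g have "\<forall>k. \<exists>n. k < N \<longrightarrow> g k \<in> combinations R n l" by blast
  then obtain \<nu> where \<nu>: "\<And>k. k < N \<Longrightarrow> g k \<in> combinations R (\<nu> k) l" by metis
  define n where "n = Max (insert 0 (\<nu> ` {..<N}))"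
  have gn: "g k \<in> combinations R n l" if "k < N" for k
  proof -
    have "\<nu> k \<le> n" using that by (auto simp: n_def intro: Max_ge)
    then show ?thesis using \<nu> [OF that] combinations_mono [OF R] by blast
  qed
  have "combinations R N g \<subseteq> combinations R n l"
    unfolding combinations_def [of R N]
  proof clarify
    fix q assume "\<forall>k<N. q k \<in> R"
    then show "(\<Sum>k<N. q k * g k) \<in> combinations R n l"
      using comb [of n] gn by (intro ideal_in_sum [OF comb]) (auto simp: ideal_in_def)
  qed
  moreover have "l n \<in> combinations R (Suc n) l"
    using R unfolding combinations_def
    by (intro CollectI exI [of _ "\<lambda>k. if k = n then 1 else 0"])
       (auto simp: subring_closed if_distrib [of "\<lambda>x. x * _"] cong: if_cong)
  ultimately have "l n \<in> combinations R n l"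
    using gen by blast
  then obtain q where q: "\<And>k. k < n \<Longrightarrow> q k \<in> R" "l n = (\<Sum>k<n. q k * l k)"
    by (auto simp: combinations_def)
  define d where "d k = degree (f n) - degree (f k)" for k
  define p where "p = f n - (\<Sum>k<n. monom (q k) (d k) * f k)"
  have coeff_shift: "coeff (monom (q k) (d k) * f k) (degree (f n)) = q k * l k" if "k < n" for k
    using deg_mono [of k n] that by (simp add: coeff_monom_mult d_def l_def)
  have "degree (monom (q k) (d k) * f k) \<le> degree (f n)" if "k < n" for k
    using deg_mono [of k n] that degree_mult_le [of "monom (q k) (d k)" "f k"] degree_monom_le [of "q k" "d k"]
    by (simp add: d_def)
  then have deg_p: "degree p \<le> degree (f n)"
    unfolding p_def by (intro degree_diff_le degree_sum_le) auto
  have top: "coeff p (degree (f n)) = 0"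
    unfolding p_def using q(2) by (simp add: coeff_sum coeff_shift l_def)
  have pR: "coeff p i \<in> R" for i
    unfolding p_def using R q(1) coeff
    by (auto simp: coeff_sum coeff_monom_mult intro!: subring_closed subring_sum)
  have eq: "poly p x = poly (f n) x - (\<Sum>k<n. (q k * x ^ d k) * poly (f k) x)"
    by (simp add: p_def poly_sum poly_monom)
  have qS: "q k * x ^ d k \<in> ?S" if "k < n" for k
    using adjoin_mult_power [OF R q(1) [OF that]] .
  have sub: "(\<Sum>k<n. (q k * x ^ d k) * poly (f k) x) \<in> combinations ?S n (\<lambda>k. poly (f k) x)"
    unfolding combinations_def using qS by (intro CollectI exI [of _ "\<lambda>k. q k * x ^ d k"]) auto
  have gens: "ideal_in ?S (combinations ?S n (\<lambda>k. poly (f k) x))"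
    by (rule combinations_ideal [OF S]) (use fI I in \<open>auto simp: ideal_in_def\<close>)
  have "out f n p"
    unfolding out_def
  proof (intro conjI allI pR notI)
    have "- 1 \<in> ?S" using S by (simp add: subring_closed)
    moreover have "(\<Sum>k<n. (q k * x ^ d k) * poly (f k) x) \<in> I"
      using I qS fI unfolding ideal_in_def by (intro ideal_in_sum [OF I]) blast
    ultimately have "(- 1) * (\<Sum>k<n. (q k * x ^ d k) * poly (f k) x) \<in> I"
      using I unfolding ideal_in_def by blast
    then have "poly (f n) x + (- 1) * (\<Sum>k<n. (q k * x ^ d k) * poly (f k) x) \<in> I"
      using fI [of n] I unfolding ideal_in_def by blast
    then show "poly p x \<in> I" by (simp add: eq)
    assume "poly p x \<in> combinations ?S n (\<lambda>k. poly (f k) x)"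
    then have "poly p x + (\<Sum>k<n. (q k * x ^ d k) * poly (f k) x) \<in> combinations ?S n (\<lambda>k. poly (f k) x)"
      using sub gens unfolding ideal_in_def by blast
    then show False
      using f [of n] by (simp add: eq out_def)
  qed
  from least [OF this] deg_p have "degree p = degree (f n)" by simp
  then have "p = 0" using top by (metis leading_coeff_0_iff)
  then show False
    using \<open>out f n p\<close> gens by (auto simp: out_def ideal_in_def)
qed


section \<open>Polynomial functions and their derivations\<close>

lemma subring_poly_funs: "subring (poly_funs m)"
  unfolding subring_def
proof (intro conjI ballI)
  show "1 \<in> poly_funs m" using poly_funs.const [of 1] by (simp add: one_fun_def)
  fix f g assume fg: "f \<in> poly_funs m" "g \<in> poly_funs m"
  have "(\<lambda>z. f z + (-1) * g z) \<in> poly_funs m" by (intro poly_funs.intros fg)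
  then show "f - g \<in> poly_funs m" by (simp add: fun_diff_def)
  show "f * g \<in> poly_funs m" using poly_funs.product [OF fg] by (simp add: times_fun_def)
qed

lemma poly_funs_Suc: "poly_funs (Suc m) = adjoin (poly_funs m) (\<lambda>z. z m)"
proof
  note S = subring_adjoin [OF subring_poly_funs, of m "\<lambda>z. z m"]
  have base: "f \<in> adjoin (poly_funs m) (\<lambda>z. z m)" if "f \<in> poly_funs m" for f
    using adjoin_mult_power [OF subring_poly_funs that, of "\<lambda>z. z m" 0] by simp
  show "poly_funs (Suc m) \<subseteq> adjoin (poly_funs m) (\<lambda>z. z m)"
  proof
    fix f assume "f \<in> poly_funs (Suc m)"
    then show "f \<in> adjoin (poly_funs m) (\<lambda>z. z m)"
    proof induction
      case (coord i)
      show ?case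
      proof (cases "i = m")
        case True
        then show ?thesis
          using adjoin_mult_power [OF subring_poly_funs poly_funs.const [of 1], of "\<lambda>z. z m" 1]
          by (simp add: times_fun_def)
      qed (use coord base poly_funs.coord in auto)
    next
      case (sum f g) then show ?case using subring_closed(5) [OF S] by (simp add: plus_fun_def)
    next
      case (product f g) then show ?case using subring_closed(3) [OF S] by (simp add: times_fun_def)
    qed (use base poly_funs.const in auto)
  qed
  show "adjoin (poly_funs m) (\<lambda>z. z m) \<subseteq> poly_funs (Suc m)"
  proof
    have up: "f \<in> poly_funs (Suc m)" if "f \<in> poly_funs m" for f
      using that by induction (auto intro: poly_funs.intros)
    fix f assume "f \<in> adjoin (poly_funs m) (\<lambda>z. z m)"
    then obtain p where p: "\<forall>i. coeff p i \<in> poly_funs m" "f = poly p (\<lambda>z. z m)"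
      by (auto simp: adjoin_def)
    have "(\<lambda>z. z m) ^ n \<in> poly_funs (Suc m)" for n
      by (intro subring_power [OF subring_poly_funs] poly_funs.coord) simp
    then show "f \<in> poly_funs (Suc m)"
      unfolding p(2) poly_altdef using p(1) up
      by (intro subring_sum [OF subring_poly_funs] subring_closed(3) [OF subring_poly_funs]) auto
  qed
qed

lemma noetherian_poly_funs: "noetherian (poly_funs m)"
proof (induction m)
  case 0
  have const: "\<exists>c. f = (\<lambda>_. c)" if "f \<in> poly_funs 0" for f
    using that by induction auto
  show ?case
    unfolding noetherian_def
  proof (intro allI impI)
    fix I :: "((nat \<Rightarrow> complex) \<Rightarrow> complex) set" assume I: "ideal_in (poly_funs 0) I"
    show "\<exists>N g. (\<forall>k<N. g k \<in> I) \<and> I \<subseteq> combinations (poly_funs 0) N g"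
    proof (cases "\<exists>c. c \<noteq> 0 \<and> (\<lambda>_. c) \<in> I")
      \<comment> \<open>an ideal of constants containing a nonzero constant is everything\<close>
      case True
      then obtain c where c: "c \<noteq> 0" "(\<lambda>_. c) \<in> I" by blast
      have "f \<in> combinations (poly_funs 0) 1 (\<lambda>_ _. c)" if f: "f \<in> I" for f
      proof -
        have "f \<in> poly_funs 0" using I f by (auto simp: ideal_in_def)
        then obtain b where "f = (\<lambda>_. b)" using const by blast
        then show ?thesis
          unfolding combinations_def using c
          by (intro CollectI exI [of _ "\<lambda>_ _. b / c"]) (auto intro: poly_funs.const simp: times_fun_def)
      qed
      then show ?thesis using c by (intro exI [of _ 1] exI [of _ "\<lambda>_ _. c"]) auto
    next
      case False
      have "f = 0" if f: "f \<in> I" for f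
      proof -
        have "f \<in> poly_funs 0" using I f by (auto simp: ideal_in_def)
        then obtain b where "f = (\<lambda>_. b)" using const by blast
        then show ?thesis using False f by (auto simp: zero_fun_def)
      qed
      then show ?thesis by (intro exI [of _ 0]) (auto simp: combinations_def)
    qed
  qed
next
  case (Suc m)
  then show ?case by (simp add: poly_funs_Suc hilbert_basis subring_poly_funs)
qed

lemma poly_fun_differentiable:
  assumes "f \<in> poly_funs m" shows "(\<lambda>t. f (z(j := t))) field_differentiable at t"
  using assms
proof induction
  case (coord i)
  then show ?case by (cases "i = j") auto
qed (auto intro: field_differentiable_add field_differentiable_mult)

lemma pderiv_at_const: "pderiv_at j (\<lambda>_. c) z = 0"
  by (simp add: pderiv_at_def)

lemma pderiv_at_coord: "pderiv_at j (\<lambda>z. z i) z = (if i = j then 1 else 0)"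
  by (simp add: pderiv_at_def)

lemma pderiv_at_add:
  assumes "f \<in> poly_funs m" "g \<in> poly_funs m"
  shows "pderiv_at j (\<lambda>z. f z + g z) z = pderiv_at j f z + pderiv_at j g z"
  using assms by (simp add: pderiv_at_def poly_fun_differentiable)

lemma pderiv_at_mult:
  assumes "f \<in> poly_funs m" "g \<in> poly_funs m"
  shows "pderiv_at j (\<lambda>z. f z * g z) z = f z * pderiv_at j g z + g z * pderiv_at j f z"
  using assms by (simp add: pderiv_at_def poly_fun_differentiable)

lemma pderiv_at_poly_fun: "f \<in> poly_funs m \<Longrightarrow> (\<lambda>z. pderiv_at j f z) \<in> poly_funs m"
proof (induction rule: poly_funs.induct)
  case (coord i)
  then show ?case by (simp add: pderiv_at_coord poly_funs.const)
next
  case (sum f g)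
  then show ?case by (simp add: pderiv_at_add poly_funs.sum)
next
  case (product f g)
  then show ?case by (simp add: pderiv_at_mult poly_funs.intros)
qed (simp add: pderiv_at_const poly_funs.const)

definition point_derivation ::
    "nat \<Rightarrow> (nat \<Rightarrow> complex) \<Rightarrow> (((nat \<Rightarrow> complex) \<Rightarrow> complex) \<Rightarrow> complex) \<Rightarrow> bool" where
  "point_derivation m w \<delta> \<longleftrightarrow> (\<forall>c. \<delta> (\<lambda>_. c) = 0) \<and>
     (\<forall>f\<in>poly_funs m. \<forall>g\<in>poly_funs m.
        \<delta> (\<lambda>z. f z + g z) = \<delta> f + \<delta> g \<and> \<delta> (\<lambda>z. f z * g z) = f w * \<delta> g + g w * \<delta> f)"

definition vector_field :: "nat \<Rightarrow> (((nat \<Rightarrow> complex) \<Rightarrow> complex) \<Rightarrow> (nat \<Rightarrow> complex) \<Rightarrow> complex) \<Rightarrow> bool" where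
  "vector_field m D \<longleftrightarrow> (\<forall>f\<in>poly_funs m. D f \<in> poly_funs m) \<and> (\<forall>w. point_derivation m w (\<lambda>f. D f w))"

text \<open>Both sides are derivations in \<open>f\<close> which agree on the coordinates.\<close>

lemma point_derivation_expand:
  assumes "point_derivation m w \<delta>" and "f \<in> poly_funs m"
  shows "\<delta> f = (\<Sum>i<m. \<delta> (\<lambda>z. z i) * pderiv_at i f w)"
  using assms(2)
proof induction
  case (coord i)
  then show ?case by (simp add: pderiv_at_coord if_distrib [of "\<lambda>x. _ * x"] cong: if_cong)
qed (use assms(1) in \<open>auto simp: point_derivation_def pderiv_at_const pderiv_at_add pderiv_at_mult
      sum.distrib sum_distrib_left algebra_simps\<close>)

lemma point_derivation_sum:
  assumes "point_derivation m w \<delta>" and "\<And>k. k < (n::nat) \<Longrightarrow> f k \<in> poly_funs m"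
  shows "(\<lambda>z. \<Sum>k<n. f k z) \<in> poly_funs m \<and> \<delta> (\<lambda>z. \<Sum>k<n. f k z) = (\<Sum>k<n. \<delta> (f k))"
  using assms(2)
proof (induction n)
  case 0
  then show ?case using assms(1) by (auto simp: point_derivation_def poly_funs.const)
next
  case (Suc n)
  then show ?case using assms(1) by (auto simp: point_derivation_def poly_funs.sum)
qed

lemma point_derivation_scale:
  assumes "point_derivation m w \<delta>" shows "point_derivation m w (\<lambda>f. c * \<delta> f)"
  using assms by (auto simp: point_derivation_def algebra_simps)

lemma point_derivation_diff:
  assumes "point_derivation m w \<delta>" "point_derivation m w \<epsilon>"
  shows "point_derivation m w (\<lambda>f. \<delta> f - \<epsilon> f)"
  using assms by (auto simp: point_derivation_def algebra_simps)

lemma poly_funs_diff: "f \<in> poly_funs m \<Longrightarrow> g \<in> poly_funs m \<Longrightarrow> (\<lambda>z. f z - g z) \<in> poly_funs m"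
  using subring_closed(4) [OF subring_poly_funs] by (simp add: fun_diff_def)

text \<open>
  Gaussian elimination on differentials: as the \<open>df\<^sub>k\<close> are independent at \<open>z\<close>, near \<open>z\<close> they can
  be completed by some of the \<open>dz\<^sub>j\<close>, \<open>j \<in> J\<close>, to a basis of all differentials.  The vector fields
  \<open>D\<^sub>j\<close> are those dual to the \<open>dz\<^sub>j\<close> in this basis, multiplied with a common denominator \<open>u\<close>; so they
  annihilate the \<open>f\<^sub>k\<close>, and \<open>u dg = \<Sum>\<^sub>j D\<^sub>j(g) dz\<^sub>j\<close> modulo the \<open>df\<^sub>k\<close>.
\<close>

lemma complete_differentials:
  fixes f :: "nat \<Rightarrow> (nat \<Rightarrow> complex) \<Rightarrow> complex"
  assumes "\<forall>k<c. f k \<in> poly_funs m"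
    and "\<forall>l. (\<forall>i<m. (\<Sum>k<c. l k * pderiv_at i (f k) z) = 0) \<longrightarrow> (\<forall>k<c. l k = 0)"
  shows "\<exists>J D u. J \<subseteq> {..<m} \<and> u \<in> poly_funs m \<and> u z \<noteq> 0 \<and>
     (\<forall>j\<in>J. vector_field m (D j) \<and> (\<forall>k<c. \<forall>w. D j (f k) w = 0)) \<and>
     (\<forall>g\<in>poly_funs m. \<forall>w. \<exists>l. \<forall>i<m. u w * pderiv_at i g w
        = (if i \<in> J then D i g w else 0) + (\<Sum>k<c. l k * pderiv_at i (f k) w))"
  using assms
proof (induction c)
  case 0
  have "vector_field m (\<lambda>g w. pderiv_at j g w)" for j
    by (auto simp: vector_field_def point_derivation_def pderiv_at_poly_fun pderiv_at_const
        pderiv_at_add pderiv_at_mult)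
  then show ?case
    by (intro exI [of _ "{..<m}"] exI [of _ "\<lambda>j g w. pderiv_at j g w"] exI [of _ "\<lambda>_. 1"])
      (auto intro: poly_funs.const)
next
  case (Suc c)
  have indep: "\<forall>l. (\<forall>i<m. (\<Sum>k<c. l k * pderiv_at i (f k) z) = 0) \<longrightarrow> (\<forall>k<c. l k = 0)"
  proof (intro allI impI)
    fix l k assume that: "\<forall>i<m. (\<Sum>k<c. l k * pderiv_at i (f k) z) = 0" and k: "k < c"
    have "(\<Sum>k<c. (l(c := 0)) k * pderiv_at i (f k) z) = (\<Sum>k<c. l k * pderiv_at i (f k) z)" for i
      by (intro sum.cong) auto
    then have *: "\<forall>k<Suc c. (l(c := 0)) k = 0"
      using that Suc.prems(2) [THEN spec, of "l(c := 0)"] by simp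
    show "l k = 0" using * [rule_format, of k] k by simp
  qed
  have "\<forall>k<c. f k \<in> poly_funs m" using Suc.prems(1) by simp
  note ih = Suc.IH [OF this indep]
  obtain J D u where J: "J \<subseteq> {..<m}"
    and u: "u \<in> poly_funs m" "u z \<noteq> 0"
    and D': "\<forall>j\<in>J. vector_field m (D j) \<and> (\<forall>k<c. \<forall>w. D j (f k) w = 0)"
    and expand': "\<forall>g\<in>poly_funs m. \<forall>w. \<exists>l. \<forall>i<m. u w * pderiv_at i g w
        = (if i \<in> J then D i g w else 0) + (\<Sum>k<c. l k * pderiv_at i (f k) w)"
    using ih by (elim exE conjE) (rule that)
  note expand = expand' [rule_format]
  have D: "\<And>j. j \<in> J \<Longrightarrow> vector_field m (D j)" "\<And>j k w. j \<in> J \<Longrightarrow> k < c \<Longrightarrow> D j (f k) w = 0"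
    using D' by auto
  have fc: "f c \<in> poly_funs m" using Suc.prems(1) by simp
  \<comment> \<open>otherwise the differential of \<open>f c\<close> at \<open>z\<close> would depend on those of the previous equations\<close>
  have "\<exists>j\<^sub>0\<in>J. D j\<^sub>0 (f c) z \<noteq> 0"
  proof (rule ccontr)
    assume "\<not> (\<exists>j\<^sub>0\<in>J. D j\<^sub>0 (f c) z \<noteq> 0)"
    then have zero: "\<And>j. j \<in> J \<Longrightarrow> D j (f c) z = 0" by blast
    obtain l where l: "\<forall>i<m. u z * pderiv_at i (f c) z
        = (if i \<in> J then D i (f c) z else 0) + (\<Sum>k<c. l k * pderiv_at i (f k) z)"
      using expand [OF fc] by blast
    have "\<forall>i<m. (\<Sum>k<Suc c. (l(c := - u z)) k * pderiv_at i (f k) z) = 0"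
    proof (intro allI impI)
      fix i assume i: "i < m"
      have "(\<Sum>k<c. (l(c := - u z)) k * pderiv_at i (f k) z) = (\<Sum>k<c. l k * pderiv_at i (f k) z)"
        by (intro sum.cong) auto
      also have "\<dots> = u z * pderiv_at i (f c) z"
        using l i zero [of i] by (cases "i \<in> J") auto
      finally show "(\<Sum>k<Suc c. (l(c := - u z)) k * pderiv_at i (f k) z) = 0"
        by simp
    qed
    then have "(l(c := - u z)) c = 0"
      using Suc.prems(2) by blast
    then show False using u by simp
  qed
  then obtain j\<^sub>0 where j\<^sub>0: "j\<^sub>0 \<in> J" "D j\<^sub>0 (f c) z \<noteq> 0" by blast
  \<comment> \<open>exchange step: \<open>f c\<close> replaces \<open>z\<^sub>j\<close> with \<open>j = j\<^sub>0\<close>, and the other fields are corrected by a multiple of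
      \<open>D j\<^sub>0\<close> so that they annihilate \<open>f c\<close>\<close>
  let ?a = "D j\<^sub>0 (f c)"
  let ?D = "\<lambda>j g w. ?a w * D j g w - D j (f c) w * D j\<^sub>0 g w"
  have Dpoly: "D j g \<in> poly_funs m" if "j \<in> J" "g \<in> poly_funs m" for j g
    using D(1) [OF that(1)] that(2) by (simp add: vector_field_def)
  have Dder: "point_derivation m w (\<lambda>g. D j g w)" if "j \<in> J" for j w
    using D(1) [OF that] by (simp add: vector_field_def)
  show ?case
  proof (intro exI [of _ "J - {j\<^sub>0}"] exI [of _ ?D] exI [of _ "\<lambda>w. ?a w * u w"] conjI ballI allI impI)
    show "J - {j\<^sub>0} \<subseteq> {..<m}" using J by blast
    show "(\<lambda>w. ?a w * u w) \<in> poly_funs m"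
      by (intro poly_funs.product Dpoly j\<^sub>0 fc u)
    show "?a z * u z \<noteq> 0" using j\<^sub>0 u by simp
  next
    fix j assume "j \<in> J - {j\<^sub>0}"
    then show "vector_field m (?D j)"
      unfolding vector_field_def using j\<^sub>0 fc
      by (auto intro!: poly_funs_diff poly_funs.product Dpoly point_derivation_diff point_derivation_scale Dder)
  next
    fix j k w assume "j \<in> J - {j\<^sub>0}" "k < Suc c"
    then show "?D j (f k) w = 0"
      using D(2) j\<^sub>0 by (cases "k = c") auto
  next
    fix g w assume g: "g \<in> poly_funs m"
    obtain l where l: "\<And>i. i < m \<Longrightarrow> u w * pderiv_at i g w
        = (if i \<in> J then D i g w else 0) + (\<Sum>k<c. l k * pderiv_at i (f k) w)"
      using expand [OF g] by blast
    obtain l' where l': "\<And>i. i < m \<Longrightarrow> u w * pderiv_at i (f c) w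
        = (if i \<in> J then D i (f c) w else 0) + (\<Sum>k<c. l' k * pderiv_at i (f k) w)"
      using expand [OF fc] by blast
    \<comment> \<open>the coefficients result from eliminating the differential of \<open>z\<^sub>j\<close>, \<open>j = j\<^sub>0\<close>, between the expansions of \<open>g\<close> and \<open>f c\<close>\<close>
    let ?b = "D j\<^sub>0 g w"
    let ?l = "\<lambda>k. if k = c then ?b * u w else ?a w * l k - ?b * l' k"
    show "\<exists>l. \<forall>i<m. ?a w * u w * pderiv_at i g w
        = (if i \<in> J - {j\<^sub>0} then ?D i g w else 0) + (\<Sum>k<Suc c. l k * pderiv_at i (f k) w)"
    proof (intro exI [of _ ?l] allI impI)
      fix i assume i: "i < m"
      have "(\<Sum>k<c. ?l k * pderiv_at i (f k) w)
          = (\<Sum>k<c. ?a w * (l k * pderiv_at i (f k) w) - ?b * (l' k * pderiv_at i (f k) w))"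
        by (intro sum.cong) (auto simp: algebra_simps)
      also have "\<dots> = ?a w * (\<Sum>k<c. l k * pderiv_at i (f k) w) - ?b * (\<Sum>k<c. l' k * pderiv_at i (f k) w)"
        by (simp add: sum_subtractf sum_distrib_left)
      also have "\<dots> = ?a w * (u w * pderiv_at i g w - (if i \<in> J then D i g w else 0))
          - ?b * (u w * pderiv_at i (f c) w - (if i \<in> J then D i (f c) w else 0))"
        by (simp only: l [OF i] l' [OF i] add_diff_cancel_left')
      finally show "?a w * u w * pderiv_at i g w
        = (if i \<in> J - {j\<^sub>0} then ?D i g w else 0) + (\<Sum>k<Suc c. ?l k * pderiv_at i (f k) w)"
        using j\<^sub>0 by (auto simp: algebra_simps)
    qed
  qed
qed

lemma ideal_in_vanishing: "ideal_in (poly_funs m) {g \<in> poly_funs m. \<forall>w\<in>Z. g w = 0}"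
  using subring_closed [OF subring_poly_funs [of m]] by (auto simp: ideal_in_def)

text \<open>
  The vector fields of \<open>complete_differentials\<close> a priori only respect the ideal generated by the
  equations \<open>f\<^sub>k\<close>, which locally at \<open>z\<close> is the vanishing ideal of \<open>Z\<close>.  The latter being finitely
  generated, a common denominator makes them respect all of it.
\<close>

lemma smooth_at_coordinates:
  assumes "smooth_at m Z z"
  obtains J D u where "J \<subseteq> {..<m}" "u \<in> poly_funs m" "u z \<noteq> 0" "\<And>j. j \<in> J \<Longrightarrow> vector_field m (D j)"
    and "\<And>j g w. j \<in> J \<Longrightarrow> g \<in> poly_funs m \<Longrightarrow> \<forall>w\<in>Z. g w = 0 \<Longrightarrow> w \<in> Z \<Longrightarrow> D j g w = 0"
    and "\<And>w \<delta> g. w \<in> Z \<Longrightarrow> point_derivation m w \<delta> \<Longrightarrow>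
      (\<And>g. g \<in> poly_funs m \<Longrightarrow> \<forall>w\<in>Z. g w = 0 \<Longrightarrow> \<delta> g = 0) \<Longrightarrow>
      g \<in> poly_funs m \<Longrightarrow> u w * \<delta> g = (\<Sum>j\<in>J. \<delta> (\<lambda>z. z j) * D j g w)"
proof -
  obtain c :: nat and f where f': "\<forall>k<c. f k \<in> poly_funs m \<and> (\<forall>w\<in>Z. f k w = 0)"
    and gen': "\<forall>g\<in>poly_funs m. (\<forall>w\<in>Z. g w = 0) \<longrightarrow> (\<exists>h\<in>poly_funs m. h z \<noteq> 0 \<and>
           (\<exists>q. (\<forall>k<c. q k \<in> poly_funs m) \<and> (\<forall>w. h w * g w = (\<Sum>k<c. q k w * f k w))))"
    and indep: "\<forall>l. (\<forall>j<m. (\<Sum>k<c. l k * pderiv_at j (f k) z) = 0) \<longrightarrow> (\<forall>k<c. l k = 0)"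
    using assms unfolding smooth_at_def by (elim exE conjE) (rule that, assumption+)
  note gen = gen' [rule_format]
  have f: "\<And>k. k < c \<Longrightarrow> f k \<in> poly_funs m" "\<And>k w. k < c \<Longrightarrow> w \<in> Z \<Longrightarrow> f k w = 0"
    using f' by auto
  have "\<forall>k<c. f k \<in> poly_funs m" using f by blast
  note complete = complete_differentials [OF this indep]
  obtain J D u where J: "J \<subseteq> {..<m}" and u: "u \<in> poly_funs m" "u z \<noteq> 0"
    and D': "\<forall>j\<in>J. vector_field m (D j) \<and> (\<forall>k<c. \<forall>w. D j (f k) w = 0)"
    and expand': "\<forall>g\<in>poly_funs m. \<forall>w. \<exists>l. \<forall>i<m. u w * pderiv_at i g w
        = (if i \<in> J then D i g w else 0) + (\<Sum>k<c. l k * pderiv_at i (f k) w)"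
    using complete by (elim exE conjE) (rule that)
  note expand = expand' [rule_format]
  have D: "\<And>j. j \<in> J \<Longrightarrow> vector_field m (D j)" "\<And>j k w. j \<in> J \<Longrightarrow> k < c \<Longrightarrow> D j (f k) w = 0"
    using D' by auto
  define I where "I = {g \<in> poly_funs m. \<forall>w\<in>Z. g w = 0}"
  have "\<exists>N g. (\<forall>k<N. g k \<in> I) \<and> I \<subseteq> combinations (poly_funs m) N g"
    using noetherian_poly_funs ideal_in_vanishing unfolding noetherian_def I_def by blast
  then obtain N g where g: "\<And>k. k < (N::nat) \<Longrightarrow> g k \<in> I" and I: "I \<subseteq> combinations (poly_funs m) N g"
    by blast
  have "\<forall>k. \<exists>h. k < N \<longrightarrow> h \<in> poly_funs m \<and> h z \<noteq> 0 \<and>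
      (\<exists>q. (\<forall>i<c. q i \<in> poly_funs m) \<and> (\<forall>w. h w * g k w = (\<Sum>i<c. q i w * f i w)))"
  proof
    fix k
    show "\<exists>h. k < N \<longrightarrow> h \<in> poly_funs m \<and> h z \<noteq> 0 \<and>
      (\<exists>q. (\<forall>i<c. q i \<in> poly_funs m) \<and> (\<forall>w. h w * g k w = (\<Sum>i<c. q i w * f i w)))"
      using gen [of "g k"] g [of k] unfolding I_def by blast
  qed
  from choice [OF this] obtain h where h': "\<forall>k. k < N \<longrightarrow> h k \<in> poly_funs m \<and> h k z \<noteq> 0 \<and>
      (\<exists>q. (\<forall>i<c. q i \<in> poly_funs m) \<and> (\<forall>w. h k w * g k w = (\<Sum>i<c. q i w * f i w)))" ..
  then have h: "\<And>k. k < N \<Longrightarrow> h k \<in> poly_funs m" "\<And>k. k < N \<Longrightarrow> h k z \<noteq> 0"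
    and hg: "\<And>k. k < N \<Longrightarrow> \<exists>q. (\<forall>i<c. q i \<in> poly_funs m) \<and> (\<forall>w. h k w * g k w = (\<Sum>i<c. q i w * f i w))"
    by blast+
  \<comment> \<open>a common denominator for the expressions of the generators \<open>g k\<close> in terms of the \<open>f i\<close>\<close>
  define H where "H = (\<lambda>w. \<Prod>k<N. h k w)"
  have H: "H \<in> poly_funs m" "H z \<noteq> 0"
  proof -
    have "(\<lambda>w. \<Prod>k<n. h k w) \<in> poly_funs m" if "n \<le> N" for n
      using that by (induction n) (auto simp: poly_funs.const poly_funs.product h)
    then show "H \<in> poly_funs m" by (simp add: H_def)
    show "H z \<noteq> 0" by (simp add: H_def h)
  qed
  have Dpoly: "D j g \<in> poly_funs m" if "j \<in> J" "g \<in> poly_funs m" for j g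
    using D(1) [OF that(1)] that(2) by (simp add: vector_field_def)
  have Dder: "point_derivation m w (\<lambda>g. D j g w)" if "j \<in> J" for j w
    using D(1) [OF that] by (simp add: vector_field_def)
  have Dmult: "D j (\<lambda>z. p z * q z) w = p w * D j q w + q w * D j p w"
    if "j \<in> J" "p \<in> poly_funs m" "q \<in> poly_funs m" for j p q w
    using Dder [OF that(1), of w] that(2,3) by (simp add: point_derivation_def)
  have kills_gen: "H w * D j (g k) w = 0" if j: "j \<in> J" and k: "k < N" and w: "w \<in> Z" for j k w
  proof -
    obtain q where q: "\<And>i. i < c \<Longrightarrow> q i \<in> poly_funs m" "\<And>w. h k w * g k w = (\<Sum>i<c. q i w * f i w)"
      using hg [OF k] by blast
    have gk: "g k \<in> poly_funs m" "g k w = 0" using g [OF k] w by (auto simp: I_def)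
    have "D j (\<lambda>w. h k w * g k w) w = (\<Sum>i<c. D j (\<lambda>w. q i w * f i w) w)"
      unfolding q(2) using point_derivation_sum [OF Dder [OF j], of c "\<lambda>i w. q i w * f i w"] q(1) f(1)
      by (simp add: poly_funs.product)
    also have "\<dots> = 0"
      using j w q(1) f D(2) by (simp add: Dmult)
    finally have "h k w * D j (g k) w = 0"
      using gk by (simp add: Dmult j k h)
    then show ?thesis
      using k by (auto simp: H_def)
  qed
  show thesis
  proof (rule that [of J "\<lambda>w. H w * u w" "\<lambda>j g w. H w * D j g w"])
    show "J \<subseteq> {..<m}" by (rule J)
    show "(\<lambda>w. H w * u w) \<in> poly_funs m" "H z * u z \<noteq> 0" using H u by (auto intro: poly_funs.product)
    show "vector_field m (\<lambda>g w. H w * D j g w)" if "j \<in> J" for j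
      unfolding vector_field_def using that by (auto intro!: poly_funs.product H Dpoly point_derivation_scale Dder)
  next
    fix j p w assume j: "j \<in> J" and p: "p \<in> poly_funs m" "\<forall>w\<in>Z. p w = 0" and w: "w \<in> Z"
    obtain q where q: "\<And>k. k < N \<Longrightarrow> q k \<in> poly_funs m" "p = (\<Sum>k<N. q k * g k)"
      using I p by (auto simp: I_def combinations_def)
    have gk: "g k \<in> poly_funs m" "g k w = 0" if "k < N" for k using g [OF that] w by (auto simp: I_def)
    have "p = (\<lambda>w. \<Sum>k<N. q k w * g k w)"
      unfolding q(2) by (induction N) (auto simp: fun_eq_iff)
    then have "D j p w = (\<Sum>k<N. D j (\<lambda>w. q k w * g k w) w)"
      using point_derivation_sum [OF Dder [OF j], of N "\<lambda>i w. q i w * g i w"] q(1) gk(1)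
      by (simp add: poly_funs.product)
    also have "\<dots> = (\<Sum>k<N. q k w * D j (g k) w)"
      using j q(1) gk by (simp add: Dmult)
    finally show "H w * D j p w = 0"
      using kills_gen [OF j _ w] by (auto simp: sum_distrib_left intro!: sum.neutral)
  next
    fix w \<delta> p assume w: "w \<in> Z" and \<delta>: "point_derivation m w \<delta>" and p: "p \<in> poly_funs m"
      and zero: "\<And>g. g \<in> poly_funs m \<Longrightarrow> \<forall>w\<in>Z. g w = 0 \<Longrightarrow> \<delta> g = 0"
    obtain l where l: "\<And>i. i < m \<Longrightarrow> u w * pderiv_at i p w
        = (if i \<in> J then D i p w else 0) + (\<Sum>k<c. l k * pderiv_at i (f k) w)"
      using expand [OF p] by blast
    have "u w * \<delta> p = (\<Sum>i<m. \<delta> (\<lambda>z. z i) * (u w * pderiv_at i p w))"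
      by (simp add: point_derivation_expand [OF \<delta> p] sum_distrib_left mult.left_commute)
    also have "\<dots> = (\<Sum>i<m. if i \<in> J then \<delta> (\<lambda>z. z i) * D i p w else 0)
        + (\<Sum>i<m. \<Sum>k<c. l k * (\<delta> (\<lambda>z. z i) * pderiv_at i (f k) w))"
      unfolding sum.distrib [symmetric]
      by (intro sum.cong) (auto simp: l distrib_left sum_distrib_left mult.left_commute)
    also have "(\<Sum>i<m. if i \<in> J then \<delta> (\<lambda>z. z i) * D i p w else 0) = (\<Sum>i\<in>J. \<delta> (\<lambda>z. z i) * D i p w)"
      using J by (intro sum.mono_neutral_cong_right) auto
    also have "(\<Sum>i<m. \<Sum>k<c. l k * (\<delta> (\<lambda>z. z i) * pderiv_at i (f k) w)) = (\<Sum>k<c. l k * \<delta> (f k))"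
      by (subst sum.swap) (simp add: point_derivation_expand [OF \<delta> f(1)] sum_distrib_left)
    also have "\<dots> = 0"
      using zero f by simp
    finally show "H w * u w * \<delta> p = (\<Sum>j\<in>J. \<delta> (\<lambda>z. z j) * (H w * D j p w))"
      by (simp add: sum_distrib_left mult.assoc mult.left_commute [of "H w"])
  qed
qed


section \<open>Regular functions, ideal sheaves and tangent vectors\<close>

lemma cut_apply [simp]: "x \<in> V \<Longrightarrow> cut V f x = f x" "x \<notin> V \<Longrightarrow> cut V f x = 0"
  by (auto simp: cut_def)

lemma cut_cut_subset [simp]: "V \<subseteq> U \<Longrightarrow> cut V (cut U f) = cut V f"
  by (auto simp: cut_def fun_eq_iff)

lemma cut_cong: "U = V \<Longrightarrow> (\<And>x. x \<in> V \<Longrightarrow> f x = g x) \<Longrightarrow> cut U f = cut V g"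
  by (auto simp: cut_def)

lemma cut_eq_self: "(\<And>x. x \<notin> U \<Longrightarrow> f x = 0) \<Longrightarrow> cut U f = f"
  by (auto simp: cut_def)

locale function_space =
  fixes X :: "'p fspace"
  assumes space: "space_with_functions X"
begin

abbreviation "opn \<equiv> openin (topo X)"

definition regular_on :: "'p set \<Rightarrow> ('p \<Rightarrow> complex) \<Rightarrow> bool" where
  "regular_on U f \<longleftrightarrow> cut U f \<in> reg X U"

lemma reg_outside: assumes "opn U" "f \<in> reg X U" "x \<notin> U" shows "f x = 0"
proof -
  have "\<forall>U f. opn U \<longrightarrow> f \<in> reg X U \<longrightarrow> (\<forall>x. x \<notin> U \<longrightarrow> f x = 0)"
    using space unfolding space_with_functions_def is_sheaf_def by (elim conjE)
  then show ?thesis using assms by blast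
qed

lemma cut_reg_self [simp]: "opn U \<Longrightarrow> f \<in> reg X U \<Longrightarrow> cut U f = f"
  by (rule cut_eq_self) (rule reg_outside)

lemma reg_regular_on: "opn U \<Longrightarrow> f \<in> reg X U \<Longrightarrow> regular_on U f"
  by (simp add: regular_on_def)

lemma reg_cut: assumes "opn U" "opn V" "V \<subseteq> U" "f \<in> reg X U" shows "cut V f \<in> reg X V"
proof -
  have "\<forall>U V f. opn U \<longrightarrow> opn V \<longrightarrow> V \<subseteq> U \<longrightarrow> f \<in> reg X U \<longrightarrow> cut V f \<in> reg X V"
    using space unfolding space_with_functions_def is_sheaf_def by (elim conjE)
  then show ?thesis using assms by blast
qed

lemma regular_on_subset: "regular_on U f \<Longrightarrow> opn U \<Longrightarrow> opn V \<Longrightarrow> V \<subseteq> U \<Longrightarrow> regular_on V f"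
  unfolding regular_on_def using reg_cut [of U V "cut U f"] by simp

lemma regular_on_cong: "(\<And>x. x \<in> U \<Longrightarrow> f x = g x) \<Longrightarrow> regular_on U f \<longleftrightarrow> regular_on U g"
  unfolding regular_on_def using cut_cong [of U U f g] by simp

lemma reg_glue:
  assumes "opn U" "\<forall>x. x \<notin> U \<longrightarrow> f x = 0"
    "\<forall>x\<in>U. \<exists>V. opn V \<and> x \<in> V \<and> V \<subseteq> U \<and> cut V f \<in> reg X V"
  shows "f \<in> reg X U"
proof -
  have "\<forall>U f. opn U \<longrightarrow> (\<forall>x. x \<notin> U \<longrightarrow> f x = 0) \<longrightarrow>
      (\<forall>x\<in>U. \<exists>V. opn V \<and> x \<in> V \<and> V \<subseteq> U \<and> cut V f \<in> reg X V) \<longrightarrow> f \<in> reg X U"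
    using space unfolding space_with_functions_def is_sheaf_def by (elim conjE)
  from this [THEN spec, THEN spec, THEN mp, THEN mp, THEN mp, OF assms] show ?thesis .
qed

lemma regular_on_local:
  assumes U: "opn U" and loc: "\<And>x. x \<in> U \<Longrightarrow> \<exists>V. opn V \<and> x \<in> V \<and> V \<subseteq> U \<and> regular_on V f"
  shows "regular_on U f"
  unfolding regular_on_def
proof (rule reg_glue [OF U])
  show "\<forall>x\<in>U. \<exists>V. opn V \<and> x \<in> V \<and> V \<subseteq> U \<and> cut V (cut U f) \<in> reg X V"
  proof
    fix x assume "x \<in> U"
    then obtain V where V: "opn V" "x \<in> V" "V \<subseteq> U" "regular_on V f" using loc by blast
    then have "cut V (cut U f) \<in> reg X V" by (simp add: regular_on_def)
    then show "\<exists>V. opn V \<and> x \<in> V \<and> V \<subseteq> U \<and> cut V (cut U f) \<in> reg X V"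
      using V by blast
  qed
qed simp

lemma regular_on_const: "opn U \<Longrightarrow> regular_on U (\<lambda>_. c)"
  using space unfolding space_with_functions_def regular_on_def by blast

lemma reg_add: "opn U \<Longrightarrow> f \<in> reg X U \<Longrightarrow> g \<in> reg X U \<Longrightarrow> (\<lambda>x. f x + g x) \<in> reg X U"
  and reg_mult: "opn U \<Longrightarrow> f \<in> reg X U \<Longrightarrow> g \<in> reg X U \<Longrightarrow> (\<lambda>x. f x * g x) \<in> reg X U"
  using space unfolding space_with_functions_def by blast+

lemma regular_on_add: "opn U \<Longrightarrow> regular_on U f \<Longrightarrow> regular_on U g \<Longrightarrow> regular_on U (\<lambda>x. f x + g x)"
  unfolding regular_on_def using reg_add [of U "cut U f" "cut U g"]
  by (simp add: cut_def if_distrib cong: if_cong)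

lemma regular_on_mult: "opn U \<Longrightarrow> regular_on U f \<Longrightarrow> regular_on U g \<Longrightarrow> regular_on U (\<lambda>x. f x * g x)"
  unfolding regular_on_def using reg_mult [of U "cut U f" "cut U g"]
  by (simp add: cut_def if_distrib cong: if_cong)

lemma regular_on_uminus: "opn U \<Longrightarrow> regular_on U f \<Longrightarrow> regular_on U (\<lambda>x. - f x)"
  using regular_on_mult [OF _ regular_on_const [of U "-1"], of f] by simp

lemma regular_on_diff: "opn U \<Longrightarrow> regular_on U f \<Longrightarrow> regular_on U g \<Longrightarrow> regular_on U (\<lambda>x. f x - g x)"
  using regular_on_add [of U f "\<lambda>x. - g x"] regular_on_uminus [of U g] by simp

lemma regular_on_sum:
  "opn U \<Longrightarrow> (\<And>i. i \<in> A \<Longrightarrow> regular_on U (f i)) \<Longrightarrow> regular_on U (\<lambda>x. \<Sum>i\<in>A. f i x)"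
  by (induction A rule: infinite_finite_induct) (auto intro: regular_on_const regular_on_add)

lemma reg_iff: "opn U \<Longrightarrow> f \<in> reg X U \<longleftrightarrow> regular_on U f \<and> (\<forall>x. x \<notin> U \<longrightarrow> f x = 0)"
  using cut_eq_self [of U f] by (auto simp: regular_on_def reg_outside)

lemma reg_zero: "opn U \<Longrightarrow> (\<lambda>_. 0) \<in> reg X U"
  by (simp add: reg_iff regular_on_const)

lemma reg_ring_cring: assumes "opn U" shows "cring (reg_ring X U)"
proof (intro cringI abelian_groupI comm_monoidI)
  fix f assume f: "f \<in> carrier (reg_ring X U)"
  then have out: "f x = 0" if "x \<notin> U" for x using that assms by (simp add: reg_ring_def reg_outside)
  then show "\<one>\<^bsub>reg_ring X U\<^esub> \<otimes>\<^bsub>reg_ring X U\<^esub> f = f"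
    by (auto simp: reg_ring_def cut_def)
  have "(\<lambda>x. - f x) \<in> reg X U"
    using f regular_on_uminus [OF assms, of f] assms by (simp add: reg_ring_def reg_iff)
  then show "\<exists>g\<in>carrier (reg_ring X U). g \<oplus>\<^bsub>reg_ring X U\<^esub> f = \<zero>\<^bsub>reg_ring X U\<^esub>"
    by (intro bexI [of _ "\<lambda>x. - f x"]) (simp_all add: reg_ring_def)
qed (use assms reg_add [OF assms] reg_mult [OF assms] reg_zero regular_on_const [OF assms, of 1]
    in \<open>auto simp: reg_ring_def algebra_simps regular_on_def\<close>)

lemma reg_ring_simps [simp]:
  "carrier (reg_ring X U) = reg X U" "f \<otimes>\<^bsub>reg_ring X U\<^esub> g = (\<lambda>x. f x * g x)"
  "f \<oplus>\<^bsub>reg_ring X U\<^esub> g = (\<lambda>x. f x + g x)" "\<zero>\<^bsub>reg_ring X U\<^esub> = (\<lambda>_. 0)"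
  "\<one>\<^bsub>reg_ring X U\<^esub> = cut U (\<lambda>_. 1)"
  by (simp_all add: reg_ring_def)

lemma reg_ring_uminus:
  assumes "opn U" "f \<in> reg X U" shows "\<ominus>\<^bsub>reg_ring X U\<^esub> f = (\<lambda>x. - f x)"
proof -
  interpret cring "reg_ring X U" by (rule reg_ring_cring) fact
  show ?thesis
    by (rule minus_equality) (use assms regular_on_uminus [of U f] in \<open>auto simp: reg_iff\<close>)
qed

lemma restriction_ring_hom:
  assumes "opn U" "opn V" "V \<subseteq> U" shows "ring_hom_ring (reg_ring X U) (reg_ring X V) (cut V)"
proof -
  interpret U: cring "reg_ring X U" by (rule reg_ring_cring) fact
  interpret V: cring "reg_ring X V" by (rule reg_ring_cring) fact
  show ?thesis
    by (intro ring_hom_ringI2 ring_hom_memI U.ring_axioms V.ring_axioms)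
      (use assms reg_cut [OF assms] in \<open>auto simp: cut_def fun_eq_iff\<close>)
qed

lemma ideal_reg_ringI:
  assumes "opn U" "I \<subseteq> reg X U" "(\<lambda>_. 0) \<in> I" "\<And>f g. f \<in> I \<Longrightarrow> g \<in> I \<Longrightarrow> (\<lambda>x. f x + g x) \<in> I"
    and mult: "\<And>r f. r \<in> reg X U \<Longrightarrow> f \<in> I \<Longrightarrow> (\<lambda>x. r x * f x) \<in> I"
  shows "ideal I (reg_ring X U)"
proof -
  interpret cring "reg_ring X U" by (rule reg_ring_cring) fact
  have neg: "(\<lambda>x. - f x) \<in> I" if "f \<in> I" for f
  proof -
    have eq: "(\<lambda>x. cut U (\<lambda>_. -1) x * f x) = (\<lambda>x. - f x)"
      using reg_outside [OF assms(1), of f] assms(2) that by (auto simp: cut_def fun_eq_iff)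
    show ?thesis
      using mult [of "cut U (\<lambda>_. -1)" f] that regular_on_const [OF assms(1), of "-1"]
      unfolding eq by (simp add: regular_on_def)
  qed
  show ?thesis
  proof (intro idealI ring_axioms add.subgroupI)
    fix a assume a: "a \<in> I"
    then have "\<ominus>\<^bsub>reg_ring X U\<^esub> a = (\<lambda>x. - a x)" using assms(1,2) by (intro reg_ring_uminus) auto
    then show "\<ominus>\<^bsub>reg_ring X U\<^esub> a \<in> I"
      using neg [OF a] by simp
    fix r assume r: "r \<in> carrier (reg_ring X U)"
    show "r \<otimes>\<^bsub>reg_ring X U\<^esub> a \<in> I" "a \<otimes>\<^bsub>reg_ring X U\<^esub> r \<in> I"
      using mult [of r a] a r by (simp_all add: mult.commute [of "a _"])
  qed (use assms in auto)
qed

end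

text \<open>The closure properties through which membership in an ideal sheaf is established; the last
  one is the gluing axiom.\<close>

locale ideal_sheaf = function_space X for X :: "'p fspace" +
  fixes I :: "'p set \<Rightarrow> ('p \<Rightarrow> complex) set"
  assumes I_reg: "opn U \<Longrightarrow> f \<in> I U \<Longrightarrow> f \<in> reg X U"
    and I_zero: "opn U \<Longrightarrow> (\<lambda>_. 0) \<in> I U"
    and I_add: "opn U \<Longrightarrow> f \<in> I U \<Longrightarrow> g \<in> I U \<Longrightarrow> (\<lambda>x. f x + g x) \<in> I U"
    and I_mult: "opn U \<Longrightarrow> r \<in> reg X U \<Longrightarrow> f \<in> I U \<Longrightarrow> (\<lambda>x. r x * f x) \<in> I U"
    and I_cut: "opn U \<Longrightarrow> opn V \<Longrightarrow> V \<subseteq> U \<Longrightarrow> f \<in> I U \<Longrightarrow> cut V f \<in> I V"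
    and I_local: "opn U \<Longrightarrow> (\<And>x. x \<notin> U \<Longrightarrow> f x = 0) \<Longrightarrow>
      (\<And>x. x \<in> U \<Longrightarrow> \<exists>V. opn V \<and> x \<in> V \<and> V \<subseteq> U \<and> cut V f \<in> I V) \<Longrightarrow> f \<in> I U"
begin

lemma I_ideal: "opn U \<Longrightarrow> ideal (I U) (reg_ring X U)"
  by (rule ideal_reg_ringI) (auto intro: I_reg I_zero I_add I_mult)

lemma I_sum: "opn U \<Longrightarrow> (\<And>i. i \<in> A \<Longrightarrow> f i \<in> I U) \<Longrightarrow> (\<lambda>x. \<Sum>i\<in>A. f i x) \<in> I U"
  by (induction A rule: infinite_finite_induct) (auto intro: I_zero I_add)

lemma I_uminus: assumes U: "opn U" and f: "f \<in> I U" shows "(\<lambda>x. - f x) \<in> I U"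
proof -
  have "(\<lambda>x. cut U (\<lambda>_. -1) x * f x) = (\<lambda>x. - f x)"
    using reg_outside [OF U I_reg [OF U f]] by (auto simp: cut_def fun_eq_iff)
  then show ?thesis
    using I_mult [OF U _ f, of "cut U (\<lambda>_. -1)"] regular_on_const [OF U, of "-1"]
    by (simp add: regular_on_def)
qed

lemma I_diff: "opn U \<Longrightarrow> f \<in> I U \<Longrightarrow> g \<in> I U \<Longrightarrow> (\<lambda>x. f x - g x) \<in> I U"
  using I_add [of U f "\<lambda>x. - g x"] I_uminus [of U g] by simp

end

locale ideal_generators = function_space X for X :: "'p fspace" +
  fixes G :: "'p set \<Rightarrow> ('p \<Rightarrow> complex) set"
  assumes G_reg: "opn U \<Longrightarrow> G U \<subseteq> reg X U"
    and G_cut: "opn U \<Longrightarrow> opn V \<Longrightarrow> V \<subseteq> U \<Longrightarrow> g \<in> G U \<Longrightarrow> cut V g \<in> G V"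
begin

abbreviation "gen U \<equiv> genideal (reg_ring X U) (G U)"

lemma gen_ideal: "opn U \<Longrightarrow> ideal (gen U) (reg_ring X U)"
proof -
  assume U: "opn U"
  interpret cring "reg_ring X U" by (rule reg_ring_cring) fact
  show ?thesis by (rule genideal_ideal) (use G_reg [OF U] in simp)
qed

lemma G_gen: "opn U \<Longrightarrow> g \<in> G U \<Longrightarrow> g \<in> gen U"
proof -
  assume U: "opn U" "g \<in> G U"
  interpret cring "reg_ring X U" by (rule reg_ring_cring) fact
  show ?thesis using genideal_self [of "G U"] G_reg [OF U(1)] U(2) by auto
qed

lemma gen_cut:
  assumes "opn U" "opn V" "V \<subseteq> U" "f \<in> gen U" shows "cut V f \<in> gen V"
proof -
  interpret ring_hom_ring "reg_ring X U" "reg_ring X V" "cut V"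
    by (rule restriction_ring_hom) fact+
  have "gen U \<subseteq> {f \<in> carrier (reg_ring X U). cut V f \<in> gen V}"
    by (intro R.genideal_minimal ideal_vimage gen_ideal assms)
      (use assms G_reg G_cut G_gen in auto)
  then show ?thesis using assms(4) by blast
qed

sublocale sheaf: ideal_sheaf X "gen_ideal_sheaf X G"
proof
  fix U assume U: "opn U"
  show "f \<in> reg X U" if "f \<in> gen_ideal_sheaf X G U" for f
    using that by (simp add: gen_ideal_sheaf_def)
  have zero: "(\<lambda>_. 0) \<in> gen U"
    using additive_subgroup.zero_closed [OF ideal.axioms(1) [OF gen_ideal [OF U]]] by simp
  have [simp]: "cut V (\<lambda>_. 0) = (\<lambda>_. 0)" for V :: "'p set" by (auto simp: cut_def)
  show "(\<lambda>_. 0) \<in> gen_ideal_sheaf X G U"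
    using zero U by (auto simp: gen_ideal_sheaf_def intro: reg_zero)
  fix f g assume f: "f \<in> gen_ideal_sheaf X G U"
  {
    assume g: "g \<in> gen_ideal_sheaf X G U"
    have "\<exists>V. opn V \<and> x \<in> V \<and> V \<subseteq> U \<and> cut V (\<lambda>x. f x + g x) \<in> gen V" if x: "x \<in> U" for x
    proof -
      obtain V W where V: "opn V" "x \<in> V" "V \<subseteq> U" "cut V f \<in> gen V"
        and W: "opn W" "x \<in> W" "W \<subseteq> U" "cut W g \<in> gen W"
        using f g x unfolding gen_ideal_sheaf_def by blast
      have VW: "opn (V \<inter> W)" using V W by blast
      interpret ideal "gen (V \<inter> W)" "reg_ring X (V \<inter> W)" by (rule gen_ideal [OF VW])
      have "cut (V \<inter> W) f \<in> gen (V \<inter> W)" "cut (V \<inter> W) g \<in> gen (V \<inter> W)"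
        using gen_cut [OF V(1) VW _ V(4)] gen_cut [OF W(1) VW _ W(4)] by auto
      from additive_subgroup.a_closed [OF ideal.axioms(1) [OF gen_ideal [OF VW]] this]
      have "(\<lambda>x. cut (V \<inter> W) f x + cut (V \<inter> W) g x) \<in> gen (V \<inter> W)" by simp
      moreover have "cut (V \<inter> W) (\<lambda>x. f x + g x) = (\<lambda>x. cut (V \<inter> W) f x + cut (V \<inter> W) g x)"
        by (auto simp: cut_def)
      ultimately have "cut (V \<inter> W) (\<lambda>x. f x + g x) \<in> gen (V \<inter> W)"
        by simp
      then show ?thesis using V W VW by blast
    qed
    then show "(\<lambda>x. f x + g x) \<in> gen_ideal_sheaf X G U"
      using f g U by (simp add: gen_ideal_sheaf_def reg_add)
  next
    fix r assume r: "r \<in> reg X U"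
    have "\<exists>V. opn V \<and> x \<in> V \<and> V \<subseteq> U \<and> cut V (\<lambda>x. r x * f x) \<in> gen V" if x: "x \<in> U" for x
    proof -
      obtain V where V: "opn V" "x \<in> V" "V \<subseteq> U" "cut V f \<in> gen V"
        using f x unfolding gen_ideal_sheaf_def by blast
      interpret ideal "gen V" "reg_ring X V" by (rule gen_ideal [OF V(1)])
      have "cut V (\<lambda>x. r x * f x) = (\<lambda>x. cut V r x * cut V f x)"
        by (auto simp: cut_def)
      then have "cut V (\<lambda>x. r x * f x) \<in> gen V"
        using I_l_closed [OF V(4), of "cut V r"] reg_cut [OF U V(1,3) r] by simp
      then show ?thesis using V by blast
    qed
    then show "(\<lambda>x. r x * f x) \<in> gen_ideal_sheaf X G U"
      using f r U by (simp add: gen_ideal_sheaf_def reg_mult)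
  next
    fix V assume V: "opn V" "V \<subseteq> U"
    have "\<exists>W. opn W \<and> x \<in> W \<and> W \<subseteq> V \<and> cut W (cut V f) \<in> gen W" if x: "x \<in> V" for x
    proof -
      obtain W where W: "opn W" "x \<in> W" "W \<subseteq> U" "cut W f \<in> gen W"
        using f x V unfolding gen_ideal_sheaf_def by blast
      have "opn (V \<inter> W)" using V W by blast
      then have "cut (V \<inter> W) f \<in> gen (V \<inter> W)"
        using gen_cut [OF W(1) _ _ W(4), of "V \<inter> W"] by auto
      then show ?thesis using V W x by (intro exI [of _ "V \<inter> W"]) auto
    qed
    then show "cut V f \<in> gen_ideal_sheaf X G V"
      using f reg_cut [OF U V] by (simp add: gen_ideal_sheaf_def)
  }
next
  fix U f assume U: "opn U" and out: "\<And>x. x \<notin> U \<Longrightarrow> f x = 0"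
    and loc: "\<And>x. x \<in> U \<Longrightarrow> \<exists>V. opn V \<and> x \<in> V \<and> V \<subseteq> U \<and> cut V f \<in> gen_ideal_sheaf X G V"
  have "regular_on U f"
    using loc by (intro regular_on_local U) (simp add: gen_ideal_sheaf_def regular_on_def, blast)
  moreover have "\<exists>W. opn W \<and> x \<in> W \<and> W \<subseteq> U \<and> cut W f \<in> gen W" if x: "x \<in> U" for x
  proof -
    obtain V where V: "opn V" "x \<in> V" "V \<subseteq> U" "cut V f \<in> gen_ideal_sheaf X G V"
      using loc [OF x] by blast
    then obtain W where "opn W" "x \<in> W" "W \<subseteq> V" "cut W (cut V f) \<in> gen W"
      unfolding gen_ideal_sheaf_def by blast
    then show ?thesis using V by (intro exI [of _ W]) auto
  qed
  ultimately show "f \<in> gen_ideal_sheaf X G U"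
    using out U by (simp add: gen_ideal_sheaf_def reg_iff)
qed

lemma G_sheaf: assumes U: "opn U" and g: "g \<in> G U" shows "g \<in> gen_ideal_sheaf X G U"
proof -
  have "g \<in> reg X U" using G_reg [OF U] g by blast
  then show ?thesis
    using G_gen [OF U g] U unfolding gen_ideal_sheaf_def by (auto intro!: exI [of _ U])
qed

end

text \<open>Ideal sheaves are compared on generators, since sections of a generated sheaf are locally in the
  generated ideal.\<close>

lemma (in ideal_sheaf) gen_ideal_sheaf_subset:
  assumes "ideal_generators X G" and G: "\<And>V. opn V \<Longrightarrow> G V \<subseteq> I V" and W: "opn W"
  shows "gen_ideal_sheaf X G W \<subseteq> I W"
proof
  interpret G: ideal_generators X G by fact
  fix f assume f: "f \<in> gen_ideal_sheaf X G W"
  show "f \<in> I W"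
  proof (rule I_local [OF W])
    show "f x = 0" if "x \<notin> W" for x
      using f reg_outside [OF W _ that] by (simp add: gen_ideal_sheaf_def)
    fix x assume "x \<in> W"
    then obtain V where V: "opn V" "x \<in> V" "V \<subseteq> W" "cut V f \<in> G.gen V"
      using f unfolding gen_ideal_sheaf_def by blast
    interpret cring "reg_ring X V" by (rule reg_ring_cring) fact
    have "G.gen V \<subseteq> I V"
      by (intro genideal_minimal I_ideal G V)
    then show "\<exists>V. opn V \<and> x \<in> V \<and> V \<subseteq> W \<and> cut V f \<in> I V" using V by blast
  qed
qed

context function_space begin

lemma regular_atI: "opn U \<Longrightarrow> p \<in> U \<Longrightarrow> regular_on U f \<Longrightarrow> f \<in> regular_at X p"
  unfolding regular_at_def regular_on_def by blast

lemma regular_atE: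
  assumes "f \<in> regular_at X p" obtains U where "opn U" "p \<in> U" "regular_on U f"
  using assms unfolding regular_at_def regular_on_def by blast

lemma regular_at_reg: "opn U \<Longrightarrow> p \<in> U \<Longrightarrow> f \<in> reg X U \<Longrightarrow> f \<in> regular_at X p"
  by (intro regular_atI [of U]) (auto simp: reg_regular_on)

lemma regular_at_const: "p \<in> topspace (topo X) \<Longrightarrow> (\<lambda>_. c) \<in> regular_at X p"
  by (rule regular_atI [of "topspace (topo X)"]) (auto intro: regular_on_const)

lemma regular_at_pair:
  assumes "f \<in> regular_at X p" "g \<in> regular_at X p"
  obtains U where "opn U" "p \<in> U" "regular_on U f" "regular_on U g"
proof -
  obtain U V where "opn U" "p \<in> U" "regular_on U f" "opn V" "p \<in> V" "regular_on V g"
    using assms by (metis regular_atE)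
  then show thesis using that [of "U \<inter> V"] regular_on_subset by blast
qed

lemma regular_at_add:
  assumes "f \<in> regular_at X p" "g \<in> regular_at X p" shows "(\<lambda>x. f x + g x) \<in> regular_at X p"
  using assms by (rule regular_at_pair) (auto intro: regular_atI regular_on_add)

lemma regular_at_mult:
  assumes "f \<in> regular_at X p" "g \<in> regular_at X p" shows "(\<lambda>x. f x * g x) \<in> regular_at X p"
  using assms by (rule regular_at_pair) (auto intro: regular_atI regular_on_mult)

lemma regular_at_cong:
  assumes "f \<in> regular_at X p" "opn U" "p \<in> U" "\<And>x. x \<in> U \<Longrightarrow> f x = g x"
  shows "g \<in> regular_at X p"
proof -
  obtain V where V: "opn V" "p \<in> V" "regular_on V f" using assms(1) by (rule regular_atE)
  have UV: "opn (U \<inter> V)" "p \<in> U \<inter> V" using V assms by auto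
  moreover have "regular_on (U \<inter> V) g"
    using regular_on_subset [OF V(3,1) UV(1)] regular_on_cong [of "U \<inter> V" f g] assms(4) by auto
  ultimately show ?thesis by (intro regular_atI)
qed

lemma regular_at_sum:
  "p \<in> topspace (topo X) \<Longrightarrow> (\<And>i. i \<in> A \<Longrightarrow> f i \<in> regular_at X p) \<Longrightarrow> (\<lambda>x. \<Sum>i\<in>A. f i x) \<in> regular_at X p"
  by (induction A rule: infinite_finite_induct) (auto intro: regular_at_const regular_at_add)

end

locale tangent_vector = function_space X for X :: "'p fspace" +
  fixes p v
  assumes point: "p \<in> topspace (topo X)" and tangent: "v \<in> tangent_space X p"
begin

lemma deriv_add: "f \<in> regular_at X p \<Longrightarrow> g \<in> regular_at X p \<Longrightarrow> v (\<lambda>x. f x + g x) = v f + v g"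
  and deriv_mult: "f \<in> regular_at X p \<Longrightarrow> g \<in> regular_at X p \<Longrightarrow> v (\<lambda>x. f x * g x) = f p * v g + g p * v f"
  and deriv_scale: "f \<in> regular_at X p \<Longrightarrow> v (\<lambda>x. c * f x) = c * v f"
  using tangent by (auto simp: tangent_space_def)

lemma deriv_const: "v (\<lambda>_. c) = 0"
proof -
  have "v (\<lambda>_. 1 * 1) = 1 * v (\<lambda>_. 1) + 1 * v (\<lambda>_. 1)"
    by (rule deriv_mult) (auto intro: regular_at_const point)
  then have "v (\<lambda>_. 1) = 0" by simp
  then show ?thesis
    using deriv_scale [OF regular_at_const [OF point, of 1], of c] by simp
qed

lemma deriv_sum: "(\<And>i. i \<in> A \<Longrightarrow> f i \<in> regular_at X p) \<Longrightarrow> v (\<lambda>x. \<Sum>i\<in>A. f i x) = (\<Sum>i\<in>A. v (f i))"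
  by (induction A rule: infinite_finite_induct) (auto simp: deriv_const deriv_add regular_at_sum point)

text \<open>The indicator function \<open>i\<close> of the neighbourhood is idempotent with \<open>i p = 1\<close>, so its derivative
  vanishes and \<open>v f = v (f i)\<close>; but \<open>f i = g i\<close>.\<close>

lemma deriv_local:
  assumes f: "f \<in> regular_at X p" and U: "opn U" "p \<in> U" and eq: "\<And>x. x \<in> U \<Longrightarrow> f x = g x"
  shows "v f = v g"
proof -
  define i :: "'p \<Rightarrow> complex" where "i = cut U (\<lambda>_. 1)"
  have i: "i \<in> regular_at X p"
    unfolding i_def by (intro regular_atI [OF U]) (use regular_on_const [OF U(1), of 1] in \<open>simp add: regular_on_def\<close>)
  have "i p = 1" "(\<lambda>x. i x * i x) = i" using U by (auto simp: i_def cut_def)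
  then have vi: "v i = 0" using deriv_mult [OF i i] by simp
  have g: "g \<in> regular_at X p" by (rule regular_at_cong [OF f U eq])
  have "(\<lambda>x. f x * i x) = (\<lambda>x. g x * i x)" using eq by (auto simp: i_def cut_def)
  then show ?thesis
    using deriv_mult [OF f i] deriv_mult [OF g i] vi \<open>i p = 1\<close> by simp
qed

lemma deriv_quotient:
  assumes f: "f \<in> regular_at X p" and g: "g \<in> regular_at X p" and h: "h \<in> regular_at X p" "h p \<noteq> 0"
    and U: "opn U" "p \<in> U" and eq: "\<And>x. x \<in> U \<Longrightarrow> f x * h x = g x"
  shows "v f = (h p * v g - g p * v h) / (h p)\<^sup>2"
proof -
  have "v g = f p * v h + h p * v f"
    using deriv_local [OF regular_at_mult [OF f h(1)] U eq] deriv_mult [OF f h(1)] by simp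
  moreover have "f p * h p = g p" using eq U by simp
  ultimately show ?thesis
    using h(2) by (simp add: field_simps power2_eq_square)
qed

end

context function_space begin

lemma tangent_vectorI: "p \<in> topspace (topo X) \<Longrightarrow> v \<in> tangent_space X p \<Longrightarrow> tangent_vector X p v"
  by unfold_locales

lemma tangent_space_zero: "(\<lambda>_. 0) \<in> tangent_space X p"
  by (simp add: tangent_space_def)

lemma tangent_space_add: "v \<in> tangent_space X p \<Longrightarrow> w \<in> tangent_space X p \<Longrightarrow> v + w \<in> tangent_space X p"
  by (simp add: tangent_space_def algebra_simps)

lemma tangent_space_scale: "v \<in> tangent_space X p \<Longrightarrow> (\<lambda>f. c * v f) \<in> tangent_space X p"
  by (simp add: tangent_space_def algebra_simps)

lemma tangent_sec_at: "\<theta> \<in> tangent_sec X U \<Longrightarrow> p \<in> U \<Longrightarrow> \<theta> p \<in> tangent_space X p"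
  by (simp add: tangent_sec_def)

lemma tangent_sec_regular:
  assumes "\<theta> \<in> tangent_sec X U" "opn V" "V \<subseteq> U" "f \<in> reg X V"
  shows "regular_on V (\<lambda>p. \<theta> p f)"
  using assms by (auto simp: tangent_sec_def regular_on_def)

lemma tangent_sec_cut:
  assumes "\<theta> \<in> tangent_sec X U" "opn V" "V \<subseteq> U" shows "cut V \<theta> \<in> tangent_sec X V"
proof -
  have "cut W (\<lambda>p. cut V \<theta> p f) \<in> reg X W" if "opn W" "W \<subseteq> V" "f \<in> reg X W" for W f
  proof -
    have "cut W (\<lambda>p. cut V \<theta> p f) = cut W (\<lambda>p. \<theta> p f)" by (rule cut_cong) (use that in auto)
    then show ?thesis using assms that by (auto simp: tangent_sec_def)
  qed
  then show ?thesis using assms by (auto simp: tangent_sec_def)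
qed

end


section \<open>Spaces of local fractions\<close>

text \<open>The conditions under which locally defined fractions form a sheaf of rings on a topology
  with the nonvanishing sets as a basis.\<close>

locale fraction_family =
  fixes \<B> :: "('p set \<times> ('p \<Rightarrow> complex) set) set"
  assumes const: "(B, R) \<in> \<B> \<Longrightarrow> \<exists>h\<in>R. \<forall>x\<in>B. h x = c"
    and sum: "(B, R) \<in> \<B> \<Longrightarrow> f \<in> R \<Longrightarrow> g \<in> R \<Longrightarrow> (\<lambda>x. f x + g x) \<in> R"
    and mult: "(B, R) \<in> \<B> \<Longrightarrow> f \<in> R \<Longrightarrow> g \<in> R \<Longrightarrow> (\<lambda>x. f x * g x) \<in> R"
    and inter: "(B, R) \<in> \<B> \<Longrightarrow> (B', R') \<in> \<B> \<Longrightarrow> \<exists>R''. (B \<inter> B', R'') \<in> \<B> \<and>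
      (\<forall>f\<in>R. \<exists>g\<in>R''. \<forall>x\<in>B \<inter> B'. g x = f x) \<and> (\<forall>f\<in>R'. \<exists>g\<in>R''. \<forall>x\<in>B \<inter> B'. g x = f x)"
begin

abbreviation "Y \<equiv> fraction_space \<B>"

lemma mem_nonvanishing: "x \<in> nonvanishing B h \<longleftrightarrow> x \<in> B \<and> h x \<noteq> 0"
  by (simp add: nonvanishing_def)

lemma open_nonvanishing: "(B, R) \<in> \<B> \<Longrightarrow> h \<in> R \<Longrightarrow> openin (topo Y) (nonvanishing B h)"
  unfolding fraction_space_def by (auto intro!: topology_generated_by_Basis)

lemma open_base: assumes "(B, R) \<in> \<B>" shows "openin (topo Y) B"
proof -
  obtain h where "h \<in> R" "\<forall>x\<in>B. h x = 1" using const [OF assms] by blast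
  moreover from this have "nonvanishing B h = B" by (auto simp: mem_nonvanishing)
  ultimately show ?thesis using open_nonvanishing [OF assms] by metis
qed

lemma topspace_Y: "topspace (topo Y) = \<Union> (fst ` \<B>)"
proof
  show "topspace (topo Y) \<subseteq> \<Union> (fst ` \<B>)"
    by (force simp: fraction_space_def mem_nonvanishing)
  show "\<Union> (fst ` \<B>) \<subseteq> topspace (topo Y)"
    using open_base openin_subset by fastforce
qed

lemma refine:
  assumes "(B, R) \<in> \<B>" "(B', R') \<in> \<B>"
  obtains R'' where "(B \<inter> B', R'') \<in> \<B>" "\<forall>f\<in>R. \<exists>g\<in>R''. \<forall>x\<in>B \<inter> B'. g x = f x"
    "\<forall>f\<in>R'. \<exists>g\<in>R''. \<forall>x\<in>B \<inter> B'. g x = f x"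
  using inter [OF assms] by blast

lemma basis:
  assumes "openin (topo Y) W" "x \<in> W"
  obtains B R h where "(B, R) \<in> \<B>" "h \<in> R" "x \<in> nonvanishing B h" "nonvanishing B h \<subseteq> W"
proof -
  have "generate_topology_on {nonvanishing B h |B R h. (B, R) \<in> \<B> \<and> h \<in> R} W"
    using assms(1) by (simp add: fraction_space_def openin_topology_generated_by_iff)
  then have "\<exists>B R h. (B, R) \<in> \<B> \<and> h \<in> R \<and> x \<in> nonvanishing B h \<and> nonvanishing B h \<subseteq> W"
    using assms(2)
  proof (induction arbitrary: x rule: generate_topology_on.induct)
    case (Int V W)
    then have x: "x \<in> V" "x \<in> W" by auto
    obtain B R h where h: "(B, R) \<in> \<B>" "h \<in> R" "x \<in> nonvanishing B h" "nonvanishing B h \<subseteq> V"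
      using Int.IH(1) [OF x(1)] by blast
    obtain B' R' h' where h': "(B', R') \<in> \<B>" "h' \<in> R'" "x \<in> nonvanishing B' h'" "nonvanishing B' h' \<subseteq> W"
      using Int.IH(2) [OF x(2)] by blast
    obtain R'' where R'': "(B \<inter> B', R'') \<in> \<B>" "\<forall>f\<in>R. \<exists>g\<in>R''. \<forall>x\<in>B \<inter> B'. g x = f x"
      "\<forall>f\<in>R'. \<exists>g\<in>R''. \<forall>x\<in>B \<inter> B'. g x = f x"
      using refine [OF h(1) h'(1)] .
    obtain k k' where k: "k \<in> R''" "\<forall>x\<in>B \<inter> B'. k x = h x" "k' \<in> R''" "\<forall>x\<in>B \<inter> B'. k' x = h' x"
      using R''(2) [rule_format, OF h(2)] R''(3) [rule_format, OF h'(2)] by blast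
    have eq: "nonvanishing (B \<inter> B') (\<lambda>x. k x * k' x) = nonvanishing B h \<inter> nonvanishing B' h'"
      using k by (auto simp: mem_nonvanishing)
    show ?case
    proof (intro exI conjI)
      show "(B \<inter> B', R'') \<in> \<B>" "(\<lambda>x. k x * k' x) \<in> R''"
        using R''(1) mult [OF R''(1) k(1,3)] by auto
      show "x \<in> nonvanishing (B \<inter> B') (\<lambda>x. k x * k' x)" "nonvanishing (B \<inter> B') (\<lambda>x. k x * k' x) \<subseteq> V \<inter> W"
        unfolding eq using h h' by auto
    qed
  next
    case (UN K)
    then obtain k where k: "k \<in> K" "x \<in> k" by blast
    obtain B R h where h: "(B, R) \<in> \<B>" "h \<in> R" "x \<in> nonvanishing B h" "nonvanishing B h \<subseteq> k"
      using UN.IH [OF k] by blast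
    then have "nonvanishing B h \<subseteq> \<Union> K" using k by blast
    then show ?case using h by blast
  next
    case (Basis s)
    then obtain B R h where h: "s = nonvanishing B h" "(B, R) \<in> \<B>" "h \<in> R" by blast
    then show ?case using \<open>x \<in> s\<close> by blast
  qed simp
  then show thesis using that by blast
qed

lemma reg_Y_iff: "f \<in> reg Y W \<longleftrightarrow> (\<forall>x. x \<notin> W \<longrightarrow> f x = 0) \<and>
    (\<forall>x\<in>W. \<exists>B R g h. (B, R) \<in> \<B> \<and> g \<in> R \<and> h \<in> R \<and> x \<in> nonvanishing B h \<and> nonvanishing B h \<subseteq> W \<and>
            (\<forall>y\<in>nonvanishing B h. f y = g y / h y))"
  by (auto simp: fraction_space_def) fast+

text \<open>A fraction defined on a basic open set which is not contained in \<open>W\<close> is restricted to one inside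
  \<open>W\<close> by multiplying numerator and denominator with a function \<open>k\<close> whose nonvanishing set lies in \<open>W\<close>.\<close>

lemma reg_YI:
  assumes W: "openin (topo Y) W" and out: "\<And>x. x \<notin> W \<Longrightarrow> f x = 0"
    and loc: "\<And>x. x \<in> W \<Longrightarrow> \<exists>B R g h. (B, R) \<in> \<B> \<and> g \<in> R \<and> h \<in> R \<and> x \<in> nonvanishing B h \<and>
            (\<forall>y\<in>nonvanishing B h \<inter> W. f y = g y / h y)"
  shows "f \<in> reg Y W"
  unfolding reg_Y_iff
proof (intro conjI allI impI ballI out)
  fix x assume x: "x \<in> W"
  obtain B R g h where B: "(B, R) \<in> \<B>" "g \<in> R" "h \<in> R" "x \<in> nonvanishing B h"
    and f: "\<And>y. y \<in> nonvanishing B h \<Longrightarrow> y \<in> W \<Longrightarrow> f y = g y / h y"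
    using loc [OF x] by blast
  obtain B' R' k where B': "(B', R') \<in> \<B>" "k \<in> R'" "x \<in> nonvanishing B' k" "nonvanishing B' k \<subseteq> W"
    using basis [OF W x] .
  obtain R'' where R'': "(B \<inter> B', R'') \<in> \<B>" "\<forall>f\<in>R. \<exists>g\<in>R''. \<forall>x\<in>B \<inter> B'. g x = f x"
    "\<forall>f\<in>R'. \<exists>g\<in>R''. \<forall>x\<in>B \<inter> B'. g x = f x"
    using refine [OF B(1) B'(1)] .
  obtain g' h' k' where *: "g' \<in> R''" "\<forall>x\<in>B \<inter> B'. g' x = g x" "h' \<in> R''" "\<forall>x\<in>B \<inter> B'. h' x = h x"
      "k' \<in> R''" "\<forall>x\<in>B \<inter> B'. k' x = k x"
    using R''(2) [rule_format, OF B(2)] R''(2) [rule_format, OF B(3)] R''(3) [rule_format, OF B'(2)] by blast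
  have "nonvanishing (B \<inter> B') (\<lambda>x. h' x * k' x) = nonvanishing B h \<inter> nonvanishing B' k"
    using * by (auto simp: mem_nonvanishing)
  moreover have "f y = (g' y * k' y) / (h' y * k' y)" if "y \<in> nonvanishing B h \<inter> nonvanishing B' k" for y
    using that f B'(4) * by (auto simp: mem_nonvanishing)
  ultimately show "\<exists>B R g h. (B, R) \<in> \<B> \<and> g \<in> R \<and> h \<in> R \<and> x \<in> nonvanishing B h \<and> nonvanishing B h \<subseteq> W \<and>
            (\<forall>y\<in>nonvanishing B h. f y = g y / h y)"
    using R''(1) mult [OF R''(1)] * B(4) B'(3,4)
    by (intro exI [of _ "B \<inter> B'"] exI [of _ R''] exI [of _ "\<lambda>x. g' x * k' x"] exI [of _ "\<lambda>x. h' x * k' x"]) auto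
qed

lemma common_fractions:
  assumes W: "openin (topo Y) W" and f: "f \<in> reg Y W" "f' \<in> reg Y W" and x: "x \<in> W"
  obtains B R g g' h where "(B, R) \<in> \<B>" "g \<in> R" "g' \<in> R" "h \<in> R" "x \<in> nonvanishing B h" "nonvanishing B h \<subseteq> W"
    "\<And>y. y \<in> nonvanishing B h \<Longrightarrow> f y = g y / h y" "\<And>y. y \<in> nonvanishing B h \<Longrightarrow> f' y = g' y / h y"
proof -
  obtain B R g h where B: "(B, R) \<in> \<B>" "g \<in> R" "h \<in> R" "x \<in> nonvanishing B h" "nonvanishing B h \<subseteq> W"
    and fg: "\<And>y. y \<in> nonvanishing B h \<Longrightarrow> f y = g y / h y"
    using f(1) x unfolding reg_Y_iff by blast
  obtain B' R' g' h' where B': "(B', R') \<in> \<B>" "g' \<in> R'" "h' \<in> R'" "x \<in> nonvanishing B' h'" "nonvanishing B' h' \<subseteq> W"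
    and fg': "\<And>y. y \<in> nonvanishing B' h' \<Longrightarrow> f' y = g' y / h' y"
    using f(2) x unfolding reg_Y_iff by blast
  obtain R'' where R'': "(B \<inter> B', R'') \<in> \<B>" "\<forall>f\<in>R. \<exists>g\<in>R''. \<forall>x\<in>B \<inter> B'. g x = f x"
    "\<forall>f\<in>R'. \<exists>g\<in>R''. \<forall>x\<in>B \<inter> B'. g x = f x"
    using refine [OF B(1) B'(1)] .
  obtain a b where ab: "a \<in> R''" "\<forall>x\<in>B \<inter> B'. a x = g x" "b \<in> R''" "\<forall>x\<in>B \<inter> B'. b x = h x"
    using R''(2) [rule_format, OF B(2)] R''(2) [rule_format, OF B(3)] by blast
  obtain a' b' where ab': "a' \<in> R''" "\<forall>x\<in>B \<inter> B'. a' x = g' x" "b' \<in> R''" "\<forall>x\<in>B \<inter> B'. b' x = h' x"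
    using R''(3) [rule_format, OF B'(2)] R''(3) [rule_format, OF B'(3)] by blast
  have eq: "nonvanishing (B \<inter> B') (\<lambda>x. b x * b' x) = nonvanishing B h \<inter> nonvanishing B' h'"
    using ab ab' by (auto simp: mem_nonvanishing)
  show thesis
  proof (rule that [of "B \<inter> B'" R'' "\<lambda>x. a x * b' x" "\<lambda>x. a' x * b x" "\<lambda>x. b x * b' x"])
    show "f y = a y * b' y / (b y * b' y)" "f' y = a' y * b y / (b y * b' y)"
      if "y \<in> nonvanishing (B \<inter> B') (\<lambda>x. b x * b' x)" for y
      using that fg [of y] fg' [of y] ab ab' unfolding eq by (auto simp: mem_nonvanishing)
  qed (use R''(1) mult [OF R''(1)] ab ab' B B' eq in auto)
qed

lemma space_with_functions_Y: "space_with_functions Y"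
  unfolding space_with_functions_def is_sheaf_def
proof (intro conjI allI impI ballI)
  show "f x = 0" if "f \<in> reg Y U" "x \<notin> U" for U f x
    using that by (simp add: reg_Y_iff)
next
  fix U V f assume V: "openin (topo Y) V" "V \<subseteq> U" and f: "f \<in> reg Y U"
  show "cut V f \<in> reg Y V"
  proof (rule reg_YI [OF V(1)])
    fix x assume "x \<in> V"
    then obtain B R g h where "(B, R) \<in> \<B> \<and> g \<in> R \<and> h \<in> R \<and> x \<in> nonvanishing B h \<and>
        (\<forall>y\<in>nonvanishing B h. f y = g y / h y)"
      using f V unfolding reg_Y_iff by blast
    then show "\<exists>B R g h. (B, R) \<in> \<B> \<and> g \<in> R \<and> h \<in> R \<and> x \<in> nonvanishing B h \<and>
            (\<forall>y\<in>nonvanishing B h \<inter> V. cut V f y = g y / h y)"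
      by (intro exI [of _ B] exI [of _ R] exI [of _ g] exI [of _ h]) auto
  qed auto
next
  fix U f assume U: "openin (topo Y) U" and out: "\<forall>x. x \<notin> U \<longrightarrow> f x = 0"
    and loc: "\<forall>x\<in>U. \<exists>V. openin (topo Y) V \<and> x \<in> V \<and> V \<subseteq> U \<and> cut V f \<in> reg Y V"
  show "f \<in> reg Y U"
  proof (rule reg_YI [OF U])
    fix x assume "x \<in> U"
    then obtain V where V: "x \<in> V" "V \<subseteq> U" "cut V f \<in> reg Y V" using loc by blast
    obtain B R g h where h: "(B, R) \<in> \<B>" "g \<in> R" "h \<in> R" "x \<in> nonvanishing B h" "nonvanishing B h \<subseteq> V"
        "\<forall>y\<in>nonvanishing B h. cut V f y = g y / h y"
      using V(1,3) unfolding reg_Y_iff by blast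
    then have "\<forall>y\<in>nonvanishing B h \<inter> U. f y = g y / h y"
      using V(2) by (metis IntD1 cut_apply(1) subsetD)
    then show "\<exists>B R g h. (B, R) \<in> \<B> \<and> g \<in> R \<and> h \<in> R \<and> x \<in> nonvanishing B h \<and>
            (\<forall>y\<in>nonvanishing B h \<inter> U. f y = g y / h y)"
      using h by blast
  qed (use out in auto)
next
  fix U c assume U: "openin (topo Y) U"
  show "cut U (\<lambda>_. c) \<in> reg Y U"
  proof (rule reg_YI [OF U])
    fix x assume "x \<in> U"
    then obtain B R h where h: "(B, R) \<in> \<B>" "h \<in> R" "x \<in> nonvanishing B h"
      using basis [OF U] by metis
    obtain g where "g \<in> R" "\<forall>x\<in>B. g x = c" using const [OF h(1)] by blast
    then show "\<exists>B R g h. (B, R) \<in> \<B> \<and> g \<in> R \<and> h \<in> R \<and> x \<in> nonvanishing B h \<and>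
            (\<forall>y\<in>nonvanishing B h \<inter> U. cut U (\<lambda>_. c) y = g y / h y)"
      using h mult [OF h(1), of g h]
      by (intro exI [of _ B] exI [of _ R] exI [of _ "\<lambda>x. g x * h x"] exI [of _ h]) (auto simp: mem_nonvanishing)
  qed auto
next
  fix U f f' assume U: "openin (topo Y) U" and f: "f \<in> reg Y U" "f' \<in> reg Y U"
  have out: "f x = 0" "f' x = 0" if "x \<notin> U" for x using f that by (auto simp: reg_Y_iff)
  show "(\<lambda>x. f x + f' x) \<in> reg Y U"
  proof (rule reg_YI [OF U])
    fix x assume x: "x \<in> U"
    obtain B R g g' h where h: "(B, R) \<in> \<B>" "g \<in> R" "g' \<in> R" "h \<in> R" "x \<in> nonvanishing B h"
      "\<And>y. y \<in> nonvanishing B h \<Longrightarrow> f y = g y / h y" "\<And>y. y \<in> nonvanishing B h \<Longrightarrow> f' y = g' y / h y"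
      using common_fractions [OF U f x] by metis
    then show "\<exists>B R g h. (B, R) \<in> \<B> \<and> g \<in> R \<and> h \<in> R \<and> x \<in> nonvanishing B h \<and>
            (\<forall>y\<in>nonvanishing B h \<inter> U. f y + f' y = g y / h y)"
      using sum [OF h(1-3)]
      by (intro exI [of _ B] exI [of _ R] exI [of _ "\<lambda>x. g x + g' x"] exI [of _ h]) (auto simp: add_divide_distrib)
  qed (use out in auto)
  show "(\<lambda>x. f x * f' x) \<in> reg Y U"
  proof (rule reg_YI [OF U])
    fix x assume x: "x \<in> U"
    obtain B R g g' h where h: "(B, R) \<in> \<B>" "g \<in> R" "g' \<in> R" "h \<in> R" "x \<in> nonvanishing B h"
      "\<And>y. y \<in> nonvanishing B h \<Longrightarrow> f y = g y / h y" "\<And>y. y \<in> nonvanishing B h \<Longrightarrow> f' y = g' y / h y"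
      using common_fractions [OF U f x] by metis
    then show "\<exists>B R g h. (B, R) \<in> \<B> \<and> g \<in> R \<and> h \<in> R \<and> x \<in> nonvanishing B h \<and>
            (\<forall>y\<in>nonvanishing B h \<inter> U. f y * f' y = g y / h y)"
      using mult [OF h(1-3)] mult [OF h(1,4,4)]
      by (intro exI [of _ B] exI [of _ R] exI [of _ "\<lambda>x. g x * g' x"] exI [of _ "\<lambda>x. h x * h x"])
        (auto simp: mem_nonvanishing)
  qed (use out in auto)
qed

sublocale function_space Y
  by unfold_locales (rule space_with_functions_Y)

lemma regular_on_iff_fractions:
  assumes "opn W"
  shows "regular_on W f \<longleftrightarrow> (\<forall>x\<in>W. \<exists>B R g h. (B, R) \<in> \<B> \<and> g \<in> R \<and> h \<in> R \<and> x \<in> nonvanishing B h \<and>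
            (\<forall>y\<in>nonvanishing B h \<inter> W. f y = g y / h y))"
proof
  assume "regular_on W f"
  show "\<forall>x\<in>W. \<exists>B R g h. (B, R) \<in> \<B> \<and> g \<in> R \<and> h \<in> R \<and> x \<in> nonvanishing B h \<and>
            (\<forall>y\<in>nonvanishing B h \<inter> W. f y = g y / h y)"
  proof
    fix x assume x: "x \<in> W"
    obtain B R g h where h: "(B, R) \<in> \<B>" "g \<in> R" "h \<in> R" "x \<in> nonvanishing B h" "nonvanishing B h \<subseteq> W"
        "\<forall>y\<in>nonvanishing B h. cut W f y = g y / h y"
      using \<open>regular_on W f\<close> x unfolding regular_on_def reg_Y_iff by blast
    then have "\<forall>y\<in>nonvanishing B h \<inter> W. f y = g y / h y" by auto
    then show "\<exists>B R g h. (B, R) \<in> \<B> \<and> g \<in> R \<and> h \<in> R \<and> x \<in> nonvanishing B h \<and>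
            (\<forall>y\<in>nonvanishing B h \<inter> W. f y = g y / h y)"
      using h by blast
  qed
next
  assume *: "\<forall>x\<in>W. \<exists>B R g h. (B, R) \<in> \<B> \<and> g \<in> R \<and> h \<in> R \<and> x \<in> nonvanishing B h \<and>
            (\<forall>y\<in>nonvanishing B h \<inter> W. f y = g y / h y)"
  show "regular_on W f"
    unfolding regular_on_def
  proof (rule reg_YI [OF assms])
    fix x assume x: "x \<in> W"
    obtain B R g h where h: "(B, R) \<in> \<B>" "g \<in> R" "h \<in> R" "x \<in> nonvanishing B h"
        "\<forall>y\<in>nonvanishing B h \<inter> W. f y = g y / h y"
      using * x by blast
    then have "\<forall>y\<in>nonvanishing B h \<inter> W. cut W f y = g y / h y" by auto
    then show "\<exists>B R g h. (B, R) \<in> \<B> \<and> g \<in> R \<and> h \<in> R \<and> x \<in> nonvanishing B h \<and>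
            (\<forall>y\<in>nonvanishing B h \<inter> W. cut W f y = g y / h y)"
      using h by blast
  qed auto
qed

lemma regular_on_generator: "(B, R) \<in> \<B> \<Longrightarrow> g \<in> R \<Longrightarrow> opn W \<Longrightarrow> W \<subseteq> B \<Longrightarrow> regular_on W g"
proof -
  assume B: "(B, R) \<in> \<B>" "g \<in> R" "opn W" "W \<subseteq> B"
  obtain h where h: "h \<in> R" "\<forall>x\<in>B. h x = 1" using const [OF B(1)] by blast
  show "regular_on W g"
    unfolding regular_on_iff_fractions [OF B(3)] using B h by (fastforce simp: mem_nonvanishing)
qed

end


section \<open>Local coordinates on smooth varieties\<close>

lemma fraction_family_affine: "fraction_family {(Z, poly_funs m)}"
  by unfold_locales (auto intro: poly_funs.intros)

text \<open>In a chart regular functions are local fractions of polynomials in the coordinates \<open>\<phi>\<close>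
  (\<open>chart_regular_iff\<close>).\<close>

locale affine_chart = function_space X for X :: "'p fspace" +
  fixes U :: "'p set" and m :: nat and Z :: "(nat \<Rightarrow> complex) set" and \<phi> :: "'p \<Rightarrow> nat \<Rightarrow> complex"
  assumes U: "opn U" and iso: "fspace_iso (open_subspace X U) (affine_variety m Z) \<phi>"
begin

sublocale Z: fraction_family "{(Z, poly_funs m)}" by (rule fraction_family_affine)

lemma homeo: "homeomorphic_map (subtopology (topo X) U) (topo (affine_variety m Z)) \<phi>"
  using iso by (simp add: fspace_iso_def open_subspace_def)

lemma affine_eq: "affine_variety m Z = Z.Y"
  by (simp add: affine_variety_def)

lemma U_top: "U \<subseteq> topspace (topo X)"
  using U by (rule openin_subset)

lemma top_U: "topspace (subtopology (topo X) U) = U"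
  using U_top by auto

lemma image_\<phi>: "\<phi> ` U = Z"
  using homeomorphic_imp_surjective_map [OF homeo] top_U by (simp add: affine_eq Z.topspace_Y)

lemma inj_\<phi>: "inj_on \<phi> U"
  using homeomorphic_imp_injective_map [OF homeo] top_U by simp

lemma \<phi>_in [simp]: "x \<in> U \<Longrightarrow> \<phi> x \<in> Z"
  using image_\<phi> by blast

lemma open_preimage:
  assumes "g \<in> poly_funs m" shows "opn {x \<in> U. g (\<phi> x) \<noteq> 0}"
proof -
  have "openin (subtopology (topo X) U) {x \<in> topspace (subtopology (topo X) U). \<phi> x \<in> nonvanishing Z g}"
    using homeomorphic_imp_continuous_map [OF homeo] Z.open_nonvanishing [of Z "poly_funs m" g] assms
    by (intro openin_continuous_map_preimage) (auto simp: affine_eq)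
  then have "openin (subtopology (topo X) U) {x \<in> U. g (\<phi> x) \<noteq> 0}"
    unfolding top_U by (simp add: Z.mem_nonvanishing cong: conj_cong)
  then show ?thesis
    by (rule openin_trans_full) (rule U)
qed

lemma open_image:
  assumes "opn V" "V \<subseteq> U" shows "openin (topo Z.Y) (\<phi> ` V)"
proof -
  have "openin (subtopology (topo X) U) V"
    using assms U by (simp add: openin_open_subtopology)
  then show ?thesis
    using homeomorphic_imp_open_map [OF homeo] by (simp add: open_map_def affine_eq)
qed

lemma shrink:
  assumes "opn V" "V \<subseteq> U" "x \<in> V"
  obtains k where "k \<in> poly_funs m" "k (\<phi> x) \<noteq> 0" "{y \<in> U. k (\<phi> y) \<noteq> 0} \<subseteq> V"
proof -
  obtain k where k: "k \<in> poly_funs m" "\<phi> x \<in> nonvanishing Z k" "nonvanishing Z k \<subseteq> \<phi> ` V"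
  proof -
    have "\<phi> x \<in> \<phi> ` V" using assms by blast
    from Z.basis [OF open_image [OF assms(1,2)] this] obtain B R h where
      "(B, R) \<in> {(Z, poly_funs m)}" "h \<in> R" "\<phi> x \<in> nonvanishing B h" "nonvanishing B h \<subseteq> \<phi> ` V" .
    then show thesis using that by blast
  qed
  moreover have "{y \<in> U. k (\<phi> y) \<noteq> 0} \<subseteq> V"
  proof clarify
    fix y assume y: "y \<in> U" "k (\<phi> y) \<noteq> 0"
    then have "\<phi> y \<in> \<phi> ` V" using k(3) by (auto simp: Z.mem_nonvanishing)
    then show "y \<in> V" using inj_on_image_mem_iff [OF inj_\<phi>] y assms by blast
  qed
  ultimately show thesis using that by (auto simp: Z.mem_nonvanishing)
qed

lemma chart_regular_iff:
  assumes V: "opn V" "V \<subseteq> U"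
  shows "regular_on V f \<longleftrightarrow> (\<forall>x\<in>V. \<exists>g\<in>poly_funs m. \<exists>h\<in>poly_funs m. h (\<phi> x) \<noteq> 0 \<and>
     (\<forall>y\<in>V. h (\<phi> y) \<noteq> 0 \<longrightarrow> f y = g (\<phi> y) / h (\<phi> y)))"
proof -
  have inV: "\<phi> x \<in> \<phi> ` V \<longleftrightarrow> x \<in> V" if "x \<in> U" for x
    using inj_on_image_mem_iff [OF inj_\<phi> that] assms by blast
  define f' where "f' = cut (\<phi> ` V) (\<lambda>z. f (inv_into U \<phi> z))"
  have f': "f' (\<phi> x) = f x" if "x \<in> V" for x
    using that assms inj_\<phi> by (auto simp: f'_def cut_def inv_into_f_f)
  have W: "{x \<in> topspace (topo (open_subspace X U)). \<phi> x \<in> \<phi> ` V} = V"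
    using inV assms(2) top_U by (auto simp: open_subspace_def)
  have "f' \<in> reg Z.Y (\<phi> ` V) \<longleftrightarrow> cut V (\<lambda>x. f' (\<phi> x)) \<in> reg X V"
  proof -
    have "\<forall>z. z \<notin> \<phi> ` V \<longrightarrow> f' z = 0" by (auto simp: f'_def)
    then show ?thesis
      using iso open_image [OF V] unfolding fspace_iso_def Let_def affine_eq
      by (elim conjE allE [of _ "\<phi> ` V"] allE [of _ f']) (simp add: W, simp add: open_subspace_def)
  qed
  also have "cut V (\<lambda>x. f' (\<phi> x)) = cut V f"
    by (rule cut_cong) (auto simp: f')
  also have "cut V f \<in> reg X V \<longleftrightarrow> regular_on V f" by (simp add: regular_on_def)
  also have "f' \<in> reg Z.Y (\<phi> ` V) \<longleftrightarrow> Z.regular_on (\<phi> ` V) f'"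
    using Z.reg_iff [OF open_image [OF V]] by (auto simp: f'_def)
  finally have "regular_on V f \<longleftrightarrow> (\<forall>z\<in>\<phi> ` V. \<exists>g\<in>poly_funs m. \<exists>h\<in>poly_funs m. z \<in> nonvanishing Z h \<and>
      (\<forall>y\<in>nonvanishing Z h \<inter> \<phi> ` V. f' y = g y / h y))"
    unfolding Z.regular_on_iff_fractions [OF open_image [OF V]] by (auto simp: Bex_def)
  also have "\<dots> \<longleftrightarrow> (\<forall>x\<in>V. \<exists>g\<in>poly_funs m. \<exists>h\<in>poly_funs m. h (\<phi> x) \<noteq> 0 \<and>
     (\<forall>y\<in>V. h (\<phi> y) \<noteq> 0 \<longrightarrow> f y = g (\<phi> y) / h (\<phi> y)))"
  proof -
    have key: "\<phi> x \<in> nonvanishing Z h \<and> (\<forall>y\<in>nonvanishing Z h \<inter> \<phi> ` V. f' y = g y / h y) \<longleftrightarrow>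
      h (\<phi> x) \<noteq> 0 \<and> (\<forall>y\<in>V. h (\<phi> y) \<noteq> 0 \<longrightarrow> f y = g (\<phi> y) / h (\<phi> y))" if "x \<in> V" for x g h
    proof -
      have "(\<forall>y\<in>nonvanishing Z h \<inter> \<phi> ` V. f' y = g y / h y) \<longleftrightarrow>
          (\<forall>y\<in>V. h (\<phi> y) \<noteq> 0 \<longrightarrow> f' (\<phi> y) = g (\<phi> y) / h (\<phi> y))"
        using V(2) by (auto simp: Z.mem_nonvanishing)
      then show ?thesis using that V(2) f' by (auto simp: Z.mem_nonvanishing)
    qed
    show ?thesis by (simp only: ball_simps key cong: ball_cong)
  qed
  finally show ?thesis .
qed

lemma poly_regular_on: "g \<in> poly_funs m \<Longrightarrow> opn V \<Longrightarrow> V \<subseteq> U \<Longrightarrow> regular_on V (\<lambda>x. g (\<phi> x))"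
  unfolding chart_regular_iff
  by (intro ballI, rule bexI [of _ g], rule bexI [of _ "\<lambda>_. 1"]) (auto intro: poly_funs.const)

lemma poly_regular_at: "g \<in> poly_funs m \<Longrightarrow> q \<in> U \<Longrightarrow> (\<lambda>x. g (\<phi> x)) \<in> regular_at X q"
  by (rule regular_atI [OF U]) (auto intro: poly_regular_on U)

lemma local_fraction:
  assumes "f \<in> regular_at X q" "q \<in> U"
  obtains V g h where "opn V" "q \<in> V" "V \<subseteq> U" "g \<in> poly_funs m" "h \<in> poly_funs m" "h (\<phi> q) \<noteq> 0"
    "\<And>y. y \<in> V \<Longrightarrow> h (\<phi> y) \<noteq> 0" "\<And>y. y \<in> V \<Longrightarrow> f y * h (\<phi> y) = g (\<phi> y)"
proof -
  obtain W where W: "opn W" "q \<in> W" "regular_on W f" using assms(1) by (rule regular_atE)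
  have UW: "opn (U \<inter> W)" "U \<inter> W \<subseteq> U" "q \<in> U \<inter> W" using U W assms by auto
  then have "regular_on (U \<inter> W) f" using regular_on_subset [OF W(3,1) UW(1)] by auto
  then obtain g h where gh: "g \<in> poly_funs m" "h \<in> poly_funs m" "h (\<phi> q) \<noteq> 0"
     "\<And>y. y \<in> U \<inter> W \<Longrightarrow> h (\<phi> y) \<noteq> 0 \<Longrightarrow> f y = g (\<phi> y) / h (\<phi> y)"
    unfolding chart_regular_iff [OF UW(1,2)] using UW(3) by blast
  have "opn (W \<inter> {x \<in> U. h (\<phi> x) \<noteq> 0})"
    using open_preimage [OF gh(2)] W by blast
  then show thesis
    using gh UW(3) by (intro that [of "W \<inter> {x \<in> U. h (\<phi> x) \<noteq> 0}" g h]) auto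
qed

lemma regular_at_inverse:
  assumes "f \<in> regular_at X q" "q \<in> U" "f q \<noteq> 0" shows "(\<lambda>x. 1 / f x) \<in> regular_at X q"
proof -
  obtain V g h where V: "opn V" "q \<in> V" "V \<subseteq> U" and g: "g \<in> poly_funs m" and h: "h \<in> poly_funs m"
    "h (\<phi> q) \<noteq> 0" "\<And>y. y \<in> V \<Longrightarrow> h (\<phi> y) \<noteq> 0" and eq: "\<And>y. y \<in> V \<Longrightarrow> f y * h (\<phi> y) = g (\<phi> y)"
    using local_fraction [OF assms(1,2)] by metis
  have gq: "g (\<phi> q) \<noteq> 0" using eq [OF V(2)] h assms(3) by auto
  define W where "W = V \<inter> {x \<in> U. g (\<phi> x) \<noteq> 0}"
  have W: "opn W" "q \<in> W" "W \<subseteq> U" using open_preimage [OF g] V gq by (auto simp: W_def)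
  have "1 / f y = h (\<phi> y) / g (\<phi> y)" if "y \<in> W" for y
    using that eq [of y, symmetric] h(3) [of y] by (auto simp: W_def)
  then have "regular_on W (\<lambda>x. 1 / f x)"
    unfolding chart_regular_iff [OF W(1,3)] using g h(1)
    by (intro ballI bexI [of _ h] bexI [of _ g]) (auto simp: W_def)
  then show ?thesis using W by (intro regular_atI)
qed

text \<open>
  Point derivations of the polynomial ring at \<open>\<phi> q\<close> which kill the vanishing ideal of \<open>Z\<close> are
  tangent vectors at \<open>q\<close>.  On a local fraction \<open>f = g / h\<close> the value can only be
  \<open>(\<delta> g - f \<delta> h) / h\<close>; two representations of \<open>f\<close> agree after multiplication with some \<open>k\<close> not
  vanishing at \<open>q\<close>, and so give the same value.
\<close>

lemma extend_derivation:
  assumes q: "q \<in> U" and \<delta>: "point_derivation m (\<phi> q) \<delta>"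
    and zero: "\<And>g. g \<in> poly_funs m \<Longrightarrow> \<forall>w\<in>Z. g w = 0 \<Longrightarrow> \<delta> g = 0"
  shows "\<exists>v\<in>tangent_space X q. \<forall>g\<in>poly_funs m. v (\<lambda>x. g (\<phi> x)) = \<delta> g"
proof -
  let ?w = "\<phi> q"
  have \<delta>_add: "\<delta> (\<lambda>z. f z + g z) = \<delta> f + \<delta> g" and \<delta>_mult: "\<delta> (\<lambda>z. f z * g z) = f ?w * \<delta> g + g ?w * \<delta> f"
    if "f \<in> poly_funs m" "g \<in> poly_funs m" for f g
    using \<delta> that by (auto simp: point_derivation_def)
  have \<delta>_const: "\<delta> (\<lambda>_. c) = 0" for c using \<delta> by (simp add: point_derivation_def)
  define rep where "rep f g h \<longleftrightarrow> g \<in> poly_funs m \<and> h \<in> poly_funs m \<and> h ?w \<noteq> 0 \<and>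
      (\<exists>V. opn V \<and> q \<in> V \<and> V \<subseteq> U \<and> (\<forall>y\<in>V. f y * h (\<phi> y) = g (\<phi> y)))" for f g h
  have ex: "\<exists>g h. rep f g h" if "f \<in> regular_at X q" for f
    by (rule local_fraction [OF that q]) (unfold rep_def, blast)
  define val where "val f g h = (\<delta> g - f q * \<delta> h) / h ?w" for f :: "'p \<Rightarrow> complex" and g h
  have unique: "val f g h = val f g' h'" if "rep f g h" "rep f g' h'" for f g h g' h'
  proof -
    obtain V where V: "opn V" "q \<in> V" "V \<subseteq> U" "\<And>y. y \<in> V \<Longrightarrow> f y * h (\<phi> y) = g (\<phi> y)"
      using \<open>rep f g h\<close> unfolding rep_def by blast
    obtain V' where V': "opn V'" "q \<in> V'" "\<And>y. y \<in> V' \<Longrightarrow> f y * h' (\<phi> y) = g' (\<phi> y)"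
      using \<open>rep f g' h'\<close> unfolding rep_def by blast
    have p: "g \<in> poly_funs m" "h \<in> poly_funs m" "h ?w \<noteq> 0" "g' \<in> poly_funs m" "h' \<in> poly_funs m" "h' ?w \<noteq> 0"
      using that by (auto simp: rep_def)
    obtain k where k: "k \<in> poly_funs m" "k ?w \<noteq> 0" "{y \<in> U. k (\<phi> y) \<noteq> 0} \<subseteq> V \<inter> V'"
      using shrink [of "V \<inter> V'" q] V V' by blast
    let ?d = "\<lambda>z. g z * h' z - g' z * h z"
    have d: "?d \<in> poly_funs m" by (intro poly_funs_diff poly_funs.product p)
    have "k z * ?d z = 0" if z: "z \<in> Z" for z
    proof -
      obtain y where y: "y \<in> U" "z = \<phi> y" using z image_\<phi> by blast
      show ?thesis
      proof (cases "k z = 0")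
        case False
        then have "y \<in> V" "y \<in> V'" using k(3) y by auto
        then show ?thesis using V(4) [of y, symmetric] V'(3) [of y, symmetric] y by simp
      qed simp
    qed
    then have "\<delta> (\<lambda>z. k z * ?d z) = 0"
      by (intro zero poly_funs.product k d) auto
    moreover have "?d ?w = 0"
      using V(4) [OF V(2), symmetric] V'(3) [OF V'(2), symmetric] by simp
    ultimately have "\<delta> ?d = 0" using k \<delta>_mult [OF k(1) d] by simp
    moreover have "\<delta> (\<lambda>z. ?d z + g' z * h z) = \<delta> ?d + \<delta> (\<lambda>z. g' z * h z)"
      by (intro \<delta>_add d poly_funs.product p)
    ultimately have "\<delta> (\<lambda>z. g z * h' z) = \<delta> (\<lambda>z. g' z * h z)" by simp
    then have *: "g ?w * \<delta> h' + h' ?w * \<delta> g = g' ?w * \<delta> h + h ?w * \<delta> g'"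
      using p by (simp add: \<delta>_mult)
    have "g ?w = f q * h ?w" "g' ?w = f q * h' ?w" using V V' by auto
    then have "h' ?w * (\<delta> g - f q * \<delta> h) = h ?w * (\<delta> g' - f q * \<delta> h')"
      using * by (simp add: algebra_simps)
    then show ?thesis using p by (simp add: val_def field_simps)
  qed
  define v where "v f = (if f \<in> regular_at X q then val f (fst (SOME (g, h). rep f g h)) (snd (SOME (g, h). rep f g h)) else 0)" for f
  have v: "v f = val f g h" if f: "f \<in> regular_at X q" and gh: "rep f g h" for f g h
  proof -
    have "(case SOME (g, h). rep f g h of (g, h) \<Rightarrow> rep f g h)"
      by (rule someI [of _ "(g, h)"]) (simp add: gh)
    then show ?thesis using f unique [OF _ gh] by (auto simp: v_def split: prod.splits)
  qed
  have "v \<in> tangent_space X q"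
    unfolding tangent_space_def
  proof (intro CollectI conjI allI ballI impI)
    show "v f = 0" if "f \<notin> regular_at X q" for f using that by (simp add: v_def)
    fix f assume f: "f \<in> regular_at X q"
    obtain g h where gh: "rep f g h" using ex [OF f] by blast
    then have p: "g \<in> poly_funs m" "h \<in> poly_funs m" "h ?w \<noteq> 0" by (auto simp: rep_def)
    obtain V where V: "opn V" "q \<in> V" "V \<subseteq> U" "\<And>y. y \<in> V \<Longrightarrow> f y * h (\<phi> y) = g (\<phi> y)"
      using gh unfolding rep_def by blast
    note gw = V(4) [OF V(2), symmetric]
    {
      fix c
      have "rep (\<lambda>x. c * f x) (\<lambda>z. c * g z) h"
        unfolding rep_def using p V by (auto intro!: poly_funs.intros exI [of _ V])
      moreover have "(\<lambda>x. c * f x) \<in> regular_at X q"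
        using regular_at_mult [OF regular_at_const f] q U_top by blast
      ultimately have "v (\<lambda>x. c * f x) = val (\<lambda>x. c * f x) (\<lambda>z. c * g z) h"
        by (intro v)
      moreover have "\<delta> (\<lambda>z. c * g z) = c * \<delta> g"
        using \<delta>_mult [OF poly_funs.const p(1), of c] by (simp add: \<delta>_const)
      ultimately show "v (\<lambda>x. c * f x) = c * v f"
        unfolding v [OF f gh] val_def by (simp add: algebra_simps)
    next
      fix f' assume f': "f' \<in> regular_at X q"
      obtain g' h' where gh': "rep f' g' h'" using ex [OF f'] by blast
      then have p': "g' \<in> poly_funs m" "h' \<in> poly_funs m" "h' ?w \<noteq> 0" by (auto simp: rep_def)
      obtain V' where V': "opn V'" "q \<in> V'" "\<And>y. y \<in> V' \<Longrightarrow> f' y * h' (\<phi> y) = g' (\<phi> y)"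
        using gh' unfolding rep_def by blast
      note gw' = V'(3) [OF V'(2), symmetric]
      have VV: "opn (V \<inter> V')" "q \<in> V \<inter> V'" "V \<inter> V' \<subseteq> U" using V V' by auto
      have "\<forall>y\<in>V \<inter> V'. (f y + f' y) * (h (\<phi> y) * h' (\<phi> y)) = g (\<phi> y) * h' (\<phi> y) + g' (\<phi> y) * h (\<phi> y)"
      proof
        fix y assume "y \<in> V \<inter> V'"
        then have "g (\<phi> y) = f y * h (\<phi> y)" "g' (\<phi> y) = f' y * h' (\<phi> y)" using V V' by auto
        then show "(f y + f' y) * (h (\<phi> y) * h' (\<phi> y)) = g (\<phi> y) * h' (\<phi> y) + g' (\<phi> y) * h (\<phi> y)"
          by (simp add: algebra_simps)
      qed
      then have "rep (\<lambda>x. f x + f' x) (\<lambda>z. g z * h' z + g' z * h z) (\<lambda>z. h z * h' z)"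
        unfolding rep_def using VV p(3) p'(3)
        by (intro conjI poly_funs.sum poly_funs.product p p') (simp, blast)
      from v [OF regular_at_add [OF f f'] this]
      show "v (\<lambda>x. f x + f' x) = v f + v f'"
        unfolding v [OF f gh] v [OF f' gh'] val_def using p p'
        by (simp add: \<delta>_add \<delta>_mult poly_funs.product gw gw') (simp add: field_simps)
      have "\<forall>y\<in>V \<inter> V'. (f y * f' y) * (h (\<phi> y) * h' (\<phi> y)) = g (\<phi> y) * g' (\<phi> y)"
      proof
        fix y assume "y \<in> V \<inter> V'"
        then have "g (\<phi> y) = f y * h (\<phi> y)" "g' (\<phi> y) = f' y * h' (\<phi> y)" using V V' by auto
        then show "(f y * f' y) * (h (\<phi> y) * h' (\<phi> y)) = g (\<phi> y) * g' (\<phi> y)"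
          by (simp only: mult.assoc mult.commute mult.left_commute)
      qed
      then have "rep (\<lambda>x. f x * f' x) (\<lambda>z. g z * g' z) (\<lambda>z. h z * h' z)"
        unfolding rep_def using VV p(3) p'(3)
        by (intro conjI poly_funs.product p p') (simp, blast)
      from v [OF regular_at_mult [OF f f'] this]
      show "v (\<lambda>x. f x * f' x) = f q * v f' + f' q * v f"
        unfolding v [OF f gh] v [OF f' gh'] val_def using p p'
        by (simp add: \<delta>_mult poly_funs.product gw gw') (simp add: field_simps)
    }
  qed
  moreover have "v (\<lambda>x. g (\<phi> x)) = \<delta> g" if g: "g \<in> poly_funs m" for g
  proof -
    have "rep (\<lambda>x. g (\<phi> x)) g (\<lambda>_. 1)"
      unfolding rep_def using g U q by (auto intro!: poly_funs.const exI [of _ U])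
    from v [OF poly_regular_at [OF g q] this] show ?thesis by (simp add: val_def \<delta>_const)
  qed
  ultimately show ?thesis by blast
qed

text \<open>Regular functions being local fractions of polynomials in the coordinates, the quotient rule
  determines a tangent vector by its values on these polynomials.\<close>

lemma tangent_eqI:
  assumes q: "q \<in> U" and v: "v \<in> tangent_space X q" and w: "w \<in> tangent_space X q"
    and eq: "\<And>g. g \<in> poly_funs m \<Longrightarrow> v (\<lambda>x. g (\<phi> x)) = w (\<lambda>x. g (\<phi> x))"
    and f: "f \<in> regular_at X q"
  shows "v f = w f"
proof -
  have qt: "q \<in> topspace (topo X)" using q U_top by blast
  obtain V g h where V: "opn V" "q \<in> V" and gh: "g \<in> poly_funs m" "h \<in> poly_funs m" "h (\<phi> q) \<noteq> 0"
    and fgh: "\<And>y. y \<in> V \<Longrightarrow> f y * h (\<phi> y) = g (\<phi> y)"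
    using local_fraction [OF f q] by metis
  have formula: "u f = (h (\<phi> q) * u (\<lambda>x. g (\<phi> x)) - g (\<phi> q) * u (\<lambda>x. h (\<phi> x))) / (h (\<phi> q))\<^sup>2"
    if "u \<in> tangent_space X q" for u
    using tangent_vector.deriv_quotient [OF tangent_vectorI [OF qt that] f poly_regular_at [OF gh(1) q]
        poly_regular_at [OF gh(2) q] _ V] gh(3) fgh by simp
  show ?thesis unfolding formula [OF v] formula [OF w] using eq gh by simp
qed

end

text \<open>
  The formula \<open>df = \<Sum>\<^sub>j \<theta>\<^sub>j(f) dx\<^sub>j\<close> for coordinates \<open>x\<^sub>j\<close> and dual vector fields \<open>\<theta>\<^sub>j\<close> near a point of a
  smooth variety.  In a chart the \<open>x\<^sub>j\<close> are the coordinates selected in \<open>smooth_at_coordinates\<close>, and the \<open>\<theta>\<^sub>j\<close>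
  are induced by the polynomial vector fields found there, divided by \<open>u\<close>; they act on functions on \<open>Z\<close>
  because they annihilate the vanishing ideal on \<open>Z\<close>.
\<close>

lemma smooth_local_coordinates:
  assumes "smooth_variety X" "p \<in> topspace (topo X)"
  obtains V and J :: "nat set" and x \<theta> where "openin (topo X) V" "p \<in> V" "finite J"
    "\<And>j. j \<in> J \<Longrightarrow> x j \<in> reg X V" "\<And>j. j \<in> J \<Longrightarrow> \<theta> j \<in> tangent_sec X V"
    "\<And>q v f. q \<in> V \<Longrightarrow> v \<in> tangent_space X q \<Longrightarrow> f \<in> regular_at X q \<Longrightarrow>
      v f = (\<Sum>j\<in>J. v (x j) * \<theta> j q f)"
proof -
  interpret function_space X
    using assms(1) by unfold_locales (simp add: smooth_variety_def)
  obtain U m Z \<phi> where chart: "opn U" "p \<in> U" "fspace_iso (open_subspace X U) (affine_variety m Z) \<phi>"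
    and sm: "smooth_at m Z (\<phi> p)"
    using assms unfolding smooth_variety_def by blast
  interpret affine_chart X U m Z \<phi>
    by unfold_locales (use chart in auto)
  show thesis
  proof (rule smooth_at_coordinates [OF sm])
    fix J :: "nat set" and D u
    assume J: "J \<subseteq> {..<m}" and u: "u \<in> poly_funs m" "u (\<phi> p) \<noteq> 0"
      and D: "\<And>j. j \<in> J \<Longrightarrow> vector_field m (D j)"
      and kill: "\<And>j g w. j \<in> J \<Longrightarrow> g \<in> poly_funs m \<Longrightarrow> \<forall>w\<in>Z. g w = 0 \<Longrightarrow> w \<in> Z \<Longrightarrow> D j g w = 0"
      and span: "\<And>w \<delta> g. w \<in> Z \<Longrightarrow> point_derivation m w \<delta> \<Longrightarrow>
        (\<And>g. g \<in> poly_funs m \<Longrightarrow> \<forall>w\<in>Z. g w = 0 \<Longrightarrow> \<delta> g = 0) \<Longrightarrow>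
        g \<in> poly_funs m \<Longrightarrow> u w * \<delta> g = (\<Sum>j\<in>J. \<delta> (\<lambda>z. z j) * D j g w)"
    define V where "V = {x \<in> U. u (\<phi> x) \<noteq> 0}"
    have V: "opn V" "p \<in> V" "V \<subseteq> U" using open_preimage [OF u(1)] chart u by (auto simp: V_def)
    have Dpoly: "D j g \<in> poly_funs m" if "j \<in> J" "g \<in> poly_funs m" for j g
      using D [OF that(1)] that(2) by (simp add: vector_field_def)
    define lifts where "lifts j q v \<longleftrightarrow> v \<in> tangent_space X q \<and>
        (\<forall>g\<in>poly_funs m. v (\<lambda>x. g (\<phi> x)) = D j g (\<phi> q) / u (\<phi> q))" for j q v
    have ex: "\<exists>v. lifts j q v" if "j \<in> J" "q \<in> V" for j q
    proof -
      have "point_derivation m (\<phi> q) (\<lambda>g. 1 / u (\<phi> q) * D j g (\<phi> q))"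
        using D [OF \<open>j \<in> J\<close>] by (intro point_derivation_scale) (simp add: vector_field_def)
      then have "\<exists>v\<in>tangent_space X q. \<forall>g\<in>poly_funs m. v (\<lambda>x. g (\<phi> x)) = 1 / u (\<phi> q) * D j g (\<phi> q)"
        by (rule extend_derivation [rotated]) (use that V kill in auto)
      then show ?thesis by (auto simp: lifts_def)
    qed
    define t where "t j q = (SOME v. lifts j q v)" for j q
    have "lifts j q (t j q)" if "j \<in> J" "q \<in> V" for j q
      unfolding t_def using ex [OF that] by (rule someI_ex)
    then have t: "\<And>j q. j \<in> J \<Longrightarrow> q \<in> V \<Longrightarrow> t j q \<in> tangent_space X q"
      "\<And>j q g. j \<in> J \<Longrightarrow> q \<in> V \<Longrightarrow> g \<in> poly_funs m \<Longrightarrow> t j q (\<lambda>x. g (\<phi> x)) = D j g (\<phi> q) / u (\<phi> q)"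
      by (auto simp: lifts_def)
    define \<theta> where "\<theta> j = cut V (t j)" for j
    define x where "x j = cut V (\<lambda>q. \<phi> q j)" for j
    have Vtop: "q \<in> topspace (topo X)" "q \<in> U" if "q \<in> V" for q using that V U_top by auto
    show thesis
    proof (rule that [of V J x \<theta>])
      show "finite J" using J finite_subset by blast
      fix j assume j: "j \<in> J"
      then have "(\<lambda>z. z j) \<in> poly_funs m" using J by (auto intro: poly_funs.coord)
      from poly_regular_on [OF this V(1,3)] show "x j \<in> reg X V"
        by (simp add: x_def regular_on_def)
      have "regular_on W (\<lambda>q. \<theta> j q f)" if W: "opn W" "W \<subseteq> V" and f: "f \<in> reg X W" for W f
      proof -
        have WU: "W \<subseteq> U" using W V by blast
        show ?thesis
          unfolding chart_regular_iff [OF W(1) WU]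
        proof
          fix y assume y: "y \<in> W"
          obtain g h where gh: "g \<in> poly_funs m" "h \<in> poly_funs m" "h (\<phi> y) \<noteq> 0"
            "\<And>y. y \<in> W \<Longrightarrow> h (\<phi> y) \<noteq> 0 \<Longrightarrow> f y = g (\<phi> y) / h (\<phi> y)"
            using reg_regular_on [OF W(1) f] y unfolding chart_regular_iff [OF W(1) WU] by blast
          \<comment> \<open>the quotient rule for \<open>f = g / h\<close>, with the denominator \<open>u\<close> of the vector field\<close>
        let ?g = "\<lambda>w. h w * D j g w - g w * D j h w" and ?h = "\<lambda>w. u w * (h w * h w)"
          show "\<exists>g\<in>poly_funs m. \<exists>h\<in>poly_funs m. h (\<phi> y) \<noteq> 0 \<and>
              (\<forall>y\<in>W. h (\<phi> y) \<noteq> 0 \<longrightarrow> \<theta> j y f = g (\<phi> y) / h (\<phi> y))"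
          proof (rule bexI [of _ ?g], rule bexI [of _ ?h], intro conjI ballI impI)
            show "?g \<in> poly_funs m" by (intro poly_funs_diff poly_funs.product gh Dpoly j)
            show "?h \<in> poly_funs m" by (intro poly_funs.product gh u)
            show "?h (\<phi> y) \<noteq> 0" using gh y W by (auto simp: V_def)
            fix q assume q: "q \<in> W" "?h (\<phi> q) \<noteq> 0"
            define N where "N = W \<inter> {x \<in> U. h (\<phi> x) \<noteq> 0}"
            have N: "opn N" "q \<in> N" using W open_preimage [OF gh(2)] q WU by (auto simp: N_def)
            have eq: "f x * h (\<phi> x) = g (\<phi> x)" if "x \<in> N" for x
              using that gh(4) [of x] by (auto simp: N_def)
            have qV: "q \<in> V" using q W by blast
            interpret tangent_vector X q "t j q"
              using Vtop [OF qV] t(1) [OF j qV] by unfold_locales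
            have "t j q f = (h (\<phi> q) * t j q (\<lambda>x. g (\<phi> x)) - g (\<phi> q) * t j q (\<lambda>x. h (\<phi> x))) / (h (\<phi> q))\<^sup>2"
              using q N eq Vtop [OF qV] gh
              by (intro deriv_quotient [of f "\<lambda>x. g (\<phi> x)" "\<lambda>x. h (\<phi> x)" N])
                (auto intro: poly_regular_at regular_at_reg [OF W(1) _ f])
            then show "\<theta> j q f = ?g (\<phi> q) / ?h (\<phi> q)"
              using q qV by (simp add: \<theta>_def t j gh field_simps power2_eq_square)
          qed
        qed
      qed
      then show "\<theta> j \<in> tangent_sec X V"
        unfolding tangent_sec_def regular_on_def using t(1) [OF j] by (auto simp: \<theta>_def)
    next
      fix q v f assume q: "q \<in> V" and v: "v \<in> tangent_space X q" and f: "f \<in> regular_at X q"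
      interpret v: tangent_vector X q v using Vtop q v by unfold_locales auto
      have coord: "v (x j) = v (\<lambda>y. \<phi> y j)" if "j \<in> J" for j
      proof -
        have "(\<lambda>z. z j) \<in> poly_funs m" using that J by (auto intro: poly_funs.coord)
        from poly_regular_at [OF this, of q] show ?thesis
          using Vtop q by (intro v.deriv_local [OF _ V(1), symmetric]) (auto simp: x_def)
      qed
      define v' where "v' = (\<lambda>f. \<Sum>j\<in>J. v (x j) * \<theta> j q f)"
      have v': "v' \<in> tangent_space X q"
      proof -
        have "(\<lambda>f. \<Sum>j\<in>K. v (x j) * \<theta> j q f) \<in> tangent_space X q" if "finite K" "K \<subseteq> J" for K
          using that
        proof (induction K)
          case (insert k K)
          have "(\<lambda>f. v (x k) * \<theta> k q f) \<in> tangent_space X q"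
            using insert q t(1) by (intro tangent_space_scale) (auto simp: \<theta>_def)
          from tangent_space_add [OF this insert.IH] insert show ?case by (simp add: plus_fun_def)
        qed (simp add: tangent_space_zero)
        then show ?thesis using J finite_subset unfolding v'_def by blast
      qed
      have "v f = v' f"
      proof (rule tangent_eqI [OF Vtop(2) [OF q] v v' _ f])
        fix g assume g: "g \<in> poly_funs m"
        let ?\<delta> = "\<lambda>g. v (\<lambda>x. g (\<phi> x))"
        have "point_derivation m (\<phi> q) ?\<delta>"
          unfolding point_derivation_def using Vtop [OF q]
          by (auto simp: v.deriv_const intro!: v.deriv_add v.deriv_mult poly_regular_at)
        moreover have "?\<delta> g = 0" if "g \<in> poly_funs m" "\<forall>w\<in>Z. g w = 0" for g
          using v.deriv_local [OF poly_regular_at [OF that(1) Vtop(2) [OF q]] chart(1) Vtop(2) [OF q], of "\<lambda>_. 0"] that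
          by (simp add: v.deriv_const)
        ultimately have "u (\<phi> q) * ?\<delta> g = (\<Sum>j\<in>J. ?\<delta> (\<lambda>z. z j) * D j g (\<phi> q))"
          using span [of "\<phi> q" ?\<delta> g] g Vtop [OF q] by simp
        then have "?\<delta> g = (\<Sum>j\<in>J. ?\<delta> (\<lambda>z. z j) * D j g (\<phi> q)) / u (\<phi> q)"
          using q by (simp add: V_def field_simps)
        also have "\<dots> = v' (\<lambda>x. g (\<phi> x))"
          using q g t(2) by (simp add: v'_def coord \<theta>_def sum_divide_distrib)
        finally show "?\<delta> g = v' (\<lambda>x. g (\<phi> x))" .
      qed
      then show "v f = (\<Sum>j\<in>J. v (x j) * \<theta> j q f)" by (simp add: v'_def)
    qed (use V in auto)
  qed
qed


section \<open>Vector bundles and the differential of a section on its zero scheme\<close>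

lemma linear_dualD:
  assumes "\<xi> \<in> linear_dual sc S"
  shows "v \<notin> S \<Longrightarrow> \<xi> v = 0" "v \<in> S \<Longrightarrow> w \<in> S \<Longrightarrow> \<xi> (v + w) = \<xi> v + \<xi> w" "v \<in> S \<Longrightarrow> \<xi> (sc c v) = c * \<xi> v"
  using assms by (auto simp: linear_dual_def)

context function_space begin

lemma dual_secD:
  fixes F :: "('p, 'v::ab_group_add) vbundle"
  assumes "\<phi> \<in> dual_sec X F U"
  shows "x \<notin> U \<Longrightarrow> \<phi> x = 0" "x \<in> U \<Longrightarrow> \<phi> x \<in> linear_dual (scal F) (fib F x)"
    "opn V \<Longrightarrow> V \<subseteq> U \<Longrightarrow> \<sigma> \<in> sec F V \<Longrightarrow> (\<lambda>x. \<phi> x (\<sigma> x)) \<in> reg X V"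
  using assms by (auto simp: dual_sec_def)

lemma dual_sec_cut:
  fixes F :: "('p, 'v::ab_group_add) vbundle"
  assumes "\<phi> \<in> dual_sec X F U" "opn V" "V \<subseteq> U" shows "cut V \<phi> \<in> dual_sec X F V"
proof -
  have "(\<lambda>x. cut V \<phi> x (\<sigma> x)) \<in> reg X W" if W: "opn W" "W \<subseteq> V" and \<sigma>: "\<sigma> \<in> sec F W" for W \<sigma>
  proof -
    have reg: "(\<lambda>x. \<phi> x (\<sigma> x)) \<in> reg X W" using dual_secD(3) [OF assms(1) W(1) _ \<sigma>] W assms by blast
    moreover have "(\<lambda>x. cut V \<phi> x (\<sigma> x)) = (\<lambda>x. \<phi> x (\<sigma> x))"
    proof
      fix x
      show "cut V \<phi> x (\<sigma> x) = \<phi> x (\<sigma> x)"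
        using reg_outside [OF W(1) reg, of x] W by (cases "x \<in> V") auto
    qed
    ultimately show ?thesis by simp
  qed
  then show ?thesis
    unfolding dual_sec_def using dual_secD [OF assms(1)] assms(3) by auto
qed

end

locale vbundle_on = function_space A for A :: "'a fspace" +
  fixes E :: "('a, 'v::ab_group_add) vbundle"
  assumes vb: "vector_bundle A E"
begin

sublocale vs: vector_space "scal E"
  using vb by (simp add: vector_bundle_def)

abbreviation "sc \<equiv> scal E"

lemma sec_outside: assumes "opn U" "\<sigma> \<in> sec E U" "x \<notin> U" shows "\<sigma> x = 0"
proof -
  have "\<forall>U f. opn U \<longrightarrow> f \<in> sec E U \<longrightarrow> (\<forall>x. x \<notin> U \<longrightarrow> f x = 0)"
    using vb unfolding vector_bundle_def is_sheaf_def by (elim conjE)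
  then show ?thesis using assms by blast
qed

lemma sec_cut: assumes "opn U" "opn V" "V \<subseteq> U" "\<sigma> \<in> sec E U" shows "cut V \<sigma> \<in> sec E V"
proof -
  have "\<forall>U V f. opn U \<longrightarrow> opn V \<longrightarrow> V \<subseteq> U \<longrightarrow> f \<in> sec E U \<longrightarrow> cut V f \<in> sec E V"
    using vb unfolding vector_bundle_def is_sheaf_def by (elim conjE)
  then show ?thesis using assms by blast
qed

lemma sec_glue:
  assumes "opn U" "\<forall>x. x \<notin> U \<longrightarrow> \<sigma> x = 0"
    "\<forall>x\<in>U. \<exists>V. opn V \<and> x \<in> V \<and> V \<subseteq> U \<and> cut V \<sigma> \<in> sec E V"
  shows "\<sigma> \<in> sec E U"
proof -
  have "\<forall>U f. opn U \<longrightarrow> (\<forall>x. x \<notin> U \<longrightarrow> f x = 0) \<longrightarrow>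
      (\<forall>x\<in>U. \<exists>V. opn V \<and> x \<in> V \<and> V \<subseteq> U \<and> cut V f \<in> sec E V) \<longrightarrow> f \<in> sec E U"
    using vb unfolding vector_bundle_def is_sheaf_def by (elim conjE)
  from this [THEN spec, THEN spec, THEN mp, THEN mp, THEN mp, OF assms] show ?thesis .
qed

lemma sec_fib: "opn U \<Longrightarrow> \<sigma> \<in> sec E U \<Longrightarrow> x \<in> U \<Longrightarrow> \<sigma> x \<in> fib E x"
  using vb unfolding vector_bundle_def by blast

lemma fib_subspace: "x \<in> topspace (topo A) \<Longrightarrow> vs.subspace (fib E x)"
  using vb unfolding vector_bundle_def by blast

lemma fib_in_dual:
  assumes x: "x \<in> topspace (topo A)" and \<xi>: "\<xi> \<in> linear_dual sc (fib E x)"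
  shows "\<xi> 0 = 0" and "(\<And>i. i \<in> K \<Longrightarrow> v i \<in> fib E x) \<Longrightarrow> \<xi> (\<Sum>i\<in>K. sc (c i) (v i)) = (\<Sum>i\<in>K. c i * \<xi> (v i))"
    and "v' \<in> fib E x \<Longrightarrow> w \<in> fib E x \<Longrightarrow> \<xi> (v' - w) = \<xi> v' - \<xi> w"
proof -
  have zero: "0 \<in> fib E x" using vs.subspace_0 [OF fib_subspace [OF x]] .
  from linear_dualD(3) [OF \<xi> zero, of 0] show 0: "\<xi> 0 = 0" by simp
  have scale: "sc c v \<in> fib E x" if "v \<in> fib E x" for c v
    using vs.subspace_scale [OF fib_subspace [OF x] that] .
  show "\<xi> (\<Sum>i\<in>K. sc (c i) (v i)) = (\<Sum>i\<in>K. c i * \<xi> (v i))" if "\<And>i. i \<in> K \<Longrightarrow> v i \<in> fib E x"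
    using that
  proof (induction K rule: infinite_finite_induct)
    case (insert k K)
    then have "(\<Sum>i\<in>K. sc (c i) (v i)) \<in> fib E x"
      by (intro vs.subspace_sum [OF fib_subspace [OF x]] scale) auto
    then show ?case using insert by (simp add: linear_dualD [OF \<xi>] scale)
  qed (simp_all add: 0)
  show "\<xi> (v' - w) = \<xi> v' - \<xi> w" if v: "v' \<in> fib E x" "w \<in> fib E x"
  proof -
    have "\<xi> (v' + sc (-1) w) = \<xi> v' + \<xi> (sc (-1) w)" by (rule linear_dualD(2) [OF \<xi> v(1) scale [OF v(2)]])
    moreover have "\<xi> (sc (-1) w) = - \<xi> w" using linear_dualD(3) [OF \<xi> v(2), of "-1"] by simp
    ultimately show ?thesis by (simp add: vs.scale_minus_left)
  qed
qed

lemma open_point: "opn U \<Longrightarrow> x \<in> U \<Longrightarrow> x \<in> topspace (topo A)"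
  using openin_subset by blast

text \<open>The dual frame.  The value zero off the fibres and off \<open>U\<close> makes its members sections of the dual
  bundle over \<open>U\<close> (\<open>coord_dual_sec\<close>).\<close>

definition coord :: "'a set \<Rightarrow> nat \<Rightarrow> (nat \<Rightarrow> 'a \<Rightarrow> 'v) \<Rightarrow> nat \<Rightarrow> 'a \<Rightarrow> 'v \<Rightarrow> complex" where
  "coord U r e i = cut U (\<lambda>x. cut (fib E x) (\<lambda>v. (SOME c. v = (\<Sum>i<r. sc (c i) (e i x))) i))"

context
  fixes U r and e :: "nat \<Rightarrow> 'a \<Rightarrow> 'v"
  assumes U: "opn U" and fr: "frame A E U r e"
begin

lemma frame_sec: "i < r \<Longrightarrow> e i \<in> sec E U"
  using fr by (simp add: frame_def)

lemma frame_fib: "i < r \<Longrightarrow> x \<in> U \<Longrightarrow> e i x \<in> fib E x"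
  using sec_fib [OF U frame_sec] .

lemma frame_section_iff: "opn V \<Longrightarrow> V \<subseteq> U \<Longrightarrow>
    \<sigma> \<in> sec E V \<longleftrightarrow> (\<exists>c. (\<forall>i<r. c i \<in> reg A V) \<and> \<sigma> = cut V (\<lambda>x. \<Sum>i<r. sc (c i x) (e i x)))"
  using fr unfolding frame_def by blast

lemma frame_sum_fib: "x \<in> U \<Longrightarrow> (\<Sum>i<r. sc (c i) (e i x)) \<in> fib E x"
  by (intro vs.subspace_sum vs.subspace_scale fib_subspace open_point [OF U]) (auto intro: frame_fib)

lemma frame_spans: assumes "x \<in> U" "v \<in> fib E x" shows "\<exists>c. v = (\<Sum>i<r. sc (c i) (e i x))"
proof -
  let ?S = "(\<lambda>i. e i x) ` {..<r}"
  have inj: "inj_on (\<lambda>i. e i x) {..<r}" and span: "vs.span ?S = fib E x"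
    using fr assms(1) by (auto simp: frame_def)
  then obtain u where "v = (\<Sum>w\<in>?S. sc (u w) w)"
    using assms(2) vs.span_finite [of ?S] by auto
  then show ?thesis
    using sum.reindex [OF inj, of "\<lambda>w. sc (u w) w"] by (intro exI [of _ "\<lambda>i. u (e i x)"]) simp
qed

lemma frame_independent:
  assumes "x \<in> U" "(\<Sum>i<r. sc (c i) (e i x)) = (\<Sum>i<r. sc (d i) (e i x))" "i < r"
  shows "c i = d i"
proof (rule ccontr)
  assume ne: "c i \<noteq> d i"
  let ?S = "(\<lambda>i. e i x) ` {..<r}"
  have inj: "inj_on (\<lambda>i. e i x) {..<r}" and indep: "\<not> vs.dependent ?S"
    using fr assms(1) by (auto simp: frame_def)
  define u where "u w = (let i = the_inv_into {..<r} (\<lambda>i. e i x) w in c i - d i)" for w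
  have u: "u (e j x) = c j - d j" if "j < r" for j
    using the_inv_into_f_f [OF inj, of j] that by (simp add: u_def)
  have "(\<Sum>w\<in>?S. sc (u w) w) = (\<Sum>i<r. sc (c i - d i) (e i x))"
    using u by (simp add: sum.reindex [OF inj])
  also have "\<dots> = 0"
    using assms(2) by (simp add: vs.scale_left_diff_distrib sum_subtractf)
  finally have "(\<Sum>w\<in>?S. sc (u w) w) = 0" .
  moreover have "\<exists>w\<in>?S. u w \<noteq> 0"
    using assms(3) ne u by (intro bexI [of _ "e i x"]) auto
  ultimately show False
    using indep vs.dependent_finite [of ?S] by blast
qed

lemma coord_frame: assumes "x \<in> U" "i < r" shows "coord U r e i x (\<Sum>i<r. sc (c i) (e i x)) = c i"
proof -
  let ?v = "\<Sum>i<r. sc (c i) (e i x)"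
  have "?v = (\<Sum>i<r. sc ((SOME c'. ?v = (\<Sum>i<r. sc (c' i) (e i x))) i) (e i x))"
    by (rule someI_ex [of "\<lambda>c'. ?v = (\<Sum>i<r. sc (c' i) (e i x))"]) blast
  from frame_independent [OF assms(1) this assms(2)] show ?thesis
    using assms frame_sum_fib by (simp add: coord_def)
qed

lemma coord_expand: assumes "x \<in> U" "v \<in> fib E x" shows "(\<Sum>i<r. sc (coord U r e i x v) (e i x)) = v"
proof -
  obtain c where c: "v = (\<Sum>i<r. sc (c i) (e i x))" using frame_spans [OF assms] by blast
  then show ?thesis using assms(1) coord_frame by simp
qed

lemma coord_dual: assumes "x \<in> U" "i < r" shows "coord U r e i x \<in> linear_dual sc (fib E x)"
  unfolding linear_dual_def
proof (intro CollectI conjI allI ballI impI)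
  show "coord U r e i x v = 0" if "v \<notin> fib E x" for v using that assms by (simp add: coord_def)
  fix v assume v: "v \<in> fib E x"
  obtain c where c: "v = (\<Sum>i<r. sc (c i) (e i x))" using frame_spans [OF assms(1) v] by blast
  show "coord U r e i x (sc a v) = a * coord U r e i x v" for a
  proof -
    have "sc a v = (\<Sum>i<r. sc (a * c i) (e i x))" by (simp add: c vs.scale_sum_right)
    then show ?thesis using coord_frame [OF assms] c by simp
  qed
  fix w assume w: "w \<in> fib E x"
  obtain d where d: "w = (\<Sum>i<r. sc (d i) (e i x))" using frame_spans [OF assms(1) w] by blast
  have "v + w = (\<Sum>i<r. sc (c i + d i) (e i x))"
    by (simp add: c d vs.scale_left_distrib sum.distrib)
  then show "coord U r e i x (v + w) = coord U r e i x v + coord U r e i x w"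
    using coord_frame [OF assms] c d by simp
qed

lemma coord_outside: "x \<notin> U \<Longrightarrow> coord U r e i x v = 0"
  by (simp add: coord_def)

lemma coord_section:
  assumes V: "opn V" "V \<subseteq> U" and \<sigma>: "\<sigma> \<in> sec E V" and i: "i < r"
  shows "(\<lambda>x. coord U r e i x (\<sigma> x)) \<in> reg A V"
proof -
  obtain c where c: "\<forall>i<r. c i \<in> reg A V" "\<sigma> = cut V (\<lambda>x. \<Sum>i<r. sc (c i x) (e i x))"
    using frame_section_iff [OF V] \<sigma> by blast
  have "coord U r e i x (\<sigma> x) = c i x" for x
  proof (cases "x \<in> V")
    case True
    then show ?thesis using c(2) V(2) coord_frame [OF _ i, of x "\<lambda>i. c i x"] by auto
  next
    case False
    then have "\<sigma> x = 0" by (simp add: c(2))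
    moreover have "coord U r e i x 0 = 0"
      using fib_in_dual(1) [OF open_point [OF U] coord_dual [OF _ i]] coord_outside by (cases "x \<in> U") auto
    ultimately show ?thesis using False c(1) i reg_outside [OF V(1)] by simp
  qed
  then show ?thesis using c(1) i by simp
qed

lemma coord_dual_sec: "i < r \<Longrightarrow> coord U r e i \<in> dual_sec A E U"
  unfolding dual_sec_def using coord_dual coord_section by (auto simp: coord_def)

lemma frame_restrict:
  assumes V: "opn V" "V \<subseteq> U" shows "frame A E V r (\<lambda>i. cut V (e i))"
proof -
  have "(\<lambda>x. \<Sum>i<r. sc (c i x) (cut V (e i) x)) x = (\<lambda>x. \<Sum>i<r. sc (c i x) (e i x)) x" if "x \<in> V" for c x
    using that by simp
  then have "cut W (\<lambda>x. \<Sum>i<r. sc (c i x) (cut V (e i) x)) = cut W (\<lambda>x. \<Sum>i<r. sc (c i x) (e i x))"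
    if "W \<subseteq> V" for W c
    using that by (intro cut_cong) auto
  moreover have "(\<lambda>i. cut V (e i) x) = (\<lambda>i. e i x)" if "x \<in> V" for x using that by simp
  ultimately show ?thesis
    unfolding frame_def using V fr frame_section_iff sec_cut [OF U V frame_sec]
    by (auto simp: frame_def subset_iff)
qed

end

lemma local_frame:
  assumes "opn U" "x \<in> U"
  obtains V r e where "opn V" "x \<in> V" "V \<subseteq> U" "frame A E V r e"
proof -
  have "\<forall>x\<in>topspace (topo A). \<exists>U r e. opn U \<and> x \<in> U \<and> frame A E U r e"
    using vb unfolding vector_bundle_def by (elim conjE)
  then obtain W r e where W: "opn W" "x \<in> W" "frame A E W r e"
    using open_point [OF assms] by blast
  have "opn (U \<inter> W)" using W assms by blast
  then show thesis
    using that [of "U \<inter> W" r "\<lambda>i. cut (U \<inter> W) (e i)"] frame_restrict [OF W(1,3)] W assms by blast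
qed

text \<open>Locally the sections are the combinations of a frame with regular coefficients; so closure
  of the sections under sums and multiples is inherited from regular functions.\<close>

lemma sec_local_frame:
  assumes U: "opn U" and out: "\<And>x. x \<notin> U \<Longrightarrow> \<sigma> x = 0"
    and loc: "\<And>V r e. opn V \<Longrightarrow> V \<subseteq> U \<Longrightarrow> frame A E V r e \<Longrightarrow>
      \<exists>c. (\<forall>i<r. c i \<in> reg A V) \<and> cut V \<sigma> = cut V (\<lambda>x. \<Sum>i<r. sc (c i x) (e i x))"
  shows "\<sigma> \<in> sec E U"
proof (rule sec_glue [OF U])
  show "\<forall>x\<in>U. \<exists>V. opn V \<and> x \<in> V \<and> V \<subseteq> U \<and> cut V \<sigma> \<in> sec E V"
  proof
    fix x assume "x \<in> U"
    then obtain V r e where V: "opn V" "x \<in> V" "V \<subseteq> U" "frame A E V r e" using local_frame [OF U] by metis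
    then have "cut V \<sigma> \<in> sec E V"
      using loc [OF V(1,3,4)] frame_section_iff [OF V(1,4,1) order_refl] by blast
    then show "\<exists>V. opn V \<and> x \<in> V \<and> V \<subseteq> U \<and> cut V \<sigma> \<in> sec E V" using V by blast
  qed
qed (use out in auto)

lemma section_in_frame:
  assumes V: "opn V" "frame A E V r e" and U: "opn U" "V \<subseteq> U" "\<sigma> \<in> sec E U"
  obtains c where "\<forall>i<r. c i \<in> reg A V" "\<forall>x\<in>V. \<sigma> x = (\<Sum>i<r. sc (c i x) (e i x))"
proof -
  have "cut V \<sigma> \<in> sec E V" by (rule sec_cut [OF U(1) V(1) U(2,3)])
  then obtain c where c: "\<forall>i<r. c i \<in> reg A V" "cut V \<sigma> = cut V (\<lambda>x. \<Sum>i<r. sc (c i x) (e i x))"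
    using frame_section_iff [OF V V(1) order_refl] by blast
  show thesis
  proof (rule that [OF c(1)])
    show "\<forall>x\<in>V. \<sigma> x = (\<Sum>i<r. sc (c i x) (e i x))"
    proof
      fix x assume "x \<in> V"
      then show "\<sigma> x = (\<Sum>i<r. sc (c i x) (e i x))" using fun_cong [OF c(2), of x] by simp
    qed
  qed
qed

lemma sec_add:
  assumes U: "opn U" and \<sigma>: "\<sigma> \<in> sec E U" and \<tau>: "\<tau> \<in> sec E U" shows "(\<lambda>x. \<sigma> x + \<tau> x) \<in> sec E U"
proof (rule sec_local_frame [OF U])
  fix V r e assume V: "opn V" "V \<subseteq> U" "frame A E V r e"
  obtain c where c: "\<forall>i<r. c i \<in> reg A V" "\<forall>x\<in>V. \<sigma> x = (\<Sum>i<r. sc (c i x) (e i x))"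
    using section_in_frame [OF V(1,3) U V(2) \<sigma>] .
  obtain d where "\<forall>i<r. d i \<in> reg A V" "\<forall>x\<in>V. \<tau> x = (\<Sum>i<r. sc (d i x) (e i x))"
    using section_in_frame [OF V(1,3) U V(2) \<tau>] .
  with c show "\<exists>c. (\<forall>i<r. c i \<in> reg A V) \<and> cut V (\<lambda>x. \<sigma> x + \<tau> x) = cut V (\<lambda>x. \<Sum>i<r. sc (c i x) (e i x))"
    using reg_add [OF V(1)]
    by (intro exI [of _ "\<lambda>i x. c i x + d i x"])
       (auto simp: vs.scale_left_distrib sum.distrib intro!: cut_cong)
qed (use sec_outside [OF U \<sigma>] sec_outside [OF U \<tau>] in auto)

lemma sec_scale:
  assumes U: "opn U" and f: "f \<in> reg A U" and \<sigma>: "\<sigma> \<in> sec E U" shows "(\<lambda>x. sc (f x) (\<sigma> x)) \<in> sec E U"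
proof (rule sec_local_frame [OF U])
  fix V r e assume V: "opn V" "V \<subseteq> U" "frame A E V r e"
  obtain c where "\<forall>i<r. c i \<in> reg A V" "\<forall>x\<in>V. \<sigma> x = (\<Sum>i<r. sc (c i x) (e i x))"
    using section_in_frame [OF V(1,3) U V(2) \<sigma>] .
  then show "\<exists>c. (\<forall>i<r. c i \<in> reg A V) \<and> cut V (\<lambda>x. sc (f x) (\<sigma> x)) = cut V (\<lambda>x. \<Sum>i<r. sc (c i x) (e i x))"
    using reg_mult [OF V(1)] reg_cut [OF U V(1,2) f]
    by (intro exI [of _ "\<lambda>i x. cut V f x * c i x"])
       (auto simp: vs.scale_sum_right intro!: cut_cong)
qed (use sec_outside [OF U \<sigma>] in auto)

lemma sec_zero: "opn U \<Longrightarrow> (\<lambda>_. 0) \<in> sec E U"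
  by (rule sec_local_frame) (auto intro!: exI [of _ "\<lambda>_ _. 0"] reg_zero simp: cut_def)

lemma sec_sum: "opn U \<Longrightarrow> (\<And>i. i \<in> K \<Longrightarrow> \<sigma> i \<in> sec E U) \<Longrightarrow> (\<lambda>x. \<Sum>i\<in>K. \<sigma> i x) \<in> sec E U"
  by (induction K rule: infinite_finite_induct) (auto intro: sec_zero sec_add)

lemma dual_sec_reg:
  assumes U: "opn U" "opn V" "V \<subseteq> U" and \<phi>: "\<phi> \<in> dual_sec A E V" and \<sigma>: "\<sigma> \<in> sec E U"
  shows "(\<lambda>x. \<phi> x (\<sigma> x)) \<in> reg A V"
proof -
  have "(\<lambda>x. \<phi> x (\<sigma> x)) = (\<lambda>x. \<phi> x (cut V \<sigma> x))"
    using dual_secD(1) [OF \<phi>] by (auto simp: cut_def)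
  then show ?thesis using dual_secD(3) [OF \<phi> U(2) order_refl sec_cut [OF U \<sigma>]] by simp
qed

end

lemma (in function_space) tangent_sec_add:
  assumes "\<theta> \<in> tangent_sec X U" "\<theta>' \<in> tangent_sec X U" shows "(\<lambda>p. \<theta> p + \<theta>' p) \<in> tangent_sec X U"
proof -
  have "cut V (\<lambda>p. (\<theta> p + \<theta>' p) f) \<in> reg X V" if "opn V" "V \<subseteq> U" "f \<in> reg X V" for V f
    using regular_on_add [OF that(1) tangent_sec_regular [OF assms(1) that] tangent_sec_regular [OF assms(2) that]]
    by (simp add: regular_on_def)
  then show ?thesis using assms by (auto simp: tangent_sec_def tangent_space_add)
qed

lemma (in function_space) tangent_sec_scale:
  assumes U: "opn U" and f: "f \<in> reg X U" and \<theta>: "\<theta> \<in> tangent_sec X U"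
  shows "(\<lambda>p g. f p * \<theta> p g) \<in> tangent_sec X U"
proof -
  have "cut V (\<lambda>p. f p * \<theta> p g) \<in> reg X V" if "opn V" "V \<subseteq> U" "g \<in> reg X V" for V g
    using regular_on_mult [OF that(1) regular_on_subset [OF reg_regular_on [OF U f] U that(1,2)]
        tangent_sec_regular [OF \<theta> that]]
    by (simp add: regular_on_def)
  moreover have "f p = 0" if "p \<notin> U" for p using reg_outside [OF U f that] .
  ultimately show ?thesis using \<theta> by (auto simp: tangent_sec_def tangent_space_scale)
qed

lemma (in function_space) tangent_sec_zero: "opn U \<Longrightarrow> (\<lambda>p. 0) \<in> tangent_sec X U"
  using tangent_space_zero
  by (auto simp: tangent_sec_def zero_fun_def cut_def reg_zero)

locale vbundle_section = vbundle_on A E for A :: "'a fspace" and E :: "('a, 'v::ab_group_add) vbundle" +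
  fixes s :: "'a \<Rightarrow> 'v"
  assumes s: "s \<in> sec E (topspace (topo A))"
begin

abbreviation "I \<equiv> zero_scheme A E s"
abbreviation "IE \<equiv> ideal_times_sec A E I"

lemma dual_s_reg: "opn V \<Longrightarrow> \<phi> \<in> dual_sec A E V \<Longrightarrow> (\<lambda>x. \<phi> x (s x)) \<in> reg A V"
  using dual_sec_reg [OF openin_topspace _ openin_subset _ s] .

sublocale I_gens: ideal_generators A "\<lambda>V. {(\<lambda>x. \<phi> x (s x)) |\<phi>. \<phi> \<in> dual_sec A E V}"
proof
  fix U assume U: "opn U"
  show "{(\<lambda>x. \<phi> x (s x)) |\<phi>. \<phi> \<in> dual_sec A E U} \<subseteq> reg A U"
    using dual_s_reg [OF U] by blast
  fix V g assume V: "opn V" "V \<subseteq> U" and "g \<in> {(\<lambda>x. \<phi> x (s x)) |\<phi>. \<phi> \<in> dual_sec A E U}"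
  then obtain \<phi> where \<phi>: "\<phi> \<in> dual_sec A E U" "g = (\<lambda>x. \<phi> x (s x))" by blast
  have "cut V g = (\<lambda>x. cut V \<phi> x (s x))" by (auto simp: \<phi>(2) cut_def)
  then show "cut V g \<in> {(\<lambda>x. \<phi> x (s x)) |\<phi>. \<phi> \<in> dual_sec A E V}"
    using dual_sec_cut [OF \<phi>(1) V] by blast
qed

lemma I_eq: "I = gen_ideal_sheaf A (\<lambda>V. {(\<lambda>x. \<phi> x (s x)) |\<phi>. \<phi> \<in> dual_sec A E V})"
  by (simp add: zero_scheme_def fun_eq_iff)

sublocale I: ideal_sheaf A I
  unfolding I_eq by (rule I_gens.sheaf.ideal_sheaf_axioms)

lemma dual_s_in_I: "opn V \<Longrightarrow> \<phi> \<in> dual_sec A E V \<Longrightarrow> (\<lambda>x. \<phi> x (s x)) \<in> I V"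
  unfolding I_eq by (rule I_gens.G_sheaf) auto

text \<open>Membership in \<open>I E\<close> can be tested with all linear forms: in a frame, the coordinates of a
  section are values of linear forms.\<close>

lemma ideal_times_sec_iff:
  assumes U: "opn U"
  shows "\<tau> \<in> IE U \<longleftrightarrow> \<tau> \<in> sec E U \<and>
    (\<forall>V \<phi>. opn V \<longrightarrow> V \<subseteq> U \<longrightarrow> \<phi> \<in> dual_sec A E V \<longrightarrow> (\<lambda>x. \<phi> x (\<tau> x)) \<in> I V)"
proof (intro iffI conjI allI impI; (elim conjE)?)
  assume \<tau>: "\<tau> \<in> IE U"
  then show sec: "\<tau> \<in> sec E U" by (simp add: ideal_times_sec_def)
  fix V \<phi> assume V: "opn V" "V \<subseteq> U" and \<phi>: "\<phi> \<in> dual_sec A E V"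
  show "(\<lambda>x. \<phi> x (\<tau> x)) \<in> I V"
  proof (rule I.I_local [OF V(1)])
    show "\<phi> x (\<tau> x) = 0" if "x \<notin> V" for x using dual_secD(1) [OF \<phi> that] by simp
    fix x assume x: "x \<in> V"
    then have xU: "x \<in> U" using V by blast
    have "\<forall>x\<in>U. \<exists>V. opn V \<and> x \<in> V \<and> V \<subseteq> U \<and>
       (\<exists>(n::nat) f \<sigma>. (\<forall>i<n. f i \<in> I V \<and> \<sigma> i \<in> sec E V) \<and>
          cut V \<tau> = (\<lambda>y. \<Sum>i<n. sc (f i y) (\<sigma> i y)))"
      using \<tau> unfolding ideal_times_sec_def mem_Collect_eq by (elim conjE)
    from bspec [OF this xU] obtain V' and n :: nat and f \<sigma> where V'': "opn V'" "x \<in> V'" "V' \<subseteq> U"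
      "\<forall>i<n. f i \<in> I V' \<and> \<sigma> i \<in> sec E V'"
      and eq: "cut V' \<tau> = (\<lambda>y. \<Sum>i<n. sc (f i y) (\<sigma> i y))"
      by (elim exE conjE) (rule that)
    then have V': "opn V'" "x \<in> V'" "V' \<subseteq> U" "\<And>i. i < n \<Longrightarrow> f i \<in> I V'" "\<And>i. i < n \<Longrightarrow> \<sigma> i \<in> sec E V'"
      by auto
    define W where "W = V \<inter> V'"
    have W: "opn W" "x \<in> W" "W \<subseteq> V" "W \<subseteq> V'" using V V' x by (auto simp: W_def)
    have "cut W (\<lambda>x. \<phi> x (\<tau> x)) = (\<lambda>x. \<Sum>i<n. cut W (\<lambda>x. \<phi> x (\<sigma> i x)) x * cut W (f i) x)"
    proof
      fix y
      show "cut W (\<lambda>x. \<phi> x (\<tau> x)) y = (\<Sum>i<n. cut W (\<lambda>x. \<phi> x (\<sigma> i x)) y * cut W (f i) y)"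
      proof (cases "y \<in> W")
        case True
        then have y: "y \<in> V" "y \<in> V'" using W by auto
        have "\<tau> y = (\<Sum>i<n. sc (f i y) (\<sigma> i y))" using fun_cong [OF eq, of y] y by simp
        then have "\<phi> y (\<tau> y) = (\<Sum>i<n. f i y * \<phi> y (\<sigma> i y))"
          using fib_in_dual(2) [OF open_point [OF V(1) y(1)] dual_secD(2) [OF \<phi> y(1)], of "{..<n}" "\<lambda>i. \<sigma> i y" "\<lambda>i. f i y"]
            sec_fib [OF V'(1,5) y(2)] by simp
        then show ?thesis using True by (simp add: mult.commute)
      qed auto
    qed
    moreover have "cut W (\<lambda>x. \<phi> x (\<sigma> i x)) \<in> reg A W" if "i < n" for i
    proof -
      have "cut W (\<lambda>x. \<phi> x (\<sigma> i x)) = (\<lambda>x. cut W \<phi> x (\<sigma> i x))" by (auto simp: cut_def)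
      then show ?thesis
        using dual_sec_reg [OF V'(1) W(1,4) dual_sec_cut [OF \<phi> W(1,3)] V'(5) [OF that]] by simp
    qed
    ultimately have "cut W (\<lambda>x. \<phi> x (\<tau> x)) \<in> I W"
      using I.I_cut [OF V'(1) W(1,4) V'(4)] by (auto intro!: I.I_sum I.I_mult W)
    then show "\<exists>W. opn W \<and> x \<in> W \<and> W \<subseteq> V \<and> cut W (\<lambda>x. \<phi> x (\<tau> x)) \<in> I W" using W by blast
  qed
next
  assume sec: "\<tau> \<in> sec E U"
    and *: "\<forall>V \<phi>. opn V \<longrightarrow> V \<subseteq> U \<longrightarrow> \<phi> \<in> dual_sec A E V \<longrightarrow> (\<lambda>x. \<phi> x (\<tau> x)) \<in> I V"
  have "\<exists>V. opn V \<and> x \<in> V \<and> V \<subseteq> U \<and> (\<exists>(n::nat) f \<sigma>. (\<forall>i<n. f i \<in> I V \<and> \<sigma> i \<in> sec E V) \<and>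
     cut V \<tau> = (\<lambda>y. \<Sum>i<n. sc (f i y) (\<sigma> i y)))" if x: "x \<in> U" for x
  proof -
    obtain V r e where V: "opn V" "x \<in> V" "V \<subseteq> U" "frame A E V r e" using local_frame [OF U x] .
    let ?f = "\<lambda>i y. coord V r e i y (\<tau> y)"
    have "?f i \<in> I V" if "i < r" for i
      using * V coord_dual_sec [OF V(1,4) that] by blast
    moreover have "cut V \<tau> = (\<lambda>y. \<Sum>i<r. sc (?f i y) (e i y))"
    proof
      fix y
      show "cut V \<tau> y = (\<Sum>i<r. sc (?f i y) (e i y))"
      proof (cases "y \<in> V")
        case True
        then show ?thesis using coord_expand [OF V(1,4) True sec_fib [OF U sec]] V by auto
      qed (simp add: coord_outside [OF V(1,4)])
    qed
    ultimately show ?thesis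
      using V frame_sec [OF V(1,4)] by (intro exI [of _ V] conjI exI [of _ r] exI [of _ ?f] exI [of _ e]) auto
  qed
  then show "\<tau> \<in> IE U"
    using sec by (simp add: ideal_times_sec_def)
qed

lemma IE_sec: "\<tau> \<in> IE U \<Longrightarrow> \<tau> \<in> sec E U"
  by (simp add: ideal_times_sec_def)

lemma IE_dual: "opn U \<Longrightarrow> \<tau> \<in> IE U \<Longrightarrow> opn V \<Longrightarrow> V \<subseteq> U \<Longrightarrow> \<phi> \<in> dual_sec A E V \<Longrightarrow> (\<lambda>x. \<phi> x (\<tau> x)) \<in> I V"
  by (rule ideal_times_sec_iff [THEN iffD1, THEN conjunct2, rule_format])

lemma IE_I:
  assumes "opn U" "\<tau> \<in> sec E U" "\<And>V \<phi>. opn V \<Longrightarrow> V \<subseteq> U \<Longrightarrow> \<phi> \<in> dual_sec A E V \<Longrightarrow> (\<lambda>x. \<phi> x (\<tau> x)) \<in> I V"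
  shows "\<tau> \<in> IE U"
  by (intro iffD2 [OF ideal_times_sec_iff [OF assms(1)]] conjI allI impI assms)

lemma dual_sec_fib:
  assumes V: "opn V" and \<phi>: "\<phi> \<in> dual_sec A E V"
  shows "v \<in> fib E x \<Longrightarrow> w \<in> fib E x \<Longrightarrow> \<phi> x (v + w) = \<phi> x v + \<phi> x w"
    "v \<in> fib E x \<Longrightarrow> \<phi> x (sc c v) = c * \<phi> x v" "\<phi> x 0 = 0"
    "v \<in> fib E x \<Longrightarrow> w \<in> fib E x \<Longrightarrow> \<phi> x (v - w) = \<phi> x v - \<phi> x w"
    "(\<And>i. i \<in> K \<Longrightarrow> v' i \<in> fib E x) \<Longrightarrow> \<phi> x (\<Sum>i\<in>K. sc (c' i) (v' i)) = (\<Sum>i\<in>K. c' i * \<phi> x (v' i))"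
proof -
  have "x \<notin> V \<or> (x \<in> topspace (topo A) \<and> \<phi> x \<in> linear_dual sc (fib E x))"
    using dual_secD(2) [OF \<phi>] open_point [OF V] by blast
  then show "v \<in> fib E x \<Longrightarrow> w \<in> fib E x \<Longrightarrow> \<phi> x (v + w) = \<phi> x v + \<phi> x w"
    "v \<in> fib E x \<Longrightarrow> \<phi> x (sc c v) = c * \<phi> x v" "\<phi> x 0 = 0"
    "v \<in> fib E x \<Longrightarrow> w \<in> fib E x \<Longrightarrow> \<phi> x (v - w) = \<phi> x v - \<phi> x w"
    "(\<And>i. i \<in> K \<Longrightarrow> v' i \<in> fib E x) \<Longrightarrow> \<phi> x (\<Sum>i\<in>K. sc (c' i) (v' i)) = (\<Sum>i\<in>K. c' i * \<phi> x (v' i))"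
    by (elim disjE conjE; simp add: dual_secD(1) [OF \<phi>] linear_dualD fib_in_dual)+
qed

lemma IE_add: assumes U: "opn U" and \<sigma>: "\<sigma> \<in> IE U" and \<tau>: "\<tau> \<in> IE U" shows "(\<lambda>x. \<sigma> x + \<tau> x) \<in> IE U"
proof (rule IE_I [OF U sec_add [OF U IE_sec [OF \<sigma>] IE_sec [OF \<tau>]]])
  fix V \<phi> assume V: "opn V" "V \<subseteq> U" and \<phi>: "\<phi> \<in> dual_sec A E V"
  have "\<phi> x (\<sigma> x + \<tau> x) = \<phi> x (\<sigma> x) + \<phi> x (\<tau> x)" for x
  proof (cases "x \<in> V")
    case True
    then have "x \<in> U" using V by blast
    then show ?thesis using True by (simp add: dual_sec_fib(1) [OF V(1) \<phi>] sec_fib [OF U IE_sec [OF \<sigma>]] sec_fib [OF U IE_sec [OF \<tau>]])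
  qed (simp add: dual_secD(1) [OF \<phi>])
  then show "(\<lambda>x. \<phi> x (\<sigma> x + \<tau> x)) \<in> I V"
    using I.I_add [OF V(1) IE_dual [OF U \<sigma> V \<phi>] IE_dual [OF U \<tau> V \<phi>]] by simp
qed

lemma IE_scale: assumes U: "opn U" and f: "f \<in> reg A U" and \<sigma>: "\<sigma> \<in> IE U" shows "(\<lambda>x. sc (f x) (\<sigma> x)) \<in> IE U"
proof (rule IE_I [OF U sec_scale [OF U f IE_sec [OF \<sigma>]]])
  fix V \<phi> assume V: "opn V" "V \<subseteq> U" and \<phi>: "\<phi> \<in> dual_sec A E V"
  have "\<phi> x (sc (f x) (\<sigma> x)) = cut V f x * \<phi> x (\<sigma> x)" for x
  proof (cases "x \<in> V")
    case True
    then have "x \<in> U" using V by blast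
    then show ?thesis using True by (simp add: dual_sec_fib(2) [OF V(1) \<phi>] sec_fib [OF U IE_sec [OF \<sigma>]])
  qed (simp add: dual_secD(1) [OF \<phi>])
  then show "(\<lambda>x. \<phi> x (sc (f x) (\<sigma> x))) \<in> I V"
    using I.I_mult [OF V(1) reg_cut [OF U V f] IE_dual [OF U \<sigma> V \<phi>]] by simp
qed

lemma IE_ideal: assumes U: "opn U" and f: "f \<in> I U" and \<sigma>: "\<sigma> \<in> sec E U" shows "(\<lambda>x. sc (f x) (\<sigma> x)) \<in> IE U"
proof (rule IE_I [OF U sec_scale [OF U I.I_reg [OF U f] \<sigma>]])
  fix V \<phi> assume V: "opn V" "V \<subseteq> U" and \<phi>: "\<phi> \<in> dual_sec A E V"
  have "\<phi> x (sc (f x) (\<sigma> x)) = \<phi> x (\<sigma> x) * cut V f x" for x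
  proof (cases "x \<in> V")
    case True
    then have "x \<in> U" using V by blast
    then show ?thesis using True by (simp add: dual_sec_fib(2) [OF V(1) \<phi>] sec_fib [OF U \<sigma>])
  qed (simp add: dual_secD(1) [OF \<phi>])
  then show "(\<lambda>x. \<phi> x (sc (f x) (\<sigma> x))) \<in> I V"
    using I.I_mult [OF V(1) dual_sec_reg [OF U V \<phi> \<sigma>] I.I_cut [OF U V f]] by simp
qed

lemma IE_zero: "opn U \<Longrightarrow> (\<lambda>_. 0) \<in> IE U"
  using IE_ideal [OF _ I.I_zero sec_zero, of U] by simp

lemma IE_sum: "opn U \<Longrightarrow> (\<And>i. i \<in> K \<Longrightarrow> \<sigma> i \<in> IE U) \<Longrightarrow> (\<lambda>x. \<Sum>i\<in>K. \<sigma> i x) \<in> IE U"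
  by (induction K rule: infinite_finite_induct) (auto intro: IE_zero IE_add)

lemma frame_coefficient_in_I:
  assumes V: "opn V" "frame A E V r e" and c: "\<And>i. i < r \<Longrightarrow> c i \<in> reg A V"
    and s_eq: "\<And>y. y \<in> V \<Longrightarrow> s y = (\<Sum>i<r. sc (c i y) (e i y))" and i: "i < r"
  shows "c i \<in> I V"
proof -
  have "c i = (\<lambda>x. coord V r e i x (s x))"
  proof
    fix x show "c i x = coord V r e i x (s x)"
      using coord_frame [OF V _ i, of x "\<lambda>i. c i x"] s_eq coord_outside [OF V, of x] reg_outside [OF V(1) c [OF i], of x]
      by (cases "x \<in> V") auto
  qed
  then show ?thesis using dual_s_in_I [OF V(1) coord_dual_sec [OF V i]] by simp
qed

text \<open>
  Frame-free description of \<open>ds(\<theta>)\<close> on the zero scheme: \<open>\<phi>(ds(\<theta>)) = \<theta>(\<phi>(s))\<close> modulo \<open>I\<close> for all linear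
  forms \<open>\<phi>\<close>, since the term \<open>(\<theta>\<phi>)(s)\<close> in the product rule lies in \<open>I\<close>.
\<close>

lemma ds_represents_iff:
  assumes U: "opn U" and \<theta>: "\<theta> \<in> tangent_sec A U"
  shows "ds_represents A E s U \<theta> \<tau> \<longleftrightarrow> \<tau> \<in> sec E U \<and> (\<forall>V \<phi>. opn V \<longrightarrow> V \<subseteq> U \<longrightarrow> \<phi> \<in> dual_sec A E V \<longrightarrow>
    cut V (\<lambda>x. \<phi> x (\<tau> x) - \<theta> x (\<lambda>y. \<phi> y (s y))) \<in> I V)"
proof (intro iffI conjI allI impI; (elim conjE)?)
  assume ds: "ds_represents A E s U \<theta> \<tau>"
  then show \<tau>: "\<tau> \<in> sec E U" by (simp add: ds_represents_def)
  fix V \<phi> assume V: "opn V" "V \<subseteq> U" and \<phi>: "\<phi> \<in> dual_sec A E V"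
  let ?\<phi>s = "\<lambda>y. \<phi> y (s y)"
  show "cut V (\<lambda>x. \<phi> x (\<tau> x) - \<theta> x ?\<phi>s) \<in> I V"
  proof (rule I.I_local [OF V(1)])
    fix x assume x: "x \<in> V"
    then have xU: "x \<in> U" using V by blast
    have "\<forall>x\<in>U. \<exists>V r e c. opn V \<and> x \<in> V \<and> V \<subseteq> U \<and> frame A E V r e \<and>
        (\<forall>i<r. c i \<in> reg A V) \<and> cut V s = (\<lambda>y. \<Sum>i<r. sc (c i y) (e i y)) \<and>
        cut V (\<lambda>y. \<tau> y - (\<Sum>i<r. sc (\<theta> y (c i)) (e i y))) \<in> IE V"
      using ds unfolding ds_represents_def by (elim conjE)
    from bspec [OF this xU] obtain V\<^sub>0 r e c where V\<^sub>0: "opn V\<^sub>0" "x \<in> V\<^sub>0" "V\<^sub>0 \<subseteq> U" and fr: "frame A E V\<^sub>0 r e"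
      and c': "\<forall>i<r. c i \<in> reg A V\<^sub>0" and s_eq: "cut V\<^sub>0 s = (\<lambda>y. \<Sum>i<r. sc (c i y) (e i y))"
      and \<rho>: "cut V\<^sub>0 (\<lambda>y. \<tau> y - (\<Sum>i<r. sc (\<theta> y (c i)) (e i y))) \<in> IE V\<^sub>0"
      by (elim exE conjE) (rule that)
    note c = c' [rule_format]
    define W where "W = V \<inter> V\<^sub>0"
    have W: "opn W" "x \<in> W" "W \<subseteq> V" "W \<subseteq> V\<^sub>0" "W \<subseteq> U" using V V\<^sub>0 x by (auto simp: W_def)
    let ?\<phi>e = "\<lambda>i. cut W (\<lambda>y. \<phi> y (e i y))"
    have \<phi>e: "?\<phi>e i \<in> reg A W" if "i < r" for i
    proof -
      have "?\<phi>e i = (\<lambda>y. cut W \<phi> y (e i y))" by (auto simp: cut_def)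
      then show ?thesis
        using dual_sec_reg [OF V\<^sub>0(1) W(1,4) dual_sec_cut [OF \<phi> W(1,3)] frame_sec [OF V\<^sub>0(1) fr that]] by simp
    qed
    have s_at\<^sub>0: "s y = (\<Sum>i<r. sc (c i y) (e i y))" if "y \<in> V\<^sub>0" for y
      using fun_cong [OF s_eq, of y] that by simp
    have cI: "c i \<in> I V\<^sub>0" if "i < r" for i
      by (rule frame_coefficient_in_I [OF V\<^sub>0(1) fr c s_at\<^sub>0 that])
    have s_at: "s y = (\<Sum>i<r. sc (c i y) (e i y))" if "y \<in> W" for y
      using s_at\<^sub>0 that W by blast
    have e_fib: "e i y \<in> fib E y" if "i < r" "y \<in> W" for i y
      using frame_fib [OF V\<^sub>0(1) fr that(1)] that(2) W by blast
    have \<phi>s: "?\<phi>s y = (\<Sum>i<r. c i y * ?\<phi>e i y)" if "y \<in> W" for y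
      using dual_sec_fib(5) [OF V(1) \<phi>, of "{..<r}" "\<lambda>i. e i y" y "\<lambda>i. c i y"] s_at [OF that] e_fib that by simp
    have deriv: "\<theta> y ?\<phi>s = (\<Sum>i<r. c i y * \<theta> y (?\<phi>e i)) + (\<Sum>i<r. \<theta> y (c i) * \<phi> y (e i y))" if y: "y \<in> W" for y
    proof -
      interpret tangent_vector A y "\<theta> y"
        using open_point [OF W(1) y] tangent_sec_at [OF \<theta>, of y] y W by unfold_locales auto
      have r: "c i \<in> regular_at A y" "?\<phi>e i \<in> regular_at A y" if "i < r" for i
        using regular_at_reg [OF V\<^sub>0(1) _ c [OF that]] regular_at_reg [OF W(1) y \<phi>e [OF that]] y W by auto
      have "\<theta> y ?\<phi>s = \<theta> y (\<lambda>y. \<Sum>i<r. c i y * ?\<phi>e i y)"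
        using \<phi>s dual_s_reg [OF V(1) \<phi>] y W
        by (intro deriv_local [OF _ W(1) y]) (auto intro: regular_at_reg [OF V(1)])
      also have "\<dots> = (\<Sum>i<r. c i y * \<theta> y (?\<phi>e i) + ?\<phi>e i y * \<theta> y (c i))"
      proof (subst deriv_sum)
        show "(\<lambda>y. c i y * ?\<phi>e i y) \<in> regular_at A y" if "i \<in> {..<r}" for i
          using r [of i] that by (intro regular_at_mult) auto
        show "(\<Sum>i<r. \<theta> y (\<lambda>y. c i y * ?\<phi>e i y)) = (\<Sum>i<r. c i y * \<theta> y (?\<phi>e i) + ?\<phi>e i y * \<theta> y (c i))"
          using r by (intro sum.cong refl deriv_mult) auto
      qed
      finally show ?thesis using y by (simp add: sum.distrib mult.commute)
    qed
    let ?\<rho> = "\<lambda>y. \<tau> y - (\<Sum>i<r. sc (\<theta> y (c i)) (e i y))"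
    have "cut W (\<lambda>x. \<phi> x (\<tau> x) - \<theta> x ?\<phi>s)
       = (\<lambda>x. cut W \<phi> x (cut V\<^sub>0 ?\<rho> x) - (\<Sum>i<r. cut W (\<lambda>x. \<theta> x (?\<phi>e i)) x * cut W (c i) x))"
    proof
      fix y
      show "cut W (\<lambda>x. \<phi> x (\<tau> x) - \<theta> x ?\<phi>s) y
       = cut W \<phi> y (cut V\<^sub>0 ?\<rho> y) - (\<Sum>i<r. cut W (\<lambda>x. \<theta> x (?\<phi>e i)) y * cut W (c i) y)"
      proof (cases "y \<in> W")
        case True
        have "\<phi> y (?\<rho> y) = \<phi> y (\<tau> y) - (\<Sum>i<r. \<theta> y (c i) * \<phi> y (e i y))"
        proof -
          have "y \<in> U" "y \<in> V\<^sub>0" using True W by auto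
          then have "\<phi> y (?\<rho> y) = \<phi> y (\<tau> y) - \<phi> y (\<Sum>i<r. sc (\<theta> y (c i)) (e i y))"
            by (intro dual_sec_fib(4) [OF V(1) \<phi>] sec_fib [OF U \<tau>] frame_sum_fib [OF V\<^sub>0(1) fr])
          then show ?thesis
            using dual_sec_fib(5) [OF V(1) \<phi>, of "{..<r}" "\<lambda>i. e i y" y "\<lambda>i. \<theta> y (c i)"] e_fib True by simp
        qed
        then show ?thesis using True W deriv [OF True] by (auto simp: mult.commute)
      qed auto
    qed
    moreover have "(\<lambda>x. cut W \<phi> x (cut V\<^sub>0 ?\<rho> x)) \<in> I W"
      by (rule IE_dual [OF V\<^sub>0(1) \<rho> W(1,4) dual_sec_cut [OF \<phi> W(1,3)]])
    moreover have "cut W (\<lambda>x. \<theta> x (?\<phi>e i)) \<in> reg A W" if "i < r" for i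
      using tangent_sec_regular [OF \<theta> W(1,5) \<phi>e [OF that]] by (simp add: regular_on_def)
    ultimately have "cut W (\<lambda>x. \<phi> x (\<tau> x) - \<theta> x ?\<phi>s) \<in> I W"
      using I.I_cut [OF V\<^sub>0(1) W(1,4) cI] by (auto intro!: I.I_diff I.I_sum I.I_mult W)
    then show "\<exists>W. opn W \<and> x \<in> W \<and> W \<subseteq> V \<and> cut W (cut V (\<lambda>x. \<phi> x (\<tau> x) - \<theta> x ?\<phi>s)) \<in> I W"
      using W by (intro exI [of _ W]) auto
  qed auto
next
  assume \<tau>: "\<tau> \<in> sec E U" and *: "\<forall>V \<phi>. opn V \<longrightarrow> V \<subseteq> U \<longrightarrow> \<phi> \<in> dual_sec A E V \<longrightarrow>
    cut V (\<lambda>x. \<phi> x (\<tau> x) - \<theta> x (\<lambda>y. \<phi> y (s y))) \<in> I V"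
  show "ds_represents A E s U \<theta> \<tau>"
    unfolding ds_represents_def
  proof (intro conjI \<tau> ballI)
    fix x assume x: "x \<in> U"
    obtain V r e where V: "opn V" "x \<in> V" "V \<subseteq> U" "frame A E V r e" using local_frame [OF U x] .
    let ?c = "\<lambda>i y. coord V r e i y (s y)"
    have c: "?c i \<in> reg A V" if "i < r" for i by (rule dual_s_reg [OF V(1) coord_dual_sec [OF V(1,4) that]])
    have s_eq: "cut V s = (\<lambda>y. \<Sum>i<r. sc (?c i y) (e i y))"
    proof
      fix y show "cut V s y = (\<Sum>i<r. sc (?c i y) (e i y))"
        using coord_expand [OF V(1,4), of y "s y"] sec_fib [OF openin_topspace s] open_point [OF V(1)] coord_outside [OF V(1,4), of y]
        by (cases "y \<in> V") auto
    qed
    let ?h = "\<lambda>i. cut V (\<lambda>y. coord V r e i y (\<tau> y) - \<theta> y (?c i))"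
    have "cut V (\<lambda>y. \<tau> y - (\<Sum>i<r. sc (\<theta> y (?c i)) (e i y))) = (\<lambda>y. \<Sum>i<r. sc (?h i y) (e i y))"
    proof
      fix y show "cut V (\<lambda>y. \<tau> y - (\<Sum>i<r. sc (\<theta> y (?c i)) (e i y))) y = (\<Sum>i<r. sc (?h i y) (e i y))"
      proof (cases "y \<in> V")
        case True
        then show ?thesis
          using coord_expand [OF V(1,4) True sec_fib [OF U \<tau>]] V(3)
          by (auto simp: vs.scale_left_diff_distrib sum_subtractf)
      qed auto
    qed
    moreover have "?h i \<in> I V" if "i < r" for i
      using * V coord_dual_sec [OF V(1,4) that] by blast
    ultimately have "cut V (\<lambda>y. \<tau> y - (\<Sum>i<r. sc (\<theta> y (?c i)) (e i y))) \<in> IE V"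
      using frame_sec [OF V(1,4)] by (auto intro!: IE_sum IE_ideal V)
    then show "\<exists>V r e c. opn V \<and> x \<in> V \<and> V \<subseteq> U \<and> frame A E V r e \<and>
        (\<forall>i<r. c i \<in> reg A V) \<and> cut V s = (\<lambda>y. \<Sum>i<r. sc (c i y) (e i y)) \<and>
        cut V (\<lambda>y. \<tau> y - (\<Sum>i<r. sc (\<theta> y (c i)) (e i y))) \<in> IE V"
      using V c s_eq by (intro exI [of _ V] exI [of _ r] exI [of _ e] exI [of _ ?c]) auto
  qed
qed

lemma ds_add:
  assumes U: "opn U" and \<theta>: "\<theta> \<in> tangent_sec A U" "\<theta>' \<in> tangent_sec A U"
    and ds: "ds_represents A E s U \<theta> \<tau>" "ds_represents A E s U \<theta>' \<tau>'"
  shows "ds_represents A E s U (\<lambda>p. \<theta> p + \<theta>' p) (\<lambda>x. \<tau> x + \<tau>' x)"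
proof -
  have \<tau>: "\<tau> \<in> sec E U" "\<tau>' \<in> sec E U" using ds by (auto simp: ds_represents_def)
  show ?thesis
    unfolding ds_represents_iff [OF U tangent_sec_add [OF \<theta>]]
  proof (intro conjI allI impI)
    show "(\<lambda>x. \<tau> x + \<tau>' x) \<in> sec E U" by (rule sec_add [OF U \<tau>])
    fix V \<phi> assume V: "opn V" "V \<subseteq> U" and \<phi>: "\<phi> \<in> dual_sec A E V"
    let ?s = "\<lambda>y. \<phi> y (s y)"
    have "cut V (\<lambda>x. \<phi> x (\<tau> x) - \<theta> x ?s) \<in> I V" "cut V (\<lambda>x. \<phi> x (\<tau>' x) - \<theta>' x ?s) \<in> I V"
      using ds V \<phi> unfolding ds_represents_iff [OF U \<theta>(1)] ds_represents_iff [OF U \<theta>(2)] by blast+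
    from I.I_add [OF V(1) this]
    show "cut V (\<lambda>x. \<phi> x (\<tau> x + \<tau>' x) - (\<theta> x + \<theta>' x) ?s) \<in> I V"
    proof (rule back_subst [where P = "\<lambda>f. f \<in> I V"], intro ext)
      fix x show "cut V (\<lambda>x. \<phi> x (\<tau> x) - \<theta> x ?s) x + cut V (\<lambda>x. \<phi> x (\<tau>' x) - \<theta>' x ?s) x
          = cut V (\<lambda>x. \<phi> x (\<tau> x + \<tau>' x) - (\<theta> x + \<theta>' x) ?s) x"
        using dual_sec_fib(1) [OF V(1) \<phi> sec_fib [OF U \<tau>(1)] sec_fib [OF U \<tau>(2)], of x] V(2)
        by (cases "x \<in> V") auto
    qed
  qed
qed

lemma ds_scale:
  assumes U: "opn U" and \<theta>: "\<theta> \<in> tangent_sec A U" and f: "f \<in> reg A U" and ds: "ds_represents A E s U \<theta> \<tau>"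
  shows "ds_represents A E s U (\<lambda>p g. f p * \<theta> p g) (\<lambda>x. sc (f x) (\<tau> x))"
proof -
  have \<tau>: "\<tau> \<in> sec E U" using ds by (auto simp: ds_represents_def)
  show ?thesis
    unfolding ds_represents_iff [OF U tangent_sec_scale [OF U f \<theta>]]
  proof (intro conjI allI impI)
    show "(\<lambda>x. sc (f x) (\<tau> x)) \<in> sec E U" by (rule sec_scale [OF U f \<tau>])
    fix V \<phi> assume V: "opn V" "V \<subseteq> U" and \<phi>: "\<phi> \<in> dual_sec A E V"
    let ?s = "\<lambda>y. \<phi> y (s y)"
    have "cut V (\<lambda>x. \<phi> x (\<tau> x) - \<theta> x ?s) \<in> I V"
      using ds V \<phi> unfolding ds_represents_iff [OF U \<theta>] by blast
    from I.I_mult [OF V(1) reg_cut [OF U V f] this]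
    show "cut V (\<lambda>x. \<phi> x (sc (f x) (\<tau> x)) - f x * \<theta> x ?s) \<in> I V"
    proof (rule back_subst [where P = "\<lambda>f. f \<in> I V"], intro ext)
      fix x show "cut V f x * cut V (\<lambda>x. \<phi> x (\<tau> x) - \<theta> x ?s) x
          = cut V (\<lambda>x. \<phi> x (sc (f x) (\<tau> x)) - f x * \<theta> x ?s) x"
        using dual_sec_fib(2) [OF V(1) \<phi> sec_fib [OF U \<tau>], of x] V(2)
        by (cases "x \<in> V") (auto simp: right_diff_distrib)
    qed
  qed
qed

lemma ds_zero: assumes U: "opn U" shows "ds_represents A E s U (\<lambda>_. 0) (\<lambda>_. 0)"
  unfolding ds_represents_iff [OF U tangent_sec_zero [OF U]]
proof (intro conjI allI impI sec_zero U)
  fix V \<phi> assume V: "opn V" "V \<subseteq> U" and \<phi>: "\<phi> \<in> dual_sec A E V"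
  have "cut V (\<lambda>x. \<phi> x 0 - 0 (\<lambda>y. \<phi> y (s y))) = (\<lambda>_. 0)"
    using dual_sec_fib(3) [OF V(1) \<phi>] by (auto simp: cut_def)
  then show "cut V (\<lambda>x. \<phi> x 0 - 0 (\<lambda>y. \<phi> y (s y))) \<in> I V" using I.I_zero [OF V(1)] by simp
qed

lemma ds_in_frame:
  assumes U: "opn U" and fr: "frame A E U r e" and \<theta>: "\<theta> \<in> tangent_sec A U"
    and c: "\<And>i. i < r \<Longrightarrow> c i \<in> reg A U" and s_eq: "cut U s = (\<lambda>y. \<Sum>i<r. sc (c i y) (e i y))"
  shows "ds_represents A E s U \<theta> (\<lambda>y. \<Sum>i<r. sc (\<theta> y (c i)) (e i y))"
proof -
  have out: "\<theta> y (c i) = 0" if "y \<notin> U" for y i using \<theta> that by (simp add: tangent_sec_def)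
  have "(\<lambda>y. \<theta> y (c i)) \<in> reg A U" if "i < r" for i
    using tangent_sec_regular [OF \<theta> U order_refl c [OF that]] out by (simp add: reg_iff [OF U])
  then have "(\<lambda>y. \<Sum>i<r. sc (\<theta> y (c i)) (e i y)) \<in> sec E U"
    using frame_sec [OF U fr] by (auto intro!: sec_sum sec_scale U)
  moreover have "cut U (\<lambda>y. (\<Sum>i<r. sc (\<theta> y (c i)) (e i y)) - (\<Sum>i<r. sc (\<theta> y (c i)) (e i y))) = (\<lambda>_. 0)"
    by (auto simp: cut_def)
  then have "cut U (\<lambda>y. (\<Sum>i<r. sc (\<theta> y (c i)) (e i y)) - (\<Sum>i<r. sc (\<theta> y (c i)) (e i y))) \<in> IE U"
    using IE_zero [OF U] by simp
  ultimately show ?thesis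
    unfolding ds_represents_def using U fr c s_eq by blast
qed

end


section \<open>Critical loci\<close>

lemma linear_dual_zero: "(\<lambda>_. 0) \<in> linear_dual sc S"
  by (simp add: linear_dual_def)

lemma linear_dual_add: "\<xi> \<in> linear_dual sc S \<Longrightarrow> \<eta> \<in> linear_dual sc S \<Longrightarrow> (\<lambda>v. \<xi> v + \<eta> v) \<in> linear_dual sc S"
  by (simp add: linear_dual_def algebra_simps)

lemma linear_dual_scale: "\<xi> \<in> linear_dual sc S \<Longrightarrow> (\<lambda>v. c * \<xi> v) \<in> linear_dual sc S"
  by (simp add: linear_dual_def algebra_simps)

lemma linear_dual_sum:
  assumes "\<And>i. i \<in> K \<Longrightarrow> \<xi> i \<in> linear_dual sc S"
  shows "(\<lambda>v. \<Sum>i\<in>K. c i * \<xi> i v) \<in> linear_dual sc S"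
  using assms
proof (induction K rule: infinite_finite_induct)
  case (insert k K)
  then have "(\<lambda>v. c k * \<xi> k v + (\<Sum>i\<in>K. c i * \<xi> i v)) \<in> linear_dual sc S"
    by (intro linear_dual_add linear_dual_scale) auto
  with insert show ?case by simp
qed (simp_all add: linear_dual_zero)

lemma (in function_space) regular_on_transfer:
  "regular_on U f \<Longrightarrow> (\<And>x. x \<in> U \<Longrightarrow> g x = f x) \<Longrightarrow> regular_on U g"
  using regular_on_cong [of U f g] by simp

context function_space begin

abbreviation "cotb \<equiv> cotangent_bundle X"

lemma fib_cot: "fib cotb p = linear_dual (\<lambda>c v f. c * v f) (tangent_space X p)"
  and scal_cot: "scal cotb = (\<lambda>c \<omega> v. c * \<omega> v)"
  by (simp_all add: cotangent_bundle_def)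

lemma differential_apply: "p \<in> topspace (topo X) \<Longrightarrow> v \<in> tangent_space X p \<Longrightarrow> differential X f p v = v f"
  by (simp add: differential_def)

lemma differential_fib: assumes "p \<in> topspace (topo X)" shows "differential X f p \<in> fib cotb p"
  unfolding fib_cot linear_dual_def using assms tangent_space_add [of _ p] tangent_space_scale [of _ p]
  by (auto simp: differential_def)

lemma differential_sec:
  assumes W: "opn W" and f: "regular_on W f" shows "cut W (differential X f) \<in> sec cotb W"
proof -
  have W_top: "p \<in> topspace (topo X)" if "p \<in> W" for p using openin_subset [OF W] that by blast
  have *: "differential X f q v = (\<Sum>i<1::nat. cut W (\<lambda>_. 1) q * v (cut W f))"
    if q: "q \<in> W" and v: "v \<in> tangent_space X q" for q v
  proof -
    interpret tangent_vector X q v using W_top [OF q] v by unfold_locales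
    have "v f = v (cut W f)"
      using f by (intro deriv_local [OF _ W q] regular_atI [OF W q]) auto
    then show ?thesis using W_top [OF q] v q by (simp add: differential_apply)
  qed
  have "\<exists>V. opn V \<and> p \<in> V \<and> V \<subseteq> W \<and> (\<exists>(n::nat) h g. (\<forall>i<n. h i \<in> reg X V \<and> g i \<in> reg X V) \<and>
      (\<forall>q\<in>V. \<forall>v\<in>tangent_space X q. cut W (differential X f) q v = (\<Sum>i<n. h i q * v (g i))))" if "p \<in> W" for p
  proof (intro exI conjI)
    show "\<forall>i<1::nat. (\<lambda>_::nat. cut W (\<lambda>_. 1)) i \<in> reg X W \<and> (\<lambda>_::nat. cut W f) i \<in> reg X W"
      using f regular_on_const [OF W, of 1] by (simp add: regular_on_def)
    show "\<forall>q\<in>W. \<forall>v\<in>tangent_space X q. cut W (differential X f) q v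
        = (\<Sum>i<1. (\<lambda>_::nat. cut W (\<lambda>_. 1)) i q * v ((\<lambda>_::nat. cut W f) i))"
      using * by simp
  qed (use W that in auto)
  then show ?thesis
    using differential_fib [OF W_top] unfolding cotangent_bundle_def by auto
qed

lemma differential_pairing_reg:
  assumes V: "opn V" and F: "regular_on (topspace (topo X)) F" and \<Phi>: "\<Phi> \<in> dual_sec X cotb V"
  shows "(\<lambda>x. \<Phi> x (differential X F x)) \<in> reg X V"
proof -
  have "regular_on V F" by (rule regular_on_subset [OF F openin_topspace V openin_subset [OF V]])
  from dual_secD(3) [OF \<Phi> V order_refl differential_sec [OF V this]]
  have "(\<lambda>x. \<Phi> x (cut V (differential X F) x)) \<in> reg X V" .
  moreover have "(\<lambda>x. \<Phi> x (cut V (differential X F) x)) = (\<lambda>x. \<Phi> x (differential X F x))"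
    using dual_secD(1) [OF \<Phi>] by (auto simp: cut_def)
  ultimately show ?thesis by simp
qed

lemma critical_generators:
  assumes F: "regular_on (topspace (topo X)) F"
  shows "ideal_generators X (\<lambda>V. {(\<lambda>x. \<Phi> x (differential X F x)) |\<Phi>. \<Phi> \<in> dual_sec X cotb V})"
proof
  fix U assume U: "opn U"
  show "{(\<lambda>x. \<Phi> x (differential X F x)) |\<Phi>. \<Phi> \<in> dual_sec X cotb U} \<subseteq> reg X U"
    using differential_pairing_reg [OF U F] by blast
  fix V g assume V: "opn V" "V \<subseteq> U" and "g \<in> {(\<lambda>x. \<Phi> x (differential X F x)) |\<Phi>. \<Phi> \<in> dual_sec X cotb U}"
  then obtain \<Phi> where \<Phi>: "\<Phi> \<in> dual_sec X cotb U" "g = (\<lambda>x. \<Phi> x (differential X F x))" by blast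
  have "cut V g = (\<lambda>x. cut V \<Phi> x (differential X F x))" by (auto simp: \<Phi>(2) cut_def)
  then show "cut V g \<in> {(\<lambda>x. \<Phi> x (differential X F x)) |\<Phi>. \<Phi> \<in> dual_sec X cotb V}"
    using dual_sec_cut [OF \<Phi>(1) V] by blast
qed

lemma critical_locus_eq:
  "critical_locus X F = gen_ideal_sheaf X (\<lambda>V. {(\<lambda>x. \<Phi> x (differential X F x)) |\<Phi>. \<Phi> \<in> dual_sec X cotb V})"
  by (simp add: critical_locus_def zero_scheme_def fun_eq_iff)

text \<open>A vector field is a linear form on differentials; it has regular values because a differential
  form is locally \<open>\<Sum>\<^sub>i f\<^sub>i dg\<^sub>i\<close>.\<close>

lemma vector_field_contraction:
  assumes W: "opn W" and \<Theta>: "\<Theta> \<in> tangent_sec X W"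
  shows "cut W (\<lambda>p. cut (fib cotb p) (\<lambda>\<omega>. \<omega> (\<Theta> p))) \<in> dual_sec X cotb W"
  unfolding dual_sec_def
proof (intro CollectI conjI allI impI ballI)
  fix p assume p: "p \<in> W"
  have add: "\<omega> + \<eta> \<in> fib cotb p" if "\<omega> \<in> fib cotb p" "\<eta> \<in> fib cotb p" for \<omega> \<eta>
    using linear_dual_add that unfolding fib_cot by (auto simp: plus_fun_def)
  have scale: "scal cotb c \<omega> \<in> fib cotb p" if "\<omega> \<in> fib cotb p" for c \<omega>
    using linear_dual_scale that unfolding fib_cot scal_cot by auto
  show "cut W (\<lambda>p. cut (fib cotb p) (\<lambda>\<omega>. \<omega> (\<Theta> p))) p \<in> linear_dual (scal cotb) (fib cotb p)"
    using p add scale by (simp add: linear_dual_def scal_cot)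
next
  fix V \<omega> assume V: "opn V" "V \<subseteq> W" and \<omega>: "\<omega> \<in> sec cotb V"
  have out: "\<omega> p = 0" if "p \<notin> V" for p using \<omega> that by (simp add: cotangent_bundle_def)
  have fibre: "\<omega> p \<in> fib cotb p" if "p \<in> V" for p using \<omega> that by (simp add: cotangent_bundle_def)
  have eq: "(\<lambda>p. cut W (\<lambda>p. cut (fib cotb p) (\<lambda>\<omega>. \<omega> (\<Theta> p))) p (\<omega> p)) = cut V (\<lambda>p. \<omega> p (\<Theta> p))"
  proof
    fix p show "cut W (\<lambda>p. cut (fib cotb p) (\<lambda>\<omega>. \<omega> (\<Theta> p))) p (\<omega> p) = cut V (\<lambda>p. \<omega> p (\<Theta> p)) p"
      using out [of p] fibre [of p] V by (cases "p \<in> V"; cases "p \<in> W") (auto simp: cut_def)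
  qed
  have "regular_on V (\<lambda>p. \<omega> p (\<Theta> p))"
  proof (rule regular_on_local [OF V(1)])
    fix p assume p: "p \<in> V"
    have "\<forall>p\<in>V. \<exists>V'. opn V' \<and> p \<in> V' \<and> V' \<subseteq> V \<and> (\<exists>(n::nat) f g. (\<forall>i<n. f i \<in> reg X V' \<and> g i \<in> reg X V') \<and>
              (\<forall>q\<in>V'. \<forall>v\<in>tangent_space X q. \<omega> q v = (\<Sum>i<n. f i q * v (g i))))"
      using \<omega> by (simp add: cotangent_bundle_def)
    from bspec [OF this p] obtain N and n :: nat and f g where N: "opn N" "p \<in> N" "N \<subseteq> V"
      and fg: "\<forall>i<n. f i \<in> reg X N \<and> g i \<in> reg X N"
      and eq: "\<forall>q\<in>N. \<forall>v\<in>tangent_space X q. \<omega> q v = (\<Sum>i<n. f i q * v (g i))"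
      by (elim exE conjE) (rule that)
    have "regular_on N (\<lambda>q. \<Sum>i<n. f i q * \<Theta> q (g i))"
    proof (intro regular_on_sum regular_on_mult N)
      fix i assume "i \<in> {..<n}"
      then have i: "f i \<in> reg X N" "g i \<in> reg X N" using fg by auto
      have NW: "N \<subseteq> W" using N V by blast
      show "regular_on N (f i)" by (rule reg_regular_on [OF N(1) i(1)])
      show "regular_on N (\<lambda>q. \<Theta> q (g i))" by (rule tangent_sec_regular [OF \<Theta> N(1) NW i(2)])
    qed
    moreover have "\<omega> q (\<Theta> q) = (\<Sum>i<n. f i q * \<Theta> q (g i))" if "q \<in> N" for q
    proof -
      have "q \<in> W" using that N V by blast
      then show ?thesis using eq that tangent_sec_at [OF \<Theta>] by blast
    qed
    ultimately have "regular_on N (\<lambda>p. \<omega> p (\<Theta> p))" by (rule regular_on_transfer)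
    then show "\<exists>N. opn N \<and> p \<in> N \<and> N \<subseteq> V \<and> regular_on N (\<lambda>p. \<omega> p (\<Theta> p))" using N by blast
  qed
  then show "(\<lambda>p. cut W (\<lambda>p. cut (fib cotb p) (\<lambda>\<omega>. \<omega> (\<Theta> p))) p (\<omega> p)) \<in> reg X V"
    unfolding eq by (simp add: regular_on_def)
qed auto

text \<open>The value of the contraction with \<open>\<Theta>\<close> on \<open>dF\<close>: this turns vector fields into elements of the critical ideal.\<close>

lemma vector_field_derivative_critical:
  assumes W: "opn W" and \<Theta>: "\<Theta> \<in> tangent_sec X W" and F: "regular_on (topspace (topo X)) F"
  shows "cut W (\<lambda>p. \<Theta> p F) \<in> critical_locus X F W"
proof -
  interpret G: ideal_generators X "\<lambda>V. {(\<lambda>x. \<Phi> x (differential X F x)) |\<Phi>. \<Phi> \<in> dual_sec X cotb V}"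
    by (rule critical_generators [OF F])
  let ?\<Phi> = "cut W (\<lambda>p. cut (fib cotb p) (\<lambda>\<omega>. \<omega> (\<Theta> p)))"
  have "cut W (\<lambda>p. \<Theta> p F) = (\<lambda>p. ?\<Phi> p (differential X F p))"
  proof
    fix p show "cut W (\<lambda>p. \<Theta> p F) p = ?\<Phi> p (differential X F p)"
      using openin_subset [OF W] differential_fib [of p F] tangent_sec_at [OF \<Theta>, of p] differential_apply [of p "\<Theta> p" F]
      by (cases "p \<in> W") auto
  qed
  then show ?thesis
    unfolding critical_locus_eq using vector_field_contraction [OF W \<Theta>] by (intro G.G_sheaf [OF W]) blast
qed

end

section \<open>The total space of the dual bundle\<close>

context fraction_family begin

lemma reg_Y_fractionE:
  assumes "f \<in> reg Y W" "x \<in> W"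
  obtains B R g h where "(B, R) \<in> \<B>" "g \<in> R" "h \<in> R" "x \<in> nonvanishing B h" "nonvanishing B h \<subseteq> W"
    "\<forall>y\<in>nonvanishing B h. f y = g y / h y"
  using assms unfolding reg_Y_iff by blast

lemma regular_on_inverse:
  assumes W: "opn W" and f: "regular_on W f" and ne: "\<And>x. x \<in> W \<Longrightarrow> f x \<noteq> 0"
  shows "regular_on W (\<lambda>x. 1 / f x)"
  unfolding regular_on_iff_fractions [OF W]
proof
  fix x assume x: "x \<in> W"
  have "\<exists>B R g h. (B, R) \<in> \<B> \<and> g \<in> R \<and> h \<in> R \<and> x \<in> nonvanishing B h \<and>
            (\<forall>y\<in>nonvanishing B h \<inter> W. f y = g y / h y)"
    using f x unfolding regular_on_iff_fractions [OF W] by blast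
  then obtain B R g h where B: "(B, R) \<in> \<B>" and gh: "g \<in> R" "h \<in> R" "x \<in> nonvanishing B h"
    and eq: "\<forall>y\<in>nonvanishing B h \<inter> W. f y = g y / h y"
    by (elim exE conjE) (rule that)
  have "x \<in> nonvanishing B (\<lambda>y. g y * h y)" using gh x eq ne [OF x] by (auto simp: mem_nonvanishing)
  moreover have "1 / f y = h y * h y / (g y * h y)" if "y \<in> nonvanishing B (\<lambda>y. g y * h y) \<inter> W" for y
    using that eq by (auto simp: mem_nonvanishing)
  ultimately show "\<exists>B R g h. (B, R) \<in> \<B> \<and> g \<in> R \<and> h \<in> R \<and> x \<in> nonvanishing B h \<and>
            (\<forall>y\<in>nonvanishing B h \<inter> W. 1 / f y = g y / h y)"
    using B mult [OF B gh(2,2)] mult [OF B gh(1,2)] by blast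
qed

end

context vbundle_on begin

lemma mem_dual_points: "y \<in> dual_points_over E U \<longleftrightarrow> fst y \<in> U \<and> snd y \<in> linear_dual sc (fib E (fst y))"
  by (cases y) (simp add: dual_points_over_def)

definition lin :: "('a \<Rightarrow> 'v) \<Rightarrow> 'a \<times> ('v \<Rightarrow> complex) \<Rightarrow> complex" where
  "lin \<sigma> y = snd y (\<sigma> (fst y))"

lemma fibre_polys_base: "f \<in> reg A U \<Longrightarrow> (\<lambda>y. f (fst y)) \<in> fibre_polys A E U"
  using fibre_polys.base [of f A U E] by (simp add: case_prod_unfold)

lemma fibre_polys_linear: "\<sigma> \<in> sec E U \<Longrightarrow> lin \<sigma> \<in> fibre_polys A E U"
  using fibre_polys.linear [of \<sigma> E U A] by (simp add: case_prod_unfold lin_def [abs_def])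

lemma fibre_polys_induct [consumes 1, case_names base linear sum product]:
  assumes "P \<in> fibre_polys A E U"
    "\<And>f. f \<in> reg A U \<Longrightarrow> Q (\<lambda>y. f (fst y))" "\<And>\<sigma>. \<sigma> \<in> sec E U \<Longrightarrow> Q (lin \<sigma>)"
    "\<And>f g. f \<in> fibre_polys A E U \<Longrightarrow> g \<in> fibre_polys A E U \<Longrightarrow> Q f \<Longrightarrow> Q g \<Longrightarrow> Q (\<lambda>y. f y + g y)"
    "\<And>f g. f \<in> fibre_polys A E U \<Longrightarrow> g \<in> fibre_polys A E U \<Longrightarrow> Q f \<Longrightarrow> Q g \<Longrightarrow> Q (\<lambda>y. f y * g y)"
  shows "Q P"
  using assms(1)
proof (induction rule: fibre_polys.induct)
  case (base f) then show ?case using assms(2) by (simp add: case_prod_unfold)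
next
  case (linear \<sigma>) then show ?case using assms(3) by (simp add: case_prod_unfold lin_def [abs_def])
qed (use assms(4,5) in blast)+

lemma fibre_polys_restrict:
  assumes P: "P \<in> fibre_polys A E U" and U: "opn U" "opn V" "V \<subseteq> U"
  shows "\<exists>P'\<in>fibre_polys A E V. \<forall>y\<in>dual_points_over E V. P' y = P y"
  using P
proof (induction rule: fibre_polys_induct)
  case (base f)
  from fibre_polys_base [OF reg_cut [OF U base]] show ?case
    by (intro bexI) (auto simp: mem_dual_points)
next
  case (linear \<sigma>)
  from fibre_polys_linear [OF sec_cut [OF U linear]] show ?case
    by (intro bexI) (auto simp: mem_dual_points lin_def)
next
  case (sum f g)
  then obtain f' g' where "f' \<in> fibre_polys A E V" "\<forall>y\<in>dual_points_over E V. f' y = f y"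
    "g' \<in> fibre_polys A E V" "\<forall>y\<in>dual_points_over E V. g' y = g y" by blast
  then show ?case by (intro bexI [of _ "\<lambda>y. f' y + g' y"]) (auto intro: fibre_polys.sum)
next
  case (product f g)
  then obtain f' g' where "f' \<in> fibre_polys A E V" "\<forall>y\<in>dual_points_over E V. f' y = f y"
    "g' \<in> fibre_polys A E V" "\<forall>y\<in>dual_points_over E V. g' y = g y" by blast
  then show ?case by (intro bexI [of _ "\<lambda>y. f' y * g' y"]) (auto intro: fibre_polys.product)
qed

lemma dual_points_Int: "dual_points_over E (U \<inter> V) = dual_points_over E U \<inter> dual_points_over E V"
  by (auto simp: mem_dual_points)

abbreviation "tot_family \<equiv> {(dual_points_over E U, fibre_polys A E U) |U. opn U}"

sublocale Y: fraction_family tot_family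
proof
  fix B R c assume "(B, R) \<in> tot_family"
  then obtain U where U: "opn U" "B = dual_points_over E U" "R = fibre_polys A E U" by blast
  have "cut U (\<lambda>_. c) \<in> reg A U" using regular_on_const [OF U(1)] by (simp add: regular_on_def)
  from fibre_polys_base [OF this] show "\<exists>h\<in>R. \<forall>x\<in>B. h x = c"
    unfolding U by (intro bexI) (auto simp: mem_dual_points)
next
  fix B R B' R' assume "(B, R) \<in> tot_family" "(B', R') \<in> tot_family"
  then obtain U U' where U: "opn U" "B = dual_points_over E U" "R = fibre_polys A E U"
    "opn U'" "B' = dual_points_over E U'" "R' = fibre_polys A E U'" by blast
  then have UU: "opn (U \<inter> U')" by blast
  show "\<exists>R''. (B \<inter> B', R'') \<in> tot_family \<and>
      (\<forall>f\<in>R. \<exists>g\<in>R''. \<forall>x\<in>B \<inter> B'. g x = f x) \<and> (\<forall>f\<in>R'. \<exists>g\<in>R''. \<forall>x\<in>B \<inter> B'. g x = f x)"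
    unfolding U(2,3,5,6) dual_points_Int [symmetric]
    using UU fibre_polys_restrict [OF _ U(1) UU] fibre_polys_restrict [OF _ U(4) UU]
    by (intro exI [of _ "fibre_polys A E (U \<inter> U')"]) blast
qed (auto intro: fibre_polys.sum fibre_polys.product)

lemma total_space_eq: "dual_total_space A E = Y.Y"
  by (simp add: dual_total_space_def)

lemma top_Y: "topspace (topo Y.Y) = dual_points_over E (topspace (topo A))"
proof -
  have "\<Union> (fst ` tot_family) = (\<Union>U\<in>{U. opn U}. dual_points_over E U)" by auto
  also have "\<dots> = dual_points_over E (topspace (topo A))"
    using openin_subset openin_topspace by (fastforce simp: mem_dual_points)
  finally show ?thesis by (simp only: Y.topspace_Y)
qed

lemma open_dual_points: "opn U \<Longrightarrow> Y.opn (dual_points_over E U)"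
  by (rule Y.open_base) blast

lemma regular_fibre_poly: "opn U \<Longrightarrow> P \<in> fibre_polys A E U \<Longrightarrow> Y.opn W \<Longrightarrow> W \<subseteq> dual_points_over E U \<Longrightarrow> Y.regular_on W P"
  by (rule Y.regular_on_generator [of "dual_points_over E U" "fibre_polys A E U"]) auto

lemma regular_pullback: "opn U \<Longrightarrow> f \<in> reg A U \<Longrightarrow> Y.opn W \<Longrightarrow> W \<subseteq> dual_points_over E U \<Longrightarrow> Y.regular_on W (\<lambda>y. f (fst y))"
  by (intro regular_fibre_poly [of U] fibre_polys_base)

lemma regular_lin: "opn U \<Longrightarrow> \<sigma> \<in> sec E U \<Longrightarrow> Y.opn W \<Longrightarrow> W \<subseteq> dual_points_over E U \<Longrightarrow> Y.regular_on W (lin \<sigma>)"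
  by (intro regular_fibre_poly [of U] fibre_polys_linear)

lemma regular_at_pullback:
  assumes y: "y \<in> dual_points_over E (topspace (topo A))" and f: "f \<in> regular_at A (fst y)"
  shows "(\<lambda>y. f (fst y)) \<in> regular_at Y.Y y"
proof -
  obtain U where U: "opn U" "fst y \<in> U" "regular_on U f" using f by (rule regular_atE)
  have "Y.regular_on (dual_points_over E U) (\<lambda>y. cut U f (fst y))"
    by (rule regular_pullback [OF U(1)]) (use U open_dual_points in \<open>auto simp: regular_on_def\<close>)
  then have "Y.regular_on (dual_points_over E U) (\<lambda>y. f (fst y))"
    using Y.regular_on_cong [of "dual_points_over E U" "\<lambda>y. cut U f (fst y)" "\<lambda>y. f (fst y)"] by (auto simp: mem_dual_points)
  then show ?thesis
    using U y by (intro Y.regular_atI [OF open_dual_points [OF U(1)]]) (auto simp: mem_dual_points)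
qed

lemma push_forward_tangent:
  assumes y: "y \<in> topspace (topo Y.Y)" and v: "v \<in> tangent_space Y.Y y"
  shows "(\<lambda>f. if f \<in> regular_at A (fst y) then v (\<lambda>y. f (fst y)) else 0) \<in> tangent_space A (fst y)"
proof -
  interpret tangent_vector Y.Y y v using y v by unfold_locales
  note r = regular_at_pullback [OF y [unfolded top_Y]]
  have top: "fst y \<in> topspace (topo A)" using y by (simp add: top_Y mem_dual_points)
  show ?thesis
    unfolding tangent_space_def
    using r regular_at_add regular_at_mult regular_at_mult [OF regular_at_const [OF top]]
    by (auto simp: deriv_add deriv_mult deriv_scale)
qed

text \<open>A family of tangent vectors of the total space is regular if it is so on functions from the
  base and on linear functions, by the product and quotient rules.\<close>

lemma tangent_sec_totalI:
  assumes V: "opn V" and out: "\<And>y. y \<notin> dual_points_over E V \<Longrightarrow> \<Theta> y = 0"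
    and tan: "\<And>y. y \<in> dual_points_over E V \<Longrightarrow> \<Theta> y \<in> tangent_space Y.Y y"
    and base: "\<And>U f. opn U \<Longrightarrow> U \<subseteq> V \<Longrightarrow> f \<in> reg A U \<Longrightarrow> Y.regular_on (dual_points_over E U) (\<lambda>y. \<Theta> y (\<lambda>y. f (fst y)))"
    and linear: "\<And>U \<sigma>. opn U \<Longrightarrow> U \<subseteq> V \<Longrightarrow> \<sigma> \<in> sec E U \<Longrightarrow> Y.regular_on (dual_points_over E U) (\<lambda>y. \<Theta> y (lin \<sigma>))"
  shows "\<Theta> \<in> tangent_sec Y.Y (dual_points_over E V)"
proof -
  let ?B = "dual_points_over E"
  have vec: "tangent_vector Y.Y y (\<Theta> y)" if "y \<in> ?B V" for y
    using tan [OF that] openin_subset [OF open_dual_points [OF V]] that by unfold_locales auto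
  have poly: "Y.regular_on (?B U) (\<lambda>y. \<Theta> y P)" if U: "opn U" "U \<subseteq> V" and P: "P \<in> fibre_polys A E U" for U P
    using P
  proof (induction rule: fibre_polys_induct)
    case (sum f g)
    have "\<Theta> y (\<lambda>y. f y + g y) = \<Theta> y f + \<Theta> y g" if y: "y \<in> ?B U" for y
    proof -
      interpret tangent_vector Y.Y y "\<Theta> y" by (rule vec) (use y U in \<open>auto simp: mem_dual_points\<close>)
      show ?thesis
        by (intro deriv_add Y.regular_atI [OF open_dual_points [OF U(1)] y] regular_fibre_poly [OF U(1)] sum.hyps open_dual_points U order_refl)
    qed
    with Y.regular_on_add [OF open_dual_points [OF U(1)] sum.IH] show ?case by (rule Y.regular_on_transfer)
  next
    case (product f g)
    have r: "Y.regular_on (?B U) f" "Y.regular_on (?B U) g"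
      by (intro regular_fibre_poly [OF U(1)] product.hyps open_dual_points U order_refl)+
    have *: "\<Theta> y (\<lambda>y. f y * g y) = f y * \<Theta> y g + g y * \<Theta> y f" if y: "y \<in> ?B U" for y
    proof -
      interpret tangent_vector Y.Y y "\<Theta> y" by (rule vec) (use y U in \<open>auto simp: mem_dual_points\<close>)
      show ?thesis by (intro deriv_mult Y.regular_atI [OF open_dual_points [OF U(1)] y] r)
    qed
    have "Y.regular_on (?B U) (\<lambda>y. f y * \<Theta> y g + g y * \<Theta> y f)"
      by (intro Y.regular_on_add Y.regular_on_mult open_dual_points U r product.IH)
    then show ?case by (rule Y.regular_on_transfer) (rule *)
  qed (use base linear U in blast)+
  have "Y.regular_on W (\<lambda>y. \<Theta> y f)" if W: "Y.opn W" "W \<subseteq> ?B V" and f: "f \<in> reg Y.Y W" for W f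
  proof (rule Y.regular_on_local [OF W(1)])
    fix y assume y: "y \<in> W"
    obtain B R g h where "(B, R) \<in> tot_family" "g \<in> R" "h \<in> R" and y': "y \<in> nonvanishing B h" "nonvanishing B h \<subseteq> W"
      and eq: "\<forall>y\<in>nonvanishing B h. f y = g y / h y"
      using Y.reg_Y_fractionE [OF f y] .
    then obtain U where U: "opn U" and gh: "g \<in> fibre_polys A E U" "h \<in> fibre_polys A E U" and B: "B = ?B U" by blast
    have UV: "opn (U \<inter> V)" "U \<inter> V \<subseteq> U" "U \<inter> V \<subseteq> V" using U V by auto
    obtain g' where g': "g' \<in> fibre_polys A E (U \<inter> V)" "\<forall>y\<in>?B (U \<inter> V). g' y = g y"
      using fibre_polys_restrict [OF gh(1) U UV(1,2)] by blast
    obtain h' where h': "h' \<in> fibre_polys A E (U \<inter> V)" "\<forall>y\<in>?B (U \<inter> V). h' y = h y"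
      using fibre_polys_restrict [OF gh(2) U UV(1,2)] by blast
    define N where "N = nonvanishing B h"
    have N: "Y.opn N" "y \<in> N" "N \<subseteq> W" "N \<subseteq> ?B (U \<inter> V)"
      using y' W(2) gh U Y.open_nonvanishing [of B "fibre_polys A E U" h]
      by (auto simp: N_def B Y.mem_nonvanishing dual_points_Int)
    have ne: "h' z \<noteq> 0" and fz: "f z * h' z = g' z" if "z \<in> N" for z
    proof -
      have "z \<in> ?B (U \<inter> V)" using that N(4) by blast
      then have "h' z = h z" "g' z = g z" using h'(2) g'(2) by auto
      moreover have "h z \<noteq> 0" "f z = g z / h z" using that eq by (auto simp: N_def Y.mem_nonvanishing)
      ultimately show "h' z \<noteq> 0" "f z * h' z = g' z" by auto
    qed
    have r: "Y.regular_on N g'" "Y.regular_on N h'"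
      using regular_fibre_poly [OF UV(1) _ N(1,4)] g' h' by auto
    have fr: "Y.regular_on N f"
      by (rule Y.regular_on_subset [OF Y.reg_regular_on [OF W(1) f] W(1) N(1,3)])
    have d: "Y.regular_on N (\<lambda>y. \<Theta> y g')" "Y.regular_on N (\<lambda>y. \<Theta> y h')"
      using Y.regular_on_subset [OF poly [OF UV(1,3)] open_dual_points [OF UV(1)] N(1,4)] g' h' by auto
    have quot: "\<Theta> z f = (h' z * \<Theta> z g' - g' z * \<Theta> z h') * (1 / (h' z * h' z))" if z: "z \<in> N" for z
    proof -
      interpret tangent_vector Y.Y z "\<Theta> z" by (rule vec) (use z N W in blast)
      show ?thesis
        using deriv_quotient [OF Y.regular_atI [OF N(1) z fr] Y.regular_atI [OF N(1) z r(1)] Y.regular_atI [OF N(1) z r(2)]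
            ne [OF z] N(1) z fz]
        by (simp add: power2_eq_square)
    qed
    have "Y.regular_on N (\<lambda>z. (h' z * \<Theta> z g' - g' z * \<Theta> z h') * (1 / (h' z * h' z)))"
      using ne by (intro Y.regular_on_mult Y.regular_on_diff Y.regular_on_inverse N r d) auto
    then have "Y.regular_on N (\<lambda>y. \<Theta> y f)" by (rule Y.regular_on_transfer) (rule quot)
    then show "\<exists>N. Y.opn N \<and> y \<in> N \<and> N \<subseteq> W \<and> Y.regular_on N (\<lambda>y. \<Theta> y f)" using N by blast
  qed
  then show ?thesis
    unfolding tangent_sec_def Y.regular_on_def using out tan by auto
qed

text \<open>The derivative in the direction of a section \<open>\<phi>\<close> of the dual bundle.  Along a line in a fibre it is
  an ordinary complex derivative, and the Leibniz rule is that of calculus.\<close>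

definition vertical :: "'a set \<Rightarrow> ('a \<Rightarrow> 'v \<Rightarrow> complex)
    \<Rightarrow> 'a \<times> ('v \<Rightarrow> complex) \<Rightarrow> ('a \<times> ('v \<Rightarrow> complex) \<Rightarrow> complex) \<Rightarrow> complex" where
  "vertical V \<phi> = cut (dual_points_over E V) (\<lambda>y. cut (regular_at Y.Y y)
     (\<lambda>g. deriv (\<lambda>t. g (fst y, \<lambda>v. snd y v + t * \<phi> (fst y) v)) 0))"

lemma vertical_differentiable:
  assumes V: "opn V" and \<phi>: "\<phi> \<in> dual_sec A E V" and y: "y \<in> dual_points_over E V" and g: "g \<in> regular_at Y.Y y"
  shows "(\<lambda>t. g (fst y, \<lambda>v. snd y v + t * \<phi> (fst y) v)) field_differentiable at 0"
proof -
  let ?\<gamma> = "\<lambda>t. (fst y, \<lambda>v. snd y v + t * \<phi> (fst y) v)"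
  have \<gamma>0: "?\<gamma> 0 = y" by simp
  have poly: "(\<lambda>t. P (?\<gamma> t)) field_differentiable at t" if "P \<in> fibre_polys A E U" for P U t
    using that by (induction rule: fibre_polys_induct)
      (auto simp: lin_def intro!: field_differentiable_add field_differentiable_mult derivative_intros)
  have mem: "?\<gamma> t \<in> dual_points_over E U" if "y \<in> dual_points_over E U" for t U
    using that y dual_secD(2) [OF \<phi>] by (auto simp: mem_dual_points intro!: linear_dual_add linear_dual_scale)
  obtain W where W: "Y.opn W" "y \<in> W" "Y.regular_on W g" using g by (rule Y.regular_atE)
  have cg: "cut W g \<in> reg Y.Y W" using W(3) by (simp add: Y.regular_on_def)
  obtain B R p q where "(B, R) \<in> tot_family" "p \<in> R" "q \<in> R" and yB: "y \<in> nonvanishing B q" "nonvanishing B q \<subseteq> W"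
      and eq: "\<forall>y\<in>nonvanishing B q. cut W g y = p y / q y"
    using Y.reg_Y_fractionE [OF cg W(2)] .
  then obtain U where pq: "p \<in> fibre_polys A E U" "q \<in> fibre_polys A E U" and B: "B = dual_points_over E U" by blast
  let ?S = "{t. q (?\<gamma> t) \<noteq> 0}"
  have "continuous_on UNIV (\<lambda>t. q (?\<gamma> t))"
    using poly [OF pq(2)] by (intro continuous_at_imp_continuous_on ballI field_differentiable_imp_continuous_at) auto
  then have S: "open ?S"
    by (simp add: open_Collect_neq)
  have 0: "0 \<in> ?S" using yB by (simp add: Y.mem_nonvanishing)
  have "(\<lambda>t. p (?\<gamma> t) / q (?\<gamma> t)) field_differentiable at 0"
    using 0 by (intro field_differentiable_divide poly [OF pq(1)] poly [OF pq(2)]) simp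
  then obtain D where "((\<lambda>t. p (?\<gamma> t) / q (?\<gamma> t)) has_field_derivative D) (at 0)"
    by (auto simp: field_differentiable_def)
  then have "((\<lambda>t. g (?\<gamma> t)) has_field_derivative D) (at 0)"
  proof (rule has_field_derivative_transform_within_open [OF _ S 0])
    fix t assume "t \<in> ?S"
    then have N: "?\<gamma> t \<in> nonvanishing B q"
      using mem [of U t] yB by (simp add: Y.mem_nonvanishing B)
    show "p (?\<gamma> t) / q (?\<gamma> t) = g (?\<gamma> t)"
      by (rule trans [OF sym [OF bspec [OF eq N]] cut_apply(1) [OF subsetD [OF yB(2) N]]])
  qed
  then show ?thesis by (auto simp: field_differentiable_def)
qed

lemma vertical_lin:
  assumes "opn V" "y \<in> dual_points_over E V" "lin \<sigma> \<in> regular_at Y.Y y"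
  shows "vertical V \<phi> y (lin \<sigma>) = \<phi> (fst y) (\<sigma> (fst y))"
proof -
  have "((\<lambda>t. snd y (\<sigma> (fst y)) + t * \<phi> (fst y) (\<sigma> (fst y))) has_field_derivative \<phi> (fst y) (\<sigma> (fst y))) (at 0)"
    by (auto intro!: derivative_eq_intros)
  from DERIV_imp_deriv [OF this] show ?thesis
    using assms by (simp add: vertical_def lin_def)
qed

lemma vertical_tangent_sec:
  assumes V: "opn V" and \<phi>: "\<phi> \<in> dual_sec A E V"
  shows "vertical V \<phi> \<in> tangent_sec Y.Y (dual_points_over E V)"
proof (rule tangent_sec_totalI [OF V])
  show "vertical V \<phi> y = 0" if "y \<notin> dual_points_over E V" for y
    using that by (simp add: vertical_def)
next
  fix y assume y: "y \<in> dual_points_over E V"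
  note d = vertical_differentiable [OF V \<phi> y]
  have top: "y \<in> topspace (topo Y.Y)" using openin_subset [OF open_dual_points [OF V]] y by blast
  show "vertical V \<phi> y \<in> tangent_space Y.Y y"
    unfolding tangent_space_def
  proof (intro CollectI conjI allI ballI impI)
    fix f assume f: "f \<in> regular_at Y.Y y"
    have sf: "(\<lambda>y. c * f y) \<in> regular_at Y.Y y" for c
      by (rule Y.regular_at_mult [OF Y.regular_at_const [OF top] f])
    show "vertical V \<phi> y (\<lambda>y. c * f y) = c * vertical V \<phi> y f" for c
      using y f sf [of c] d [OF f] by (simp add: vertical_def)
    fix g assume g: "g \<in> regular_at Y.Y y"
    note fg = Y.regular_at_add [OF f g] Y.regular_at_mult [OF f g]
    show "vertical V \<phi> y (\<lambda>x. f x + g x) = vertical V \<phi> y f + vertical V \<phi> y g"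
      using y f g fg(1) d [OF f] d [OF g] by (simp add: vertical_def)
    show "vertical V \<phi> y (\<lambda>x. f x * g x) = f y * vertical V \<phi> y g + g y * vertical V \<phi> y f"
      using y f g fg(2) d [OF f] d [OF g] by (simp add: vertical_def)
  qed (simp add: vertical_def y)
next
  fix U f assume U: "opn U" "U \<subseteq> V" and f: "f \<in> reg A U"
  have "vertical V \<phi> y (\<lambda>y. f (fst y)) = 0" for y
    by (cases "y \<in> dual_points_over E V"; cases "(\<lambda>y. f (fst y)) \<in> regular_at Y.Y y") (auto simp: vertical_def)
  then show "Y.regular_on (dual_points_over E U) (\<lambda>y. vertical V \<phi> y (\<lambda>y. f (fst y)))"
    using Y.regular_on_const [OF open_dual_points [OF U(1)], of 0] by simp
next
  fix U \<sigma> assume U: "opn U" "U \<subseteq> V" and \<sigma>: "\<sigma> \<in> sec E U"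
  have "vertical V \<phi> y (lin \<sigma>) = \<phi> (fst y) (\<sigma> (fst y))" if y: "y \<in> dual_points_over E U" for y
  proof (rule vertical_lin [OF V])
    show "y \<in> dual_points_over E V" using y U by (auto simp: mem_dual_points)
    show "lin \<sigma> \<in> regular_at Y.Y y"
      by (intro Y.regular_atI [OF open_dual_points [OF U(1)] y] regular_lin [OF U(1) \<sigma> open_dual_points [OF U(1)]] order_refl)
  qed
  with regular_pullback [OF U(1) dual_secD(3) [OF \<phi> U \<sigma>] open_dual_points [OF U(1)] order_refl]
  show "Y.regular_on (dual_points_over E U) (\<lambda>y. vertical V \<phi> y (lin \<sigma>))"
    by (rule Y.regular_on_transfer)
qed

end


section \<open>The critical ideal of the function defined by a section\<close>

lemma (in affine_chart) regular_at_nonzero_nbhd: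
  assumes "f \<in> regular_at X q" "q \<in> U" "f q \<noteq> 0"
  shows "\<exists>N. opn N \<and> q \<in> N \<and> (\<forall>x\<in>N. f x \<noteq> 0)"
proof (rule local_fraction [OF assms(1,2)])
  fix V g h assume V: "opn V" "q \<in> V" "V \<subseteq> U" and g: "g \<in> poly_funs m" and h: "h \<in> poly_funs m" "h (\<phi> q) \<noteq> 0"
    and eq: "\<And>y. y \<in> V \<Longrightarrow> f y * h (\<phi> y) = g (\<phi> y)"
  let ?N = "V \<inter> {x \<in> U. g (\<phi> x) \<noteq> 0}"
  have "opn ?N" using open_preimage [OF g] V by blast
  moreover have "q \<in> ?N" using eq [OF V(2), symmetric] V h assms by auto
  moreover have "\<forall>x\<in>?N. f x \<noteq> 0" using eq by fastforce
  ultimately show ?thesis by blast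
qed

lemma smooth_regular_at_inverse:
  assumes "smooth_variety X" "p \<in> topspace (topo X)" "f \<in> regular_at X p" "f p \<noteq> 0"
  shows "(\<lambda>x. 1 / f x) \<in> regular_at X p" "\<exists>N. openin (topo X) N \<and> p \<in> N \<and> (\<forall>x\<in>N. f x \<noteq> 0)"
proof -
  interpret function_space X
    using assms(1) by unfold_locales (simp add: smooth_variety_def)
  obtain U m Z \<phi> where chart: "opn U" "p \<in> U" "fspace_iso (open_subspace X U) (affine_variety m Z) \<phi>"
    using assms unfolding smooth_variety_def by blast
  interpret affine_chart X U m Z \<phi>
    by unfold_locales (use chart in auto)
  show "(\<lambda>x. 1 / f x) \<in> regular_at X p" "\<exists>N. openin (topo X) N \<and> p \<in> N \<and> (\<forall>x\<in>N. f x \<noteq> 0)"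
    using regular_at_inverse regular_at_nonzero_nbhd assms chart(2) by auto
qed

lemma (in function_space) covector_sum:
  assumes \<Phi>: "\<Phi> \<in> linear_dual (scal cotb) (fib cotb p)" and \<omega>: "\<And>i. i \<in> K \<Longrightarrow> \<omega> i \<in> fib cotb p"
  shows "\<Phi> (\<lambda>v. \<Sum>i\<in>K. c i * \<omega> i v) = (\<Sum>i\<in>K. c i * \<Phi> (\<omega> i))"
  using \<omega>
proof (induction K rule: infinite_finite_induct)
  case (insert k K)
  have mem: "(\<lambda>v. c k * \<omega> k v) \<in> fib cotb p" "(\<lambda>v. \<Sum>i\<in>K. c i * \<omega> i v) \<in> fib cotb p"
    using insert.prems unfolding fib_cot by (auto intro!: linear_dual_scale linear_dual_sum)
  have "\<Phi> (\<lambda>v. c k * \<omega> k v) = c k * \<Phi> (\<omega> k)"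
    using linear_dualD(3) [OF \<Phi>, of "\<omega> k" "c k"] insert.prems by (simp add: scal_cot)
  moreover have "\<Phi> ((\<lambda>v. c k * \<omega> k v) + (\<lambda>v. \<Sum>i\<in>K. c i * \<omega> i v)) = \<Phi> (\<lambda>v. c k * \<omega> k v) + \<Phi> (\<lambda>v. \<Sum>i\<in>K. c i * \<omega> i v)"
    by (rule linear_dualD(2) [OF \<Phi> mem])
  ultimately show ?case using insert by (simp add: plus_fun_def)
next
  have "(\<lambda>_. 0) \<in> fib cotb p" unfolding fib_cot by (rule linear_dual_zero)
  from linear_dualD(3) [OF \<Phi> this, of 0] have "\<Phi> (\<lambda>_. 0) = 0" by (simp add: scal_cot)
  then show "\<Phi> (\<lambda>v. \<Sum>i\<in>K. c i * \<omega> i v) = (\<Sum>i\<in>K. c i * \<Phi> (\<omega> i))" if "infinite K" for K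
    using that by simp
  from \<open>\<Phi> (\<lambda>_. 0) = 0\<close> show "\<Phi> (\<lambda>v. \<Sum>i\<in>{}. c i * \<omega> i v) = (\<Sum>i\<in>{}. c i * \<Phi> (\<omega> i))" by simp
qed

locale smooth_section = vbundle_section A E s for A :: "'a fspace" and E :: "('a, 'v::ab_group_add) vbundle" and s +
  assumes smooth: "smooth_variety A"
begin

abbreviation "tot U \<equiv> dual_points_over E U"

text \<open>The section through a point \<open>y\<close> with constant coordinates in the dual frame.\<close>

definition slice :: "'a set \<Rightarrow> nat \<Rightarrow> (nat \<Rightarrow> 'a \<Rightarrow> 'v) \<Rightarrow> 'a \<times> ('v \<Rightarrow> complex) \<Rightarrow> 'a \<Rightarrow> 'a \<times> ('v \<Rightarrow> complex)" where
  "slice V r e y b = (b, \<lambda>v. \<Sum>i<r. snd y (e i (fst y)) * coord V r e i b v)"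

text \<open>The lift of a vector field on the base along these sections; it annihilates the fibre
  coordinates given by the frame.\<close>

definition horizontal :: "'a set \<Rightarrow> nat \<Rightarrow> (nat \<Rightarrow> 'a \<Rightarrow> 'v) \<Rightarrow> ('a \<Rightarrow> ('a \<Rightarrow> complex) \<Rightarrow> complex)
    \<Rightarrow> 'a \<times> ('v \<Rightarrow> complex) \<Rightarrow> ('a \<times> ('v \<Rightarrow> complex) \<Rightarrow> complex) \<Rightarrow> complex" where
  "horizontal V r e \<theta> = cut (tot V) (\<lambda>y. cut (regular_at Y.Y y) (\<lambda>g. \<theta> (fst y) (\<lambda>b. g (slice V r e y b))))"

context
  fixes V r and e :: "nat \<Rightarrow> 'a \<Rightarrow> 'v"
  assumes V: "opn V" and fr: "frame A E V r e"
begin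

lemma expand_lin: assumes "y \<in> tot V" "v \<in> fib E (fst y)"
  shows "snd y v = (\<Sum>i<r. snd y (e i (fst y)) * coord V r e i (fst y) v)"
proof -
  have a: "fst y \<in> V" and \<xi>: "snd y \<in> linear_dual sc (fib E (fst y))" using assms by (auto simp: mem_dual_points)
  have "snd y v = snd y (\<Sum>i<r. sc (coord V r e i (fst y) v) (e i (fst y)))"
    using coord_expand [OF V fr a assms(2)] by simp
  also have "\<dots> = (\<Sum>i<r. coord V r e i (fst y) v * snd y (e i (fst y)))"
    by (rule fib_in_dual(2) [OF open_point [OF V a] \<xi>]) (use frame_fib [OF V fr _ a] in auto)
  finally show ?thesis by (simp add: mult.commute)
qed

lemma slice_self: assumes "y \<in> tot V" shows "slice V r e y (fst y) = y"
proof -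
  have a: "fst y \<in> V" and \<xi>: "snd y \<in> linear_dual sc (fib E (fst y))" using assms by (auto simp: mem_dual_points)
  have "(\<Sum>i<r. snd y (e i (fst y)) * coord V r e i (fst y) v) = snd y v" for v
  proof (cases "v \<in> fib E (fst y)")
    case False
    then show ?thesis using linear_dualD(1) [OF \<xi>] a by (simp add: coord_def)
  qed (use expand_lin [OF assms] in simp)
  then show ?thesis by (simp add: slice_def)
qed

lemma slice_mem: "b \<in> V \<Longrightarrow> b \<in> U \<Longrightarrow> slice V r e y b \<in> tot U"
  unfolding slice_def mem_dual_points by (auto intro!: linear_dual_sum coord_dual [OF V fr])

lemma slice_poly:
  assumes "P \<in> fibre_polys A E U" and U: "opn U" shows "regular_on (U \<inter> V) (\<lambda>b. P (slice V r e y b))"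
proof -
  have UV: "opn (U \<inter> V)" "U \<inter> V \<subseteq> U" "U \<inter> V \<subseteq> V" using U V by auto
  show ?thesis
    using assms(1)
  proof (induction rule: fibre_polys_induct)
    case (base f)
    then show ?case using regular_on_subset [OF reg_regular_on [OF U base] U UV(1,2)] by (simp add: slice_def)
  next
    case (linear \<sigma>)
    have "regular_on (U \<inter> V) (\<lambda>b. coord V r e i b (\<sigma> b))" if "i < r" for i
    proof -
      have "(\<lambda>b. coord V r e i b (cut (U \<inter> V) \<sigma> b)) \<in> reg A (U \<inter> V)"
        by (rule dual_secD(3) [OF coord_dual_sec [OF V fr that] UV(1,3) sec_cut [OF U UV(1,2) linear]])
      from reg_regular_on [OF UV(1) this] show ?thesis by (rule regular_on_transfer) simp
    qed
    then show ?case
      unfolding lin_def slice_def by (auto intro!: regular_on_sum regular_on_mult regular_on_const UV(1))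
  next
    case (sum f g) then show ?case by (intro regular_on_add UV(1))
  next
    case (product f g) then show ?case by (intro regular_on_mult UV(1))
  qed
qed

text \<open>Along a slice a local fraction remains a fraction of regular functions, and on a smooth variety
  a regular function can be inverted where it does not vanish.\<close>

lemma slice_regular:
  assumes y: "y \<in> tot V" and g: "g \<in> regular_at Y.Y y"
  shows "(\<lambda>b. g (slice V r e y b)) \<in> regular_at A (fst y)"
proof -
  let ?S = "slice V r e y"
  have a: "fst y \<in> V" using y by (simp add: mem_dual_points)
  obtain W where W: "Y.opn W" "y \<in> W" "Y.regular_on W g" using g by (rule Y.regular_atE)
  have cg: "cut W g \<in> reg Y.Y W" using W(3) by (simp add: Y.regular_on_def)
  obtain B R p q where "(B, R) \<in> tot_family" "p \<in> R" "q \<in> R" and yB: "y \<in> nonvanishing B q" "nonvanishing B q \<subseteq> W"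
      and eq: "\<forall>y\<in>nonvanishing B q. cut W g y = p y / q y"
    using Y.reg_Y_fractionE [OF cg W(2)] .
  then obtain U where U: "opn U" and pq: "p \<in> fibre_polys A E U" "q \<in> fibre_polys A E U" and B: "B = tot U" by blast
  have aU: "fst y \<in> U \<inter> V" using yB a by (auto simp: Y.mem_nonvanishing B mem_dual_points)
  have UV: "opn (U \<inter> V)" using U V by blast
  have r: "(\<lambda>b. p (?S b)) \<in> regular_at A (fst y)" "(\<lambda>b. q (?S b)) \<in> regular_at A (fst y)"
    by (intro regular_atI [OF UV aU] slice_poly [OF _ U] pq)+
  have ne: "q (?S (fst y)) \<noteq> 0" using yB by (simp add: slice_self [OF y] Y.mem_nonvanishing)
  note inv = smooth_regular_at_inverse [OF smooth open_point [OF V a] r(2) ne]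
  obtain N where N: "opn N" "fst y \<in> N" "\<forall>x\<in>N. q (?S x) \<noteq> 0" using inv(2) by blast
  show ?thesis
  proof (rule regular_at_cong [OF regular_at_mult [OF r(1) inv(1)]])
    show "opn (N \<inter> (U \<inter> V))" "fst y \<in> N \<inter> (U \<inter> V)" using N UV aU by auto
    fix b assume b: "b \<in> N \<inter> (U \<inter> V)"
    then have nv: "?S b \<in> nonvanishing B q"
      using N slice_mem [of b U y] by (simp add: Y.mem_nonvanishing B)
    have "p (?S b) / q (?S b) = g (?S b)"
      by (rule trans [OF sym [OF bspec [OF eq nv]] cut_apply(1) [OF subsetD [OF yB(2) nv]]])
    then show "p (?S b) * (1 / q (?S b)) = g (?S b)" by simp
  qed
qed

lemma horizontal_lin:
  assumes "y \<in> tot V" "lin \<sigma> \<in> regular_at Y.Y y" and \<sigma>: "opn U" "fst y \<in> U" "\<sigma> \<in> sec E U" and \<theta>: "\<theta> \<in> tangent_sec A V"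
  shows "horizontal V r e \<theta> y (lin \<sigma>) = (\<Sum>i<r. lin (e i) y * \<theta> (fst y) (\<lambda>b. coord V r e i b (\<sigma> b)))"
proof -
  have a: "fst y \<in> V" using assms by (simp add: mem_dual_points)
  interpret tangent_vector A "fst y" "\<theta> (fst y)"
    using open_point [OF V a] tangent_sec_at [OF \<theta> a] by unfold_locales
  have UV: "opn (U \<inter> V)" "U \<inter> V \<subseteq> U" "U \<inter> V \<subseteq> V" "fst y \<in> U \<inter> V" using \<sigma> a V by auto
  have c: "(\<lambda>b. coord V r e i b (\<sigma> b)) \<in> regular_at A (fst y)" if "i < r" for i
  proof -
    have "(\<lambda>b. coord V r e i b (cut (U \<inter> V) \<sigma> b)) \<in> reg A (U \<inter> V)"
      by (rule dual_secD(3) [OF coord_dual_sec [OF V fr that] UV(1,3) sec_cut [OF \<sigma>(1) UV(1,2) \<sigma>(3)]])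
    then have "(\<lambda>b. coord V r e i b (cut (U \<inter> V) \<sigma> b)) \<in> regular_at A (fst y)"
      by (rule regular_at_reg [OF UV(1,4)])
    then show ?thesis by (rule regular_at_cong [OF _ UV(1,4)]) simp
  qed
  have sc: "(\<lambda>b. k * coord V r e i b (\<sigma> b)) \<in> regular_at A (fst y)" if "i < r" for i k
    by (rule regular_at_mult [OF regular_at_const [OF point] c [OF that]])
  have "horizontal V r e \<theta> y (lin \<sigma>) = \<theta> (fst y) (\<lambda>b. \<Sum>i<r. lin (e i) y * coord V r e i b (\<sigma> b))"
    using assms(1,2) by (simp add: horizontal_def slice_def lin_def)
  also have "\<dots> = (\<Sum>i<r. \<theta> (fst y) (\<lambda>b. lin (e i) y * coord V r e i b (\<sigma> b)))"
    by (rule deriv_sum) (use sc in auto)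
  also have "\<dots> = (\<Sum>i<r. lin (e i) y * \<theta> (fst y) (\<lambda>b. coord V r e i b (\<sigma> b)))"
    using c by (intro sum.cong refl deriv_scale) auto
  finally show ?thesis .
qed

lemma horizontal_tangent_sec:
  assumes \<theta>: "\<theta> \<in> tangent_sec A V" shows "horizontal V r e \<theta> \<in> tangent_sec Y.Y (tot V)"
proof (rule tangent_sec_totalI [OF V])
  show "horizontal V r e \<theta> y = 0" if "y \<notin> tot V" for y
    using that by (simp add: horizontal_def)
next
  fix y assume y: "y \<in> tot V"
  have top: "y \<in> topspace (topo Y.Y)" using openin_subset [OF open_dual_points [OF V]] y by blast
  have a: "fst y \<in> V" using y by (simp add: mem_dual_points)
  interpret tangent_vector A "fst y" "\<theta> (fst y)"
    using open_point [OF V a] tangent_sec_at [OF \<theta> a] by unfold_locales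
  note r = slice_regular [OF y]
  show "horizontal V r e \<theta> y \<in> tangent_space Y.Y y"
    unfolding tangent_space_def
  proof (intro CollectI conjI allI ballI impI)
    fix f assume f: "f \<in> regular_at Y.Y y"
    have sf: "(\<lambda>y. c * f y) \<in> regular_at Y.Y y" for c
      by (rule Y.regular_at_mult [OF Y.regular_at_const [OF top] f])
    show "horizontal V r e \<theta> y (\<lambda>y. c * f y) = c * horizontal V r e \<theta> y f" for c
      using y f sf [of c] deriv_scale [OF r [OF f], of c] by (simp add: horizontal_def)
    fix g assume g: "g \<in> regular_at Y.Y y"
    note fg = Y.regular_at_add [OF f g] Y.regular_at_mult [OF f g]
    show "horizontal V r e \<theta> y (\<lambda>x. f x + g x) = horizontal V r e \<theta> y f + horizontal V r e \<theta> y g"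
      using y f g fg(1) deriv_add [OF r [OF f] r [OF g]] by (simp add: horizontal_def)
    show "horizontal V r e \<theta> y (\<lambda>x. f x * g x) = f y * horizontal V r e \<theta> y g + g y * horizontal V r e \<theta> y f"
      using y f g fg(2) deriv_mult [OF r [OF f] r [OF g]] by (simp add: horizontal_def slice_self [OF y])
  qed (simp add: horizontal_def y)
next
  fix U f assume U: "opn U" "U \<subseteq> V" and f: "f \<in> reg A U"
  let ?g = "cut U (\<lambda>b. \<theta> b f)"
  have "?g \<in> reg A U" using tangent_sec_regular [OF \<theta> U f] by (simp add: regular_on_def)
  from regular_pullback [OF U(1) this open_dual_points [OF U(1)] order_refl]
  show "Y.regular_on (tot U) (\<lambda>y. horizontal V r e \<theta> y (\<lambda>y. f (fst y)))"
  proof (rule Y.regular_on_transfer)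
    fix y assume y: "y \<in> tot U"
    then have "(\<lambda>y. f (fst y)) \<in> regular_at Y.Y y"
      by (intro Y.regular_atI [OF open_dual_points [OF U(1)] y] regular_pullback [OF U(1) f open_dual_points [OF U(1)]] order_refl)
    then show "horizontal V r e \<theta> y (\<lambda>y. f (fst y)) = ?g (fst y)"
      using y U by (auto simp: horizontal_def slice_def mem_dual_points)
  qed
next
  fix U \<sigma> assume U: "opn U" "U \<subseteq> V" and \<sigma>: "\<sigma> \<in> sec E U"
  let ?c = "\<lambda>i b. coord V r e i b (\<sigma> b)"
  have "Y.regular_on (tot U) (\<lambda>y. \<Sum>i<r. lin (cut U (e i)) y * cut U (\<lambda>b. \<theta> b (?c i)) (fst y))"
  proof (intro Y.regular_on_sum Y.regular_on_mult open_dual_points U)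
    fix i assume "i \<in> {..<r}"
    then have i: "i < r" by simp
    show "Y.regular_on (tot U) (lin (cut U (e i)))"
      by (rule regular_lin [OF U(1) sec_cut [OF V U frame_sec [OF V fr i]] open_dual_points [OF U(1)] order_refl])
    have "cut U (\<lambda>b. \<theta> b (?c i)) \<in> reg A U"
      using tangent_sec_regular [OF \<theta> U coord_section [OF V fr U \<sigma> i]] by (simp add: regular_on_def)
    from regular_pullback [OF U(1) this open_dual_points [OF U(1)] order_refl]
    show "Y.regular_on (tot U) (\<lambda>y. cut U (\<lambda>b. \<theta> b (?c i)) (fst y))" .
  qed
  then show "Y.regular_on (tot U) (\<lambda>y. horizontal V r e \<theta> y (lin \<sigma>))"
  proof (rule Y.regular_on_transfer)
    fix y assume y: "y \<in> tot U"
    have a: "fst y \<in> U" using y by (simp add: mem_dual_points)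
    have "lin \<sigma> \<in> regular_at Y.Y y"
      by (intro Y.regular_atI [OF open_dual_points [OF U(1)] y] regular_lin [OF U(1) \<sigma> open_dual_points [OF U(1)]] order_refl)
    moreover have "y \<in> tot V" using y U by (auto simp: mem_dual_points)
    ultimately show "horizontal V r e \<theta> y (lin \<sigma>) = (\<Sum>i<r. lin (cut U (e i)) y * cut U (\<lambda>b. \<theta> b (?c i)) (fst y))"
      using horizontal_lin [OF _ _ U(1) a \<sigma> \<theta>] a by (simp add: lin_def)
  qed
qed

end

abbreviation "F \<equiv> fibre_linear A E s"
abbreviation "J \<equiv> critical_locus Y.Y F"

lemma F_eq: "y \<in> topspace (topo Y.Y) \<Longrightarrow> F y = lin s y"
  by (simp add: fibre_linear_def top_Y lin_def case_prod_unfold)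

lemma F_regular: "Y.regular_on (topspace (topo Y.Y)) F"
proof -
  have "Y.regular_on (topspace (topo Y.Y)) (lin s)"
    by (rule regular_lin [OF openin_topspace s openin_topspace]) (simp add: top_Y)
  then show ?thesis by (rule Y.regular_on_transfer) (rule F_eq)
qed

lemma lin_s_regular_at: "y \<in> topspace (topo Y.Y) \<Longrightarrow> lin s \<in> regular_at Y.Y y"
  by (rule Y.regular_atI [OF openin_topspace _ Y.regular_on_transfer [OF F_regular]]) (simp_all add: F_eq)

lemma derivative_F:
  assumes W: "Y.opn W" and \<Theta>: "\<Theta> \<in> tangent_sec Y.Y W" and y: "y \<in> W" shows "\<Theta> y F = \<Theta> y (lin s)"
proof -
  have top: "y \<in> topspace (topo Y.Y)" using openin_subset [OF W] y by blast
  interpret tangent_vector Y.Y y "\<Theta> y"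
    using top Y.tangent_sec_at [OF \<Theta> y] by unfold_locales
  show ?thesis
    by (rule deriv_local [OF Y.regular_atI [OF openin_topspace top F_regular] openin_topspace top F_eq])
qed

sublocale J_gens: ideal_generators Y.Y "\<lambda>V. {(\<lambda>x. \<Phi> x (differential Y.Y F x)) |\<Phi>. \<Phi> \<in> dual_sec Y.Y Y.cotb V}"
  by (rule Y.critical_generators [OF F_regular])

sublocale J: ideal_sheaf Y.Y J
  unfolding Y.critical_locus_eq by (rule J_gens.sheaf.ideal_sheaf_axioms)

text \<open>On a fibre \<open>F\<close> is the linear function \<open>\<xi> \<mapsto> \<xi>(s)\<close>, with derivative \<open>\<phi>(s)\<close> in the direction \<open>\<phi>\<close>.\<close>

lemma dual_s_in_J:
  assumes V: "opn V" and \<phi>: "\<phi> \<in> dual_sec A E V"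
  shows "cut (tot V) (\<lambda>y. \<phi> (fst y) (s (fst y))) \<in> J (tot V)"
proof -
  note W = open_dual_points [OF V] and \<Theta> = vertical_tangent_sec [OF V \<phi>]
  have "vertical V \<phi> y F = \<phi> (fst y) (s (fst y))" if y: "y \<in> tot V" for y
  proof -
    have "y \<in> topspace (topo Y.Y)" using openin_subset [OF W] y by blast
    then show ?thesis
      using derivative_F [OF W \<Theta> y] vertical_lin [OF V y lin_s_regular_at] by simp
  qed
  then have "cut (tot V) (\<lambda>y. vertical V \<phi> y F) = cut (tot V) (\<lambda>y. \<phi> (fst y) (s (fst y)))"
    by (intro cut_cong) auto
  then show ?thesis
    using Y.vector_field_derivative_critical [OF W \<Theta> F_regular] by simp
qed

lemma tot_mono: "U \<subseteq> V \<Longrightarrow> tot U \<subseteq> tot V"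
  by (auto simp: mem_dual_points)

lemma I_in_J:
  assumes V: "opn V" and f: "f \<in> I V" shows "cut (tot V) (\<lambda>y. f (fst y)) \<in> J (tot V)"
proof (rule J.I_local [OF open_dual_points [OF V]])
  fix y assume y: "y \<in> tot V"
  then have a: "fst y \<in> V" by (simp add: mem_dual_points)
  then obtain U where U: "opn U" "fst y \<in> U" "U \<subseteq> V" "cut U f \<in> I_gens.gen U"
    using f unfolding I_eq gen_ideal_sheaf_def by blast
  note W = open_dual_points [OF U(1)]
  let ?K = "{g \<in> reg A U. cut (tot U) (\<lambda>y. g (fst y)) \<in> J (tot U)}"
  interpret R: cring "reg_ring A U" by (rule reg_ring_cring) fact
  have "ideal ?K (reg_ring A U)"
  proof (rule ideal_reg_ringI [OF U(1)])
    have "cut (tot U) (\<lambda>y. 0) = (\<lambda>_. 0 :: complex)" by (auto simp: cut_def)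
    then show "(\<lambda>_. 0) \<in> ?K" using J.I_zero [OF W] reg_zero [OF U(1)] by simp
  next
    fix g h assume gh: "g \<in> ?K" "h \<in> ?K"
    have "cut (tot U) (\<lambda>y. g (fst y) + h (fst y))
       = (\<lambda>y. cut (tot U) (\<lambda>y. g (fst y)) y + cut (tot U) (\<lambda>y. h (fst y)) y)"
      by (auto simp: cut_def)
    then show "(\<lambda>x. g x + h x) \<in> ?K" using gh J.I_add [OF W] reg_add [OF U(1)] by simp
  next
    fix k g assume k: "k \<in> reg A U" and g: "g \<in> ?K"
    have "cut (tot U) (\<lambda>y. k (fst y) * g (fst y))
       = (\<lambda>y. cut (tot U) (\<lambda>y. k (fst y)) y * cut (tot U) (\<lambda>y. g (fst y)) y)"
      by (auto simp: cut_def)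
    moreover have "cut (tot U) (\<lambda>y. k (fst y)) \<in> reg Y.Y (tot U)"
      using regular_pullback [OF U(1) k W order_refl] by (simp add: Y.regular_on_def)
    ultimately show "(\<lambda>x. k x * g x) \<in> ?K" using g k J.I_mult [OF W] reg_mult [OF U(1)] by simp
  qed auto
  moreover have "{(\<lambda>x. \<phi> x (s x)) |\<phi>. \<phi> \<in> dual_sec A E U} \<subseteq> ?K"
    using dual_s_reg [OF U(1)] dual_s_in_J [OF U(1)] by blast
  ultimately have "I_gens.gen U \<subseteq> ?K" by (rule R.genideal_minimal)
  then have "cut (tot U) (\<lambda>y. cut U f (fst y)) \<in> J (tot U)" using U(4) by blast
  moreover have "cut (tot U) (\<lambda>y. cut U f (fst y)) = cut (tot U) (cut (tot V) (\<lambda>y. f (fst y)))"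
    using U(3) by (auto simp: cut_def mem_dual_points fun_eq_iff)
  ultimately have "cut (tot U) (cut (tot V) (\<lambda>y. f (fst y))) \<in> J (tot U)" by simp
  moreover have "y \<in> tot U" using y U by (auto simp: mem_dual_points)
  ultimately show "\<exists>W. Y.opn W \<and> y \<in> W \<and> W \<subseteq> tot V \<and> cut W (cut (tot V) (\<lambda>y. f (fst y))) \<in> J W"
    using W tot_mono [OF U(3)] by blast
qed auto

lemma IE_in_J:
  assumes V: "opn V" and \<tau>: "\<tau> \<in> IE V" shows "cut (tot V) (lin \<tau>) \<in> J (tot V)"
proof (rule J.I_local [OF open_dual_points [OF V]])
  fix y assume y: "y \<in> tot V"
  then have a: "fst y \<in> V" by (simp add: mem_dual_points)
  obtain U r e where U: "opn U" "fst y \<in> U" "U \<subseteq> V" and fr: "frame A E U r e" using local_frame [OF V a] .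
  note W = open_dual_points [OF U(1)]
  let ?f = "\<lambda>i b. coord U r e i b (\<tau> b)"
  have eq: "cut (tot U) (cut (tot V) (lin \<tau>)) = (\<lambda>z. \<Sum>i<r. cut (tot U) (lin (e i)) z * cut (tot U) (\<lambda>z. ?f i (fst z)) z)"
  proof
    fix z
    show "cut (tot U) (cut (tot V) (lin \<tau>)) z = (\<Sum>i<r. cut (tot U) (lin (e i)) z * cut (tot U) (\<lambda>z. ?f i (fst z)) z)"
    proof (cases "z \<in> tot U")
      case True
      moreover have "\<tau> (fst z) \<in> fib E (fst z)"
        using sec_fib [OF V IE_sec [OF \<tau>]] True U by (auto simp: mem_dual_points)
      ultimately show ?thesis
        using expand_lin [OF U(1) fr True] tot_mono [OF U(3)] by (simp add: lin_def)
    qed auto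
  qed
  have "cut (tot U) (lin (e i)) \<in> reg Y.Y (tot U)" if "i < r" for i
    using regular_lin [OF U(1) frame_sec [OF U(1) fr that] W order_refl] by (simp add: Y.regular_on_def)
  moreover have "cut (tot U) (\<lambda>z. ?f i (fst z)) \<in> J (tot U)" if "i < r" for i
    by (rule I_in_J [OF U(1) IE_dual [OF V \<tau> U(1,3) coord_dual_sec [OF U(1) fr that]]])
  ultimately have "cut (tot U) (cut (tot V) (lin \<tau>)) \<in> J (tot U)"
    unfolding eq by (intro J.I_sum J.I_mult W) auto
  moreover have "y \<in> tot U" using y U by (auto simp: mem_dual_points)
  ultimately show "\<exists>W. Y.opn W \<and> y \<in> W \<and> W \<subseteq> tot V \<and> cut W (cut (tot V) (lin \<tau>)) \<in> J W"
    using W tot_mono [OF U(3)] by blast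
qed auto

text \<open>In a frame, the horizontal lift of \<open>\<theta>\<close> applied to \<open>F = \<Sum>\<^sub>i c\<^sub>i \<xi>\<^sub>i\<close> is \<open>\<Sum>\<^sub>i \<theta>(c\<^sub>i) \<xi>\<^sub>i\<close>, the linear function
  belonging to \<open>ds(\<theta>)\<close>; representatives of \<open>ds(\<theta>)\<close> differ by sections of \<open>I E\<close>, whose coordinates are in \<open>I\<close>.\<close>

lemma ds_in_J:
  assumes V: "opn V" and \<theta>: "\<theta> \<in> tangent_sec A V" and ds: "ds_represents A E s V \<theta> \<tau>"
  shows "cut (tot V) (lin \<tau>) \<in> J (tot V)"
proof (rule J.I_local [OF open_dual_points [OF V]])
  fix y assume y: "y \<in> tot V"
  then have a: "fst y \<in> V" by (simp add: mem_dual_points)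
  obtain U r e where U: "opn U" "fst y \<in> U" "U \<subseteq> V" and fr: "frame A E U r e" using local_frame [OF V a] .
  note W = open_dual_points [OF U(1)]
  have \<tau>: "\<tau> \<in> sec E V" using ds by (simp add: ds_represents_def)
  have \<theta>': "cut U \<theta> \<in> tangent_sec A U" by (rule tangent_sec_cut [OF \<theta> U(1,3)])
  note \<Theta> = horizontal_tangent_sec [OF U(1) fr \<theta>']
  let ?c = "\<lambda>i b. coord U r e i b (s b)"
  let ?h = "\<lambda>i. cut U (\<lambda>b. coord U r e i b (\<tau> b) - \<theta> b (?c i))"
  let ?H = "horizontal U r e (cut U \<theta>)"
  have eq: "cut (tot U) (cut (tot V) (lin \<tau>)) = (\<lambda>z. (\<Sum>i<r. cut (tot U) (lin (e i)) z * cut (tot U) (\<lambda>z. ?h i (fst z)) z)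
      + cut (tot U) (\<lambda>z. ?H z F) z)"
  proof
    fix z
    show "cut (tot U) (cut (tot V) (lin \<tau>)) z = (\<Sum>i<r. cut (tot U) (lin (e i)) z * cut (tot U) (\<lambda>z. ?h i (fst z)) z)
      + cut (tot U) (\<lambda>z. ?H z F) z"
    proof (cases "z \<in> tot U")
      case True
      have b: "fst z \<in> U" "fst z \<in> V" using True U by (auto simp: mem_dual_points)
      have top: "z \<in> topspace (topo Y.Y)" using openin_subset [OF W] True by blast
      have "?H z F = (\<Sum>i<r. lin (e i) z * \<theta> (fst z) (?c i))"
        using derivative_F [OF W \<Theta> True]
          horizontal_lin [OF U(1) fr True lin_s_regular_at [OF top] openin_topspace open_point [OF U(1) b(1)] s \<theta>'] b
        by simp
      moreover have "lin \<tau> z = (\<Sum>i<r. lin (e i) z * coord U r e i (fst z) (\<tau> (fst z)))"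
        using expand_lin [OF U(1) fr True sec_fib [OF V \<tau> b(2)]] by (simp add: lin_def)
      ultimately show ?thesis
        using True b tot_mono [OF U(3)] by (auto simp: right_diff_distrib sum_subtractf)
    qed auto
  qed
  have "cut (tot U) (lin (e i)) \<in> reg Y.Y (tot U)" if "i < r" for i
    using regular_lin [OF U(1) frame_sec [OF U(1) fr that] W order_refl] by (simp add: Y.regular_on_def)
  moreover have "cut (tot U) (\<lambda>z. ?h i (fst z)) \<in> J (tot U)" if "i < r" for i
  proof (rule I_in_J [OF U(1)])
    show "?h i \<in> I U"
      using ds U(1,3) coord_dual_sec [OF U(1) fr that] unfolding ds_represents_iff [OF V \<theta>] by blast
  qed
  moreover have "cut (tot U) (\<lambda>z. ?H z F) \<in> J (tot U)"
    by (rule Y.vector_field_derivative_critical [OF W \<Theta> F_regular])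
  ultimately have "cut (tot U) (cut (tot V) (lin \<tau>)) \<in> J (tot U)"
    unfolding eq by (intro J.I_add J.I_sum J.I_mult W) auto
  moreover have "y \<in> tot U" using y U by (auto simp: mem_dual_points)
  ultimately show "\<exists>W. Y.opn W \<and> y \<in> W \<and> W \<subseteq> tot V \<and> cut W (cut (tot V) (lin \<tau>)) \<in> J W"
    using W tot_mono [OF U(3)] by blast
qed auto

text \<open>
  Conversely, \<open>dF = \<Sum>\<^sub>i c\<^sub>i d\<xi>\<^sub>i + \<Sum>\<^sub>i \<xi>\<^sub>i dc\<^sub>i\<close> for \<open>F = \<Sum>\<^sub>i c\<^sub>i \<xi>\<^sub>i\<close>, and with local coordinates \<open>x\<^sub>j\<close> and vector fields
  \<open>\<theta>\<^sub>j\<close> on the base the second sum is \<open>\<Sum>\<^sub>j (\<Sum>\<^sub>i \<theta>\<^sub>j(c\<^sub>i) \<xi>\<^sub>i) dx\<^sub>j\<close>.  So the critical ideal lies in every ideal sheaf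
  which contains the \<open>c\<^sub>i\<close> and the linear functions belonging to the \<open>ds(\<theta>\<^sub>j)\<close>.
\<close>

lemma critical_generator_in:
  assumes K: "ideal_sheaf Y.Y K"
    and K_I: "\<And>V N f. opn V \<Longrightarrow> Y.opn N \<Longrightarrow> N \<subseteq> tot V \<Longrightarrow> f \<in> I V \<Longrightarrow> cut N (\<lambda>y. f (fst y)) \<in> K N"
    and K_ds: "\<And>V N \<theta> \<tau>. opn V \<Longrightarrow> Y.opn N \<Longrightarrow> N \<subseteq> tot V \<Longrightarrow> \<theta> \<in> tangent_sec A V \<Longrightarrow>
      ds_represents A E s V \<theta> \<tau> \<Longrightarrow> cut N (lin \<tau>) \<in> K N"
    and W: "Y.opn W" and \<Phi>: "\<Phi> \<in> dual_sec Y.Y Y.cotb W"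
  shows "(\<lambda>y. \<Phi> y (differential Y.Y F y)) \<in> K W"
proof -
  interpret K: ideal_sheaf Y.Y K by (rule K)
  let ?d = "differential Y.Y"
  show ?thesis
  proof (rule K.I_local [OF W])
    show "\<Phi> y (?d F y) = 0" if "y \<notin> W" for y using Y.dual_secD(1) [OF \<Phi> that] by simp
    fix y assume y: "y \<in> W"
    have a: "fst y \<in> topspace (topo A)" and \<xi>: "snd y \<in> linear_dual sc (fib E (fst y))"
      using openin_subset [OF W] y by (auto simp: top_Y mem_dual_points)
    obtain V\<^sub>1 and Q :: "nat set" and x \<theta> where V\<^sub>1: "opn V\<^sub>1" "fst y \<in> V\<^sub>1" and Q: "finite Q"
      and x: "\<And>j. j \<in> Q \<Longrightarrow> x j \<in> reg A V\<^sub>1" and \<theta>: "\<And>j. j \<in> Q \<Longrightarrow> \<theta> j \<in> tangent_sec A V\<^sub>1"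
      and chain: "\<And>q v f. q \<in> V\<^sub>1 \<Longrightarrow> v \<in> tangent_space A q \<Longrightarrow> f \<in> regular_at A q \<Longrightarrow>
        v f = (\<Sum>j\<in>Q. v (x j) * \<theta> j q f)"
      using smooth_local_coordinates [OF smooth a] by blast
    obtain V r e where V: "opn V" "fst y \<in> V" "V \<subseteq> V\<^sub>1" and fr: "frame A E V r e" using local_frame [OF V\<^sub>1] .
    define N where "N = W \<inter> tot V"
    have N: "Y.opn N" "y \<in> N" "N \<subseteq> W" "N \<subseteq> tot V" "N \<subseteq> tot V\<^sub>1"
      using W open_dual_points [OF V(1)] y V(2) \<xi> tot_mono [OF V(3)] by (auto simp: N_def mem_dual_points)
    let ?c = "\<lambda>i b. coord V r e i b (s b)"
    have cI: "?c i \<in> I V" and c: "?c i \<in> reg A V" if "i < r" for i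
      by (rule dual_s_in_I [OF V(1) coord_dual_sec [OF V(1) fr that]], rule dual_s_reg [OF V(1) coord_dual_sec [OF V(1) fr that]])
    have s_eq: "cut V s = (\<lambda>b. \<Sum>i<r. sc (?c i b) (e i b))"
    proof
      fix b show "cut V s b = (\<Sum>i<r. sc (?c i b) (e i b))"
        using coord_expand [OF V(1) fr, of b "s b"] sec_fib [OF openin_topspace s] open_point [OF V(1)] coord_outside [OF V(1) fr, of b]
        by (cases "b \<in> V") auto
    qed
    let ?\<theta> = "\<lambda>j. cut V (\<theta> j)"
    let ?\<tau> = "\<lambda>j b. \<Sum>i<r. sc (?\<theta> j b (?c i)) (e i b)"
    have \<theta>': "?\<theta> j \<in> tangent_sec A V" if "j \<in> Q" for j by (rule tangent_sec_cut [OF \<theta> [OF that] V(1,3)])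
    have \<tau>K: "cut N (lin (?\<tau> j)) \<in> K N" if "j \<in> Q" for j
      by (rule K_ds [OF V(1) N(1,4) \<theta>' [OF that] ds_in_frame [OF V(1) fr \<theta>' [OF that] c s_eq]])
    have lin_\<tau>: "lin (?\<tau> j) z = (\<Sum>i<r. \<theta> j (fst z) (?c i) * lin (e i) z)" if z: "z \<in> N" for j z
    proof -
      have b: "fst z \<in> V" and \<zeta>: "snd z \<in> linear_dual sc (fib E (fst z))" using z N(4) by (auto simp: mem_dual_points)
      show ?thesis
        unfolding lin_def using b
        by (subst fib_in_dual(2) [OF open_point [OF V(1) b] \<zeta>]) (auto intro: frame_fib [OF V(1) fr])
    qed
    have e_reg: "Y.regular_on N (lin (e i))" if "i < r" for i
      by (rule regular_lin [OF V(1) frame_sec [OF V(1) fr that] N(1,4)])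
    have c_reg: "Y.regular_on N (\<lambda>z. ?c i (fst z))" if "i < r" for i
      by (rule regular_pullback [OF V(1) c [OF that] N(1,4)])
    have x_reg: "Y.regular_on N (\<lambda>z. x j (fst z))" if "j \<in> Q" for j
      by (rule regular_pullback [OF V\<^sub>1(1) x [OF that] N(1,5)])
    have top: "z \<in> topspace (topo Y.Y)" if "z \<in> N" for z using openin_subset [OF N(1)] that by blast
    \<comment> \<open>the product rule for \<open>F = \<Sum>\<^sub>i c\<^sub>i \<xi>\<^sub>i\<close>, and \<open>dc\<^sub>i = \<Sum>\<^sub>j \<theta>\<^sub>j(c\<^sub>i) dx\<^sub>j\<close> applied to the image of \<open>v\<close> in the base\<close>
    have dF: "?d F z v = (\<Sum>i<r. ?c i (fst z) * ?d (lin (e i)) z v) + (\<Sum>j\<in>Q. lin (?\<tau> j) z * ?d (\<lambda>z. x j (fst z)) z v)"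
      if z: "z \<in> N" and v: "v \<in> tangent_space Y.Y z" for z v
    proof -
      interpret tangent_vector Y.Y z v using top [OF z] v by unfold_locales
      have b: "fst z \<in> V" "fst z \<in> V\<^sub>1" using z N by (auto simp: mem_dual_points)
      note at = Y.regular_atI [OF N(1) z]
      have F_sum: "F w = (\<Sum>i<r. ?c i (fst w) * lin (e i) w)" if w: "w \<in> N" for w
      proof -
        have "fst w \<in> topspace (topo A)" using top [OF w] by (simp add: top_Y mem_dual_points)
        then show ?thesis
          using F_eq [OF top [OF w]] expand_lin [OF V(1) fr _ sec_fib [OF openin_topspace s], of w] w N(4)
          by (auto simp: lin_def mult.commute)
      qed
      have c_at: "?c i \<in> regular_at A (fst z)" if "i < r" for i
        by (rule regular_at_reg [OF V(1) b(1) c [OF that]])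
      have x_at: "x j \<in> regular_at A (fst z)" if "j \<in> Q" for j
        by (rule regular_at_reg [OF V\<^sub>1(1) b(2) x [OF that]])
      have vc: "v (\<lambda>z. ?c i (fst z)) = (\<Sum>j\<in>Q. v (\<lambda>z. x j (fst z)) * \<theta> j (fst z) (?c i))" if "i < r" for i
        using chain [OF b(2) push_forward_tangent [OF top [OF z] v] c_at [OF that]] c_at [OF that] x_at
        by (simp cong: sum.cong)
      have "v F = v (\<lambda>w. \<Sum>i<r. ?c i (fst w) * lin (e i) w)"
        by (rule deriv_local [OF Y.regular_atI [OF openin_topspace top [OF z] F_regular] N(1) z F_sum])
      also have "\<dots> = (\<Sum>i<r. v (\<lambda>w. ?c i (fst w) * lin (e i) w))"
        by (intro deriv_sum Y.regular_at_mult at c_reg e_reg) auto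
      also have "\<dots> = (\<Sum>i<r. ?c i (fst z) * v (lin (e i)) + lin (e i) z * v (\<lambda>w. ?c i (fst w)))"
        by (intro sum.cong refl deriv_mult at c_reg e_reg) auto
      also have "\<dots> = (\<Sum>i<r. ?c i (fst z) * v (lin (e i)))
          + (\<Sum>i<r. \<Sum>j\<in>Q. lin (e i) z * (v (\<lambda>z. x j (fst z)) * \<theta> j (fst z) (?c i)))"
        by (simp add: sum.distrib vc sum_distrib_left)
      also have "(\<Sum>i<r. \<Sum>j\<in>Q. lin (e i) z * (v (\<lambda>z. x j (fst z)) * \<theta> j (fst z) (?c i)))
          = (\<Sum>j\<in>Q. lin (?\<tau> j) z * v (\<lambda>z. x j (fst z)))"
        by (subst sum.swap) (simp add: lin_\<tau> [OF z] sum_distrib_left sum_distrib_right mult_ac)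
      finally show ?thesis
        using top [OF z] v by (simp add: Y.differential_apply)
    qed
    have \<Phi>dF: "\<Phi> z (?d F z) = (\<Sum>i<r. ?c i (fst z) * \<Phi> z (?d (lin (e i)) z)) + (\<Sum>j\<in>Q. lin (?\<tau> j) z * \<Phi> z (?d (\<lambda>z. x j (fst z)) z))"
      if z: "z \<in> N" for z
    proof -
      have zW: "z \<in> W" using z N by blast
      note \<Phi>z = Y.dual_secD(2) [OF \<Phi> zW]
      note fibre = Y.differential_fib [OF top [OF z]]
      let ?\<omega> = "\<lambda>v. \<Sum>i<r. ?c i (fst z) * ?d (lin (e i)) z v" and ?\<eta> = "\<lambda>v. \<Sum>j\<in>Q. lin (?\<tau> j) z * ?d (\<lambda>z. x j (fst z)) z v"
      have out: "?d f z v = 0" if "v \<notin> tangent_space Y.Y z" for f v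
        using top [OF z] that by (simp add: differential_def)
      have "?d F z = ?\<omega> + ?\<eta>"
      proof
        fix v show "?d F z v = (?\<omega> + ?\<eta>) v"
          using dF [OF z, of v] out [of v] by (cases "v \<in> tangent_space Y.Y z") (simp_all add: plus_fun_def)
      qed
      moreover have "?\<omega> \<in> fib Y.cotb z" "?\<eta> \<in> fib Y.cotb z"
        using fibre unfolding Y.fib_cot by (auto intro!: linear_dual_sum)
      ultimately have "\<Phi> z (?d F z) = \<Phi> z ?\<omega> + \<Phi> z ?\<eta>"
        using linear_dualD(2) [OF \<Phi>z] by simp
      then show ?thesis
        by (simp only: Y.covector_sum [OF \<Phi>z fibre])
    qed
    have \<Phi>_reg: "cut N (\<lambda>z. \<Phi> z (?d g z)) \<in> reg Y.Y N" if g: "Y.regular_on N g" for g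
    proof -
      have "(\<lambda>z. \<Phi> z (cut N (?d g) z)) \<in> reg Y.Y N"
        by (rule Y.dual_secD(3) [OF \<Phi> N(1,3) Y.differential_sec [OF N(1) g]])
      from Y.reg_regular_on [OF N(1) this] have "Y.regular_on N (\<lambda>z. \<Phi> z (?d g z))"
        by (rule Y.regular_on_transfer) simp
      then show ?thesis by (simp add: Y.regular_on_def)
    qed
    have "cut N (\<lambda>z. \<Phi> z (?d F z)) =
      (\<lambda>z. (\<Sum>i<r. cut N (\<lambda>z. \<Phi> z (?d (lin (e i)) z)) z * cut N (\<lambda>z. ?c i (fst z)) z)
         + (\<Sum>j\<in>Q. cut N (\<lambda>z. \<Phi> z (?d (\<lambda>z. x j (fst z)) z)) z * cut N (lin (?\<tau> j)) z))"
    proof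
      fix z
      show "cut N (\<lambda>z. \<Phi> z (?d F z)) z =
        (\<Sum>i<r. cut N (\<lambda>z. \<Phi> z (?d (lin (e i)) z)) z * cut N (\<lambda>z. ?c i (fst z)) z)
         + (\<Sum>j\<in>Q. cut N (\<lambda>z. \<Phi> z (?d (\<lambda>z. x j (fst z)) z)) z * cut N (lin (?\<tau> j)) z)"
        using \<Phi>dF [of z] by (cases "z \<in> N") (simp_all add: mult.commute)
    qed
    moreover have "\<dots> \<in> K N"
      using cI \<tau>K by (intro K.I_add K.I_sum K.I_mult N \<Phi>_reg e_reg x_reg K_I [OF V(1) N(1,4)]) auto
    ultimately have "cut N (\<lambda>z. \<Phi> z (?d F z)) \<in> K N" by simp
    then show "\<exists>N. Y.opn N \<and> y \<in> N \<and> N \<subseteq> W \<and> cut N (\<lambda>y. \<Phi> y (?d F y)) \<in> K N" using N by blast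
  qed
qed

end


section \<open>Equations of the cone of the obstruction sheaf\<close>

text \<open>The class of zero satisfies \<open>q + q = q\<close>, and for such \<open>q\<close> the additivity relation of the symmetric
  algebra reduces to the negative of the variable.\<close>

lemma (in cring) idempotent_mvar_in_sym_ideal:
  assumes Q: "\<And>x y. x \<in> carrier Q \<Longrightarrow> y \<in> carrier Q \<Longrightarrow> x \<oplus>\<^bsub>Q\<^esub> y \<in> carrier Q"
      "\<And>r x. r \<in> carrier R \<Longrightarrow> x \<in> carrier Q \<Longrightarrow> r \<odot>\<^bsub>Q\<^esub> x \<in> carrier Q"
    and q: "q \<in> carrier Q" "q \<oplus>\<^bsub>Q\<^esub> q = q"
  shows "mvar R q \<in> sym_ideal R Q"
proof -
  let ?P = "mpoly_ring R (carrier Q)"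
  interpret P: cring ?P by (rule mpoly_cring)
  have "mvar R (q \<oplus>\<^bsub>Q\<^esub> q) \<ominus>\<^bsub>?P\<^esub> (mvar R q \<oplus>\<^bsub>?P\<^esub> mvar R q) \<in> sym_relations R Q"
    unfolding sym_relations_def Let_def using q(1) by blast
  then have "mvar R (q \<oplus>\<^bsub>Q\<^esub> q) \<ominus>\<^bsub>?P\<^esub> (mvar R q \<oplus>\<^bsub>?P\<^esub> mvar R q) \<in> sym_ideal R Q"
    unfolding sym_ideal_eq using P.genideal_self [OF sym_relations_carrier [of Q, OF Q]] by blast
  moreover have v: "mvar R q \<in> carrier ?P" by (rule mvar_closed [OF q(1)])
  then have "mvar R (q \<oplus>\<^bsub>Q\<^esub> q) \<ominus>\<^bsub>?P\<^esub> (mvar R q \<oplus>\<^bsub>?P\<^esub> mvar R q) = \<ominus>\<^bsub>?P\<^esub> mvar R q"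
    unfolding q(2) by (simp add: P.minus_eq P.minus_add P.a_assoc [symmetric] P.r_neg)
  ultimately have neg: "\<ominus>\<^bsub>?P\<^esub> mvar R q \<in> sym_ideal R Q" by simp
  have "ideal (sym_ideal R Q) ?P"
    unfolding sym_ideal_eq by (rule P.genideal_ideal [OF sym_relations_carrier [of Q, OF Q]])
  from ideal.I_l_closed [OF this neg, of "\<ominus>\<^bsub>?P\<^esub> \<one>\<^bsub>?P\<^esub>"] show ?thesis
    using v by (simp add: P.l_minus P.r_minus)
qed

lemma (in function_space) finsum_reg_ring:
  assumes "opn U" "finite K" "\<And>k. k \<in> K \<Longrightarrow> f k \<in> reg X U"
  shows "finsum (reg_ring X U) f K = (\<lambda>x. \<Sum>k\<in>K. f k x)"
proof -
  interpret cring "reg_ring X U" by (rule reg_ring_cring) fact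
  show ?thesis using assms(2,3)
  proof (induction K)
    case (insert k K)
    then have "finsum (reg_ring X U) f (insert k K) = f k \<oplus>\<^bsub>reg_ring X U\<^esub> finsum (reg_ring X U) f K"
      by (intro finsum_insert) auto
    with insert show ?case by simp
  qed simp
qed

context smooth_section begin

context
  fixes V assumes V: "opn V"
begin

abbreviation "RV \<equiv> reg_ring A V"
abbreviation "RV' \<equiv> structure_on_zero A E s V"
abbreviation "SV \<equiv> sec_module E V"
abbreviation "BV \<equiv> bundle_on_zero A E s V"
abbreviation "LV \<equiv> ds_image A E s V"
abbreviation "OV \<equiv> obstruction_sheaf A E s V"

text \<open>The projections from functions on \<open>A\<close> to functions on \<open>M\<close>, from sections of \<open>E\<close> to sections of its
  restriction to \<open>M\<close>, and on to the obstruction module.\<close>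

definition res :: "('a \<Rightarrow> complex) \<Rightarrow> ('a \<Rightarrow> complex) set" where
  "res f = I V +>\<^bsub>RV\<^esub> f"

definition cls :: "('a \<Rightarrow> 'v) \<Rightarrow> ('a \<Rightarrow> 'v) set" where
  "cls \<sigma> = IE V +>\<^bsub>SV\<^esub> \<sigma>"

definition ob :: "('a \<Rightarrow> 'v) \<Rightarrow> ('a \<Rightarrow> 'v) set set" where
  "ob \<sigma> = LV +>\<^bsub>BV\<^esub> cls \<sigma>"

definition ds_sections :: "('a \<Rightarrow> 'v) set" where
  "ds_sections = {\<tau>. \<exists>\<theta>\<in>tangent_sec A V. ds_represents A E s V \<theta> \<tau>}"

lemma ds_sections_sec: "\<tau> \<in> ds_sections \<Longrightarrow> \<tau> \<in> sec E V"
  by (auto simp: ds_sections_def ds_represents_def)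

lemma ds_sections_zero: "(\<lambda>_. 0) \<in> ds_sections"
  using ds_zero [OF V] tangent_sec_zero [OF V] unfolding ds_sections_def by blast

lemma ds_sections_add: "\<tau> \<in> ds_sections \<Longrightarrow> \<tau>' \<in> ds_sections \<Longrightarrow> (\<lambda>x. \<tau> x + \<tau>' x) \<in> ds_sections"
  using ds_add [OF V] tangent_sec_add unfolding ds_sections_def by blast

lemma ds_sections_scale: "f \<in> reg A V \<Longrightarrow> \<tau> \<in> ds_sections \<Longrightarrow> (\<lambda>x. sc (f x) (\<tau> x)) \<in> ds_sections"
  using ds_scale [OF V] tangent_sec_scale [OF V] unfolding ds_sections_def by blast

lemma minus_one: "cut V (\<lambda>_. -1) \<in> reg A V"
  using regular_on_const [OF V, of "-1"] by (simp add: regular_on_def)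

lemma sec_minus: "\<sigma> \<in> sec E V \<Longrightarrow> (\<lambda>x. sc (cut V (\<lambda>_. -1) x) (\<sigma> x)) = (\<lambda>x. - \<sigma> x)"
  using sec_outside [OF V, of \<sigma>] by (auto simp: cut_def vs.scale_minus_left)

lemma ds_sections_uminus: "\<tau> \<in> ds_sections \<Longrightarrow> (\<lambda>x. - \<tau> x) \<in> ds_sections"
  using ds_sections_scale [OF minus_one, of \<tau>] sec_minus [OF ds_sections_sec, of \<tau>] by simp

lemma IE_uminus: "\<tau> \<in> IE V \<Longrightarrow> (\<lambda>x. - \<tau> x) \<in> IE V"
  using IE_scale [OF V minus_one, of \<tau>] sec_minus [OF IE_sec, of \<tau>] by simp

lemma SV_simps [simp]: "carrier SV = sec E V" "\<sigma> \<oplus>\<^bsub>SV\<^esub> \<tau> = (\<lambda>x. \<sigma> x + \<tau> x)"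
  "f \<odot>\<^bsub>SV\<^esub> \<sigma> = (\<lambda>x. sc (f x) (\<sigma> x))"
  by (simp_all add: sec_module_def)

lemma mem_cls: "\<sigma>' \<in> cls \<sigma> \<longleftrightarrow> (\<lambda>x. \<sigma>' x - \<sigma> x) \<in> IE V"
proof
  assume "\<sigma>' \<in> cls \<sigma>"
  then obtain h where "h \<in> IE V" "\<sigma>' = (\<lambda>x. h x + \<sigma> x)" by (auto simp: cls_def a_r_coset_def')
  then show "(\<lambda>x. \<sigma>' x - \<sigma> x) \<in> IE V" by simp
next
  assume "(\<lambda>x. \<sigma>' x - \<sigma> x) \<in> IE V"
  then show "\<sigma>' \<in> cls \<sigma>"
    unfolding cls_def a_r_coset_def' by (intro UN_I) auto
qed

lemma cls_self: "\<sigma> \<in> cls \<sigma>"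
  using IE_zero [OF V] by (simp add: mem_cls)

lemma cls_eqI: assumes "(\<lambda>x. \<sigma>' x - \<sigma> x) \<in> IE V" shows "cls \<sigma>' = cls \<sigma>"
proof -
  have "(\<lambda>x. \<rho> x - \<sigma>' x) \<in> IE V \<longleftrightarrow> (\<lambda>x. \<rho> x - \<sigma> x) \<in> IE V" for \<rho>
    using IE_add [OF V _ assms, of "\<lambda>x. \<rho> x - \<sigma>' x"] IE_add [OF V _ IE_uminus [OF assms], of "\<lambda>x. \<rho> x - \<sigma> x"] by auto
  then show ?thesis by (auto simp: mem_cls)
qed

lemma cls_add: "cls \<sigma> <+>\<^bsub>SV\<^esub> cls \<tau> = cls (\<lambda>x. \<sigma> x + \<tau> x)"
proof
  show "cls \<sigma> <+>\<^bsub>SV\<^esub> cls \<tau> \<subseteq> cls (\<lambda>x. \<sigma> x + \<tau> x)"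
  proof
    fix \<rho> assume "\<rho> \<in> cls \<sigma> <+>\<^bsub>SV\<^esub> cls \<tau>"
    then obtain \<sigma>' \<tau>' where *: "\<sigma>' \<in> cls \<sigma>" "\<tau>' \<in> cls \<tau>" "\<rho> = (\<lambda>x. \<sigma>' x + \<tau>' x)"
      by (auto simp: set_add_def')
    then show "\<rho> \<in> cls (\<lambda>x. \<sigma> x + \<tau> x)"
      using IE_add [OF V, of "\<lambda>x. \<sigma>' x - \<sigma> x" "\<lambda>x. \<tau>' x - \<tau> x"] by (simp add: mem_cls algebra_simps)
  qed
  show "cls (\<lambda>x. \<sigma> x + \<tau> x) \<subseteq> cls \<sigma> <+>\<^bsub>SV\<^esub> cls \<tau>"
  proof
    fix \<rho> assume \<rho>: "\<rho> \<in> cls (\<lambda>x. \<sigma> x + \<tau> x)"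
    then have "(\<lambda>x. \<rho> x - \<tau> x) \<in> cls \<sigma>" by (simp add: mem_cls algebra_simps)
    moreover have "\<rho> = (\<lambda>x. (\<rho> x - \<tau> x) + \<tau> x)" by simp
    ultimately show "\<rho> \<in> cls \<sigma> <+>\<^bsub>SV\<^esub> cls \<tau>"
      using cls_self [of \<tau>] unfolding set_add_def' SV_simps by blast
  qed
qed

lemma BV_simps: "carrier BV = cls ` sec E V" "C \<oplus>\<^bsub>BV\<^esub> D = C <+>\<^bsub>SV\<^esub> D"
  "K \<odot>\<^bsub>BV\<^esub> D = (\<Union>f\<in>K. \<Union>\<tau>\<in>D. cls (\<lambda>x. sc (f x) (\<tau> x)))"
  by (auto simp: bundle_on_zero_def Let_def A_RCOSETS_def' cls_def)

lemma LV_eq: "LV = cls ` ds_sections"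
  by (auto simp: ds_image_def ds_sections_def cls_def)

lemma mem_ob: "C \<in> ob \<sigma> \<longleftrightarrow> (\<exists>\<tau>\<in>ds_sections. C = cls (\<lambda>x. \<tau> x + \<sigma> x))"
  unfolding ob_def LV_eq a_r_coset_def' BV_simps by (auto simp: cls_add)

lemma obI: "\<tau> \<in> ds_sections \<Longrightarrow> C = cls (\<lambda>x. \<tau> x + \<sigma> x) \<Longrightarrow> C \<in> ob \<sigma>"
  unfolding mem_ob by (rule bexI)

lemma cls_in_ob: "cls \<sigma> \<in> ob \<sigma>"
  unfolding mem_ob by (rule bexI [where x = "\<lambda>_. 0"]) (simp_all add: ds_sections_zero)

lemma ob_shift: assumes "\<tau> \<in> ds_sections" shows "ob (\<lambda>x. \<tau> x + \<sigma> x) = ob \<sigma>"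
proof (intro subset_antisym subsetI)
  fix C assume "C \<in> ob (\<lambda>x. \<tau> x + \<sigma> x)"
  then obtain \<rho> where "\<rho> \<in> ds_sections" "C = cls (\<lambda>x. (\<rho> x + \<tau> x) + \<sigma> x)" by (auto simp: mem_ob add.assoc)
  then show "C \<in> ob \<sigma>" using obI [OF ds_sections_add [OF _ assms]] by simp
next
  fix C assume "C \<in> ob \<sigma>"
  then obtain \<rho> where \<rho>: "\<rho> \<in> ds_sections" "C = cls (\<lambda>x. \<rho> x + \<sigma> x)" by (auto simp: mem_ob)
  have "(\<lambda>x. \<rho> x + - \<tau> x) \<in> ds_sections" by (rule ds_sections_add [OF \<rho>(1) ds_sections_uminus [OF assms]])
  moreover have "C = cls (\<lambda>x. (\<rho> x + - \<tau> x) + (\<tau> x + \<sigma> x))" by (simp add: \<rho>(2) algebra_simps)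
  ultimately show "C \<in> ob (\<lambda>x. \<tau> x + \<sigma> x)" by (rule obI)
qed

lemma OV_carrier: "carrier OV = ob ` sec E V"
  by (auto simp: obstruction_sheaf_def quotient_module_def A_RCOSETS_def' BV_simps ob_def)

lemma ob_add: "ob \<sigma> \<oplus>\<^bsub>OV\<^esub> ob \<tau> = ob (\<lambda>x. \<sigma> x + \<tau> x)"
proof -
  have "ob \<sigma> \<oplus>\<^bsub>OV\<^esub> ob \<tau> = (\<Union>C\<in>ob \<sigma>. \<Union>D\<in>ob \<tau>. {C <+>\<^bsub>SV\<^esub> D})"
    by (simp add: obstruction_sheaf_def quotient_module_def set_add_def' [of BV] BV_simps)
  also have "\<dots> = ob (\<lambda>x. \<sigma> x + \<tau> x)"
  proof (intro subset_antisym subsetI)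
    fix C assume "C \<in> (\<Union>C\<in>ob \<sigma>. \<Union>D\<in>ob \<tau>. {C <+>\<^bsub>SV\<^esub> D})"
    then obtain \<rho> \<rho>' where \<rho>: "\<rho> \<in> ds_sections" "\<rho>' \<in> ds_sections" and "C = cls (\<lambda>x. (\<rho> x + \<sigma> x) + (\<rho>' x + \<tau> x))"
      by (auto simp: mem_ob cls_add)
    moreover have "(\<lambda>x. (\<rho> x + \<sigma> x) + (\<rho>' x + \<tau> x)) = (\<lambda>x. (\<rho> x + \<rho>' x) + (\<sigma> x + \<tau> x))" by (simp add: algebra_simps)
    ultimately show "C \<in> ob (\<lambda>x. \<sigma> x + \<tau> x)" by (intro obI [OF ds_sections_add [OF \<rho>]]) simp
  next
    fix C assume "C \<in> ob (\<lambda>x. \<sigma> x + \<tau> x)"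
    then obtain \<rho> where \<rho>: "\<rho> \<in> ds_sections" "C = cls (\<lambda>x. \<rho> x + (\<sigma> x + \<tau> x))" by (auto simp: mem_ob)
    have "C = cls (\<lambda>x. \<rho> x + \<sigma> x) <+>\<^bsub>SV\<^esub> cls \<tau>" by (simp add: \<rho>(2) cls_add algebra_simps)
    moreover have "cls (\<lambda>x. \<rho> x + \<sigma> x) \<in> ob \<sigma>" by (rule obI [OF \<rho>(1) refl])
    moreover note cls_in_ob [of \<tau>]
    ultimately show "C \<in> (\<Union>C\<in>ob \<sigma>. \<Union>D\<in>ob \<tau>. {C <+>\<^bsub>SV\<^esub> D})" by blast
  qed
  finally show ?thesis .
qed

lemma mem_res: assumes "f \<in> reg A V" shows "g \<in> res f \<longleftrightarrow> (\<lambda>x. g x - f x) \<in> I V"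
proof
  assume "g \<in> res f"
  then obtain h where "h \<in> I V" "g = (\<lambda>x. h x + f x)" by (auto simp: res_def a_r_coset_def')
  then show "(\<lambda>x. g x - f x) \<in> I V" by simp
next
  assume "(\<lambda>x. g x - f x) \<in> I V"
  then show "g \<in> res f" unfolding res_def a_r_coset_def' by (intro UN_I) auto
qed

lemma res_smult_cls:
  assumes f: "f \<in> reg A V" and \<sigma>: "\<sigma> \<in> sec E V"
  shows "res f \<odot>\<^bsub>BV\<^esub> cls \<sigma> = cls (\<lambda>x. sc (f x) (\<sigma> x))"
proof -
  have "cls (\<lambda>x. sc (g x) (\<tau> x)) = cls (\<lambda>x. sc (f x) (\<sigma> x))" if g: "g \<in> res f" and \<tau>: "\<tau> \<in> cls \<sigma>" for g \<tau>
  proof (rule cls_eqI)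
    have d: "(\<lambda>x. g x - f x) \<in> I V" "(\<lambda>x. \<tau> x - \<sigma> x) \<in> IE V" using g \<tau> mem_res [OF f] mem_cls by auto
    have "(\<lambda>x. (\<tau> x - \<sigma> x) + \<sigma> x) \<in> sec E V" by (rule sec_add [OF V IE_sec [OF d(2)] \<sigma>])
    then have "\<tau> \<in> sec E V" by simp
    from IE_add [OF V IE_ideal [OF V d(1) this] IE_scale [OF V f d(2)]]
    show "(\<lambda>x. sc (g x) (\<tau> x) - sc (f x) (\<sigma> x)) \<in> IE V"
      by (simp add: vs.scale_left_diff_distrib vs.scale_right_diff_distrib)
  qed
  moreover have "f \<in> res f" using mem_res [OF f] I.I_zero [OF V] by simp
  ultimately show ?thesis
    unfolding BV_simps using cls_self by blast
qed

lemma ob_smult: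
  assumes f: "f \<in> reg A V" and \<sigma>: "\<sigma> \<in> sec E V"
  shows "res f \<odot>\<^bsub>OV\<^esub> ob \<sigma> = ob (\<lambda>x. sc (f x) (\<sigma> x))"
proof -
  have "LV +>\<^bsub>BV\<^esub> (res f \<odot>\<^bsub>BV\<^esub> C) = ob (\<lambda>x. sc (f x) (\<sigma> x))" if "C \<in> ob \<sigma>" for C
  proof -
    obtain \<tau> where \<tau>: "\<tau> \<in> ds_sections" "C = cls (\<lambda>x. \<tau> x + \<sigma> x)" using \<open>C \<in> ob \<sigma>\<close> by (auto simp: mem_ob)
    have "LV +>\<^bsub>BV\<^esub> (res f \<odot>\<^bsub>BV\<^esub> C) = ob (\<lambda>x. sc (f x) (\<tau> x + \<sigma> x))"
      using res_smult_cls [OF f sec_add [OF V ds_sections_sec [OF \<tau>(1)] \<sigma>]] by (simp add: ob_def \<tau>(2))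
    also have "\<dots> = ob (\<lambda>x. sc (f x) (\<sigma> x))"
      using ob_shift [OF ds_sections_scale [OF f \<tau>(1)]] by (simp add: vs.scale_right_distrib)
    finally show ?thesis .
  qed
  moreover note cls_in_ob [of \<sigma>]
  ultimately show ?thesis
    by (simp add: obstruction_sheaf_def quotient_module_def) blast
qed

lemma RV'_eq: "RV' = RV Quot I V"
  by (simp add: structure_on_zero_def)

lemma res_ring_hom: "ring_hom_cring RV RV' res"
proof -
  interpret RV: cring RV by (rule reg_ring_cring [OF V])
  interpret I: ideal "I V" RV by (rule I.I_ideal [OF V])
  have "cring RV'" unfolding RV'_eq by (rule I.quotient_is_cring [OF RV.is_cring])
  moreover have "res = (\<lambda>f. I V +>\<^bsub>RV\<^esub> f)" by (simp add: res_def fun_eq_iff)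
  then have "res \<in> ring_hom RV RV'" unfolding RV'_eq using I.rcos_ring_hom by simp
  ultimately show ?thesis
    by (intro ring_hom_cring.intro ring_hom_cring_axioms.intro RV.is_cring)
qed

text \<open>The lemmas above compute the operations of the obstruction module on classes of sections; they
  show that its operations, defined as unions over representatives, are those induced from \<open>E\<close>.\<close>

lemma obstruction_functoriality: "sym_functoriality RV RV' res SV OV ob"
proof (intro sym_functoriality.intro res_ring_hom sym_functoriality_axioms.intro)
  show "carrier RV' = res ` carrier RV"
    by (auto simp: RV'_eq FactRing_def A_RCOSETS_def' res_def)
qed (simp_all add: sec_add [OF V] sec_scale [OF V] OV_carrier ob_add ob_smult)

lemma sym_to_obstruction_eq: "sym_to_obstruction A E s V = sym_map RV RV' OV res ob"
  by (simp add: sym_to_obstruction_def res_def [abs_def] ob_def [abs_def] cls_def [abs_def])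

lemma cone_equations_iff:
  "h \<in> cone_equations A E s V \<longleftrightarrow> (\<exists>P\<in>carrier (mpoly_ring RV (sec E V)).
     mpoly_map RV RV' res ob P \<in> sym_ideal RV' OV \<and> h = sym_eval P)"
proof -
  interpret sym_functoriality RV RV' res SV OV ob by (rule obstruction_functoriality)
  show ?thesis
    unfolding cone_equations_def sym_to_obstruction_eq
    using kernel_sym_mapI kernel_sym_mapD by (auto simp: SV_simps) blast
qed

text \<open>A constant polynomial with coefficient in \<open>I\<close> is zero over \<open>M\<close>.\<close>

lemma pullback_in_cone:
  assumes f: "f \<in> I V" shows "\<exists>h\<in>cone_equations A E s V. \<forall>y\<in>tot V. h y = f (fst y)"
proof
  interpret sym_functoriality RV RV' res SV OV ob by (rule obstruction_functoriality)
  have fR: "f \<in> reg A V" by (rule I.I_reg [OF V f])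
  have "res f = I V"
    unfolding res_def by (rule R.a_rcos_zero [OF I.I_ideal [OF V] f])
  then have "mpoly_map RV RV' res ob (mconst RV f) = \<zero>\<^bsub>mpoly_ring RV' (carrier OV)\<^esub>"
    using mpoly_map_mconst [OF hom, of f ob] fR by (simp add: mpoly_zero) (simp add: mconst_def RV'_eq FactRing_def fun_eq_iff)
  moreover have "\<zero>\<^bsub>mpoly_ring RV' (carrier OV)\<^esub> \<in> sym_ideal RV' OV"
    by (rule additive_subgroup.zero_closed [OF ideal.axioms(1) [OF sym_ideal_ideal']])
  ultimately show "sym_eval (mconst RV f) \<in> cone_equations A E s V"
    unfolding cone_equations_iff using R.mconst_closed [of f] fR
    by (intro bexI [where x = "mconst RV f"]) simp_all
  show "\<forall>y\<in>tot V. sym_eval (mconst RV f) y = f (fst y)"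
  proof
    fix y assume "y \<in> tot V"
    show "sym_eval (mconst RV f) y = f (fst y)"
    proof (cases "f = (\<lambda>_. 0)")
      case False
      then have supp: "{n. mconst RV f n \<noteq> (\<lambda>_. 0)} = {{#}}" by (auto simp: mconst_def)
      show ?thesis unfolding sym_eval_def case_prod_unfold supp by (simp add: mconst_def)
    qed (simp add: sym_eval_def case_prod_unfold mconst_def)
  qed
qed

text \<open>The variable of a section in the image of \<open>ds\<close> maps to the variable of the zero class.\<close>

lemma ds_in_cone:
  assumes \<tau>: "\<tau> \<in> ds_sections" shows "\<exists>h\<in>cone_equations A E s V. \<forall>y\<in>tot V. h y = lin \<tau> y"
proof
  interpret sym_functoriality RV RV' res SV OV ob by (rule obstruction_functoriality)
  have "ob (\<lambda>x. \<tau> x + 0) = ob (\<lambda>_. 0)" by (rule ob_shift [OF \<tau>])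
  then have eq: "ob \<tau> = ob (\<lambda>_. 0)" by simp
  have "mvar RV' (ob \<tau>) \<in> sym_ideal RV' OV"
    by (rule S.idempotent_mvar_in_sym_ideal [OF Q'_add Q'_smult])
      (simp_all add: eq ob_add, simp add: OV_carrier sec_zero [OF V])
  then show "sym_eval (mvar RV \<tau>) \<in> cone_equations A E s V"
    unfolding cone_equations_iff using R.mvar_closed [OF ds_sections_sec [OF \<tau>]] mpoly_map_mvar [OF hom, of ob \<tau>]
    by (intro bexI [where x = "mvar RV \<tau>"]) simp_all
  show "\<forall>y\<in>tot V. sym_eval (mvar RV \<tau>) y = lin \<tau> y"
  proof
    fix y assume "y \<in> tot V"
    then have a: "fst y \<in> V" by (simp add: mem_dual_points)
    then have "cut V (\<lambda>_. 1 :: complex) \<noteq> (\<lambda>_. 0)" by (metis cut_apply(1) zero_neq_one)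
    then have "{n. mvar RV \<tau> n \<noteq> (\<lambda>_. 0)} = {{#\<tau>#}}" by (auto simp: mvar_def)
    then show "sym_eval (mvar RV \<tau>) y = lin \<tau> y"
      using a by (simp add: sym_eval_def case_prod_unfold) (simp add: mvar_def lin_def)
  qed
qed

text \<open>
  Modulo \<open>J\<close>, evaluation on the total space of the dual of \<open>E\<close> only depends on the classes of functions modulo \<open>I\<close>
  and of sections in the obstruction sheaf.  So it factors over the symmetric algebra of the
  latter, and the elements of the kernel evaluate into \<open>J\<close>.
\<close>

lemma cone_equation_in_J:
  assumes N: "Y.opn N" "N \<subseteq> tot V" and h: "h \<in> cone_equations A E s V"
  shows "cut N h \<in> J N"
proof -
  interpret sym_functoriality RV RV' res SV OV ob by (rule obstruction_functoriality)
  let ?RY = "reg_ring Y.Y N"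
  interpret RY: cring ?RY by (rule Y.reg_ring_cring [OF N(1)])
  interpret JN: ideal "J N" ?RY by (rule J.I_ideal [OF N(1)])
  let ?T = "?RY Quot J N"
  interpret T: cring ?T by (rule JN.quotient_is_cring [OF RY.is_cring])
  define \<kappa> where "\<kappa> g = J N +>\<^bsub>?RY\<^esub> g" for g
  interpret \<kappa>: ring_hom_cring ?RY ?T \<kappa>
  proof (intro ring_hom_cring.intro ring_hom_cring_axioms.intro RY.is_cring T.is_cring)
    have "\<kappa> = (\<lambda>g. J N +>\<^bsub>?RY\<^esub> g)" by (simp add: \<kappa>_def fun_eq_iff)
    then show "\<kappa> \<in> ring_hom ?RY ?T" using JN.rcos_ring_hom by simp
  qed
  have \<kappa>_eqI: "\<kappa> g = \<kappa> g'" if g: "g \<in> reg Y.Y N" "g' \<in> reg Y.Y N" and d: "(\<lambda>y. g y - g' y) \<in> J N" for g g'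
  proof -
    have "\<kappa> (\<lambda>y. (g y - g' y) + g' y) = \<kappa> (\<lambda>y. g y - g' y) \<oplus>\<^bsub>?T\<^esub> \<kappa> g'"
      using \<kappa>.hom_add [of "\<lambda>y. g y - g' y" g'] J.I_reg [OF N(1) d] g by simp
    moreover have "\<kappa> (\<lambda>y. g y - g' y) = \<zero>\<^bsub>?T\<^esub>"
      unfolding \<kappa>_def using RY.a_rcos_zero [OF J.I_ideal [OF N(1)] d] by (simp add: FactRing_def)
    ultimately show ?thesis using g \<kappa>.hom_closed [of g'] by simp
  qed
  define pull where "pull f = cut N (\<lambda>y. f (fst y))" for f :: "'a \<Rightarrow> complex"
  define lam where "lam \<sigma> = cut N (lin \<sigma>)" for \<sigma>
  have pull_reg: "pull f \<in> reg Y.Y N" if "f \<in> reg A V" for f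
    using regular_pullback [OF V that N] by (simp add: pull_def Y.regular_on_def)
  have lam_reg: "lam \<sigma> \<in> reg Y.Y N" if "\<sigma> \<in> sec E V" for \<sigma>
    using regular_lin [OF V that N] by (simp add: lam_def Y.regular_on_def)
  have to_N: "cut N g \<in> J N" if "cut (tot V) g \<in> J (tot V)" for g
    using J.I_cut [OF open_dual_points [OF V] N that] N(2) by simp
  have ring: "ring_hom_cring RV ?RY pull"
  proof (intro ring_hom_cring.intro ring_hom_cring_axioms.intro R.is_cring RY.is_cring ring_hom_memI)
    have "a \<in> V" if "(a, \<xi>) \<in> N" for a \<xi> using subsetD [OF N(2) that] by (simp add: mem_dual_points)
    then show "pull \<one>\<^bsub>RV\<^esub> = \<one>\<^bsub>?RY\<^esub>" by (auto simp add: pull_def fun_eq_iff cut_def)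
  qed (auto simp: pull_reg, auto simp: pull_def cut_def)
  have lam_add: "lam (\<lambda>x. \<sigma> x + \<tau> x) = (\<lambda>y. lam \<sigma> y + lam \<tau> y)"
    and lam_scale: "lam (\<lambda>x. sc (f x) (\<sigma> x)) = (\<lambda>y. pull f y * lam \<sigma> y)"
    and lam_diff: "lam (\<lambda>x. \<sigma> x - \<tau> x) = (\<lambda>y. lam \<sigma> y - lam \<tau> y)"
    if "\<sigma> \<in> sec E V" "\<tau> \<in> sec E V" for \<sigma> \<tau> f
  proof -
    have "lin (\<lambda>x. \<sigma> x + \<tau> x) y = lin \<sigma> y + lin \<tau> y \<and> lin (\<lambda>x. sc (f x) (\<sigma> x)) y = f (fst y) * lin \<sigma> y
      \<and> lin (\<lambda>x. \<sigma> x - \<tau> x) y = lin \<sigma> y - lin \<tau> y" if y: "y \<in> N" for y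
    proof -
      have b: "fst y \<in> V" and \<xi>: "snd y \<in> linear_dual sc (fib E (fst y))" using y N(2) by (auto simp: mem_dual_points)
      show ?thesis
        using linear_dualD(2,3) [OF \<xi>] fib_in_dual(3) [OF open_point [OF V b] \<xi>] sec_fib [OF V \<open>\<sigma> \<in> sec E V\<close> b] sec_fib [OF V \<open>\<tau> \<in> sec E V\<close> b]
        by (simp add: lin_def)
    qed
    then show "lam (\<lambda>x. \<sigma> x + \<tau> x) = (\<lambda>y. lam \<sigma> y + lam \<tau> y)"
      "lam (\<lambda>x. sc (f x) (\<sigma> x)) = (\<lambda>y. pull f y * lam \<sigma> y)" "lam (\<lambda>x. \<sigma> x - \<tau> x) = (\<lambda>y. lam \<sigma> y - lam \<tau> y)"
      by (auto simp: lam_def pull_def cut_def)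
  qed
  have IJ: "pull f \<in> J N" if "f \<in> I V" for f
    unfolding pull_def by (rule to_N [OF I_in_J [OF V that]])
  have TJ: "lam \<tau> \<in> J N" if "\<tau> \<in> ds_sections" for \<tau>
    using that ds_in_J [OF V] to_N unfolding lam_def ds_sections_def by blast
  have IEJ: "lam \<tau> \<in> J N" if "\<tau> \<in> IE V" for \<tau>
    unfolding lam_def by (rule to_N [OF IE_in_J [OF V that]])
  have pull_cong: "\<kappa> (pull f) = \<kappa> (pull g)" if f: "f \<in> reg A V" and g: "g \<in> reg A V" and eq: "res f = res g" for f g
  proof (rule \<kappa>_eqI [OF pull_reg [OF f] pull_reg [OF g]])
    have "f \<in> res g" using mem_res [OF f, of f] I.I_zero [OF V] eq by simp
    then have "(\<lambda>x. f x - g x) \<in> I V" using mem_res [OF g] by simp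
    from IJ [OF this] show "(\<lambda>y. pull f y - pull g y) \<in> J N"
      by (rule back_subst [where P = "\<lambda>k. k \<in> J N"]) (auto simp: pull_def cut_def)
  qed
  have lam_cong: "\<kappa> (lam \<sigma>) = \<kappa> (lam \<tau>)" if \<sigma>: "\<sigma> \<in> sec E V" and \<tau>: "\<tau> \<in> sec E V" and eq: "ob \<sigma> = ob \<tau>" for \<sigma> \<tau>
  proof (rule \<kappa>_eqI [OF lam_reg [OF \<sigma>] lam_reg [OF \<tau>]])
    obtain \<rho> where \<rho>: "\<rho> \<in> ds_sections" "cls \<sigma> = cls (\<lambda>x. \<rho> x + \<tau> x)"
      using cls_in_ob [of \<sigma>] eq by (auto simp: mem_ob)
    then have d: "(\<lambda>x. \<sigma> x - (\<rho> x + \<tau> x)) \<in> IE V" using cls_self [of \<sigma>] mem_cls by metis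
    have \<rho>s: "\<rho> \<in> sec E V" by (rule ds_sections_sec [OF \<rho>(1)])
    have "(\<lambda>y. lam (\<lambda>x. \<sigma> x - (\<rho> x + \<tau> x)) y + lam \<rho> y) \<in> J N"
      by (rule J.I_add [OF N(1) IEJ [OF d] TJ [OF \<rho>(1)]])
    then show "(\<lambda>y. lam \<sigma> y - lam \<tau> y) \<in> J N"
      by (simp add: lam_diff lam_add \<sigma> \<tau> \<rho>s sec_add [OF V \<rho>s \<tau>])
  qed
  \<comment> \<open>evaluation modulo \<open>J\<close> on classes, through chosen representatives; off the obstruction module \<open>v\<close> takes
      the value 1, as its multiplicative extension needs a value in the ring for every variable\<close>
  define \<phi>' where "\<phi>' C = \<kappa> (pull (SOME f. f \<in> reg A V \<and> res f = C))" for C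
  have \<phi>': "\<phi>' (res f) = \<kappa> (pull f)" if f: "f \<in> reg A V" for f
  proof -
    have "(SOME g. g \<in> reg A V \<and> res g = res f) \<in> reg A V \<and> res (SOME g. g \<in> reg A V \<and> res g = res f) = res f"
      by (rule someI [of _ f]) (simp add: f)
    then show ?thesis unfolding \<phi>'_def by (intro pull_cong f) auto
  qed
  define v where "v q = (if q \<in> carrier OV then \<kappa> (lam (SOME \<sigma>. \<sigma> \<in> sec E V \<and> ob \<sigma> = q)) else \<one>\<^bsub>?T\<^esub>)" for q
  have v: "v (ob \<sigma>) = \<kappa> (lam \<sigma>)" if \<sigma>: "\<sigma> \<in> sec E V" for \<sigma>
  proof -
    define \<tau> where "\<tau> = (SOME \<tau>. \<tau> \<in> sec E V \<and> ob \<tau> = ob \<sigma>)"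
    have \<tau>: "\<tau> \<in> sec E V \<and> ob \<tau> = ob \<sigma>" unfolding \<tau>_def by (rule someI [of _ \<sigma>]) (simp add: \<sigma>)
    have "v (ob \<sigma>) = \<kappa> (lam \<tau>)" unfolding v_def \<tau>_def using \<sigma> by (simp add: OV_carrier)
    also have "\<dots> = \<kappa> (lam \<sigma>)" using \<tau> by (intro lam_cong \<sigma>) auto
    finally show ?thesis .
  qed
  interpret pull: ring_hom_cring RV ?RY pull by (rule ring)
  have \<kappa>_reg: "\<kappa> g \<in> carrier ?T" if "g \<in> reg Y.Y N" for g using \<kappa>.hom_closed [of g] that by simp
  have \<phi>'_hom: "ring_hom_cring RV' ?T \<phi>'"
  proof (intro ring_hom_cring.intro ring_hom_cring_axioms.intro S.is_cring T.is_cring ring_hom_memI)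
    fix C D assume "C \<in> carrier RV'" "D \<in> carrier RV'"
    then obtain f g where f: "f \<in> reg A V" "C = res f" and g: "g \<in> reg A V" "D = res g" by (auto simp: onto)
    show "\<phi>' C \<in> carrier ?T" using f by (simp add: \<phi>' \<kappa>_reg pull_reg)
    have "\<phi>' (res (f \<otimes>\<^bsub>RV\<^esub> g)) = \<kappa> (pull (f \<otimes>\<^bsub>RV\<^esub> g))" by (rule \<phi>') (simp add: reg_mult [OF V f(1) g(1)])
    also have "\<dots> = \<kappa> (pull f) \<otimes>\<^bsub>?T\<^esub> \<kappa> (pull g)"
      using f g pull.hom_mult [of f g] \<kappa>.hom_mult [of "pull f" "pull g"] pull_reg by simp
    finally show "\<phi>' (C \<otimes>\<^bsub>RV'\<^esub> D) = \<phi>' C \<otimes>\<^bsub>?T\<^esub> \<phi>' D"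
      using f g hom_mult [of f g] by (simp add: \<phi>')
    have "\<phi>' (res (f \<oplus>\<^bsub>RV\<^esub> g)) = \<kappa> (pull (f \<oplus>\<^bsub>RV\<^esub> g))" by (rule \<phi>') (simp add: reg_add [OF V f(1) g(1)])
    also have "\<dots> = \<kappa> (pull f) \<oplus>\<^bsub>?T\<^esub> \<kappa> (pull g)"
      using f g pull.hom_add [of f g] \<kappa>.hom_add [of "pull f" "pull g"] pull_reg by simp
    finally show "\<phi>' (C \<oplus>\<^bsub>RV'\<^esub> D) = \<phi>' C \<oplus>\<^bsub>?T\<^esub> \<phi>' D"
      using f g hom_add [of f g] by (simp add: \<phi>')
  next
    have "\<phi>' (res \<one>\<^bsub>RV\<^esub>) = \<kappa> (pull \<one>\<^bsub>RV\<^esub>)" by (rule \<phi>') (use R.one_closed in simp)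
    then show "\<phi>' \<one>\<^bsub>RV'\<^esub> = \<one>\<^bsub>?T\<^esub>" using hom_one pull.hom_one \<kappa>.hom_one by simp
  qed
  have v_closed: "v q \<in> carrier ?T" for q
  proof (cases "q \<in> carrier OV")
    case True
    then show ?thesis using v \<kappa>_reg lam_reg by (auto simp: OV_carrier)
  qed (simp add: v_def)
  obtain w where w: "\<And>k. w k \<in> carrier ?T" "w {#} = \<one>\<^bsub>?T\<^esub>" "\<And>k l. w (k + l) = w k \<otimes>\<^bsub>?T\<^esub> w l" "\<And>q. w {#q#} = v q"
    by (rule T.multiplicative_extension [of v, OF v_closed]) (rule that)
  obtain P where P: "P \<in> carrier (mpoly_ring RV (sec E V))" and ker: "mpoly_map RV RV' res ob P \<in> sym_ideal RV' OV"
    and hP: "h = sym_eval P"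
    using h unfolding cone_equations_iff by blast
  have "pairing RV' ?T \<phi>' w (mpoly_map RV RV' res ob P) = \<zero>\<^bsub>?T\<^esub>"
  proof (rule evaluation_sym_ideal [OF \<phi>'_hom w(1-3) Q'_add Q'_smult _ _ ker])
    fix x y assume "x \<in> carrier OV" "y \<in> carrier OV"
    then obtain \<sigma> \<tau> where \<sigma>: "\<sigma> \<in> sec E V" "x = ob \<sigma>" and \<tau>: "\<tau> \<in> sec E V" "y = ob \<tau>" by (auto simp: OV_carrier)
    show "w {#x \<oplus>\<^bsub>OV\<^esub> y#} = w {#x#} \<oplus>\<^bsub>?T\<^esub> w {#y#}"
      using \<sigma> \<tau> \<kappa>.hom_add [of "lam \<sigma>" "lam \<tau>"] lam_reg
      by (simp add: w(4) ob_add v sec_add [OF V] lam_add)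
  next
    fix C x assume "C \<in> carrier RV'" "x \<in> carrier OV"
    then obtain f \<sigma> where f: "f \<in> reg A V" "C = res f" and \<sigma>: "\<sigma> \<in> sec E V" "x = ob \<sigma>" by (auto simp: OV_carrier onto)
    show "w {#C \<odot>\<^bsub>OV\<^esub> x#} = \<phi>' C \<otimes>\<^bsub>?T\<^esub> w {#x#}"
      using f \<sigma> \<kappa>.hom_mult [of "pull f" "lam \<sigma>"] lam_reg pull_reg
      by (simp add: w(4) ob_smult v sec_scale [OF V] lam_scale \<phi>')
  qed
  then have zero: "pairing RV ?T (\<lambda>f. \<phi>' (res f)) (\<lambda>k. w (image_mset ob k)) P = \<zero>\<^bsub>?T\<^esub>"
    by (simp add: pairing_mpoly_map [OF hom \<phi>'_hom P w(1)])
  define mon where "mon k = cut N (\<lambda>y. \<Prod>\<sigma>\<in>#k. lin \<sigma> y)" for k :: "('a \<Rightarrow> 'v) multiset"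
  have mon: "mon k \<in> reg Y.Y N \<and> w (image_mset ob k) = \<kappa> (mon k)" if "set_mset k \<subseteq> sec E V" for k
    using that
  proof (induction k)
    case empty
    have "mon {#} = \<one>\<^bsub>?RY\<^esub>" by (simp add: mon_def)
    then show ?case using w(2) \<kappa>.hom_one RY.one_closed by simp
  next
    case (add \<sigma> k)
    then have \<sigma>: "\<sigma> \<in> sec E V" and k: "mon k \<in> reg Y.Y N" "w (image_mset ob k) = \<kappa> (mon k)" by auto
    have eq: "mon (add_mset \<sigma> k) = (\<lambda>y. lam \<sigma> y * mon k y)" by (auto simp: mon_def lam_def cut_def)
    have "w (image_mset ob (add_mset \<sigma> k)) = w {#ob \<sigma>#} \<otimes>\<^bsub>?T\<^esub> w (image_mset ob k)"
      using w(3) [of "{#ob \<sigma>#}" "image_mset ob k"] by simp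
    then show ?case
      using \<kappa>.hom_mult [of "lam \<sigma>" "mon k"] k lam_reg [OF \<sigma>] Y.reg_mult [OF N(1) lam_reg [OF \<sigma>] k(1)]
      by (simp add: eq w(4) v [OF \<sigma>])
  qed
  let ?K = "{n. P n \<noteq> \<zero>\<^bsub>RV\<^esub>}"
  have fin: "finite ?K" by (rule mpoly_carrierD(2) [OF P])
  have Pn: "P n \<in> reg A V" for n using mpoly_carrierD(1) [OF P, of n] by simp
  have Kn: "set_mset n \<subseteq> sec E V" if "n \<in> ?K" for n using mpoly_carrierD(3) [OF P] that by blast
  have trm: "(\<lambda>y. pull (P n) y * mon n y) \<in> reg Y.Y N" if "n \<in> ?K" for n
    using mon [OF Kn [OF that]] pull_reg [OF Pn] by (intro Y.reg_mult [OF N(1)]) auto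
  have "finsum ?RY (\<lambda>n. \<lambda>y. pull (P n) y * mon n y) ?K = (\<lambda>y. \<Sum>n\<in>?K. pull (P n) y * mon n y)"
    by (rule Y.finsum_reg_ring [OF N(1) fin trm])
  also have "\<dots> = cut N (sym_eval P)"
    by (auto simp: fun_eq_iff pull_def mon_def cut_def sym_eval_def lin_def)
  finally have sum: "finsum ?RY (\<lambda>n. \<lambda>y. pull (P n) y * mon n y) ?K = cut N (sym_eval P)" .
  have "\<kappa> (cut N (sym_eval P)) = finsum ?T (\<lambda>n. \<kappa> (\<lambda>y. pull (P n) y * mon n y)) ?K"
    unfolding sum [symmetric] using trm by (subst \<kappa>.hom_finsum) (auto simp: o_def)
  also have "\<dots> = pairing RV ?T (\<lambda>f. \<phi>' (res f)) (\<lambda>k. w (image_mset ob k)) P"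
    unfolding pairing_def
  proof (intro T.finsum_cong' refl)
    fix n assume n: "n \<in> ?K"
    show "\<kappa> (\<lambda>y. pull (P n) y * mon n y) = \<phi>' (res (P n)) \<otimes>\<^bsub>?T\<^esub> w (image_mset ob n)"
      using mon [OF Kn [OF n]] \<kappa>.hom_mult [of "pull (P n)" "mon n"] pull_reg [OF Pn] by (simp add: \<phi>' [OF Pn])
  qed (simp add: \<phi>' [OF Pn] \<kappa>_reg pull_reg [OF Pn] w(1))
  finally have "\<kappa> (cut N (sym_eval P)) = J N" using zero by (simp add: FactRing_def)
  moreover have "cut N (sym_eval P) \<in> reg Y.Y N"
    using RY.finsum_closed [of "\<lambda>n y. pull (P n) y * mon n y" ?K] trm unfolding sum by (simp add: Pi_iff)
  then have "cut N (sym_eval P) \<in> \<kappa> (cut N (sym_eval P))"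
    unfolding \<kappa>_def using JN.a_rcos_self by simp
  ultimately show ?thesis by (simp add: hP)
qed

end

lemma cone_generators: "ideal_generators Y.Y
    (\<lambda>W. {cut W h |V h. opn V \<and> W \<subseteq> tot V \<and> h \<in> cone_equations A E s V})"
proof
  fix U assume U: "Y.opn U"
  show "{cut U h |V h. opn V \<and> U \<subseteq> tot V \<and> h \<in> cone_equations A E s V} \<subseteq> reg Y.Y U"
    using cone_equation_in_J U J.I_reg by blast
  fix W g assume W: "Y.opn W" "W \<subseteq> U"
    and "g \<in> {cut U h |V h. opn V \<and> U \<subseteq> tot V \<and> h \<in> cone_equations A E s V}"
  then obtain V h where g: "g = cut U h" "opn V" "U \<subseteq> tot V" "h \<in> cone_equations A E s V" by blast
  then have "cut W g = cut W h" "W \<subseteq> tot V" using W by auto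
  then show "cut W g \<in> {cut W h |V h. opn V \<and> W \<subseteq> tot V \<and> h \<in> cone_equations A E s V}"
    using g by blast
qed

theorem obstruction_cone_eq_critical_locus:
  assumes W: "Y.opn W" shows "obstruction_cone A E s W = J W"
proof -
  let ?G = "\<lambda>W. {cut W h |V h. opn V \<and> W \<subseteq> tot V \<and> h \<in> cone_equations A E s V}"
  interpret G: ideal_generators Y.Y ?G by (rule cone_generators)
  have cone: "obstruction_cone A E s = gen_ideal_sheaf Y.Y ?G"
    by (simp add: obstruction_cone_def total_space_eq)
  have K_gen: "cut N g \<in> gen_ideal_sheaf Y.Y ?G N"
    if V: "opn V" and N: "Y.opn N" "N \<subseteq> tot V" and g: "\<exists>h\<in>cone_equations A E s V. \<forall>y\<in>tot V. h y = g y" for V N g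
  proof -
    obtain h where h: "h \<in> cone_equations A E s V" "\<forall>y\<in>tot V. h y = g y" using g by blast
    have "cut N g = cut N h" using h(2) N(2) by (intro cut_cong refl) auto
    then show ?thesis using V N h(1) by (intro G.G_sheaf [OF N(1)]) blast
  qed
  show ?thesis
  proof
    show "obstruction_cone A E s W \<subseteq> J W"
      unfolding cone using cone_equation_in_J by (intro J.gen_ideal_sheaf_subset [OF cone_generators _ W]) blast
    have "(\<lambda>y. \<Phi> y (differential Y.Y F y)) \<in> gen_ideal_sheaf Y.Y ?G U" if "Y.opn U" "\<Phi> \<in> dual_sec Y.Y Y.cotb U" for U \<Phi>
    proof (rule critical_generator_in [OF G.sheaf.ideal_sheaf_axioms _ _ that])
      show "cut N (\<lambda>y. f (fst y)) \<in> gen_ideal_sheaf Y.Y ?G N"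
        if "opn V" "Y.opn N" "N \<subseteq> tot V" "f \<in> I V" for V N f
        by (rule K_gen [OF that(1-3) pullback_in_cone [OF that(1,4)]])
      show "cut N (lin \<tau>) \<in> gen_ideal_sheaf Y.Y ?G N"
        if "opn V" "Y.opn N" "N \<subseteq> tot V" "\<theta> \<in> tangent_sec A V" "ds_represents A E s V \<theta> \<tau>" for V N \<theta> \<tau>
      proof (rule K_gen [OF that(1-3) ds_in_cone [OF that(1)]])
        show "\<tau> \<in> ds_sections V" unfolding ds_sections_def [OF that(1)] using that(4,5) by blast
      qed
    qed
    then show "J W \<subseteq> obstruction_cone A E s W"
      unfolding cone Y.critical_locus_eq
      by (intro G.sheaf.gen_ideal_sheaf_subset [OF J_gens.ideal_generators_axioms _ W]) blast
  qed
qed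

end

theorem proposition8:
  fixes A :: "'a fspace"
    and E :: "('a, 'v::ab_group_add) vbundle"
    and s :: "'a \<Rightarrow> 'v"
    and W :: "('a \<times> ('v \<Rightarrow> complex)) set"
  assumes "smooth_variety A"
    and "vector_bundle A E"
    and "s \<in> sec E (topspace (topo A))"
    and "openin (topo (dual_total_space A E)) W"
  shows "obstruction_cone A E s W = critical_locus (dual_total_space A E) (fibre_linear A E s) W"
proof -
  interpret smooth_section A E s
    by unfold_locales (use assms in \<open>auto simp: smooth_variety_def\<close>)
  show ?thesis
    using obstruction_cone_eq_critical_locus [OF assms(4) [unfolded total_space_eq]]
    by (simp only: total_space_eq)
qed

end
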